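(* Let $\theta$ be an inner automorphism of $\mathfrak{gl}_n(\mathbb F)$ of order $3$, with multiplicities vector $\hat r=(r_0,r_1,r_2)$. Then $\theta$ has GIB if and only if, up to a cyclic permutation of its entries, $\hat r$ is of one of the following forms (with $a,b$ non-negative integers): $$(a,b,0),\qquad (a,b,1),\qquad (2,2,a).$$
   Context: $\mathbb F$ is an algebraically closed field of characteristic zero. For a Lie algebra $\mathfrak q$ and a finite-dimensional $\mathfrak q$-module $V$, the index is $\mathrm{ind}(\mathfrak q,V)=\dim V-\max_{\xi\in V^*}\dim(\mathfrak q\cdot\xi)$. Let $Q$ be an algebraic group with $\mathfrak q=\mathrm{Lie}\,Q$ and $V$ a finite-dimensional $Q$-module; $\mathfrak q_v=\{x\in\mathfrak q\mid x\cdot v=0\}$. The pair $(Q,V)$ has GIB (good index behaviour) if $\mathrm{ind}(\mathfrak q,V^* )=\mathrm{ind}(\mathfrak q_v,(V/\mathfrak q\cdot v)^* )$ for every $v\in V$. Inner automorphisms of $\mathfrak g=\mathfrak{gl}(\mathbb V)$, where $\mathbb V$ is a finite-dimensional vector space over $\mathbb F$: fix a primitive $m$-th root of unity $\zeta$. A vector $\hat r=(r_0,\dots,r_{m-1})$ of non-negative integers with $\sum r_t=\dim\mathbb V$ (the multiplicities vector) defines the inner automorphism $\theta$ of $\mathfrak g$ given by conjugation by the diagonalisable element of $\mathrm{GL}(\mathbb V)$ that acts as $\zeta^t$ on $\mathbb V_t$, where $\mathbb V=\bigoplus_t\mathbb V_t$ and $\dim\mathbb V_t=r_t$. Up to conjugation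 every inner automorphism of order $m$ is so defined, and cyclic permutations of the entries of $\hat r$ define the same automorphism. Let $\mathfrak g=\bigoplus_{i\in\mathbb Z/m\mathbb Z}\mathfrak g_i$ be the corresponding grading, $\mathfrak g_i$ being the $\zeta^i$-eigenspace of $\theta$; then $\mathfrak g_1=\bigoplus_{i}\mathrm{Hom}(\mathbb V_i,\mathbb V_{i+1})$ (indices modulo $m$), and $G_0=\mathrm{GL}(\mathbb V_0)\times\dots\times\mathrm{GL}(\mathbb V_{m-1})$ acts on $\mathfrak g_1$ by restriction of the adjoint action. One says $\theta$ has GIB if the pair $(G_0,\mathfrak g_1)$ has GIB. Here $m=3$. *)

theory Defs
  imports
    "Jordan_Normal_Form.VS_Connect"
    "HOL-Computational_Algebra.Polynomial"
    "HOL-Algebra.AbelCoset"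
    "HOL-Library.FuncSet"
begin

section \<open>Duals and quotients of vector spaces\<close>

text \<open>
  Vector spaces are module records with an explicit carrier, over \<^const>\<open>class_ring\<close>.  A linear
  form on \<open>V\<close> is represented by a function that is \<^const>\<open>undefined\<close> outside the carrier of \<open>V\<close>,
  so that equality of functions is equality of linear forms.
\<close>

definition linear_form :: "('k::field, 'v) module \<Rightarrow> ('v \<Rightarrow> 'k) \<Rightarrow> bool" where
  "linear_form V f \<longleftrightarrow>
     f \<in> extensional (carrier V) \<and>
     (\<forall>u\<in>carrier V. \<forall>v\<in>carrier V. f (u \<oplus>\<^bsub>V\<^esub> v) = f u + f v) \<and>
     (\<forall>c. \<forall>v\<in>carrier V. f (c \<odot>\<^bsub>V\<^esub> v) = c * f v)"

definition dual_space :: "('k::field, 'v) module \<Rightarrow> ('k, 'v \<Rightarrow> 'k) module" where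
  "dual_space V =
    \<lparr>carrier = {f. linear_form V f},
     mult = undefined, one = undefined,
     zero = (\<lambda>v\<in>carrier V. 0),
     add = (\<lambda>f g. \<lambda>v\<in>carrier V. f v + g v),
     smult = (\<lambda>c f. \<lambda>v\<in>carrier V. c * f v)\<rparr>"

text \<open>
  The elements of \<open>V/U\<close> are the cosets of \<open>U\<close>.  The product \<open>c \<cdot> (w + U)\<close> is formed as
  \<open>U + {c s | s \<in> w + U}\<close>; adding \<open>U\<close> only matters for \<open>c = 0\<close>.
\<close>

definition quotient_space :: "('k::field, 'v) module \<Rightarrow> 'v set \<Rightarrow> ('k, 'v set) module" where
  "quotient_space V U =
    \<lparr>carrier = a_rcosets\<^bsub>V\<^esub> U,
     mult = undefined, one = undefined,
     zero = U,
     add = (\<lambda>S T. S <+>\<^bsub>V\<^esub> T),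
     smult = (\<lambda>c S. U <+>\<^bsub>V\<^esub> ((\<lambda>s. c \<odot>\<^bsub>V\<^esub> s) ` S))\<rparr>"

definition internal_direct_sum :: "('k::field, 'v) module \<Rightarrow> nat \<Rightarrow> (nat \<Rightarrow> 'v set) \<Rightarrow> bool" where
  "internal_direct_sum V m W \<longleftrightarrow>
     (\<forall>t<m. subspace class_ring (W t) V) \<and>
     (\<forall>v\<in>carrier V. \<exists>!w. w \<in> (\<Pi>\<^sub>E t\<in>{..<m}. W t) \<and> v = finsum V w {..<m})"

section \<open>Index and good index behaviour\<close>

text \<open>
  A module \<open>V\<close> of a Lie algebra is given by the underlying set \<open>q\<close> of the Lie algebra, the vector
  space \<open>V\<close> and the action \<open>act :: 'x \<Rightarrow> 'v \<Rightarrow> 'v\<close>.  The bracket of \<open>q\<close> does not occur in the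
  definition of the index.
\<close>

definition orbit_tangent :: "'x set \<Rightarrow> ('x \<Rightarrow> 'v \<Rightarrow> 'v) \<Rightarrow> 'v \<Rightarrow> 'v set" where
  "orbit_tangent q act v = (\<lambda>x. act x v) ` q"

definition annihilator :: "'x set \<Rightarrow> ('k, 'v) module \<Rightarrow> ('x \<Rightarrow> 'v \<Rightarrow> 'v) \<Rightarrow> 'v \<Rightarrow> 'x set" where
  "annihilator q V act v = {x \<in> q. act x v = \<zero>\<^bsub>V\<^esub>}"

definition dual_action ::
  "('k::field, 'v) module \<Rightarrow> ('x \<Rightarrow> 'v \<Rightarrow> 'v) \<Rightarrow> 'x \<Rightarrow> ('v \<Rightarrow> 'k) \<Rightarrow> ('v \<Rightarrow> 'k)" where
  "dual_action V act x f = (\<lambda>v\<in>carrier V. - f (act x v))"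

text \<open>
  For \<open>x\<close> with \<open>x \<cdot> U \<subseteq> U\<close>, this is the induced action \<open>x \<cdot> (w + U) = x \<cdot> w + U\<close> on \<open>V/U\<close>.
\<close>

definition quotient_action ::
  "('k, 'v) module \<Rightarrow> 'v set \<Rightarrow> ('x \<Rightarrow> 'v \<Rightarrow> 'v) \<Rightarrow> 'x \<Rightarrow> 'v set \<Rightarrow> 'v set" where
  "quotient_action V U act x S = U <+>\<^bsub>V\<^esub> (act x ` S)"

definition lie_index :: "'x set \<Rightarrow> ('k::field, 'v) module \<Rightarrow> ('x \<Rightarrow> 'v \<Rightarrow> 'v) \<Rightarrow> int" where
  "lie_index q V act =
     int (vectorspace.dim class_ring V) -
     int (Max ((\<lambda>\<xi>. vectorspace.dim class_ring
                      ((dual_space V)\<lparr>carrier := orbit_tangent q (dual_action V act) \<xi>\<rparr>))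
               ` carrier (dual_space V)))"

text \<open>
  Good index behaviour of a pair \<open>(Q, V)\<close> depends on the group \<open>Q\<close> only through the action of
  \<open>q = Lie Q\<close> on \<open>V\<close>.
\<close>

definition good_index_behaviour ::
  "'x set \<Rightarrow> ('k::field, 'v) module \<Rightarrow> ('x \<Rightarrow> 'v \<Rightarrow> 'v) \<Rightarrow> bool" where
  "good_index_behaviour q V act \<longleftrightarrow>
     (\<forall>v\<in>carrier V.
        let U = orbit_tangent q act v; VU = quotient_space V U in
        lie_index q (dual_space V) (dual_action V act) =
        lie_index (annihilator q V act v) (dual_space VU)
          (dual_action VU (quotient_action V U act)))"

section \<open>Inner automorphisms of the general linear Lie algebra\<close>

text \<open>
  An automorphism of \<open>gl\<^sub>n\<close> is a function on matrices; only its values on \<open>carrier_mat n n\<close> matter.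
\<close>

definition primitive_root_of_unity :: "nat \<Rightarrow> 'k::field \<Rightarrow> bool" where
  "primitive_root_of_unity m \<zeta> \<longleftrightarrow> 0 < m \<and> \<zeta> ^ m = 1 \<and> (\<forall>k. 0 < k \<and> k < m \<longrightarrow> \<zeta> ^ k \<noteq> 1)"

definition has_order :: "nat \<Rightarrow> ('k::field mat \<Rightarrow> 'k mat) \<Rightarrow> nat \<Rightarrow> bool" where
  "has_order n \<theta> m \<longleftrightarrow>
     0 < m \<and> (\<forall>A\<in>carrier_mat n n. (\<theta> ^^ m) A = A) \<and>
     (\<forall>k. 0 < k \<and> k < m \<longrightarrow> (\<exists>A\<in>carrier_mat n n. (\<theta> ^^ k) A \<noteq> A))"

definition conjugation_by :: "nat \<Rightarrow> 'k::field mat \<Rightarrow> ('k mat \<Rightarrow> 'k mat) \<Rightarrow> bool" where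
  "conjugation_by n g \<theta> \<longleftrightarrow>
     g \<in> carrier_mat n n \<and>
     (\<exists>h\<in>carrier_mat n n. g * h = 1\<^sub>m n \<and> h * g = 1\<^sub>m n \<and>
        (\<forall>A\<in>carrier_mat n n. \<theta> A = g * A * h))"

definition inner_automorphism_with_multiplicities ::
  "nat \<Rightarrow> 'k::field \<Rightarrow> nat list \<Rightarrow> ('k mat \<Rightarrow> 'k mat) \<Rightarrow> bool" where
  "inner_automorphism_with_multiplicities n \<zeta> r \<theta> \<longleftrightarrow>
     sum_list r = n \<and>
     (\<exists>g W. conjugation_by n g \<theta> \<and>
        internal_direct_sum (module_vec TYPE('k) n) (length r) W \<and>
        (\<forall>t<length r.
           vectorspace.dim class_ring ((module_vec TYPE('k) n)\<lparr>carrier := W t\<rparr>) = r ! t \<and>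
           (\<forall>v\<in>W t. g *\<^sub>v v = \<zeta> ^ t \<cdot>\<^sub>v v)))"

definition graded_part :: "nat \<Rightarrow> 'k::field \<Rightarrow> ('k mat \<Rightarrow> 'k mat) \<Rightarrow> nat \<Rightarrow> 'k mat set" where
  "graded_part n \<zeta> \<theta> i = {A \<in> carrier_mat n n. \<theta> A = \<zeta> ^ i \<cdot>\<^sub>m A}"

text \<open>
  The Lie algebra of \<open>G\<^sub>0 = GL(V\<^sub>0) \<times> \<dots> \<times> GL(V\<^sub>m\<^sub>-\<^sub>1)\<close> is the degree \<open>0\<close> part \<open>g\<^sub>0\<close>, and the
  differential of the adjoint action of \<open>G\<^sub>0\<close> on \<open>g\<^sub>1\<close> is the commutator.
\<close>

definition automorphism_has_GIB :: "nat \<Rightarrow> 'k::field \<Rightarrow> ('k mat \<Rightarrow> 'k mat) \<Rightarrow> bool" where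
  "automorphism_has_GIB n \<zeta> \<theta> \<longleftrightarrow>
     good_index_behaviour
       (graded_part n \<zeta> \<theta> 0)
       ((module_mat TYPE('k) n n)\<lparr>carrier := graded_part n \<zeta> \<theta> 1\<rparr>)
       (\<lambda>x y. x * y - y * x)"

end

theory Submission
  imports
    "HOL-Combinatorics.Transposition"
    "Jordan_Normal_Form.Char_Poly"
    "HOL-Library.Function_Algebras"
    Defs
begin

text \<open>
  In coordinates adapted to the eigenspaces, \<open>g\<^sub>1\<close> consists of the representations \<open>v = (x, y, z)\<close> of the cyclic
  quiver \<open>V\<^sub>0 \<rightarrow> V\<^sub>1 \<rightarrow> V\<^sub>2 \<rightarrow> V\<^sub>0\<close>, and GIB says that for every \<open>v\<close> some \<open>u\<close> makes \<open>q v + q\<^sub>v u\<close> as large as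
  the tangent space of a generic orbit, whose codimension is \<open>p = min r\<^sub>i\<close>.  A linear form on \<open>g\<^sub>1\<close> is a triple
  \<open>w\<close> of maps in the opposite direction; it kills \<open>q v + q\<^sub>v u\<close> iff it extends to a triple \<open>w + \<epsilon> w'\<close> that
  commutes with \<open>v + \<epsilon> u\<close> modulo \<open>\<epsilon>\<^sup>2\<close>.

  For \<open>(a, b, 0)\<close> and \<open>(a, b, 1)\<close> one brings \<open>x\<close> to rank normal form and takes \<open>u\<close> complementary to it.  For
  \<open>(2, 2, a)\<close> one finds bases in which \<open>v\<close> is monomial and chooses \<open>u\<close> so that \<open>v + \<epsilon> u\<close> consists of two
  3-cycles with different monodromy or of one 6-cycle; if \<open>y\<close> is injective and \<open>z\<close> surjective, then \<open>x\<close> and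
  \<open>z y\<close> form a 2-cycle of \<open>2 \<times> 2\<close> matrices, which is treated directly.

  In all other cases let \<open>v\<close> be the sum of a uniserial representation \<open>A\<close> of length \<open>3k + 5\<close> from \<open>V\<^sub>0\<close> to
  \<open>V\<^sub>1\<close>, of \<open>B = (V\<^sub>1 \<rightarrow> V\<^sub>2 \<rightarrow> V\<^sub>0)\<close>, and of simple ones.  Besides the powers \<open>v\<^sup>3\<^sup>j\<^sup>+\<^sup>2\<close> and their restriction
  to \<open>B\<close>, for every \<open>u\<close> a suitable combination of the maps \<open>A \<rightarrow> B\<close> and \<open>B \<rightarrow> A\<close> kills \<open>q v + q\<^sub>v u\<close>, so
  that its codimension exceeds \<open>p\<close>.
\<close>

text \<open>Only one inequality needs work: for all but finitely many \<open>t\<close> the tangent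
  space at \<open>v + t u\<close> is at least as large as \<open>q v + q_v u\<close>, so the latter
  never exceeds a generic orbit. The awkward ingredient is the stabiliser \<open>q_v\<close>. Where
  GIB holds it is never computed: if a form \<open>w\<close> kills \<open>q_v u\<close>, then
  \<open>w (\<xi> u)\<close> vanishes whenever \<open>\<xi> v = 0\<close>, hence is a linear
  function of \<open>\<xi> v\<close>, and that function is, up to sign, the \<open>w'\<close> of the
  overview. Where GIB fails, the constants come from a count. \<open>A\<close> has dimension vector
  \<open>(k + 2, k + 2, k + 1)\<close> and \<open>B\<close> has \<open>(1, 1, 1)\<close>. The powers
  with \<open>j \<le> k\<close> give \<open>k + 1\<close> forms, the square of \<open>v\<close> on
  \<open>B\<close> one more, and the maps between \<open>A\<close> and \<open>B\<close> another:
  \<open>k + 3\<close> forms, too many if \<open>p = r\<^sub>2 = k + 2\<close>. If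
  \<open>p = r\<^sub>0 = r\<^sub>1 = k + 3\<close>, then \<open>V\<^sub>2\<close> has room for a
  simple summand, and maps between it and \<open>A\<close> give form number \<open>k + 4\<close>.
  The mixed forms take their coefficients crosswise from \<open>u\<close>, so that the contributions
  of the two directions cancel on \<open>q_v u\<close>.\<close>

section \<open>Module records embedded in a type-based vector space, and their duals\<close>

locale coordinate_space = vector_space scale
  for scale :: "'a::field \<Rightarrow> 'b::ab_group_add \<Rightarrow> 'b"
begin

text \<open>Only zero, addition and scalar multiplication occur, so records with unspecified
  \<open>mult\<close> and \<open>one\<close> qualify. The vector space axioms are not assumed; they
  are pulled back along the injection afterwards.\<close>

definition embedding :: "('a, 'v) module \<Rightarrow> ('v \<Rightarrow> 'b) \<Rightarrow> bool" where
  "embedding R \<phi> \<longleftrightarrow>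
     inj_on \<phi> (carrier R) \<and> \<zero>\<^bsub>R\<^esub> \<in> carrier R \<and> \<phi> \<zero>\<^bsub>R\<^esub> = 0 \<and>
     (\<forall>u\<in>carrier R. \<forall>v\<in>carrier R. u \<oplus>\<^bsub>R\<^esub> v \<in> carrier R \<and> \<phi> (u \<oplus>\<^bsub>R\<^esub> v) = \<phi> u + \<phi> v) \<and>
     (\<forall>c. \<forall>v\<in>carrier R. c \<odot>\<^bsub>R\<^esub> v \<in> carrier R \<and> \<phi> (c \<odot>\<^bsub>R\<^esub> v) = scale c (\<phi> v))"

lemma embeddingD:
  fixes R :: "('a, 'v) module" and c :: 'a
  assumes "embedding R \<phi>"
  shows "inj_on \<phi> (carrier R)" "\<zero>\<^bsub>R\<^esub> \<in> carrier R" "\<phi> \<zero>\<^bsub>R\<^esub> = 0"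
    "u \<in> carrier R \<Longrightarrow> v \<in> carrier R \<Longrightarrow> u \<oplus>\<^bsub>R\<^esub> v \<in> carrier R"
    "u \<in> carrier R \<Longrightarrow> v \<in> carrier R \<Longrightarrow> \<phi> (u \<oplus>\<^bsub>R\<^esub> v) = \<phi> u + \<phi> v"
    "v \<in> carrier R \<Longrightarrow> c \<odot>\<^bsub>R\<^esub> v \<in> carrier R"
    "v \<in> carrier R \<Longrightarrow> \<phi> (c \<odot>\<^bsub>R\<^esub> v) = scale c (\<phi> v)"
  using assms unfolding embedding_def by auto

lemma embedding_vectorspace:
  assumes "embedding R \<phi>"
  shows "vectorspace class_ring R"
proof -
  note D = embeddingD[OF assms]
  have eq: "\<phi> u = \<phi> v \<Longrightarrow> u \<in> carrier R \<Longrightarrow> v \<in> carrier R \<Longrightarrow> u = v" for u v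
    using D(1) by (auto dest: inj_onD)
  have ag: "abelian_group R"
  proof (rule abelian_groupI)
    fix x assume x: "x \<in> carrier R"
    show "\<exists>y\<in>carrier R. y \<oplus>\<^bsub>R\<^esub> x = \<zero>\<^bsub>R\<^esub>"
    proof (intro bexI eq)
      show "\<phi> ((-1) \<odot>\<^bsub>R\<^esub> x \<oplus>\<^bsub>R\<^esub> x) = \<phi> \<zero>\<^bsub>R\<^esub>" using x by (simp add: D)
    qed (use x D in auto)
  qed (auto intro!: eq simp: D add.assoc add.commute)
  have m: "module class_ring R"
    by (rule moduleI)
      (use class_field ag in \<open>auto intro!: eq simp: D scale_left_distrib scale_right_distrib field_def domain_def\<close>)
  then show ?thesis
    using class_field by (simp add: vectorspace_def)
qed

lemma embedding_span:
  assumes "embedding R \<phi>" and A: "finite A" "A \<subseteq> carrier R"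
  shows "\<phi> ` LinearCombinations.module.span class_ring R A = span (\<phi> ` A)"
proof -
  note D = embeddingD[OF assms(1)]
  interpret R: vectorspace class_ring R by (rule embedding_vectorspace[OF assms(1)])
  have inj: "inj_on \<phi> A" using D(1) A(2) by (rule inj_on_subset)
  have lc: "R.lincomb a B \<in> carrier R \<and> \<phi> (R.lincomb a B) = (\<Sum>b\<in>B. scale (a b) (\<phi> b))"
    if "finite B" "B \<subseteq> carrier R" for a B
    using that
  proof (induction B)
    case empty
    then show ?case by (simp add: R.lincomb_def D)
  next
    case (insert b B)
    have "R.lincomb a (insert b B) = (a b \<odot>\<^bsub>R\<^esub> b) \<oplus>\<^bsub>R\<^esub> R.lincomb a B"
      unfolding R.lincomb_def using insert by (subst R.finsum_insert) (auto simp: D)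
    then show ?case using insert by (simp add: D)
  qed
  have "R.span A = range (\<lambda>a. R.lincomb a A)"
    using R.finite_span[OF A] by auto
  then have "\<phi> ` R.span A = range (\<lambda>a. \<Sum>b\<in>A. scale (a b) (\<phi> b))"
    by (simp add: image_image lc[OF A])
  also have "\<dots> = range (\<lambda>a. \<Sum>b\<in>\<phi> ` A. scale (a b) b)"
  proof (intro equalityI subsetI; clarify)
    fix a :: "_ \<Rightarrow> 'a"
    show "(\<Sum>b\<in>A. scale (a b) (\<phi> b)) \<in> range (\<lambda>a. \<Sum>b\<in>\<phi> ` A. scale (a b) b)"
      by (rule range_eqI[of _ _ "a \<circ> the_inv_into A \<phi>"])
        (simp add: sum.reindex[OF inj] the_inv_into_f_f[OF inj])
    fix a' :: "_ \<Rightarrow> 'a"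
    show "(\<Sum>b\<in>\<phi> ` A. scale (a' b) b) \<in> range (\<lambda>a. \<Sum>b\<in>A. scale (a b) (\<phi> b))"
      by (rule range_eqI[of _ _ "a' \<circ> \<phi>"]) (simp add: sum.reindex[OF inj])
  qed
  also have "\<dots> = span (\<phi> ` A)"
    using A(1) by (simp add: span_finite)
  finally show ?thesis .
qed

text \<open>\<open>vectorspace.dim\<close> is the least size of a finite generating set,
  \<open>dim\<close> the size of a basis. Spans correspond under \<phi>, and the finite set
  \<open>W\<close> forces bases of the image to be finite, so that the least size is
  attained.\<close>

lemma embedding_dim:
  assumes e: "embedding R \<phi>" and fd: "\<phi> ` carrier R \<subseteq> span W" "finite W"
  shows "vectorspace.dim class_ring R = dim (\<phi> ` carrier R)"
proof -
  note D = embeddingD[OF e]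
  interpret R: vectorspace class_ring R by (rule embedding_vectorspace[OF e])
  have gen: "R.gen_set A \<longleftrightarrow> span (\<phi> ` A) = \<phi> ` carrier R" if "finite A" "A \<subseteq> carrier R" for A
    using embedding_span[OF e that] D(1) R.span_is_subset2[OF that(2)]
    by (metis inj_on_image_eq_iff subset_refl)
  obtain B where B: "B \<subseteq> \<phi> ` carrier R" "independent B" "\<phi> ` carrier R \<subseteq> span B"
      "card B = dim (\<phi> ` carrier R)"
    using basis_exists by blast
  have finB: "finite B"
    using independent_span_bound[OF fd(2) B(2)] B(1) fd(1) by blast
  have sub: "subspace (\<phi> ` carrier R)"
  proof (rule subspaceI)
    show "0 \<in> \<phi> ` carrier R" using D(2,3) by (metis imageI)
    show "x + y \<in> \<phi> ` carrier R" if "x \<in> \<phi> ` carrier R" "y \<in> \<phi> ` carrier R" for x y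
      using that D(4,5) by (metis (no_types, lifting) imageE imageI)
    show "scale c x \<in> \<phi> ` carrier R" if "x \<in> \<phi> ` carrier R" for c x
      using that D(6,7) by (metis (no_types, lifting) imageE imageI)
  qed
  obtain A where A: "A \<subseteq> carrier R" "B = \<phi> ` A" "inj_on \<phi> A"
    using B(1) by (metis subset_image_inj)
  have finA: "finite A" and cA: "card A = card B"
    using A finB by (auto simp: card_image finite_image_iff)
  show ?thesis
    unfolding R.dim_def
  proof (rule Least_equality)
    have "span B = \<phi> ` carrier R"
      using B sub by (metis span_subspace)
    then show "\<exists>A. finite A \<and> card A = dim (\<phi> ` carrier R) \<and> A \<subseteq> carrier R \<and> R.gen_set A"
      using A finA cA B(4) gen by metis
  next
    fix n assume "\<exists>A. finite A \<and> card A = n \<and> A \<subseteq> carrier R \<and> R.gen_set A"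
    then obtain A where "finite A" "card A = n" "A \<subseteq> carrier R" "R.gen_set A" by blast
    then have "dim (\<phi> ` carrier R) \<le> card (\<phi> ` A)"
      using gen by (intro dim_le_card) auto
    also have "\<dots> \<le> n" using \<open>card A = n\<close> \<open>finite A\<close> card_image_le by blast
    finally show "dim (\<phi> ` carrier R) \<le> n" .
  qed
qed


lemma embedding_subspace_image:
  assumes "embedding R \<phi>"
  shows "subspace (\<phi> ` carrier R)"
proof (rule subspaceI)
  note D = embeddingD[OF assms]
  show "0 \<in> \<phi> ` carrier R" using D(2,3) by (metis imageI)
  show "x + y \<in> \<phi> ` carrier R" if "x \<in> \<phi> ` carrier R" "y \<in> \<phi> ` carrier R" for x y
    using that D(4,5) by (metis (no_types, lifting) imageE imageI)
  show "scale c x \<in> \<phi> ` carrier R" if "x \<in> \<phi> ` carrier R" for c x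
    using that D(6,7) by (metis (no_types, lifting) imageE imageI)
qed

lemma embedding_restrict:
  assumes e: "embedding R \<phi>" and S: "S \<subseteq> carrier R" "subspace (\<phi> ` S)"
  shows "embedding (R\<lparr>carrier := S\<rparr>) \<phi>"
proof -
  note D = embeddingD[OF e]
  have mem: "u \<in> S" if u: "u \<in> carrier R" "\<phi> u \<in> \<phi> ` S" for u
  proof -
    obtain w where "w \<in> S" "\<phi> u = \<phi> w" using u(2) by auto
    then show ?thesis using inj_onD[OF D(1), of u w] u(1) S(1) by auto
  qed
  have "\<zero>\<^bsub>R\<^esub> \<in> S"
    using D(2,3) subspace_0[OF S(2)] by (intro mem) simp_all
  moreover have "u \<oplus>\<^bsub>R\<^esub> v \<in> S" if "u \<in> S" "v \<in> S" for u v
    using that S(1) D(4,5) subspace_add[OF S(2), of "\<phi> u" "\<phi> v"] by (intro mem) (simp_all add: subset_iff)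
  moreover have "c \<odot>\<^bsub>R\<^esub> v \<in> S" if "v \<in> S" for c v
    using that S(1) D(6,7) subspace_scale[OF S(2), of "\<phi> v" c] by (intro mem) (simp_all add: subset_iff)
  ultimately show ?thesis
    using D(3,5,7) S(1) inj_on_subset[OF D(1) S(1)] unfolding embedding_def by (simp add: subset_iff)
qed

lemma linear_formD:
  assumes "linear_form R f"
  shows "f \<in> extensional (carrier R)"
    "u \<in> carrier R \<Longrightarrow> v \<in> carrier R \<Longrightarrow> f (u \<oplus>\<^bsub>R\<^esub> v) = f u + f v"
    "v \<in> carrier R \<Longrightarrow> f (c \<odot>\<^bsub>R\<^esub> v) = c * f v"
  using assms by (auto simp: linear_form_def)

lemma dual_space_simps:
  "carrier (dual_space R) = {f. linear_form R f}"
  "\<zero>\<^bsub>dual_space R\<^esub> = (\<lambda>v\<in>carrier R. 0)"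
  "f \<oplus>\<^bsub>dual_space R\<^esub> g = (\<lambda>v\<in>carrier R. f v + g v)"
  "c \<odot>\<^bsub>dual_space R\<^esub> f = (\<lambda>v\<in>carrier R. c * f v)"
  by (simp_all add: dual_space_def)

text \<open>A form is sent to the vector whose coordinates in the basis \<open>B\<close> are its
  values on \<open>B\<close>. Thus the dual lands in the same space, with the same image as
  \<open>R\<close>, and the construction can be iterated to reach the bidual.\<close>

definition dual_embedding :: "'b set \<Rightarrow> ('a, 'v) module \<Rightarrow> ('v \<Rightarrow> 'b) \<Rightarrow> ('v \<Rightarrow> 'a) \<Rightarrow> 'b" where
  "dual_embedding B R \<phi> f = (\<Sum>b\<in>B. scale (f (the_inv_into (carrier R) \<phi> b)) b)"

definition coordinate_form :: "'b set \<Rightarrow> ('a, 'v) module \<Rightarrow> ('v \<Rightarrow> 'b) \<Rightarrow> 'b \<Rightarrow> 'v \<Rightarrow> 'a" where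
  "coordinate_form B R \<phi> b = (\<lambda>v\<in>carrier R. representation B (\<phi> v) b)"

context
  fixes R :: "('a, 'v) module" and \<phi> :: "'v \<Rightarrow> 'b" and B :: "'b set"
  assumes e: "embedding R \<phi>" and B: "finite B" "independent B" "span B = \<phi> ` carrier R"
begin

lemma linear_form_expand:
  assumes f: "linear_form R f" and v: "v \<in> carrier R"
  shows "f v = (\<Sum>b\<in>B. representation B (\<phi> v) b * f (the_inv_into (carrier R) \<phi> b))"
proof -
  note D = embeddingD[OF e] and L = linear_formD[OF f]
  let ?i = "the_inv_into (carrier R) \<phi>"
  have iB: "?i b \<in> carrier R" "\<phi> (?i b) = b" if "b \<in> span B" for b
    using that B(3) D(1) by (auto simp: the_inv_into_f_f)
  have "0 \<odot>\<^bsub>R\<^esub> \<zero>\<^bsub>R\<^esub> = \<zero>\<^bsub>R\<^esub>"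
    by (rule inj_onD[OF D(1)]) (simp_all add: D(2,3,6,7))
  then have f0: "f \<zero>\<^bsub>R\<^esub> = 0"
    using L(3)[OF D(2), of 0] by simp
  have i0: "?i 0 = \<zero>\<^bsub>R\<^esub>"
    by (rule the_inv_into_f_eq) (simp_all add: D(1-3))
  have expand: "f (?i (\<Sum>b\<in>A. scale (a b) b)) = (\<Sum>b\<in>A. a b * f (?i b))" if "A \<subseteq> B" for a A
    using finite_subset[OF that B(1)] that
  proof (induction A)
    case empty
    then show ?case by (simp add: i0 f0)
  next
    case (insert x A)
    let ?s = "\<Sum>b\<in>A. scale (a b) b"
    have s: "?s \<in> span B"
      by (rule span_sum) (use insert.prems in \<open>auto intro: span_scale span_base\<close>)
    have x: "x \<in> span B"
      using insert.prems by (auto intro: span_base)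
    have "?i (scale (a x) x + ?s) = a x \<odot>\<^bsub>R\<^esub> ?i x \<oplus>\<^bsub>R\<^esub> ?i ?s"
      by (rule the_inv_into_f_eq[OF D(1)]) (simp_all add: D(4-7) iB s x)
    then show ?case
      using insert by (simp add: L(2,3) iB s x D(6))
  qed
  have "(\<Sum>b\<in>B. scale (representation B (\<phi> v) b) b) = \<phi> v"
    using v B by (intro sum_representation_eq) auto
  with expand[OF subset_refl, of "representation B (\<phi> v)"] show ?thesis
    using the_inv_into_f_f[OF D(1) v] by simp
qed

lemma coordinate_form:
  assumes "b \<in> B"
  shows "linear_form R (coordinate_form B R \<phi> b)"
    "dual_embedding B R \<phi> (coordinate_form B R \<phi> b) = b"
proof -
  note D = embeddingD[OF e]
  have s: "\<phi> v \<in> span B" if "v \<in> carrier R" for v using that B(3) by auto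
  show "linear_form R (coordinate_form B R \<phi> b)"
    using s by (auto simp: linear_form_def coordinate_form_def D representation_add[OF B(2)]
        representation_scale[OF B(2)])
  have "the_inv_into (carrier R) \<phi> c \<in> carrier R" "\<phi> (the_inv_into (carrier R) \<phi> c) = c"
    if "c \<in> B" for c
    using that span_base[OF that] B(3) D(1) by (auto simp: the_inv_into_f_f)
  then have "dual_embedding B R \<phi> (coordinate_form B R \<phi> b)
      = (\<Sum>c\<in>B. if c = b then scale 1 b else 0)"
    unfolding dual_embedding_def coordinate_form_def
    by (intro sum.cong) (auto simp: representation_basis[OF B(2)])
  then show "dual_embedding B R \<phi> (coordinate_form B R \<phi> b) = b"
    using B(1) assms by simp
qed

lemma dual_embedding:
  "embedding (dual_space R) (dual_embedding B R \<phi>)"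
  "dual_embedding B R \<phi> ` carrier (dual_space R) = \<phi> ` carrier R"
proof -
  note D = embeddingD[OF e]
  let ?i = "the_inv_into (carrier R) \<phi>" and ?d = "dual_embedding B R \<phi>"
  have iB: "?i b \<in> carrier R" "\<phi> (?i b) = b" if "b \<in> B" for b
    using span_base[OF that] B(3) D(1) by (auto simp: the_inv_into_f_f)
  have inj: "f = g" if f: "linear_form R f" and g: "linear_form R g" and eq: "?d f = ?d g" for f g
  proof -
    have "(\<Sum>b\<in>B. scale (f (?i b) - g (?i b)) b) = 0"
      using eq by (simp add: dual_embedding_def scale_left_diff_distrib sum_subtractf)
    then have "f (?i b) = g (?i b)" if "b \<in> B" for b
      using B that independentD[OF B(2) B(1) subset_refl, of "\<lambda>b. f (?i b) - g (?i b)" b] by simp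
    then have "f v = g v" if "v \<in> carrier R" for v
      using linear_form_expand[OF f that] linear_form_expand[OF g that] by simp
    then show ?thesis
      using linear_formD(1)[OF f] linear_formD(1)[OF g] by (auto intro: extensionalityI)
  qed
  show emb: "embedding (dual_space R) ?d"
    unfolding embedding_def dual_space_simps
  proof (intro conjI ballI allI)
    show "inj_on ?d {f. linear_form R f}" by (auto intro: inj_onI inj)
    show "(\<lambda>v\<in>carrier R. 0) \<in> {f. linear_form R f}" by (auto simp: linear_form_def D)
    show "?d (\<lambda>v\<in>carrier R. 0) = 0" by (simp add: dual_embedding_def iB)
    fix f assume f: "f \<in> {f. linear_form R f}"
    show "(\<lambda>v\<in>carrier R. c * f v) \<in> {f. linear_form R f}" for c
      using f by (auto simp: linear_form_def D distrib_left)
    show "?d (\<lambda>v\<in>carrier R. c * f v) = scale c (?d f)" for c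
      by (simp add: dual_embedding_def iB scale_sum_right)
    fix g assume g: "g \<in> {f. linear_form R f}"
    show "(\<lambda>v\<in>carrier R. f v + g v) \<in> {f. linear_form R f}"
      using f g by (auto simp: linear_form_def D distrib_left)
    show "?d (\<lambda>v\<in>carrier R. f v + g v) = ?d f + ?d g"
      by (simp add: dual_embedding_def iB scale_left_distrib sum.distrib)
  qed
  have "?d ` carrier (dual_space R) \<subseteq> span B"
    by (auto simp: dual_embedding_def intro!: span_sum intro: span_scale span_base)
  moreover have "B \<subseteq> ?d ` carrier (dual_space R)"
    using coordinate_form by (force simp: dual_space_simps)
  ultimately show "?d ` carrier (dual_space R) = \<phi> ` carrier R"
    using span_minimal[OF _ embedding_subspace_image[OF emb]] B(3) by blast
qed

end

definition evaluation :: "('a, 'v) module \<Rightarrow> 'v \<Rightarrow> ('v \<Rightarrow> 'a) \<Rightarrow> 'a" where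
  "evaluation R v = (\<lambda>f\<in>carrier (dual_space R). f v)"

text \<open>The index of the dual takes a maximum over the bidual. Every element of the bidual is an
  evaluation, and on evaluations the two sign changes of the twice dualised action cancel, so the
  maximum is taken over the orbits in \<open>V\<close> itself.\<close>

theorem lie_index_dual:
  fixes V :: "('a, 'v) module"
  assumes e: "embedding V \<phi>" and fd: "\<phi> ` carrier V \<subseteq> span W" "finite W"
    and act: "\<And>x v. x \<in> q \<Longrightarrow> v \<in> carrier V \<Longrightarrow> act x v \<in> carrier V"
      "\<And>x u v. x \<in> q \<Longrightarrow> u \<in> carrier V \<Longrightarrow> v \<in> carrier V \<Longrightarrow>
        act x (u \<oplus>\<^bsub>V\<^esub> v) = act x u \<oplus>\<^bsub>V\<^esub> act x v"
      "\<And>x c v. x \<in> q \<Longrightarrow> v \<in> carrier V \<Longrightarrow> act x (c \<odot>\<^bsub>V\<^esub> v) = c \<odot>\<^bsub>V\<^esub> act x v"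
    and orb: "\<And>v. v \<in> carrier V \<Longrightarrow> subspace (\<phi> ` orbit_tangent q act v)"
  shows "lie_index q (dual_space V) (dual_action V act) =
    int (dim (\<phi> ` carrier V)) - int (Max ((\<lambda>v. dim (\<phi> ` orbit_tangent q act v)) ` carrier V))"
proof -
  obtain B where B0: "B \<subseteq> \<phi> ` carrier V" "independent B" "\<phi> ` carrier V \<subseteq> span B"
    by (rule basis_exists)
  have B: "finite B" "independent B" "span B = \<phi> ` carrier V"
    using independent_span_bound[OF fd(2) B0(2)] B0 fd(1) span_subspace[OF B0(1,3)]
      embedding_subspace_image[OF e] by auto
  let ?D = "dual_space V" and ?\<psi> = "dual_embedding B V \<phi>"
  let ?DD = "dual_space ?D" and ?\<chi> = "dual_embedding B (dual_space V) (dual_embedding B V \<phi>)"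
  note d1 = dual_embedding[OF e B]
  have B': "span B = ?\<psi> ` carrier ?D" using d1(2) B(3) by simp
  note d2 = dual_embedding[OF d1(1) B(1,2) B']
  have ev: "evaluation V v \<in> carrier ?DD" if "v \<in> carrier V" for v
    using that embeddingD(4,6)[OF d1(1)]
    by (auto simp: evaluation_def linear_form_def dual_space_simps)
  \<comment> \<open>In the coordinates given by \<open>B\<close>, evaluation at \<open>v\<close> is
    \<phi> applied to \<open>v\<close>. As the bidual has the same image as \<open>V\<close>,
    surjectivity of evaluation follows without a dimension count.\<close>
  have chi: "?\<chi> (evaluation V v) = \<phi> v" if v: "v \<in> carrier V" for v
  proof -
    have "the_inv_into (carrier ?D) ?\<psi> b = coordinate_form B V \<phi> b" if "b \<in> B" for b
      using coordinate_form[OF e B that] embeddingD(1)[OF d1(1)]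
      by (intro the_inv_into_f_eq) (auto simp: dual_space_simps)
    then have "?\<chi> (evaluation V v) = (\<Sum>b\<in>B. scale (representation B (\<phi> v) b) b)"
      unfolding dual_embedding_def using coordinate_form[OF e B] v
      by (intro sum.cong) (auto simp: evaluation_def dual_space_simps coordinate_form_def)
    also have "\<dots> = \<phi> v"
      using B v by (intro sum_representation_eq) auto
    finally show ?thesis .
  qed
  have surj: "carrier ?DD = evaluation V ` carrier V"
  proof
    show "evaluation V ` carrier V \<subseteq> carrier ?DD" using ev by auto
    show "carrier ?DD \<subseteq> evaluation V ` carrier V"
    proof
      fix \<xi> assume x: "\<xi> \<in> carrier ?DD"
      then obtain v where v: "v \<in> carrier V" "?\<chi> \<xi> = \<phi> v"
        using d2(2) d1(2) by (metis (no_types, lifting) imageE imageI)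
      then have "\<xi> = evaluation V v"
        using inj_onD[OF embeddingD(1)[OF d2(1)], of \<xi> "evaluation V v"] x chi ev by simp
      then show "\<xi> \<in> evaluation V ` carrier V" using v by auto
    qed
  qed
  have da: "dual_action V act x f \<in> carrier ?D" if "x \<in> q" "f \<in> carrier ?D" for x f
    using that embeddingD(4,6)[OF e]
    by (auto simp: dual_space_simps dual_action_def linear_form_def act)
  have orbit: "orbit_tangent q (dual_action ?D (dual_action V act)) (evaluation V v)
      = evaluation V ` orbit_tangent q act v" if v: "v \<in> carrier V" for v
  proof -
    have "dual_action ?D (dual_action V act) x (evaluation V v) = evaluation V (act x v)"
      if "x \<in> q" for x
      unfolding evaluation_def dual_action_def[of ?D]
      by (rule restrict_ext) (use da[OF that] v in \<open>simp add: dual_action_def\<close>)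
    then show ?thesis
      by (auto simp: orbit_tangent_def image_image)
  qed
  have dimorb: "vectorspace.dim class_ring
        (?DD\<lparr>carrier := orbit_tangent q (dual_action ?D (dual_action V act)) (evaluation V v)\<rparr>)
      = dim (\<phi> ` orbit_tangent q act v)" if v: "v \<in> carrier V" for v
  proof -
    let ?O = "orbit_tangent q act v"
    have O: "?O \<subseteq> carrier V" using act(1) v by (auto simp: orbit_tangent_def)
    then have im: "?\<chi> ` evaluation V ` ?O = \<phi> ` ?O"
      using chi by (force simp: image_image)
    have "embedding (?DD\<lparr>carrier := evaluation V ` ?O\<rparr>) ?\<chi>"
      using O ev orb[OF v] im by (intro embedding_restrict[OF d2(1)]) auto
    from embedding_dim[OF this, of W] show ?thesis
      using im O fd orbit[OF v] by auto
  qed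
  have "vectorspace.dim class_ring ?D = dim (\<phi> ` carrier V)"
    using embedding_dim[OF d1(1), of W] d1(2) fd by simp
  then show ?thesis
    unfolding lie_index_def surj by (simp add: image_image dimorb cong: image_cong_simp)
qed

end

section \<open>Linear algebra relative to finite-dimensional subspaces\<close>

context coordinate_space
begin

sublocale endo: vector_space_pair scale scale
  by unfold_locales

sublocale functional: vector_space_pair scale "(*) :: 'a \<Rightarrow> 'a \<Rightarrow> 'a"
  by unfold_locales (simp_all add: algebra_simps)

definition finite_dim :: "'b set \<Rightarrow> bool" where
  "finite_dim S \<longleftrightarrow> (\<exists>W. finite W \<and> S \<subseteq> span W)"

lemma finite_dim_subset: "finite_dim T \<Longrightarrow> S \<subseteq> T \<Longrightarrow> finite_dim S"
  unfolding finite_dim_def by blast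

lemma finite_dim_independent:
  assumes "finite_dim S" "independent B" "B \<subseteq> S"
  shows "finite B"
  using assms independent_span_bound[of _ B] unfolding finite_dim_def by (meson subset_trans)

lemma finite_dim_dim_mono:
  assumes "finite_dim T" "S \<subseteq> T"
  shows "dim S \<le> dim T"
proof -
  obtain B where B: "B \<subseteq> T" "independent B" "T \<subseteq> span B" "card B = dim T"
    by (rule basis_exists)
  then have "finite B" using finite_dim_independent assms(1) by blast
  with B show ?thesis using dim_le_card[of S B] assms(2) by auto
qed

text \<open>Rank-nullity for the restriction of \<open>L\<close> to \<open>T\<close>: a basis of the
  kernel is extended to \<open>T\<close>, and the added vectors map to a basis of the image.\<close>

lemma dim_kernel_image:
  assumes L: "Vector_Spaces.linear scale scale L" and T: "subspace T" "finite_dim T"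
    and S: "subspace S" "S \<subseteq> T" and ker: "\<And>x. x \<in> T \<Longrightarrow> L x = 0 \<longleftrightarrow> x \<in> S"
  shows "dim T = dim S + dim (L ` T)"
proof -
  obtain A where A: "A \<subseteq> S" "independent A" "S \<subseteq> span A" "card A = dim S"
    by (rule basis_exists)
  obtain B where B: "A \<subseteq> B" "B \<subseteq> T" "independent B" "T \<subseteq> span B"
    using maximal_independent_subset_extend[of A T] A S by (metis subset_trans)
  have fin: "finite B" "finite A" using finite_dim_independent[OF T(2) B(3,2)] B(1) finite_subset by auto
  have sp: "span B = T" "span A = S"
    using span_subspace[OF B(2,4) T(1)] span_subspace[OF A(1,3) S(1)] by auto
  let ?C = "B - A"
  have inj: "inj_on L (span ?C)"
  proof (subst endo.linear_inj_on_iff_eq_0[OF L subspace_span], intro ballI impI)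
    fix x assume x: "x \<in> span ?C" "L x = 0"
    have "x \<in> span B" using x(1) span_mono[of ?C B] by auto
    then have xA: "x \<in> span A" using x(2) ker sp by auto
    have 1: "representation B x = representation A x"
      using B by (intro representation_extend xA) auto
    have 2: "representation B x = representation ?C x"
      using B by (intro representation_extend x) auto
    have "representation A x b = 0" for b
      using representation_ne_zero[of A x b] representation_ne_zero[of ?C x b] 1 2 by auto
    then show "x = 0"
      using sum_nonzero_representation_eq[OF A(2) xA] by simp
  qed
  have ind: "independent (L ` ?C)"
    using inj B(3) endo.linear_independent_injective_image[OF L] independent_mono by blast
  have "L ` T \<subseteq> span (L ` ?C)"
  proof -
    have "L b \<in> span (L ` ?C)" if "b \<in> B" for b
    proof (cases "b \<in> A")
      case True
      then have "L b = 0" using ker[of b] A(1) S(2) by auto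
      then show ?thesis by (simp add: span_zero)
    qed (use that in \<open>auto intro: span_base\<close>)
    then have "span (L ` B) \<subseteq> span (L ` ?C)" by (intro span_minimal) auto
    then show ?thesis using sp(1) endo.linear_span_image[OF L, of B] by simp
  qed
  then have "dim (L ` T) = card (L ` ?C)"
    using B(2) by (intro dim_unique[OF _ _ ind]) auto
  also have "\<dots> = card B - card A"
    using inj_on_subset[OF inj] span_superset fin B(1) by (subst card_image) (auto simp: card_Diff_subset)
  finally show ?thesis
    using basis_card_eq_dim[OF B(2,4,3)] A(4) card_mono[OF fin(1) B(1)] by simp
qed

text \<open>A model of the quotient \<open>T/S\<close> inside the ambient space: extend a basis of
  \<open>S\<close> to \<open>T\<close>, kill the former and fix the added vectors. Quotient records
  can then be treated by embeddings again.\<close>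

lemma linear_with_kernel:
  assumes S: "subspace S" "S \<subseteq> T" "subspace T"
  obtains L where "Vector_Spaces.linear scale scale L" "\<And>x. x \<in> T \<Longrightarrow> L x = 0 \<longleftrightarrow> x \<in> S"
proof -
  obtain A where A: "A \<subseteq> S" "independent A" "S \<subseteq> span A" "card A = dim S"
    by (rule basis_exists)
  obtain B where B: "A \<subseteq> B" "B \<subseteq> T" "independent B" "T \<subseteq> span B"
    using maximal_independent_subset_extend[of A T] A S by (metis subset_trans)
  obtain L where L: "Vector_Spaces.linear scale scale L" "\<And>x. x \<in> B \<Longrightarrow> L x = (if x \<in> A then 0 else x)"
    using endo.linear_independent_extend[OF B(3), of "\<lambda>x. if x \<in> A then 0 else x"] by auto
  have sA: "span A = S" using span_subspace[OF A(1,3) S(1)] .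
  have "L x = 0 \<longleftrightarrow> x \<in> S" if x: "x \<in> T" for x
  proof
    assume "x \<in> S"
    then show "L x = 0"
      using sA endo.linear_eq_0_on_span[OF L(1), of A x] L(2) B(1) by (simp add: subset_iff)
  next
    assume Lx: "L x = 0"
    let ?r = "representation B x" and ?F = "{b. representation B x b \<noteq> 0}"
    have F: "finite ?F" "?F \<subseteq> B" using finite_representation representation_ne_zero by auto
    have x': "x = (\<Sum>b\<in>?F. scale (?r b) b)"
      using x B(3,4) by (subst sum_nonzero_representation_eq) auto
    have "0 = (\<Sum>b\<in>?F. scale (?r b) (L b))"
      using arg_cong[OF x', of L] Lx by (simp add: endo.linear_sum[OF L(1)] endo.linear_scale[OF L(1)])
    also have "\<dots> = (\<Sum>b\<in>?F. if b \<in> A then 0 else scale (?r b) b)"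
      using F(2) L(2) by (intro sum.cong) auto
    also have "\<dots> = (\<Sum>b\<in>?F - A. scale (?r b) b)"
      using F(1) by (intro sum.mono_neutral_cong_right) auto
    finally have "?r b = 0" if "b \<in> ?F - A" for b
      using independentD[OF B(3), of "?F - A" ?r b] F that by auto
    then have "?F \<subseteq> A" by auto
    then have "x \<in> span A"
      by (subst x') (auto intro!: span_sum intro: span_scale span_base)
    then show "x \<in> S" using sA by simp
  qed
  with L(1) show ?thesis by (rule that)
qed

lemma separating_functional:
  assumes S: "subspace S" "x \<notin> S"
  obtains f where "Vector_Spaces.linear scale (*) f" "\<And>y. y \<in> S \<Longrightarrow> f y = 0" "f x = 1"
proof -
  obtain A where A: "A \<subseteq> S" "independent A" "S \<subseteq> span A" "card A = dim S"
    by (rule basis_exists)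
  have sA: "span A = S" using span_subspace[OF A(1,3) S(1)] .
  then have "independent (insert x A)"
    using A S by (intro independent_insertI) auto
  from functional.linear_independent_extend[OF this, of "\<lambda>y. if y = x then 1 else 0"]
  obtain f where f: "Vector_Spaces.linear scale (*) f"
    "\<forall>y\<in>insert x A. f y = (if y = x then 1 else 0)" by blast
  have "f y = 0" if "y \<in> S" for y
  proof (rule functional.linear_eq_0_on_span[OF f(1), of A y])
    show "f z = 0" if "z \<in> A" for z using that f(2) A(1) S(2) by auto
    show "y \<in> span A" using that sA by simp
  qed
  with f show ?thesis by (intro that[of f]) auto
qed

text \<open>A form that vanishes on the kernel of \<open>L\<close> depends on \<open>L x\<close>
  only, so it can be defined on a basis of the image by chosen preimages. Its use is with
  \<open>L\<close> the map from \<xi> to \<open>\<xi> v\<close> and \<open>g\<close> the map from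
  \<xi> to \<open>w (\<xi> u)\<close>; the factor is the first-order part of a functional.\<close>

lemma factor_functional:
  assumes q: "subspace q"
    and L: "\<And>x y. x \<in> q \<Longrightarrow> y \<in> q \<Longrightarrow> L (x + y) = L x + L y"
      "\<And>c x. x \<in> q \<Longrightarrow> L (scale c x) = scale c (L x)"
    and g: "\<And>x y. x \<in> q \<Longrightarrow> y \<in> q \<Longrightarrow> g (x + y) = g x + g y"
      "\<And>c x. x \<in> q \<Longrightarrow> g (scale c x) = c * g x"
    and ker: "\<And>x. x \<in> q \<Longrightarrow> L x = 0 \<Longrightarrow> g x = 0"
  obtains f where "Vector_Spaces.linear scale (*) f" "\<And>x. x \<in> q \<Longrightarrow> g x = f (L x)"
proof -
  obtain C where C: "C \<subseteq> L ` q" "independent C" "L ` q \<subseteq> span C" "card C = dim (L ` q)"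
    by (rule basis_exists)
  have "\<forall>c\<in>C. \<exists>x. x \<in> q \<and> L x = c" using C(1) by auto
  then obtain h where h: "\<And>c. c \<in> C \<Longrightarrow> h c \<in> q \<and> L (h c) = c"
    by (auto simp: bchoice_iff)
  obtain f where f: "Vector_Spaces.linear scale (*) f" "\<And>c. c \<in> C \<Longrightarrow> f c = g (h c)"
    using functional.linear_independent_extend[OF C(2), of "\<lambda>c. g (h c)"] by metis
  have L0: "L 0 = 0" and g0: "g 0 = 0"
    using L(2)[of 0 0] g(2)[of 0 0] subspace_0[OF q] by simp_all
  have lin: "(\<Sum>c\<in>F. scale (r c) (h c)) \<in> q \<and>
      L (\<Sum>c\<in>F. scale (r c) (h c)) = (\<Sum>c\<in>F. scale (r c) c) \<and>
      g (\<Sum>c\<in>F. scale (r c) (h c)) = (\<Sum>c\<in>F. r c * g (h c))"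
    if "finite F" "F \<subseteq> C" for F r
    using that
  proof (induction F)
    case empty
    then show ?case using L0 g0 subspace_0[OF q] by simp
  next
    case (insert c F)
    then show ?case
      using h[of c] subspace_add[OF q] subspace_scale[OF q] by (simp add: L g)
  qed
  have "g x = f (L x)" if x: "x \<in> q" for x
  proof -
    let ?r = "representation C (L x)" and ?F = "{c. representation C (L x) c \<noteq> 0}"
    have F: "finite ?F" "?F \<subseteq> C" using finite_representation representation_ne_zero by auto
    let ?y = "\<Sum>c\<in>?F. scale (?r c) (h c)"
    have Lx: "(\<Sum>c\<in>?F. scale (?r c) c) = L x"
      using C x by (intro sum_nonzero_representation_eq) auto
    note y = lin[OF F, of ?r]
    have d: "x - ?y = x + scale (-1) ?y" by simp
    have y': "?y \<in> q" "L ?y = L x" "scale (-1) ?y \<in> q" using y Lx subspace_neg[OF q] by auto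
    have "L (x - ?y) = 0" unfolding d L(1)[OF x y'(3)] L(2)[OF y'(1)] y'(2) by simp
    then have "g (x - ?y) = 0" using ker subspace_diff[OF q] x y by blast
    then have "g x = g ?y" unfolding d g(1)[OF x y'(3)] g(2)[OF y'(1)] by simp
    also have "\<dots> = (\<Sum>c\<in>?F. ?r c * f c)" using y F(2) f(2) by (auto intro!: sum.cong)
    also have "\<dots> = f (\<Sum>c\<in>?F. scale (?r c) c)"
      by (simp add: functional.linear_sum[OF f(1)] functional.linear_scale[OF f(1)])
    finally show ?thesis using Lx by simp
  qed
  with f(1) show ?thesis by (rule that)
qed

end

section \<open>Quotient records, and indices as dimensions of subspaces\<close>

context coordinate_space
begin

context
  fixes V :: "('a, 'v) module" and \<phi> :: "'v \<Rightarrow> 'b" and U :: "'v set" and L :: "'b \<Rightarrow> 'b"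
  assumes e: "embedding V \<phi>" and U: "U \<subseteq> carrier V" "subspace (\<phi> ` U)"
    and L: "Vector_Spaces.linear scale scale L"
    and ker: "\<forall>x\<in>\<phi> ` carrier V. L x = 0 \<longleftrightarrow> x \<in> \<phi> ` U"
begin

text \<open>The cosets of \<open>U\<close>, described as level sets: set operations on cosets become
  computations with the values of \<open>L\<close>.\<close>

definition fibre :: "'v \<Rightarrow> 'v set" where
  "fibre v = {w \<in> carrier V. L (\<phi> w) = L (\<phi> v)}"

lemma L_U: "u \<in> U \<Longrightarrow> L (\<phi> u) = 0"
  using ker U(1) by blast

lemma translate:
  assumes "v \<in> carrier V" "w \<in> carrier V" "L (\<phi> w) = L (\<phi> v)"
  obtains u where "u \<in> U" "w = u \<oplus>\<^bsub>V\<^esub> v"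
proof -
  note D = embeddingD[OF e]
  have "\<phi> w - \<phi> v \<in> \<phi> ` carrier V"
    using embedding_subspace_image[OF e] assms by (auto intro: subspace_diff)
  moreover have "L (\<phi> w - \<phi> v) = 0"
    using assms by (simp add: endo.linear_diff[OF L])
  ultimately obtain u where u: "u \<in> U" "\<phi> u = \<phi> w - \<phi> v" using ker by (metis imageE)
  have "w = u \<oplus>\<^bsub>V\<^esub> v"
    by (rule inj_onD[OF D(1)]) (use u U(1) assms D in auto)
  with u(1) show ?thesis by (rule that)
qed

lemma coset_eq_fibre:
  assumes v: "v \<in> carrier V"
  shows "U +>\<^bsub>V\<^esub> v = fibre v"
proof -
  note D = embeddingD[OF e]
  have "U +>\<^bsub>V\<^esub> v = (\<lambda>u. u \<oplus>\<^bsub>V\<^esub> v) ` U"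
    by (auto simp: a_r_coset_def r_coset_def)
  also have "\<dots> = fibre v"
  proof
    show "(\<lambda>u. u \<oplus>\<^bsub>V\<^esub> v) ` U \<subseteq> fibre v"
      using v U(1) L_U by (auto simp: fibre_def D subset_iff endo.linear_add[OF L])
    show "fibre v \<subseteq> (\<lambda>u. u \<oplus>\<^bsub>V\<^esub> v) ` U"
      using v by (auto simp: fibre_def elim: translate)
  qed
  finally show ?thesis .
qed

lemma set_add_eq: "S <+>\<^bsub>V\<^esub> T = {s \<oplus>\<^bsub>V\<^esub> t | s t. s \<in> S \<and> t \<in> T}"
  by (auto simp: set_add_def set_mult_def)

lemma fibre_zero: "fibre \<zero>\<^bsub>V\<^esub> = U"
proof -
  note D = embeddingD[OF e]
  have "v \<in> U" if "v \<in> carrier V" "\<phi> v \<in> \<phi> ` U" for v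
    using that inj_onD[OF D(1)] U(1) by (metis (no_types, lifting) imageE subset_eq)
  then show ?thesis
    using ker U(1) D(3) L_U by (auto simp: fibre_def endo.linear_0[OF L])
qed

lemma fibre_add:
  assumes "v \<in> carrier V" "w \<in> carrier V"
  shows "fibre v <+>\<^bsub>V\<^esub> fibre w = fibre (v \<oplus>\<^bsub>V\<^esub> w)"
proof
  note D = embeddingD[OF e]
  show "fibre v <+>\<^bsub>V\<^esub> fibre w \<subseteq> fibre (v \<oplus>\<^bsub>V\<^esub> w)"
    using assms by (auto simp: set_add_eq fibre_def D endo.linear_add[OF L])
  show "fibre (v \<oplus>\<^bsub>V\<^esub> w) \<subseteq> fibre v <+>\<^bsub>V\<^esub> fibre w"
  proof
    fix x assume x: "x \<in> fibre (v \<oplus>\<^bsub>V\<^esub> w)"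
    obtain u where u: "u \<in> U" "x = u \<oplus>\<^bsub>V\<^esub> (v \<oplus>\<^bsub>V\<^esub> w)"
      by (rule translate[of "v \<oplus>\<^bsub>V\<^esub> w" x]) (use assms D(4) x in \<open>auto simp: fibre_def\<close>)
    have uc: "u \<in> carrier V" using u(1) U(1) by auto
    have "x = (u \<oplus>\<^bsub>V\<^esub> v) \<oplus>\<^bsub>V\<^esub> w"
      unfolding u(2) by (rule inj_onD[OF D(1)]) (use uc assms in \<open>simp_all add: D add.assoc\<close>)
    moreover have "u \<oplus>\<^bsub>V\<^esub> v \<in> fibre v" "w \<in> fibre w"
      using uc assms L_U[OF u(1)] by (auto simp: fibre_def D endo.linear_add[OF L])
    ultimately show "x \<in> fibre v <+>\<^bsub>V\<^esub> fibre w" by (auto simp: set_add_eq)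
  qed
qed

text \<open>Covers scalar multiplication and the induced action at once, as both have the shape
  \<open>U\<close> plus the image of a coset. The summand \<open>U\<close> completes an image that
  is too small, for instance under the scalar zero.\<close>

lemma U_add_image_fibre:
  assumes v: "v \<in> carrier V"
    and f: "\<And>w. w \<in> carrier V \<Longrightarrow> f w \<in> carrier V"
      "\<And>w. w \<in> fibre v \<Longrightarrow> L (\<phi> (f w)) = L (\<phi> (f v))"
  shows "U <+>\<^bsub>V\<^esub> (f ` fibre v) = fibre (f v)"
proof
  note D = embeddingD[OF e]
  have c: "w \<in> carrier V" if "w \<in> fibre v" for w using that by (simp add: fibre_def)
  show "U <+>\<^bsub>V\<^esub> (f ` fibre v) \<subseteq> fibre (f v)"
    using U(1) f c L_U by (auto simp: set_add_eq fibre_def[of "f v"] D subset_iff endo.linear_add[OF L])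
  show "fibre (f v) \<subseteq> U <+>\<^bsub>V\<^esub> (f ` fibre v)"
  proof
    fix x assume x: "x \<in> fibre (f v)"
    obtain u where "u \<in> U" "x = u \<oplus>\<^bsub>V\<^esub> f v"
      by (rule translate[of "f v" x]) (use v f(1) x in \<open>auto simp: fibre_def\<close>)
    moreover have "v \<in> fibre v" using v by (simp add: fibre_def)
    ultimately show "x \<in> U <+>\<^bsub>V\<^esub> (f ` fibre v)" by (auto simp: set_add_eq)
  qed
qed

lemma fibre_smult:
  assumes v: "v \<in> carrier V"
  shows "U <+>\<^bsub>V\<^esub> ((\<lambda>s. c \<odot>\<^bsub>V\<^esub> s) ` fibre v) = fibre (c \<odot>\<^bsub>V\<^esub> v)"
  using v embeddingD[OF e]
  by (intro U_add_image_fibre) (auto simp: fibre_def endo.linear_scale[OF L])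

definition fibre_value :: "'v set \<Rightarrow> 'b" where
  "fibre_value S = the_elem ((\<lambda>w. L (\<phi> w)) ` S)"

lemma fibre_value: "v \<in> carrier V \<Longrightarrow> fibre_value (fibre v) = L (\<phi> v)"
proof -
  assume v: "v \<in> carrier V"
  then have "(\<lambda>w. L (\<phi> w)) ` fibre v = {L (\<phi> v)}" by (auto simp: fibre_def)
  then show ?thesis by (simp add: fibre_value_def)
qed

lemma quotient_carrier: "carrier (quotient_space V U) = fibre ` carrier V"
  using coset_eq_fibre
  by (auto simp: quotient_space_def A_RCOSETS_def RCOSETS_def a_r_coset_def[symmetric])

lemma quotient_embedding: "embedding (quotient_space V U) fibre_value"
proof -
  note D = embeddingD[OF e]
  have ops: "\<zero>\<^bsub>quotient_space V U\<^esub> = U" "S \<oplus>\<^bsub>quotient_space V U\<^esub> T = S <+>\<^bsub>V\<^esub> T"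
    "c \<odot>\<^bsub>quotient_space V U\<^esub> S = U <+>\<^bsub>V\<^esub> ((\<lambda>s. c \<odot>\<^bsub>V\<^esub> s) ` S)" for S T c
    by (simp_all add: quotient_space_def)
  have "inj_on fibre_value (fibre ` carrier V)"
  proof (rule inj_onI)
    fix S T assume "S \<in> fibre ` carrier V" "T \<in> fibre ` carrier V" "fibre_value S = fibre_value T"
    then obtain v w where "S = fibre v" "T = fibre w" "L (\<phi> v) = L (\<phi> w)"
      by (auto simp: fibre_value)
    then show "S = T" by (simp add: fibre_def)
  qed
  moreover have "U \<in> fibre ` carrier V" "fibre_value U = 0"
    using fibre_zero D(2,3) fibre_value[OF D(2)] endo.linear_0[OF L] by auto
  ultimately show ?thesis
    unfolding embedding_def quotient_carrier ops
    by (simp add: fibre_add fibre_smult fibre_value D endo.linear_add[OF L] endo.linear_scale[OF L])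
qed

end

text \<open>The preimage in \<open>V\<close> of the orbit of \<open>u + U\<close> under the
  annihilator of \<open>v\<close> is \<open>q v + q_v u\<close>, where \<open>U = q v\<close>. Both
  terms of the index of the quotient therefore differ from dimensions in \<open>V\<close> by
  \<open>dim U\<close>, which cancels.\<close>

theorem good_index_behaviour_iff_dim:
  fixes V :: "('a, 'v) module" and q :: "'x set"
  assumes e: "embedding V \<phi>" and fd: "finite_dim (\<phi> ` carrier V)"
    and act: "\<And>x v. x \<in> q \<Longrightarrow> v \<in> carrier V \<Longrightarrow> act x v \<in> carrier V"
      "\<And>x u v. x \<in> q \<Longrightarrow> u \<in> carrier V \<Longrightarrow> v \<in> carrier V \<Longrightarrow>
        act x (u \<oplus>\<^bsub>V\<^esub> v) = act x u \<oplus>\<^bsub>V\<^esub> act x v"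
      "\<And>x c v. x \<in> q \<Longrightarrow> v \<in> carrier V \<Longrightarrow> act x (c \<odot>\<^bsub>V\<^esub> v) = c \<odot>\<^bsub>V\<^esub> act x v"
    and orb: "\<And>v. v \<in> carrier V \<Longrightarrow> subspace (\<phi> ` orbit_tangent q act v)"
      "\<And>u v. u \<in> carrier V \<Longrightarrow> v \<in> carrier V \<Longrightarrow>
        subspace (\<phi> ` orbit_tangent (annihilator q V act v) act u)"
    and stable: "\<And>x v w. v \<in> carrier V \<Longrightarrow> x \<in> annihilator q V act v \<Longrightarrow>
        w \<in> orbit_tangent q act v \<Longrightarrow> act x w \<in> orbit_tangent q act v"
  shows "good_index_behaviour q V act \<longleftrightarrow>
    (\<forall>v\<in>carrier V. Max ((\<lambda>w. dim (\<phi> ` orbit_tangent q act w)) ` carrier V) =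
      Max ((\<lambda>u. dim {a + b | a b. a \<in> \<phi> ` orbit_tangent q act v \<and>
        b \<in> \<phi> ` orbit_tangent (annihilator q V act v) act u}) ` carrier V))"
proof -
  note D = embeddingD[OF e]
  let ?N = "dim (\<phi> ` carrier V)"
  let ?D = "Max ((\<lambda>w. dim (\<phi> ` orbit_tangent q act w)) ` carrier V)"
  define P where "P v u = {a + b | a b. a \<in> \<phi> ` orbit_tangent q act v \<and>
        b \<in> \<phi> ` orbit_tangent (annihilator q V act v) act u}" for v u
  have sV: "subspace (\<phi> ` carrier V)" by (rule embedding_subspace_image[OF e])
  obtain W where W: "finite W" "\<phi> ` carrier V \<subseteq> span W"
    using fd unfolding finite_dim_def by auto
  have lhs: "lie_index q (dual_space V) (dual_action V act) = int ?N - int ?D"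
    by (rule lie_index_dual[OF e W(2,1) act orb(1)])
  have dimle: "dim S \<le> ?N" if "S \<subseteq> \<phi> ` carrier V" for S
    using finite_dim_dim_mono[OF fd that] .
  have "lie_index (annihilator q V act v) (dual_space (quotient_space V (orbit_tangent q act v)))
      (dual_action (quotient_space V (orbit_tangent q act v))
        (quotient_action V (orbit_tangent q act v) act))
    = int ?N - int (Max (dim ` P v ` carrier V))" if v: "v \<in> carrier V" for v
  proof -
    let ?U = "orbit_tangent q act v" and ?q = "annihilator q V act v"
    have U: "?U \<subseteq> carrier V" "subspace (\<phi> ` ?U)"
      using act(1) v orb(1) by (auto simp: orbit_tangent_def)
    obtain L where L: "Vector_Spaces.linear scale scale L"
      "\<And>x. x \<in> \<phi> ` carrier V \<Longrightarrow> L x = 0 \<longleftrightarrow> x \<in> \<phi> ` ?U"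
      using linear_with_kernel[OF U(2) image_mono[OF U(1)] sV] by blast
    have "\<forall>x\<in>\<phi> ` carrier V. L x = 0 \<longleftrightarrow> x \<in> \<phi> ` ?U" using L(2) by blast
    note ctx = e U L(1) this
    let ?f = "fibre V \<phi> L" and ?\<chi> = "fibre_value \<phi> L" and ?VU = "quotient_space V ?U"
      and ?qa = "quotient_action V ?U act"
    note fv = fibre_value[OF ctx]
    have qx: "x \<in> q" if "x \<in> ?q" for x using that by (simp add: annihilator_def)
    have qa: "?qa x (?f w) = ?f (act x w)" if x: "x \<in> ?q" and w: "w \<in> carrier V" for x w
      unfolding quotient_action_def
    proof (rule U_add_image_fibre[OF ctx w])
      fix w' assume "w' \<in> ?f w"
      then have w': "w' \<in> carrier V" "L (\<phi> w') = L (\<phi> w)" by (auto simp: fibre_def[OF ctx])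
      then obtain u where u: "u \<in> ?U" "w' = u \<oplus>\<^bsub>V\<^esub> w"
        using translate[OF ctx w] by metis
      then have uc: "u \<in> carrier V" using U(1) by auto
      have "L (\<phi> (act x u)) = 0" using L_U[OF ctx stable[OF v x u(1)]] .
      then show "L (\<phi> (act x w')) = L (\<phi> (act x w))"
        unfolding u(2) using act(1,2)[OF qx[OF x]] uc w D(5) by (simp add: endo.linear_add[OF L(1)])
    qed (use act(1) qx x in auto)
    have im: "?\<chi> ` carrier ?VU = L ` \<phi> ` carrier V"
      using fv by (auto simp: quotient_carrier[OF ctx] image_image)
    have orbU: "?\<chi> ` orbit_tangent ?q ?qa (?f w) = L ` \<phi> ` orbit_tangent ?q act w"
      if w: "w \<in> carrier V" for w
      unfolding orbit_tangent_def[of ?q] image_image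
      by (rule image_cong) (simp_all add: qa w fv act(1)[OF qx])
    have fdq: "?\<chi> ` carrier ?VU \<subseteq> span (L ` W)"
      unfolding im using W(2) by (auto simp: endo.linear_span_image[OF L(1)])
    have idx: "lie_index ?q (dual_space ?VU) (dual_action ?VU ?qa) =
      int (dim (?\<chi> ` carrier ?VU))
        - int (Max ((\<lambda>S. dim (?\<chi> ` orbit_tangent ?q ?qa S)) ` carrier ?VU))"
    proof (rule lie_index_dual[OF quotient_embedding[OF ctx] fdq])
      fix x S assume x: "x \<in> ?q" and S: "S \<in> carrier ?VU"
      then obtain w where w: "w \<in> carrier V" "S = ?f w" by (auto simp: quotient_carrier[OF ctx])
      show "?qa x S \<in> carrier ?VU"
        using x w qa act(1)[OF qx] by (auto simp: quotient_carrier[OF ctx])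
      have ops: "S \<oplus>\<^bsub>?VU\<^esub> T = S <+>\<^bsub>V\<^esub> T"
        "c \<odot>\<^bsub>?VU\<^esub> S = ?U <+>\<^bsub>V\<^esub> ((\<lambda>s. c \<odot>\<^bsub>V\<^esub> s) ` S)" for S T c
        by (simp_all add: quotient_space_def)
      show "?qa x (c \<odot>\<^bsub>?VU\<^esub> S) = c \<odot>\<^bsub>?VU\<^esub> ?qa x S" for c
        unfolding ops w(2)
        using x w(1) act(1,3)[OF qx[OF x]] D(6) by (simp add: qa fibre_smult[OF ctx])
      fix T assume "T \<in> carrier ?VU"
      then obtain w' where w': "w' \<in> carrier V" "T = ?f w'" by (auto simp: quotient_carrier[OF ctx])
      show "?qa x (S \<oplus>\<^bsub>?VU\<^esub> T) = ?qa x S \<oplus>\<^bsub>?VU\<^esub> ?qa x T"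
        unfolding ops w(2) w'(2)
        using x w(1) w'(1) act(1,2)[OF qx[OF x]] D(4) by (simp add: qa fibre_add[OF ctx])
    next
      fix S assume "S \<in> carrier ?VU"
      then obtain w where w: "w \<in> carrier V" "S = ?f w" by (auto simp: quotient_carrier[OF ctx])
      show "subspace (?\<chi> ` orbit_tangent ?q ?qa S)"
        unfolding w(2) orbU[OF w(1)]
        by (rule endo.linear_subspace_image[OF L(1) orb(2)[OF w(1) v]])
    qed (rule finite_imageI[OF W(1)])
    have dV: "?N = dim (\<phi> ` ?U) + dim (?\<chi> ` carrier ?VU)"
      unfolding im by (rule dim_kernel_image[OF L(1) sV fd U(2) image_mono[OF U(1)] L(2)])
    have dP: "dim (P v u) = dim (\<phi> ` ?U) + dim (?\<chi> ` orbit_tangent ?q ?qa (?f u))"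
      if u: "u \<in> carrier V" for u
    proof -
      let ?O = "orbit_tangent ?q act u"
      have O: "?O \<subseteq> carrier V" "subspace (\<phi> ` ?O)"
        using act(1) qx u orb(2)[OF u v] by (auto simp: orbit_tangent_def)
      have sP: "subspace (P v u)" unfolding P_def by (rule subspace_sums[OF U(2) O(2)])
      have PV: "P v u \<subseteq> \<phi> ` carrier V"
      proof -
        have "\<phi> a + \<phi> b \<in> \<phi> ` carrier V" if "a \<in> ?U" "b \<in> ?O" for a b
          using that U(1) O(1) by (intro subspace_add[OF sV]) auto
        then show ?thesis by (auto simp: P_def)
      qed
      have UP: "\<phi> ` ?U \<subseteq> P v u"
        using subspace_0[OF O(2)] unfolding P_def by force
      have "L ` P v u = L ` \<phi> ` ?O"
      proof
        show "L ` P v u \<subseteq> L ` \<phi> ` ?O"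
          using L_U[OF ctx] by (auto simp: P_def endo.linear_add[OF L(1)])
        have "\<phi> ` ?O \<subseteq> P v u"
          using subspace_0[OF U(2)] unfolding P_def by force
        then show "L ` \<phi> ` ?O \<subseteq> L ` P v u" by auto
      qed
      then show ?thesis
        unfolding orbU[OF u]
        using dim_kernel_image[OF L(1) sP finite_dim_subset[OF fd PV] U(2) UP L(2)[OF subsetD[OF PV]]]
        by simp
    qed
    let ?M = "(\<lambda>u. dim (?\<chi> ` orbit_tangent ?q ?qa (?f u))) ` carrier V"
    have fin: "finite ?M"
    proof (rule finite_subset)
      have "dim (P v u) \<le> ?N" if u: "u \<in> carrier V" for u
        using U(1) act(1)[OF qx] u subspace_add[OF sV]
        by (intro dimle) (auto simp: P_def orbit_tangent_def)
      then show "?M \<subseteq> {..?N}" using dP by fastforce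
    qed simp
    \<comment> \<open>All dimensions are shifted by the constant \<open>dim U\<close>, so their
      maximum is shifted by the same amount.\<close>
    have "Max (dim ` P v ` carrier V) = Max ((\<lambda>m. dim (\<phi> ` ?U) + m) ` ?M)"
      by (simp add: image_image dP)
    also have "\<dots> = dim (\<phi> ` ?U) + Max ?M"
      using fin D(2) by (subst mono_Max_commute[symmetric]) (auto intro: monoI)
    finally show ?thesis
      unfolding idx using dV by (simp add: quotient_carrier[OF ctx] image_image)
  qed
  then show ?thesis
    unfolding good_index_behaviour_def Let_def lhs P_def[symmetric] by (auto simp: image_image)
qed

end

section \<open>Matrices as functions with bounded support\<close>

text \<open>\<open>N\<close> is any common bound for the inner dimensions. One product thus serves
  blocks of all shapes, associativity holds without side conditions, and sizes are tracked by
  \<open>supp\<close> alone.\<close>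

definition mm :: "nat \<Rightarrow> (nat \<Rightarrow> nat \<Rightarrow> 'k::comm_ring_1) \<Rightarrow> (nat \<Rightarrow> nat \<Rightarrow> 'k) \<Rightarrow> nat \<Rightarrow> nat \<Rightarrow> 'k" where
  "mm N A B i j = (\<Sum>l<N. A i l * B l j)"

definition supp :: "nat \<Rightarrow> nat \<Rightarrow> (nat \<Rightarrow> nat \<Rightarrow> 'k::zero) \<Rightarrow> bool" where
  "supp a b A \<longleftrightarrow> (\<forall>i j. A i j \<noteq> 0 \<longrightarrow> i < a \<and> j < b)"

lemma suppD: "supp a b A \<Longrightarrow> \<not> (i < a \<and> j < b) \<Longrightarrow> A i j = 0"
  by (auto simp: supp_def)

lemma mm_supp_left:
  assumes "supp a b A" "b \<le> N"
  shows "mm N A B i j = (\<Sum>l<b. A i l * B l j)"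
  unfolding mm_def by (rule sum.mono_neutral_right) (use assms in \<open>auto simp: suppD\<close>)

lemma mm_supp_right:
  assumes "supp b c B" "b \<le> N"
  shows "mm N A B i j = (\<Sum>l<b. A i l * B l j)"
  unfolding mm_def by (rule sum.mono_neutral_right) (use assms in \<open>auto simp: suppD\<close>)

definition vec_coords :: "'k::field vec \<Rightarrow> nat \<Rightarrow> 'k" where
  "vec_coords v = (\<lambda>i. if i < dim_vec v then v $ i else 0)"

definition fscale :: "'k::field \<Rightarrow> ('i \<Rightarrow> 'k) \<Rightarrow> 'i \<Rightarrow> 'k" where
  "fscale c f = (\<lambda>i. c * f i)"

lemma fscale_apply: "fscale c f i = c * f i"
  by (simp add: fscale_def)

interpretation fun_space: coordinate_space "fscale :: 'k::field \<Rightarrow> ('i \<Rightarrow> 'k) \<Rightarrow> 'i \<Rightarrow> 'k"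
  by unfold_locales (simp_all add: fscale_def fun_eq_iff algebra_simps)

lemma (in coordinate_space) embedding_finsum:
  assumes "embedding R \<phi>" "finite A" "w \<in> A \<rightarrow> carrier R"
  shows "finsum R w A \<in> carrier R \<and> \<phi> (finsum R w A) = (\<Sum>a\<in>A. \<phi> (w a))"
proof -
  note D = embeddingD[OF assms(1)]
  interpret R: vectorspace class_ring R by (rule embedding_vectorspace[OF assms(1)])
  show ?thesis
    using assms(2,3)
  proof (induction A)
    case (insert a A)
    then have "w \<in> A \<rightarrow> carrier R" "w a \<in> carrier R" by auto
    with insert show ?case by (simp add: D R.finsum_insert)
  qed (simp add: D)
qed

lemma vec_coords_embedding: "fun_space.embedding (module_vec TYPE('k::field) n) vec_coords"
  unfolding fun_space.embedding_def
  by (auto simp: module_vec_simps vec_coords_def fscale_def fun_eq_iff intro!: inj_onI eq_vecI)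
    (metis)

lemma sum_fun_apply: "(\<Sum>i\<in>I. f i) j = (\<Sum>i\<in>I. f i j)"
  by (induction I rule: infinite_finite_induct) auto

lemma unit_expansion:
  assumes "finite I" "\<And>i. i \<notin> I \<Longrightarrow> f i = 0"
  shows "f = (\<Sum>i\<in>I. fscale (f i :: 'k::field) (\<lambda>j. if j = i then 1 else 0))"
proof
  fix j
  have "(\<Sum>i\<in>I. fscale (f i) (\<lambda>j. if j = i then 1 else 0)) j = (\<Sum>i\<in>I. if j = i then f i else 0)"
    unfolding sum_fun_apply fscale_def by (rule sum.cong) auto
  then show "f j = (\<Sum>i\<in>I. fscale (f i) (\<lambda>j. if j = i then 1 else 0)) j"
    using assms by auto
qed

lemma finite_dim_finite_support:
  assumes "finite I" "\<And>f i. f \<in> S \<Longrightarrow> i \<notin> I \<Longrightarrow> f i = 0"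
  shows "fun_space.finite_dim (S :: ('i \<Rightarrow> 'k::field) set)"
  unfolding fun_space.finite_dim_def
proof (intro exI conjI subsetI)
  let ?e = "\<lambda>i j. if j = i then 1 else 0 :: 'k"
  show "finite (?e ` I)" using assms(1) by simp
  fix f assume f: "f \<in> S"
  have "(\<Sum>i\<in>I. fscale (f i) (?e i)) \<in> fun_space.span (?e ` I)"
    by (intro fun_space.span_sum fun_space.span_scale fun_space.span_base) auto
  then show "f \<in> fun_space.span (?e ` I)"
    using unit_expansion[OF assms(1), of f] assms(2)[OF f] by simp
qed

lemma sum_lessThan_add:
  fixes f :: "nat \<Rightarrow> 'k::comm_monoid_add"
  shows "(\<Sum>l<a + b. f l) = (\<Sum>l<a. f l) + (\<Sum>l<b. f (a + l))"
  by (induction b) (simp_all add: add.assoc)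

section \<open>Coordinates for the grading\<close>

definition offset :: "(nat \<Rightarrow> nat) \<Rightarrow> nat \<Rightarrow> nat" where
  "offset r t = (\<Sum>u<t. r u)"

definition total_dim :: "(nat \<Rightarrow> nat) \<Rightarrow> nat" where
  "total_dim r = r 0 + r 1 + r 2"

lemma less_3_iff: "t < 3 \<longleftrightarrow> t = 0 \<or> t = 1 \<or> t = (2::nat)"
  by auto

lemma offset_simps [simp]: "offset r 0 = 0" "offset r (Suc 0) = r 0" "offset r 2 = r 0 + r 1"
  by (simp_all add: offset_def numeral_2_eq_2)

lemma sum_total_dim:
  fixes f :: "nat \<Rightarrow> 'k::comm_monoid_add"
  shows "(\<Sum>l<total_dim r. f l) = (\<Sum>u<3. \<Sum>i<r u. f (offset r u + i))"
proof -
  have "{..<3} = {0, 1, 2::nat}" by auto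
  then show ?thesis by (simp add: total_dim_def sum_lessThan_add add.assoc)
qed

lemma offset_less_total: "t < 3 \<Longrightarrow> i < r t \<Longrightarrow> offset r t + i < total_dim r"
  by (auto simp: less_3_iff total_dim_def)

lemma r_le_total: "t < 3 \<Longrightarrow> r t \<le> total_dim r"
  by (auto simp: less_3_iff total_dim_def)

lemma index_cases:
  assumes "k < total_dim r"
  obtains t i where "t < 3" "i < r t" "k = offset r t + i"
proof (cases "k < r 0")
  case True
  then show ?thesis by (intro that[of 0 k]) auto
next
  case F: False
  show ?thesis
  proof (cases "k < r 0 + r 1")
    case True
    with F show ?thesis by (intro that[of 1 "k - r 0"]) auto
  next
    case False
    with assms show ?thesis by (intro that[of 2 "k - (r 0 + r 1)"]) (auto simp: total_dim_def)
  qed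
qed

lemma index_unique:
  assumes "offset r s + i = offset r t + j" "s < 3" "t < 3" "i < r s" "j < r t"
  shows "s = t" "i = j"
  using assms by (auto simp: less_3_iff)

definition block :: "(nat \<Rightarrow> nat) \<Rightarrow> 'k::field mat \<Rightarrow> nat \<Rightarrow> nat \<Rightarrow> nat \<Rightarrow> nat \<Rightarrow> 'k" where
  "block r A s t i j = (if i < r s \<and> j < r t then A $$ (offset r s + i, offset r t + j) else 0)"

lemma supp_block: "supp (r s) (r t) (block r A s t)"
  by (auto simp: supp_def block_def)

lemma block_mult:
  assumes "A \<in> carrier_mat (total_dim r) (total_dim r)" "B \<in> carrier_mat (total_dim r) (total_dim r)" "s < 3" "t < 3"
  shows "block r (A * B) s t = (\<Sum>u<3. mm (total_dim r) (block r A s u) (block r B u t))"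
proof (intro ext)
  fix i j
  have m: "mm (total_dim r) (block r A s u) (block r B u t) i j
      = (\<Sum>l<r u. block r A s u i l * block r B u t l j)" if "u < 3" for u
    using that by (intro mm_supp_right[OF supp_block] r_le_total)
  show "block r (A * B) s t i j = (\<Sum>u<3. mm (total_dim r) (block r A s u) (block r B u t)) i j"
  proof (cases "i < r s \<and> j < r t")
    case True
    then have "(A * B) $$ (offset r s + i, offset r t + j) =
        (\<Sum>l<total_dim r. A $$ (offset r s + i, l) * B $$ (l, offset r t + j))"
      using assms offset_less_total[OF assms(3), of i r] offset_less_total[OF assms(4), of j r]
      by (simp add: scalar_prod_def lessThan_atLeast0)
    then show ?thesis
      using True by (simp add: sum_total_dim sum_fun_apply m) (simp add: block_def)
  next
    case False
    then show ?thesis by (auto simp: sum_fun_apply m block_def)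
  qed
qed

lemma block_eqI:
  assumes "A \<in> carrier_mat (total_dim r) (total_dim r)" "B \<in> carrier_mat (total_dim r) (total_dim r)"
    and "\<And>s t. s < 3 \<Longrightarrow> t < 3 \<Longrightarrow> block r A s t = block r B s t"
  shows "A = B"
proof (rule eq_matI)
  fix k l assume "k < dim_row B" "l < dim_col B"
  then have "k < total_dim r" "l < total_dim r" using assms(2) by auto
  then obtain s i t j where *: "s < 3" "i < r s" "k = offset r s + i" "t < 3" "j < r t" "l = offset r t + j"
    by (meson index_cases)
  then show "A $$ (k, l) = B $$ (k, l)"
    using fun_cong[OF fun_cong[OF assms(3)[OF *(1,4)]], of i j] by (simp add: block_def)
qed (use assms in auto)

lemma block_exists:
  assumes "\<And>s t. s < 3 \<Longrightarrow> t < 3 \<Longrightarrow> supp (r s) (r t) (F s t)"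
  obtains A :: "'k::field mat" where "A \<in> carrier_mat (total_dim r) (total_dim r)"
    "\<And>s t. s < 3 \<Longrightarrow> t < 3 \<Longrightarrow> block r A s t = F s t"
proof -
  \<comment> \<open>The inverse of the numbering \<open>offset r t + i\<close>; well defined by
    \<open>index_unique\<close>.\<close>
  let ?g = "\<lambda>k. THE (p :: nat \<times> nat). fst p < 3 \<and> snd p < r (fst p) \<and> k = offset r (fst p) + snd p"
  have g: "?g (offset r t + i) = (t, i)" if "t < 3" "i < r t" for t i
    by (rule the_equality) (use that index_unique[of r t i] in force)+
  let ?A = "mat (total_dim r) (total_dim r) (\<lambda>(k, l). F (fst (?g k)) (fst (?g l)) (snd (?g k)) (snd (?g l)))"
  have "block r ?A s t = F s t" if "s < 3" "t < 3" for s t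
    using assms[OF that] that
    by (intro ext) (auto simp: block_def offset_less_total g supp_def)
  then show ?thesis by (intro that[of ?A]) auto
qed

lemma block_linear:
  assumes "A \<in> carrier_mat (total_dim r) (total_dim r)" "B \<in> carrier_mat (total_dim r) (total_dim r)" "s < 3" "t < 3"
  shows "block r (A + B) s t i j = block r A s t i j + block r B s t i j"
    "block r (A - B) s t i j = block r A s t i j - block r B s t i j"
  using assms offset_less_total[OF assms(3), of i r] offset_less_total[OF assms(4), of j r]
  by (auto simp: block_def)

lemma block_smult:
  assumes "A \<in> carrier_mat (total_dim r) (total_dim r)" "s < 3" "t < 3"
  shows "block r (c \<cdot>\<^sub>m A) s t i j = c * block r A s t i j"
  using assms offset_less_total[OF assms(2), of i r] offset_less_total[OF assms(3), of j r]
  by (auto simp: block_def)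

lemma block_zero:
  assumes "s < 3" "t < 3"
  shows "block r (0\<^sub>m (total_dim r) (total_dim r)) s t i j = 0"
  using offset_less_total[OF assms(1), of i r] offset_less_total[OF assms(2), of j r]
  by (auto simp: block_def)

text \<open>All dimension vectors share one type: the index \<open>(t, i, j)\<close> stands for the
  entry \<open>(i, j)\<close> of the map from the space at vertex \<open>t\<close> to the next one.
  Vanishing outside the ranges makes equality of functions equality of representations.\<close>

definition rep_space :: "(nat \<Rightarrow> nat) \<Rightarrow> (nat \<times> nat \<times> nat \<Rightarrow> 'k::field) set" where
  "rep_space r = {v. \<forall>t i j. v (t, i, j) \<noteq> 0 \<longrightarrow> t < 3 \<and> i < r (Suc t mod 3) \<and> j < r t}"

definition level_algebra :: "(nat \<Rightarrow> nat) \<Rightarrow> (nat \<times> nat \<times> nat \<Rightarrow> 'k::field) set" where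
  "level_algebra r = {x. \<forall>t i j. x (t, i, j) \<noteq> 0 \<longrightarrow> t < 3 \<and> i < r t \<and> j < r t}"

definition arrow :: "(nat \<times> nat \<times> nat \<Rightarrow> 'k) \<Rightarrow> nat \<Rightarrow> nat \<Rightarrow> nat \<Rightarrow> 'k" where
  "arrow v t = (\<lambda>i j. v (t, i, j))"

text \<open>The commutator of a block diagonal matrix with an element of degree one, written arrow
  by arrow.\<close>

definition rep_action ::
  "nat \<Rightarrow> (nat \<times> nat \<times> nat \<Rightarrow> 'k::field) \<Rightarrow> (nat \<times> nat \<times> nat \<Rightarrow> 'k) \<Rightarrow> nat \<times> nat \<times> nat \<Rightarrow> 'k" where
  "rep_action N x v = (\<lambda>(t, i, j). if t < 3
     then mm N (arrow x (Suc t mod 3)) (arrow v t) i j - mm N (arrow v t) (arrow x t) i j else 0)"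

lemma mult_entry:
  assumes "A \<in> carrier_mat n n" "B \<in> carrier_mat n n" "k < n" "l < n"
  shows "(A * B) $$ (k, l) = (\<Sum>m<n. A $$ (k, m) * B $$ (m, l))"
  using assms by (simp add: scalar_prod_def lessThan_atLeast0)

lemma smult_entry:
  assumes "A \<in> carrier_mat n n" "k < n" "l < n"
  shows "(c \<cdot>\<^sub>m A) $$ (k, l) = c * A $$ (k, l)"
  using assms by simp

text \<open>The columns of \<open>S\<close> are bases of the eigenspaces \<open>W t\<close> one
  after the other. They are independent because the zero vector has only one decomposition in the
  internal direct sum, and each \<open>W t\<close> is treated through its own embedding.\<close>

lemma eigen_frame:
  fixes \<zeta> :: "'k::field" and W :: "nat \<Rightarrow> 'k vec set"
  assumes ds: "internal_direct_sum (module_vec TYPE('k) n) 3 W"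
    and dim: "\<And>t. t < 3 \<Longrightarrow>
      vectorspace.dim class_ring ((module_vec TYPE('k) n)\<lparr>carrier := W t\<rparr>) = r t"
    and eig: "\<And>t v. t < 3 \<Longrightarrow> v \<in> W t \<Longrightarrow> g *\<^sub>v v = \<zeta> ^ t \<cdot>\<^sub>v v"
    and n: "total_dim r = n" and g: "g \<in> carrier_mat n n"
  obtains S T where "S \<in> carrier_mat n n" "T \<in> carrier_mat n n" "S * T = 1\<^sub>m n" "T * S = 1\<^sub>m n"
    "\<And>k. k < n \<Longrightarrow> \<exists>t i. t < 3 \<and> i < r t \<and> k = offset r t + i \<and> g *\<^sub>v col S k = \<zeta> ^ t \<cdot>\<^sub>v col S k"
proof -
  let ?V = "module_vec TYPE('k) n"
  note e = vec_coords_embedding[where 'k='k and n=n]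
  note D = fun_space.embeddingD[OF e]
  have fd: "fun_space.finite_dim (vec_coords ` carrier ?V)"
    by (rule finite_dim_finite_support[of "{..<n}"]) (auto simp: vec_coords_def module_vec_simps)
  have WC: "W t \<subseteq> carrier ?V" and sW: "fun_space.subspace (vec_coords ` W t)" if t: "t < 3" for t
  proof -
    have sub: "VectorSpace.subspace class_ring (W t) ?V" using ds t by (simp add: internal_direct_sum_def)
    then interpret sm: submodule class_ring "W t" ?V by (simp add: subspace_def)
    show WC: "W t \<subseteq> carrier ?V" using sm.subset .
    show "fun_space.subspace (vec_coords ` W t)"
    proof (rule fun_space.subspaceI)
      show "0 \<in> vec_coords ` W t" using sm.zero_closed D(3) by (metis imageI)
    next
      fix x y assume "x \<in> vec_coords ` W t" "y \<in> vec_coords ` W t"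
      then obtain u v where uv: "u \<in> W t" "v \<in> W t" "x = vec_coords u" "y = vec_coords v" by auto
      then have "x + y = vec_coords (u \<oplus>\<^bsub>?V\<^esub> v)" using WC by (subst D(5)) auto
      then show "x + y \<in> vec_coords ` W t" using sm.m_closed[OF uv(1,2)] by simp
    next
      fix c x assume "x \<in> vec_coords ` W t"
      then obtain u where u: "u \<in> W t" "x = vec_coords u" by auto
      then have "fscale c x = vec_coords (c \<odot>\<^bsub>?V\<^esub> u)" using WC by (subst D(7)) auto
      then show "fscale c x \<in> vec_coords ` W t" using sm.smult_closed[of c, OF _ u(1)] by simp
    qed
  qed
  have "\<exists>b. (\<forall>i<r t. b i \<in> W t) \<and> inj_on (\<lambda>i. vec_coords (b i)) {..<r t} \<and>
      fun_space.independent ((\<lambda>i. vec_coords (b i)) ` {..<r t})"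
    if t: "t < 3" for t
  proof -
    have eW: "fun_space.embedding (?V\<lparr>carrier := W t\<rparr>) vec_coords"
      by (rule fun_space.embedding_restrict[OF e WC[OF t] sW[OF t]])
    obtain F where F: "finite F" "vec_coords ` carrier ?V \<subseteq> fun_space.span F"
      using fd by (auto simp: fun_space.finite_dim_def)
    have "vec_coords ` W t \<subseteq> fun_space.span F" using F(2) WC[OF t] by auto
    then have d: "fun_space.dim (vec_coords ` W t) = r t"
      using fun_space.embedding_dim[OF eW _ F(1)] dim[OF t] by simp
    obtain B where B: "B \<subseteq> vec_coords ` W t" "fun_space.independent B"
      "vec_coords ` W t \<subseteq> fun_space.span B" "card B = r t"
      using fun_space.basis_exists[of "vec_coords ` W t"] d by metis
    have "finite B"
      using fun_space.finite_dim_independent[OF fd B(2)] B(1) WC[OF t] by auto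
    then obtain h where h: "bij_betw h {..<r t} B"
      using ex_bij_betw_nat_finite[of B] B(4) by (auto simp: lessThan_atLeast0)
    let ?b = "\<lambda>i. inv_into (W t) vec_coords (h i)"
    have b: "?b i \<in> W t" "vec_coords (?b i) = h i" if "i < r t" for i
      using that h B(1) by (auto simp: bij_betw_def intro!: inv_into_into f_inv_into_f)
    have "inj_on (\<lambda>i. vec_coords (?b i)) {..<r t}"
      using h b(2) by (auto simp: bij_betw_def inj_on_def)
    moreover have "(\<lambda>i. vec_coords (?b i)) ` {..<r t} = B"
      using h b(2) by (force simp: bij_betw_def)
    ultimately show ?thesis using b(1) B(2) by (intro exI[of _ ?b]) auto
  qed
  then have "\<forall>t. \<exists>b. t < 3 \<longrightarrow> (\<forall>i<r t. b i \<in> W t) \<and> inj_on (\<lambda>i. vec_coords (b i)) {..<r t} \<and>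
      fun_space.independent ((\<lambda>i. vec_coords (b i)) ` {..<r t})" by blast
  then obtain b where b: "\<And>t i. t < 3 \<Longrightarrow> i < r t \<Longrightarrow> b t i \<in> W t"
    "\<And>t. t < 3 \<Longrightarrow> inj_on (\<lambda>i. vec_coords (b t i)) {..<r t}"
    "\<And>t. t < 3 \<Longrightarrow> fun_space.independent ((\<lambda>i. vec_coords (b t i)) ` {..<r t})"
    unfolding choice_iff by blast
  have bc: "b t i \<in> carrier_vec n" if "t < 3" "i < r t" for t i
    using b(1) that WC by (auto simp: module_vec_simps)
  define ix where "ix k = (THE (p :: nat \<times> nat). fst p < 3 \<and> snd p < r (fst p) \<and> k = offset r (fst p) + snd p)" for k
  have ix: "ix (offset r t + i) = (t, i)" if "t < 3" "i < r t" for t i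
    unfolding ix_def by (rule the_equality) (use that index_unique[of r t i] in force)+
  define S where "S = mat n n (\<lambda>(l, k). b (fst (ix k)) (snd (ix k)) $ l)"
  have S: "S \<in> carrier_mat n n" by (simp add: S_def)
  have S_entry: "S $$ (l, offset r t + i) = b t i $ l" if "t < 3" "i < r t" "l < n" for t i l
    using that offset_less_total[of t i r] n by (simp add: S_def ix)
  have colS: "col S (offset r t + i) = b t i" if "t < 3" "i < r t" for t i
  proof (rule eq_vecI)
    show "dim_vec (col S (offset r t + i)) = dim_vec (b t i)" using bc[OF that] S by auto
    fix l assume "l < dim_vec (b t i)"
    then show "col S (offset r t + i) $ l = b t i $ l"
      using bc[OF that] S offset_less_total[of t i r] n that by (simp add: S_entry)
  qed
  have "det S \<noteq> 0"
  proof
    assume "det S = 0"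
    then obtain c where c: "c \<in> carrier_vec n" "c \<noteq> 0\<^sub>v n" "S *\<^sub>v c = 0\<^sub>v n"
      using det_0_iff_vec_prod_zero_field[OF S] by auto
    \<comment> \<open>The component in \<open>W t\<close> of the vanishing combination
      \<open>S *\<^sub>v c\<close>.\<close>
    let ?s = "\<lambda>t. \<Sum>i<r t. fscale (c $ (offset r t + i)) (vec_coords (b t i))"
    have "?s t \<in> vec_coords ` W t" if "t < 3" for t
      using b(1)[OF that] by (intro fun_space.subspace_sum[OF sW[OF that]]
          fun_space.subspace_scale[OF sW[OF that]]) auto
    then have "\<forall>t. \<exists>x. t < 3 \<longrightarrow> x \<in> W t \<and> vec_coords x = ?s t" by (simp add: image_iff) metis
    then obtain x where x: "\<And>t. t < 3 \<Longrightarrow> x t \<in> W t" "\<And>t. t < 3 \<Longrightarrow> vec_coords (x t) = ?s t"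
      unfolding choice_iff by blast
    let ?x = "\<lambda>t\<in>{..<3}. x t" and ?z = "\<lambda>t\<in>{..<3::nat}. 0\<^sub>v n :: 'k vec"
    have fin: "finsum ?V w {..<3} \<in> carrier ?V \<and> vec_coords (finsum ?V w {..<3}) = (\<Sum>t<3. vec_coords (w t))"
      if "w \<in> (\<Pi>\<^sub>E t\<in>{..<3}. W t)" for w
      using that WC by (intro fun_space.embedding_finsum[OF e]) (auto simp: PiE_def Pi_def)
    have z0: "0\<^sub>v n \<in> W t" if "t < 3" for t
      using ds that submodule.zero_closed[of class_ring "W t" ?V]
      by (simp add: internal_direct_sum_def subspace_def module_vec_simps)
    have xm: "?x \<in> (\<Pi>\<^sub>E t\<in>{..<3}. W t)" and zm: "?z \<in> (\<Pi>\<^sub>E t\<in>{..<3}. W t)"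
      using x(1) z0 by auto
    have cz: "vec_coords (0\<^sub>v n :: 'k vec) = 0" using D(3) by (simp add: module_vec_simps)
    have "(\<Sum>t<3. vec_coords (x t)) = 0"
    proof
      fix l
      have "(\<Sum>t<3. vec_coords (x t)) l =
          (\<Sum>t<3. \<Sum>i<r t. c $ (offset r t + i) * vec_coords (b t i) l)"
        unfolding sum_fun_apply by (rule sum.cong) (simp_all add: x(2) sum_fun_apply fscale_def)
      note sx = this
      show "(\<Sum>t<3. vec_coords (x t)) l = 0 l"
      proof (cases "l < n")
        case True
        have "(\<Sum>t<3. vec_coords (x t)) l = (\<Sum>t<3. \<Sum>i<r t. c $ (offset r t + i) * b t i $ l)"
          unfolding sx
        proof (intro sum.cong refl)
          fix t i assume "t \<in> {..<3::nat}" "i \<in> {..<r t}"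
          then show "c $ (offset r t + i) * vec_coords (b t i) l = c $ (offset r t + i) * b t i $ l"
            using True bc[of t i] by (simp add: vec_coords_def carrier_vecD)
        qed
        also have "\<dots> = (\<Sum>t<3. \<Sum>i<r t. S $$ (l, offset r t + i) * c $ (offset r t + i))"
          using True by (intro sum.cong) (auto simp: S_entry mult.commute)
        also have "\<dots> = (\<Sum>k<n. S $$ (l, k) * c $ k)"
          using sum_total_dim[of "\<lambda>k. S $$ (l, k) * c $ k" r] n by simp
        also have "\<dots> = (S *\<^sub>v c) $ l"
          using True S c(1) by (simp add: scalar_prod_def lessThan_atLeast0)
        finally show ?thesis using c(3) True by simp
      next
        case False
        show ?thesis
          unfolding sx zero_fun_apply
        proof (intro sum.neutral ballI)
          fix t i assume "t \<in> {..<3::nat}" "i \<in> {..<r t}"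
          then show "c $ (offset r t + i) * vec_coords (b t i) l = 0"
            using False bc[of t i] by (simp add: vec_coords_def carrier_vecD)
        qed
      qed
    qed
    moreover have "(\<Sum>t<3. vec_coords (?x t)) = (\<Sum>t<3. vec_coords (x t))"
      by (rule sum.cong) auto
    moreover have "(\<Sum>t<3. vec_coords (?z t)) = 0"
      by (rule sum.neutral) (simp add: cz)
    moreover note conjunct2[OF fin[OF xm]] conjunct2[OF fin[OF zm]]
    ultimately have vz: "vec_coords (finsum ?V ?x {..<3}) = vec_coords (finsum ?V ?z {..<3})"
      by simp
    note fx = conjunct1[OF fin[OF xm]] and fz = conjunct1[OF fin[OF zm]]
    have eq: "finsum ?V ?x {..<3} = finsum ?V ?z {..<3}"
      using inj_onD[OF D(1) vz fx fz] .
    \<comment> \<open>The same vector is decomposed by the components of the relation and by zeros;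
      uniqueness identifies them.\<close>
    have "\<exists>!w. w \<in> (\<Pi>\<^sub>E t\<in>{..<3}. W t) \<and> finsum ?V ?x {..<3} = finsum ?V w {..<3}"
      using ds fin[OF xm] unfolding internal_direct_sum_def by blast
    then have xz: "?x = ?z" using xm zm eq by blast
    have x0: "?s t = 0" if "t < 3" for t
      using x(2)[OF that] fun_cong[OF xz, of t] cz that by simp
    have "c $ (offset r t + i) = 0" if t: "t < 3" and i: "i < r t" for t i
    proof -
      let ?f = "\<lambda>i. vec_coords (b t i)"
      have "(\<Sum>v\<in>?f ` {..<r t}. fscale (c $ (offset r t + the_inv_into {..<r t} ?f v)) v) = 0"
        using x0[OF t] by (simp add: sum.reindex[OF b(2)[OF t]] the_inv_into_f_f[OF b(2)[OF t]])
      from fun_space.independentD[OF b(3)[OF t] _ subset_refl this, of "?f i"] i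
      show ?thesis by (simp add: the_inv_into_f_f[OF b(2)[OF t]])
    qed
    then have "c = 0\<^sub>v n"
      using c(1) n by (intro eq_vecI) (auto elim!: index_cases[where r=r])
    with c(2) show False by simp
  qed
  then obtain T where T: "T \<in> carrier_mat n n" "S * T = 1\<^sub>m n" "T * S = 1\<^sub>m n"
    using det_non_zero_imp_unit[OF S, of "()"] by (auto simp: Units_def ring_mat_def)
  show ?thesis
  proof (rule that[OF S T])
    fix k assume "k < n"
    then obtain t i where ti: "t < 3" "i < r t" "k = offset r t + i" using n by (metis index_cases)
    then show "\<exists>t i. t < 3 \<and> i < r t \<and> k = offset r t + i \<and> g *\<^sub>v col S k = \<zeta> ^ t \<cdot>\<^sub>v col S k"
      using eig[OF ti(1) b(1)[OF ti(1,2)]] colS[OF ti(1,2)] by (intro exI[of _ t] exI[of _ i]) simp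
  qed
qed

lemma (in -) primitive_cube_root_power_eq:
  assumes "primitive_root_of_unity 3 (\<zeta> :: 'k::field)" "s < 3" "t < 3"
  shows "\<zeta> ^ s = \<zeta> ^ (i + t) \<longleftrightarrow> s = (t + i) mod 3"
proof -
  have z: "\<zeta> ^ 3 = 1" "\<zeta> \<noteq> 1" "\<zeta> ^ 2 \<noteq> 1" using assms(1) by (auto simp: primitive_root_of_unity_def)
  have z0: "\<zeta> \<noteq> 0" using z(1) by auto
  have "\<zeta> ^ k = \<zeta> ^ (k mod 3)" for k
  proof -
    have "\<zeta> ^ (3 * (k div 3) + k mod 3) = \<zeta> ^ (k mod 3)" unfolding power_add power_mult z(1) by simp
    then show ?thesis by simp
  qed
  then have "\<zeta> ^ (i + t) = \<zeta> ^ ((t + i) mod 3)" by (metis add.commute)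
  moreover have "\<zeta> \<noteq> \<zeta> ^ 2" using z z0 by (simp add: power2_eq_square)
  then have "\<zeta> ^ s = \<zeta> ^ u \<longleftrightarrow> s = u" if "u < 3" for u
    using assms(2) that z z[symmetric] by (auto simp: less_3_iff)
  ultimately show ?thesis by simp
qed

text \<open>In the eigenbasis \<open>g\<close> becomes the diagonal matrix \<open>D\<close> with
  \<zeta> to the power \<open>t\<close> on block \<open>t\<close>, and membership in degree
  \<open>i\<close> becomes \<open>D * B = \<zeta> ^ i \<cdot>\<^sub>m (B * D)\<close>. On the block
  \<open>(s, t)\<close> this compares the powers \<open>s\<close> and \<open>i + t\<close> of a
  primitive cube root of unity.\<close>

theorem graded_frame:
  fixes \<zeta> :: "'k::field"
  assumes z: "primitive_root_of_unity 3 \<zeta>"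
    and inner: "inner_automorphism_with_multiplicities n \<zeta> [r0, r1, r2] \<theta>"
  defines "r \<equiv> \<lambda>t. [r0, r1, r2] ! t"
  obtains S T where "total_dim r = n" "S \<in> carrier_mat n n" "T \<in> carrier_mat n n"
    "S * T = 1\<^sub>m n" "T * S = 1\<^sub>m n"
    "\<forall>A\<in>carrier_mat n n. \<forall>i. A \<in> graded_part n \<zeta> \<theta> i \<longleftrightarrow>
      (\<forall>s<3. \<forall>t<3. s \<noteq> (t + i) mod 3 \<longrightarrow> block r (T * A * S) s t = 0)"
proof -
  have tot: "total_dim r = n" using inner by (simp add: inner_automorphism_with_multiplicities_def r_def total_dim_def)
  obtain g W where gW: "conjugation_by n g \<theta>" "internal_direct_sum (module_vec TYPE('k) n) 3 W"
    "\<And>t. t < 3 \<Longrightarrow> vectorspace.dim class_ring ((module_vec TYPE('k) n)\<lparr>carrier := W t\<rparr>) = r t"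
    "\<And>t v. t < 3 \<Longrightarrow> v \<in> W t \<Longrightarrow> g *\<^sub>v v = \<zeta> ^ t \<cdot>\<^sub>v v"
    using inner unfolding inner_automorphism_with_multiplicities_def r_def
    by (auto simp: numeral_3_eq_3)
  obtain h where gh: "g \<in> carrier_mat n n" "h \<in> carrier_mat n n" "g * h = 1\<^sub>m n" "h * g = 1\<^sub>m n"
    "\<And>A. A \<in> carrier_mat n n \<Longrightarrow> \<theta> A = g * A * h"
    using gW(1) by (auto simp: conjugation_by_def)
  obtain S T where ST: "S \<in> carrier_mat n n" "T \<in> carrier_mat n n" "S * T = 1\<^sub>m n" "T * S = 1\<^sub>m n"
    "\<And>k. k < n \<Longrightarrow> \<exists>t i. t < 3 \<and> i < r t \<and> k = offset r t + i \<and> g *\<^sub>v col S k = \<zeta> ^ t \<cdot>\<^sub>v col S k"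
    using eigen_frame[OF gW(2,3,4) tot gh(1)] by metis
  have cancel: "S * (T * X) = X" "T * (S * X) = X" "g * (h * X) = X" "h * (g * X) = X"
    if "X \<in> carrier_mat n n" for X
    using that ST(1-4) gh(1-4) by (simp_all flip: assoc_mult_mat[of _ n n _ n _ n])
  note mats = ST(1,2) gh(1,2) assoc_mult_mat[of _ n n _ n _ n] cancel ST(3,4) gh(3,4)
  define D where "D = T * g * S"
  have D: "D \<in> carrier_mat n n" using ST(1,2) gh(1) by (simp add: D_def)
  have Dent: "D $$ (k, offset r t + i) = (if k = offset r t + i then \<zeta> ^ t else 0)"
    if "k < n" "t < 3" "i < r t" for k t i
  proof -
    let ?l = "offset r t + i"
    have l: "?l < n" using offset_less_total[of t i r] that tot by simp
    obtain t' i' where "t' < 3" "i' < r t'" "?l = offset r t' + i'" "g *\<^sub>v col S ?l = \<zeta> ^ t' \<cdot>\<^sub>v col S ?l"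
      using ST(5)[OF l] by blast
    then have eg: "g *\<^sub>v col S ?l = \<zeta> ^ t \<cdot>\<^sub>v col S ?l" using index_unique(1)[of r t i t' i'] that by metis
    have "col D ?l = T *\<^sub>v (g *\<^sub>v col S ?l)"
      unfolding D_def using mats(1-4) l by (simp add: col_mult2[of _ n n _ n] mats(5))
    also have "\<dots> = \<zeta> ^ t \<cdot>\<^sub>v (T *\<^sub>v col S ?l)"
      unfolding eg using mats(1,2) l by (simp add: mult_mat_vec[of _ n n])
    also have "T *\<^sub>v col S ?l = col (1\<^sub>m n) ?l"
      using col_mult2[OF ST(2,1) l] ST(4) by simp
    finally have "col D ?l $ k = (\<zeta> ^ t \<cdot>\<^sub>v col (1\<^sub>m n) ?l) $ k" by simp
    then show ?thesis using that l D by simp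
  qed
  have main: "A \<in> graded_part n \<zeta> \<theta> i \<longleftrightarrow>
      (\<forall>s<3. \<forall>t<3. s \<noteq> (t + i) mod 3 \<longrightarrow> block r (T * A * S) s t = 0)"
    if A: "A \<in> carrier_mat n n" for A i
  proof -
    define B where "B = T * A * S"
    have B: "B \<in> carrier_mat n n" using A ST(1,2) by (simp add: B_def)
    have "\<theta> A = \<zeta> ^ i \<cdot>\<^sub>m A \<longleftrightarrow> g * A = \<zeta> ^ i \<cdot>\<^sub>m (A * g)"
    proof
      assume "\<theta> A = \<zeta> ^ i \<cdot>\<^sub>m A"
      then have "g * A * h * g = \<zeta> ^ i \<cdot>\<^sub>m A * g" by (simp only: gh(5)[OF A])
      then show "g * A = \<zeta> ^ i \<cdot>\<^sub>m (A * g)"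
        using A by (simp add: mats mult_smult_assoc_mat[of _ n n _ n])
    next
      assume "g * A = \<zeta> ^ i \<cdot>\<^sub>m (A * g)"
      then have "g * A * h = \<zeta> ^ i \<cdot>\<^sub>m (A * g) * h" by simp
      then show "\<theta> A = \<zeta> ^ i \<cdot>\<^sub>m A"
        using A gh(5)[OF A] by (simp add: mats mult_smult_assoc_mat[of _ n n _ n])
    qed
    also have "\<dots> \<longleftrightarrow> D * B = \<zeta> ^ i \<cdot>\<^sub>m (B * D)"
    proof -
      have 1: "D * B = T * (g * A) * S" and 2: "B * D = T * (A * g) * S"
        unfolding D_def B_def using A by (simp_all add: mats mult_carrier_mat[of _ n n _ n])
      have inj: "X = Y" if "T * X * S = T * Y * S" "X \<in> carrier_mat n n" "Y \<in> carrier_mat n n" for X Y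
      proof -
        have *: "S * (T * Z * S) * T = Z" if Z: "Z \<in> carrier_mat n n" for Z
          using Z by (simp add: mats)
        show ?thesis using *[OF that(2)] *[OF that(3)] that(1) by metis
      qed
      have 3: "\<zeta> ^ i \<cdot>\<^sub>m (T * (A * g) * S) = T * (\<zeta> ^ i \<cdot>\<^sub>m (A * g)) * S"
        using ST(1,2) A gh(1) by (simp add: mult_smult_assoc_mat[of _ n n _ n] mult_smult_distrib[of _ n n _ n])
      show ?thesis unfolding 1 2 3 using inj[of "g * A" "\<zeta> ^ i \<cdot>\<^sub>m (A * g)"] A gh(1) by auto
    qed
    also have "\<dots> \<longleftrightarrow> (\<forall>s<3. \<forall>t<3. s \<noteq> (t + i) mod 3 \<longrightarrow> block r B s t = 0)"
    proof -
      have DB: "(D * B) $$ (offset r s + p, offset r t + q) = \<zeta> ^ s * B $$ (offset r s + p, offset r t + q)"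
        and BD: "(B * D) $$ (offset r s + p, offset r t + q) = \<zeta> ^ t * B $$ (offset r s + p, offset r t + q)"
        if *: "s < 3" "t < 3" "p < r s" "q < r t" for s t p q
      proof -
        let ?k = "offset r s + p" and ?l = "offset r t + q"
        have kl: "?k < n" "?l < n" using offset_less_total[of _ _ r] * tot by auto
        have Dk: "D $$ (?k, l) = (if l = ?k then \<zeta> ^ s else 0)" if l: "l < n" for l
        proof -
          obtain t' i' where l': "t' < 3" "i' < r t'" "l = offset r t' + i'"
            using l tot by (metis index_cases)
          have "?k = l \<Longrightarrow> t' = s"
            using index_unique(1)[of r s p t' i'] *(1,3) l' by simp
          then show ?thesis using Dent[OF kl(1) l'(1,2)] l'(3) by auto
        qed
        have "(D * B) $$ (?k, ?l) = (\<Sum>l<n. D $$ (?k, l) * B $$ (l, ?l))"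
          by (rule mult_entry[OF D B kl])
        also have "\<dots> = (\<Sum>l<n. if l = ?k then \<zeta> ^ s * B $$ (?k, ?l) else 0)"
          by (rule sum.cong) (auto simp: Dk)
        finally show "(D * B) $$ (?k, ?l) = \<zeta> ^ s * B $$ (?k, ?l)" using kl by simp
        have "(B * D) $$ (?k, ?l) = (\<Sum>l<n. B $$ (?k, l) * D $$ (l, ?l))"
          by (rule mult_entry[OF B D kl])
        also have "\<dots> = (\<Sum>l<n. if l = ?l then \<zeta> ^ t * B $$ (?k, ?l) else 0)"
          by (rule sum.cong) (auto simp: Dent[OF _ *(2,4)])
        finally show "(B * D) $$ (?k, ?l) = \<zeta> ^ t * B $$ (?k, ?l)" using kl by simp
      qed
      have pw: "\<zeta> ^ s = \<zeta> ^ (i + t) \<longleftrightarrow> s = (t + i) mod 3" if "s < 3" "t < 3" for s t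
        by (rule primitive_cube_root_power_eq[OF z that])
      show ?thesis
      proof (intro iffI allI impI)
        fix s t :: nat assume eq: "D * B = \<zeta> ^ i \<cdot>\<^sub>m (B * D)" and st: "s < 3" "t < 3" "s \<noteq> (t + i) mod 3"
        show "block r B s t = 0"
        proof (intro ext)
          fix p q
          show "block r B s t p q = 0 p q"
          proof (cases "p < r s \<and> q < r t")
            case True
            have kl: "offset r s + p < n" "offset r t + q < n" using offset_less_total[of _ _ r] st True tot by auto
            have "\<zeta> ^ s * B $$ (offset r s + p, offset r t + q)
                = \<zeta> ^ i * (\<zeta> ^ t * B $$ (offset r s + p, offset r t + q))"
              using arg_cong[OF eq, of "\<lambda>M. M $$ (offset r s + p, offset r t + q)"] st True kl
                smult_entry[OF mult_carrier_mat[OF B D] kl]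
              by (simp add: DB BD)
            then have "(\<zeta> ^ s - \<zeta> ^ (i + t)) * B $$ (offset r s + p, offset r t + q) = 0"
              unfolding left_diff_distrib power_add mult.assoc by simp
            then show ?thesis using pw[OF st(1,2)] st(3) by (simp add: block_def)
          qed (auto simp: block_def)
        qed
      next
        assume bl: "\<forall>s<3. \<forall>t<3. s \<noteq> (t + i) mod 3 \<longrightarrow> block r B s t = 0"
        show "D * B = \<zeta> ^ i \<cdot>\<^sub>m (B * D)"
        proof (rule eq_matI)
          fix k l assume "k < dim_row (\<zeta> ^ i \<cdot>\<^sub>m (B * D))" "l < dim_col (\<zeta> ^ i \<cdot>\<^sub>m (B * D))"
          then have kl: "k < n" "l < n" using B D by auto
          obtain s p where s: "s < 3" "p < r s" "k = offset r s + p" using kl(1) tot by (metis index_cases)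
          obtain t q where t: "t < 3" "q < r t" "l = offset r t + q" using kl(2) tot by (metis index_cases)
          have "(\<zeta> ^ s - \<zeta> ^ (i + t)) * B $$ (k, l) = 0"
          proof (cases "s = (t + i) mod 3")
            case False
            then have "block r B s t p q = 0" using bl s(1) t(1) by simp
            then show ?thesis using s t by (simp add: block_def)
          qed (use pw[OF s(1) t(1)] in simp)
          then have "\<zeta> ^ s * B $$ (k, l) = \<zeta> ^ i * (\<zeta> ^ t * B $$ (k, l))"
            unfolding left_diff_distrib power_add mult.assoc by simp
          then show "(D * B) $$ (k, l) = (\<zeta> ^ i \<cdot>\<^sub>m (B * D)) $$ (k, l)"
            unfolding smult_entry[OF mult_carrier_mat[OF B D] kl]
            unfolding s(3) t(3) DB[OF s(1) t(1) s(2) t(2)] BD[OF s(1) t(1) s(2) t(2)] .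
        qed (use B D in auto)
      qed
    qed
    finally show ?thesis using A by (simp add: graded_part_def B_def)
  qed
  show ?thesis by (rule that[OF tot ST(1-4)]) (use main in blast)
qed

lemma mm_add:
  "mm N (\<lambda>i j. A i j + B i j) C i j = mm N A C i j + mm N B C i j"
  "mm N C (\<lambda>i j. A i j + B i j) i j = mm N C A i j + mm N C B i j"
  "mm N (\<lambda>i j. c * A i j) C i j = c * mm N A C i j"
  "mm N C (\<lambda>i j. c * A i j) i j = c * mm N C A i j"
  by (simp_all add: mm_def algebra_simps sum.distrib sum_distrib_left)

lemma mm_zero [simp]: "mm N (\<lambda>i j. 0) C = (\<lambda>i j. 0)" "mm N C (\<lambda>i j. 0) = (\<lambda>i j. 0)"
  by (simp_all add: mm_def fun_eq_iff)

lemma arrow_linear: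
  "arrow (v + w) t = (\<lambda>i j. arrow v t i j + arrow w t i j)"
  "arrow (fscale c v) t = (\<lambda>i j. c * arrow v t i j)"
  "arrow 0 t = (\<lambda>i j. 0)"
  by (simp_all add: arrow_def fscale_def)

lemma rep_action_linear:
  "rep_action N (x + y) v = rep_action N x v + rep_action N y v"
  "rep_action N (fscale c x) v = fscale c (rep_action N x v)"
  "rep_action N x (v + w) = rep_action N x v + rep_action N x w"
  "rep_action N x (fscale c v) = fscale c (rep_action N x v)"
  by (auto simp: rep_action_def fun_eq_iff arrow_linear mm_add fscale_apply algebra_simps)

lemma rep_action_zero [simp]: "rep_action N 0 v = 0" "rep_action N x 0 = 0"
  by (auto simp: rep_action_def fun_eq_iff arrow_linear)

text \<open>The tangent space \<open>q v\<close> of the group orbit, not the orbit itself.\<close>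

definition orbit :: "(nat \<Rightarrow> nat) \<Rightarrow> (nat \<times> nat \<times> nat \<Rightarrow> 'k::field) \<Rightarrow> (nat \<times> nat \<times> nat \<Rightarrow> 'k) set" where
  "orbit r v = (\<lambda>x. rep_action (total_dim r) x v) ` level_algebra r"

definition stabiliser :: "(nat \<Rightarrow> nat) \<Rightarrow> (nat \<times> nat \<times> nat \<Rightarrow> 'k::field) \<Rightarrow> (nat \<times> nat \<times> nat \<Rightarrow> 'k) set" where
  "stabiliser r v = {x \<in> level_algebra r. rep_action (total_dim r) x v = 0}"

text \<open>The space \<open>q v + q_v u\<close>, the preimage of the orbit of the class of
  \<open>u\<close> in the quotient by \<open>q v\<close>.\<close>

definition double_orbit ::
  "(nat \<Rightarrow> nat) \<Rightarrow> (nat \<times> nat \<times> nat \<Rightarrow> 'k::field) \<Rightarrow> (nat \<times> nat \<times> nat \<Rightarrow> 'k) \<Rightarrow> (nat \<times> nat \<times> nat \<Rightarrow> 'k) set" where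
  "double_orbit r v u = {a + b | a b. a \<in> orbit r v \<and> b \<in> (\<lambda>x. rep_action (total_dim r) x u) ` stabiliser r v}"

lemma subspace_level_algebra: "fun_space.subspace (level_algebra r)"
  by (auto intro!: fun_space.subspaceI simp: level_algebra_def fscale_def)
    (metis add_eq_0_iff add.right_neutral add.left_neutral)+

lemma subspace_rep_space: "fun_space.subspace (rep_space r)"
  by (auto intro!: fun_space.subspaceI simp: rep_space_def fscale_def)
    (metis add_eq_0_iff add.right_neutral add.left_neutral)+

lemma subspace_stabiliser: "fun_space.subspace (stabiliser r v)"
proof (rule fun_space.subspaceI)
  note L = subspace_level_algebra[of r]
  show "0 \<in> stabiliser r v" using fun_space.subspace_0[OF L] by (simp add: stabiliser_def)
  show "x + y \<in> stabiliser r v" if "x \<in> stabiliser r v" "y \<in> stabiliser r v" for x y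
    using that by (simp add: stabiliser_def rep_action_linear fun_space.subspace_add[OF L])
  show "fscale c x \<in> stabiliser r v" if "x \<in> stabiliser r v" for c x
    using that by (simp add: stabiliser_def rep_action_linear fun_space.subspace_scale[OF L])
qed

lemma subspace_action_image:
  assumes "fun_space.subspace Q"
  shows "fun_space.subspace ((\<lambda>x. rep_action N x v) ` Q)"
proof (rule fun_space.subspaceI)
  show "0 \<in> (\<lambda>x. rep_action N x v) ` Q"
    using fun_space.subspace_0[OF assms] by (rule rev_image_eqI) simp
  show "a + b \<in> (\<lambda>x. rep_action N x v) ` Q"
    if "a \<in> (\<lambda>x. rep_action N x v) ` Q" "b \<in> (\<lambda>x. rep_action N x v) ` Q" for a b
    using that fun_space.subspace_add[OF assms] by (auto simp flip: rep_action_linear)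
  show "fscale c a \<in> (\<lambda>x. rep_action N x v) ` Q" if "a \<in> (\<lambda>x. rep_action N x v) ` Q" for c a
    using that fun_space.subspace_scale[OF assms] by (auto simp flip: rep_action_linear)
qed

lemma finite_dim_rep_space: "fun_space.finite_dim (rep_space r :: (nat \<times> nat \<times> nat \<Rightarrow> 'k::field) set)"
proof (rule finite_dim_finite_support)
  let ?I = "{..<3::nat} \<times> {..<total_dim r} \<times> {..<total_dim r}"
  show "finite ?I" by simp
  fix v :: "nat \<times> nat \<times> nat \<Rightarrow> 'k" and p
  assume v: "v \<in> rep_space r" and p: "p \<notin> ?I"
  obtain t i j where tij: "p = (t, i, j)" by (cases p)
  show "v p = 0"
  proof (rule ccontr)
    assume "v p \<noteq> 0"
    then have "t < 3" "i < r (Suc t mod 3)" "j < r t" using v tij by (auto simp: rep_space_def)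
    then show False using r_le_total[of "Suc t mod 3" r] r_le_total[of t r] p tij by auto
  qed
qed

text \<open>Conjugation into the eigenbasis and reading of blocks identify degree 0 with
  \<open>level_algebra r\<close> and degree 1 with \<open>rep_space r\<close>, compatibly with the
  actions, so the dimension criterion can be transported.\<close>

theorem automorphism_has_GIB_iff:
  fixes \<zeta> :: "'k::field"
  assumes z: "primitive_root_of_unity 3 \<zeta>"
    and inner: "inner_automorphism_with_multiplicities n \<zeta> [r0, r1, r2] \<theta>"
  defines "r \<equiv> \<lambda>t. [r0, r1, r2] ! t"
  shows "automorphism_has_GIB n \<zeta> \<theta> \<longleftrightarrow>
    (\<forall>v\<in>rep_space r :: (nat \<times> nat \<times> nat \<Rightarrow> 'k) set. Max ((\<lambda>w. fun_space.dim (orbit r w :: (nat \<times> nat \<times> nat \<Rightarrow> 'k) set)) ` rep_space r) =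
      Max ((\<lambda>u. fun_space.dim (double_orbit r v u)) ` rep_space r))"
proof -
  obtain S T where ST: "total_dim r = n" "S \<in> carrier_mat n n" "T \<in> carrier_mat n n"
    "S * T = 1\<^sub>m n" "T * S = 1\<^sub>m n"
    "\<forall>A\<in>carrier_mat n n. \<forall>i. A \<in> graded_part n \<zeta> \<theta> i \<longleftrightarrow>
      (\<forall>s<3. \<forall>t<3. s \<noteq> (t + i) mod 3 \<longrightarrow> block r (T * A * S) s t = 0)"
    by (rule graded_frame[OF z inner, folded r_def])
  let ?G = "graded_part n \<zeta> \<theta>" and ?N = "total_dim r"
  let ?C = "carrier_mat n n :: 'k mat set"
  have G: "A \<in> ?C" if "A \<in> ?G i" for A i using that by (simp add: graded_part_def)
  note mats = assoc_mult_mat[of _ n n _ n _ n]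
  define hat where "hat A = T * A * S" for A
  have hC: "hat A \<in> carrier_mat ?N ?N" if "A \<in> ?C" for A
    using that ST(1-3) by (simp add: hat_def)
  have cancel: "S * (T * X) = X" "T * (S * X) = X" if "X \<in> ?C" for X
    using that ST(1-5) by (simp_all flip: assoc_mult_mat[of _ n n _ n _ n])
  have hat_inv: "S * hat A * T = A" if "A \<in> ?C" for A
    using that ST(2-5) by (simp add: hat_def mats cancel mult_carrier_mat[of _ n n _ n])
  have hat_inj: "A = B" if "hat A = hat B" "A \<in> ?C" "B \<in> ?C" for A B
    using that hat_inv by metis
  have hat_surj: "hat (S * B * T) = B" if "B \<in> ?C" for B
    using that ST(2-5) by (simp add: hat_def mats cancel mult_carrier_mat[of _ n n _ n])
  have hat_ops: "hat (A + B) = hat A + hat B" "hat (A - B) = hat A - hat B"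
    "hat (c \<cdot>\<^sub>m A) = c \<cdot>\<^sub>m hat A" "hat (A * B) = hat A * hat B"
    if "A \<in> ?C" "B \<in> ?C" for A B c
    using that ST(2-5)
    by (simp_all add: hat_def mult_add_distrib_mat[of _ n n _ n] add_mult_distrib_mat[of _ n n _ _ n]
        mult_minus_distrib_mat[of _ n n _ n] minus_mult_distrib_mat[of _ n n _ _ n]
        mult_smult_distrib[of _ n n _ n] mult_smult_assoc_mat[of _ n n _ n] mats cancel
        mult_carrier_mat[of _ n n _ n])
  have graded: "A \<in> ?G i \<longleftrightarrow> (\<forall>s<3. \<forall>t<3. s \<noteq> (t + i) mod 3 \<longrightarrow> block r (hat A) s t = 0)"
    if "A \<in> ?C" for A i
    using ST(6) that by (simp add: hat_def)
  have bl_ops: "block r (hat (A + B)) s t p q = block r (hat A) s t p q + block r (hat B) s t p q"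
    "block r (hat (A - B)) s t p q = block r (hat A) s t p q - block r (hat B) s t p q"
    "block r (hat (c \<cdot>\<^sub>m A)) s t p q = c * block r (hat A) s t p q"
    if "A \<in> ?C" "B \<in> ?C" "s < 3" "t < 3" for A B c s t p q
    using that hC by (simp_all add: hat_ops[of A B] block_linear block_smult)
  \<comment> \<open>A homogeneous right factor has only one non-zero block in column
    \<open>t\<close>, so the sum over the middle vertex has one term.\<close>
  have bl_mult: "block r (hat (A * B)) s t = mm ?N (block r (hat A) s ((t + j) mod 3)) (block r (hat B) ((t + j) mod 3) t)"
    if A: "A \<in> ?C" and B: "B \<in> ?G j" and st: "s < 3" "t < 3" for A B j s t
  proof -
    have "block r (hat (A * B)) s t = (\<Sum>u<3. mm ?N (block r (hat A) s u) (block r (hat B) u t))"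
      using A G[OF B] hC st by (simp add: hat_ops block_mult)
    also have "\<dots> = (\<Sum>u\<in>{(t + j) mod 3}. mm ?N (block r (hat A) s u) (block r (hat B) u t))"
    proof (rule sum.mono_neutral_right)
      show "\<forall>u\<in>{..<3} - {(t + j) mod 3}. mm ?N (block r (hat A) s u) (block r (hat B) u t) = 0"
        using B G[OF B] graded st by (auto simp: mm_def fun_eq_iff)
    qed auto
    finally show ?thesis by simp
  qed
  have bl_zero: "block r (hat A) s t = 0" if "A \<in> ?G i" "s < 3" "t < 3" "s \<noteq> (t + i) mod 3" for A i s t
    using that graded G by blast
  have G_mult: "A * B \<in> ?G (i + j)" if "A \<in> ?G i" "B \<in> ?G j" for A B i j
  proof -
    have AB: "A \<in> ?C" "B \<in> ?C" "A * B \<in> ?C" using G[OF that(1)] G[OF that(2)] by auto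
    show ?thesis
      unfolding graded[OF AB(3)]
    proof (intro allI impI)
      fix s t :: nat assume st: "s < 3" "t < 3" "s \<noteq> (t + (i + j)) mod 3"
      have "(t + (i + j)) mod 3 = ((t + j) mod 3 + i) mod 3"
        by (simp add: mod_simps add.assoc add.commute[of i])
      then have "block r (hat A) s ((t + j) mod 3) = 0"
        using st bl_zero[OF that(1) st(1), of "(t + j) mod 3"] by simp
      then show "block r (hat (A * B)) s t = 0"
        using bl_mult[OF AB(1) that(2) st(1,2)] by (simp add: mm_def fun_eq_iff)
    qed
  qed
  have G_ops: "A + B \<in> ?G i" "A - B \<in> ?G i" "c \<cdot>\<^sub>m A \<in> ?G i" if "A \<in> ?G i" "B \<in> ?G i" for A B c i
  proof -
    have C: "A \<in> ?C" "B \<in> ?C" "A + B \<in> ?C" "A - B \<in> ?C" "c \<cdot>\<^sub>m A \<in> ?C"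
      using G[OF that(1)] G[OF that(2)] by auto
    note zz = bl_zero[OF that(1)] bl_zero[OF that(2)]
    show "A + B \<in> ?G i" unfolding graded[OF C(3)] by (auto simp: fun_eq_iff bl_ops[OF C(1,2)] zz)
    show "A - B \<in> ?G i" unfolding graded[OF C(4)] by (auto simp: fun_eq_iff bl_ops[OF C(1,2)] zz)
    show "c \<cdot>\<^sub>m A \<in> ?G i" unfolding graded[OF C(5)] by (auto simp: fun_eq_iff bl_ops[OF C(1,2)] zz)
  qed
  have G_zero: "0\<^sub>m n n \<in> ?G i" for i
  proof -
    have "block r (hat (0\<^sub>m n n)) s t = 0" if "s < 3" "t < 3" for s t
      using block_zero[OF that, where 'a='k and r=r] ST(1-3) by (simp add: hat_def fun_eq_iff)
    then show ?thesis using graded[of "0\<^sub>m n n"] by simp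
  qed
  let ?V = "(module_mat TYPE('k) n n)\<lparr>carrier := ?G 1\<rparr>"
  let ?act = "\<lambda>x y :: 'k mat. x * y - y * x"
  define \<phi> where "\<phi> A = (\<lambda>(t, i, j). if t < 3 then block r (hat A) (Suc t mod 3) t i j else 0)" for A
  define \<psi> where "\<psi> A = (\<lambda>(t, i, j). if t < 3 then block r (hat A) t t i j else 0)" for A
  have ext_eq: "A = B" if "A \<in> ?G i" "B \<in> ?G i" "\<And>t. t < 3 \<Longrightarrow> block r (hat A) ((t + i) mod 3) t = block r (hat B) ((t + i) mod 3) t"
    for A B i
  proof (rule hat_inj)
    show "hat A = hat B"
    proof (rule block_eqI[where r=r])
      show "block r (hat A) s t = block r (hat B) s t" if "s < 3" "t < 3" for s t
        using that bl_zero[OF \<open>A \<in> ?G i\<close> that] bl_zero[OF \<open>B \<in> ?G i\<close> that]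
          \<open>\<And>t. t < 3 \<Longrightarrow> block r (hat A) ((t + i) mod 3) t = block r (hat B) ((t + i) mod 3) t\<close>
        by (cases "s = (t + i) mod 3") auto
    qed (use that G hC in auto)
  qed (use that G in auto)
  have ex: "\<exists>A\<in>?G i. \<forall>t<3. block r (hat A) ((t + i) mod 3) t = F t"
    if F: "\<And>t. t < 3 \<Longrightarrow> supp (r ((t + i) mod 3)) (r t) (F t)" for F i
  proof -
    obtain B where B: "B \<in> carrier_mat ?N ?N"
      "\<And>s t. s < 3 \<Longrightarrow> t < 3 \<Longrightarrow> block r B s t = (if s = (t + i) mod 3 then F t else (\<lambda>_ _. 0))"
      by (rule block_exists[of r "\<lambda>s t. if s = (t + i) mod 3 then F t else (\<lambda>_ _. 0)"])
        (use F in \<open>auto simp: supp_def\<close>)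
    have C: "B \<in> ?C" "S * B * T \<in> ?C" using B(1) ST(1-3) by auto
    then have "S * B * T \<in> ?G i"
      unfolding graded[OF C(2)] hat_surj[OF C(1)] using B(2) by (auto simp: fun_eq_iff)
    then show ?thesis using B(2) hat_surj[OF C(1)] by (intro bexI[of _ "S * B * T"]) auto
  qed
  have arr_\<phi>: "arrow (\<phi> A) t = (if t < 3 then block r (hat A) (Suc t mod 3) t else (\<lambda>_ _. 0))"
    and arr_\<psi>: "arrow (\<psi> A) t = (if t < 3 then block r (hat A) t t else (\<lambda>_ _. 0))" for A t
    by (auto simp: arrow_def \<phi>_def \<psi>_def)
  have \<phi>_im: "\<phi> ` ?G 1 = rep_space r"
  proof
    show "\<phi> ` ?G 1 \<subseteq> rep_space r"
      by (auto simp: \<phi>_def rep_space_def block_def split: if_splits)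
    show "rep_space r \<subseteq> \<phi> ` ?G 1"
    proof
      fix v :: "nat \<times> nat \<times> nat \<Rightarrow> 'k" assume v: "v \<in> rep_space r"
      then obtain A where A: "A \<in> ?G 1" "\<forall>t<3. block r (hat A) ((t + 1) mod 3) t = arrow v t"
        using ex[of 1 "arrow v"] by (auto simp: supp_def arrow_def rep_space_def)
      have "v (t, i, j) = 0" if "\<not> t < 3" for t i j using v that by (auto simp: rep_space_def)
      then have "\<phi> A = v" using A(2) by (auto simp: \<phi>_def fun_eq_iff arrow_def)
      then show "v \<in> \<phi> ` ?G 1" using A(1) by auto
    qed
  qed
  have \<psi>_im: "\<psi> ` ?G 0 = level_algebra r"
  proof
    show "\<psi> ` ?G 0 \<subseteq> level_algebra r"
      by (auto simp: \<psi>_def level_algebra_def block_def split: if_splits)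
    show "level_algebra r \<subseteq> \<psi> ` ?G 0"
    proof
      fix v :: "nat \<times> nat \<times> nat \<Rightarrow> 'k" assume v: "v \<in> level_algebra r"
      then obtain A where A: "A \<in> ?G 0" "\<forall>t<3. block r (hat A) ((t + 0) mod 3) t = arrow v t"
        using ex[of 0 "arrow v"] by (auto simp: supp_def arrow_def level_algebra_def)
      have "v (t, i, j) = 0" if "\<not> t < 3" for t i j using v that by (auto simp: level_algebra_def)
      then have "\<psi> A = v" using A(2) by (auto simp: \<psi>_def fun_eq_iff arrow_def)
      then show "v \<in> \<psi> ` ?G 0" using A(1) by auto
    qed
  qed
  have \<phi>_act: "\<phi> (?act x v) = rep_action ?N (\<psi> x) (\<phi> v)" if x: "x \<in> ?G 0" and v: "v \<in> ?G 1" for x v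
  proof (rule ext)
    fix p :: "nat \<times> nat \<times> nat"
    obtain t i j where p: "p = (t, i, j)" by (cases p)
    show "\<phi> (?act x v) p = rep_action ?N (\<psi> x) (\<phi> v) p"
    proof (cases "t < 3")
      case True
      have "block r (hat (x * v)) (Suc t mod 3) t = mm ?N (block r (hat x) (Suc t mod 3) (Suc t mod 3)) (block r (hat v) (Suc t mod 3) t)"
        using bl_mult[OF G[OF x] v, of "Suc t mod 3" t] True by simp
      moreover have "block r (hat (v * x)) (Suc t mod 3) t = mm ?N (block r (hat v) (Suc t mod 3) t) (block r (hat x) t t)"
        using bl_mult[OF G[OF v] x, of "Suc t mod 3" t] True by simp
      ultimately show ?thesis
        using True G[OF x] G[OF v]
        by (simp add: p \<phi>_def[of "?act x v"] bl_ops rep_action_def arr_\<phi> arr_\<psi>)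
    qed (simp add: p \<phi>_def rep_action_def)
  qed
  have act_closed: "?act x v \<in> ?G 1" if "x \<in> ?G 0" "v \<in> ?G 1" for x v
    using G_mult[OF that] G_mult[OF that(2,1)] G_ops(2) by simp
  have e: "fun_space.embedding ?V \<phi>"
    unfolding fun_space.embedding_def
  proof (intro conjI ballI allI)
    show "inj_on \<phi> (carrier ?V)"
    proof (rule inj_onI)
      fix A B assume AB: "A \<in> carrier ?V" "B \<in> carrier ?V" "\<phi> A = \<phi> B"
      show "A = B"
      proof (rule ext_eq[of _ 1])
        fix t :: nat assume "t < 3"
        then show "block r (hat A) ((t + 1) mod 3) t = block r (hat B) ((t + 1) mod 3) t"
          using arg_cong[OF AB(3), of "\<lambda>f. arrow f t"] by (simp add: arr_\<phi>)
      qed (use AB in auto)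
    qed
    show "\<zero>\<^bsub>?V\<^esub> \<in> carrier ?V" using G_zero by (simp add: module_mat_simps)
    show "\<phi> \<zero>\<^bsub>?V\<^esub> = 0"
      using block_zero[where 'a='k and r=r] ST(1-3)
      by (auto simp: module_mat_simps \<phi>_def hat_def fun_eq_iff)
    fix u v assume "u \<in> carrier ?V" "v \<in> carrier ?V"
    then show "u \<oplus>\<^bsub>?V\<^esub> v \<in> carrier ?V" "\<phi> (u \<oplus>\<^bsub>?V\<^esub> v) = \<phi> u + \<phi> v"
      using G G_ops(1) by (auto simp: module_mat_simps \<phi>_def fun_eq_iff bl_ops)
  next
    fix c v assume "v \<in> carrier ?V"
    then have v: "v \<in> ?G 1" by simp
    show "c \<odot>\<^bsub>?V\<^esub> v \<in> carrier ?V"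
      using G_ops(3)[OF v v] by (simp add: module_mat_simps)
    show "\<phi> (c \<odot>\<^bsub>?V\<^esub> v) = fscale c (\<phi> v)"
      using bl_ops(3)[OF G[OF v] G[OF v]] by (auto simp: module_mat_simps \<phi>_def fun_eq_iff fscale_def)
  qed
  have orb: "\<phi> ` orbit_tangent (?G 0) ?act v = orbit r (\<phi> v)" if v: "v \<in> ?G 1" for v
    unfolding orbit_tangent_def orbit_def \<psi>_im[symmetric] image_image
    by (rule image_cong[OF refl]) (rule \<phi>_act[OF _ v])
  have ann: "\<psi> ` annihilator (?G 0) ?V ?act v = stabiliser r (\<phi> v)" if v: "v \<in> ?G 1" for v
  proof -
    note D = fun_space.embeddingD[OF e]
    have "?act x v = \<zero>\<^bsub>?V\<^esub> \<longleftrightarrow> rep_action ?N (\<psi> x) (\<phi> v) = 0" if x: "x \<in> ?G 0" for x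
      using \<phi>_act[OF x v] D(2,3) inj_onD[OF D(1), of "?act x v" "\<zero>\<^bsub>?V\<^esub>"] act_closed[OF x v] by auto
    then show ?thesis
      unfolding stabiliser_def \<psi>_im[symmetric] annihilator_def by auto
  qed
  have orb2: "\<phi> ` orbit_tangent (annihilator (?G 0) ?V ?act v) ?act u
      = (\<lambda>x. rep_action ?N x (\<phi> u)) ` stabiliser r (\<phi> v)" if v: "v \<in> ?G 1" and u: "u \<in> ?G 1" for u v
    unfolding orbit_tangent_def ann[OF v, symmetric] image_image
    by (rule image_cong[OF refl]) (rule \<phi>_act[OF _ u], simp add: annihilator_def)
  have cV: "carrier ?V = ?G 1" by simp
  have "good_index_behaviour (?G 0) ?V ?act \<longleftrightarrow>
    (\<forall>v\<in>carrier ?V. Max ((\<lambda>w. fun_space.dim (\<phi> ` orbit_tangent (?G 0) ?act w)) ` carrier ?V) =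
      Max ((\<lambda>u. fun_space.dim {a + b | a b. a \<in> \<phi> ` orbit_tangent (?G 0) ?act v \<and>
        b \<in> \<phi> ` orbit_tangent (annihilator (?G 0) ?V ?act v) ?act u}) ` carrier ?V))"
  proof (rule fun_space.good_index_behaviour_iff_dim[OF e])
    show "fun_space.finite_dim (\<phi> ` carrier ?V)" unfolding cV \<phi>_im by (rule finite_dim_rep_space)
    fix x v assume x: "x \<in> ?G 0" and v: "v \<in> carrier ?V"
    then show "?act x v \<in> carrier ?V" using act_closed by simp
    show "?act x (c \<odot>\<^bsub>?V\<^esub> v) = c \<odot>\<^bsub>?V\<^esub> ?act x v" for c
      using G[OF x] G[of v 1] v
      by (auto simp: module_mat_simps mult_smult_distrib[of _ n n _ n] mult_smult_assoc_mat[of _ n n _ n]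
          right_diff_distrib intro!: eq_matI)
    fix u assume u: "u \<in> carrier ?V"
    show "?act x (u \<oplus>\<^bsub>?V\<^esub> v) = ?act x u \<oplus>\<^bsub>?V\<^esub> ?act x v"
      using G[OF x] G[of v 1] G[of u 1] v u
      by (auto simp: module_mat_simps mult_add_distrib_mat[of _ n n _ n] add_mult_distrib_mat[of _ n n _ _ n]
          intro!: eq_matI)
  next
    fix v assume v: "v \<in> carrier ?V"
    then have v': "v \<in> ?G 1" by simp
    show "fun_space.subspace (\<phi> ` orbit_tangent (?G 0) ?act v)"
      unfolding orb[OF v'] orbit_def by (rule subspace_action_image[OF subspace_level_algebra])
  next
    fix u v assume "u \<in> carrier ?V" "v \<in> carrier ?V"
    then have uv: "v \<in> ?G 1" "u \<in> ?G 1" by simp_all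
    show "fun_space.subspace (\<phi> ` orbit_tangent (annihilator (?G 0) ?V ?act v) ?act u)"
      unfolding orb2[OF uv] by (rule subspace_action_image[OF subspace_stabiliser])
  next
    fix x v w assume v: "v \<in> carrier ?V" and x: "x \<in> annihilator (?G 0) ?V ?act v"
      and w: "w \<in> orbit_tangent (?G 0) ?act v"
    then obtain y where y: "y \<in> ?G 0" "w = ?act y v" by (auto simp: orbit_tangent_def)
    have x': "x \<in> ?G 0" "x * v - v * x = 0\<^sub>m n n" using x by (auto simp: annihilator_def module_mat_simps)
    have C: "x \<in> ?C" "y \<in> ?C" "v \<in> ?C" using x'(1) y(1) v G by auto
    have xv: "v * x = x * v"
    proof (rule eq_matI)
      fix i j assume ij: "i < dim_row (x * v)" "j < dim_col (x * v)"
      then have "(x * v - v * x) $$ (i, j) = 0" using x'(2) C by auto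
      then show "(v * x) $$ (i, j) = (x * v) $$ (i, j)" using ij C by auto
    qed (use C in auto)
    \<comment> \<open>Since \<open>x\<close> commutes with \<open>v\<close>, the Jacobi identity
      gives \<open>[x, [y, v]] = [[x, y], v]\<close>; this makes \<open>q v\<close> stable under
      \<open>q_v\<close>.\<close>
    let ?z = "x * y - y * x"
    have z: "?z \<in> ?G 0" using G_mult[OF x'(1) y(1)] G_mult[OF y(1) x'(1)] G_ops(2) by simp
    have xvy: "v * (x * y) = x * (v * y)" "y * (v * x) = y * (x * v)"
      using assoc_mult_mat[OF C(3,1,2)] assoc_mult_mat[OF C(1,3,2)] by (simp_all add: xv)
    have "?act x w = ?act ?z v"
      unfolding y(2) using C xvy
      by (auto simp: mult_minus_distrib_mat[of _ n n _ n] minus_mult_distrib_mat[of _ n n _ _ n] mats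
          mult_carrier_mat[of _ n n _ n] simp del: index_mult_mat(1) intro!: eq_matI)
    then show "?act x w \<in> orbit_tangent (?G 0) ?act v" using z by (auto simp: orbit_tangent_def)
  qed
  also have "\<dots> \<longleftrightarrow> (\<forall>v\<in>?G 1. Max ((\<lambda>w. fun_space.dim (orbit r (\<phi> w))) ` ?G 1) =
      Max ((\<lambda>u. fun_space.dim (double_orbit r (\<phi> v) (\<phi> u))) ` ?G 1))"
    by (simp add: orb orb2 double_orbit_def del: One_nat_def cong: image_cong_simp)
  also have "\<dots> \<longleftrightarrow> (\<forall>v\<in>rep_space r :: (nat \<times> nat \<times> nat \<Rightarrow> 'k) set. Max ((\<lambda>w. fun_space.dim (orbit r w :: (nat \<times> nat \<times> nat \<Rightarrow> 'k) set)) ` rep_space r) =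
      Max ((\<lambda>u. fun_space.dim (double_orbit r v u)) ` rep_space r))"
    unfolding \<phi>_im[symmetric] by (simp add: image_image)
  finally show ?thesis unfolding automorphism_has_GIB_def .
qed

section \<open>The tangent criterion\<close>

context coordinate_space
begin

text \<open>In coordinates with respect to \<open>B\<close>, a vanishing combination with
  coefficients \<open>c\<close> of the perturbed vectors reads \<open>G c = - (1 / t) c\<close>,
  where \<open>G\<close> is the matrix of \<open>g\<close>. Bad values of \<open>t\<close> thus come
  from roots of the characteristic polynomial of \<open>G\<close>.\<close>

lemma independent_perturbation:
  assumes B: "finite B" "independent B"
  shows "finite {t. t \<noteq> 0 \<and> \<not> (inj_on (\<lambda>b. b + scale t (g b)) B \<and> independent ((\<lambda>b. b + scale t (g b)) ` B))}"
proof -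
  obtain h where h: "bij_betw h {..<card B} B"
    using ex_bij_betw_nat_finite[OF B(1)] by (auto simp: lessThan_atLeast0)
  let ?m = "card B"
  have "\<exists>F. Vector_Spaces.linear scale (*) F \<and> (\<forall>x\<in>B. F x = (if x = b then 1 else 0))" for b
    using functional.linear_independent_extend[OF B(2), of "\<lambda>x. if x = b then 1 else 0"] by simp
  then obtain F where F: "\<And>b. Vector_Spaces.linear scale (*) (F b)"
    "\<And>b x. x \<in> B \<Longrightarrow> F b x = (if x = b then 1 else 0)" by metis
  define G where "G = mat ?m ?m (\<lambda>(j, i). F (h j) (g (h i)))"
  have G: "G \<in> carrier_mat ?m ?m" by (simp add: G_def)
  have nz: "char_poly G \<noteq> 0" using degree_monic_char_poly[OF G] by auto
  have key: "\<forall>b\<in>B. c b = 0"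
    if t: "t \<noteq> 0" "poly (char_poly G) (- (1 / t)) \<noteq> 0"
      and s: "(\<Sum>b\<in>B. scale (c b) (b + scale t (g b))) = 0" for t c
  proof -
    define x where "x = vec ?m (\<lambda>i. c (h i))"
    have "(G *\<^sub>v x) $ j = (- (1 / t) \<cdot>\<^sub>v x) $ j" if j: "j < ?m" for j
    proof -
      have hj: "h j \<in> B" using h j by (auto simp: bij_betw_def)
      have "0 = F (h j) (\<Sum>b\<in>B. scale (c b) (b + scale t (g b)))"
        unfolding s using functional.linear_0[OF F(1)] by simp
      also have "\<dots> = (\<Sum>b\<in>B. c b * F (h j) b) + t * (\<Sum>b\<in>B. c b * F (h j) (g b))"
        unfolding functional.linear_sum[OF F(1)] functional.linear_scale[OF F(1)]
            functional.linear_add[OF F(1)] distrib_left sum.distrib sum_distrib_left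
        by (simp only: mult.assoc mult.left_commute)
      also have "(\<Sum>b\<in>B. c b * F (h j) b) = (\<Sum>b\<in>B. if b = h j then c (h j) else 0)"
        by (rule sum.cong) (auto simp: F(2))
      also have "\<dots> = c (h j)" using B(1) hj by simp
      also have "(\<Sum>b\<in>B. c b * F (h j) (g b)) = (\<Sum>i<?m. c (h i) * F (h j) (g (h i)))"
        using sum.reindex_bij_betw[OF h, of "\<lambda>b. c b * F (h j) (g b)"] by simp
      also have "\<dots> = (G *\<^sub>v x) $ j"
        using j by (simp add: G_def x_def scalar_prod_def lessThan_atLeast0 mult.commute)
      finally have "(G *\<^sub>v x) $ j = - (1 / t) * c (h j)" using t(1) by (simp add: field_simps eq_neg_iff_add_eq_0 add.commute)
      then show ?thesis using j by (simp add: x_def)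
    qed
    then have "G *\<^sub>v x = - (1 / t) \<cdot>\<^sub>v x" using G by (intro eq_vecI) (auto simp: x_def)
    moreover have "\<not> eigenvalue G (- (1 / t))" using t(2) eigenvalue_root_char_poly[OF G] by blast
    moreover have "x \<in> carrier_vec ?m" by (simp add: x_def)
    ultimately have "x = 0\<^sub>v ?m" using G unfolding eigenvalue_def eigenvector_def by auto
    then have "c (h i) = 0" if "i < ?m" for i using that by (metis index_vec index_zero_vec(1) x_def)
    moreover have "\<exists>i<?m. b = h i" if "b \<in> B" for b using h that by (auto simp: bij_betw_def)
    ultimately show ?thesis by auto
  qed
  have ind: "inj_on (\<lambda>b. b + scale t (g b)) B \<and> independent ((\<lambda>b. b + scale t (g b)) ` B)"
    if t: "t \<noteq> 0" "poly (char_poly G) (- (1 / t)) \<noteq> 0" for t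
  proof
    let ?f = "\<lambda>b. b + scale t (g b)"
    show inj: "inj_on ?f B"
    proof (rule inj_onI, rule ccontr)
      fix b b' assume b: "b \<in> B" "b' \<in> B" "?f b = ?f b'" "b \<noteq> b'"
      let ?c = "\<lambda>x. if x = b then 1 else if x = b' then -1 else (0 :: 'a)"
      have "(\<Sum>x\<in>B. scale (?c x) (?f x)) = (\<Sum>x\<in>{b, b'}. scale (?c x) (?f x))"
        using B(1) b by (intro sum.mono_neutral_right) auto
      also have "\<dots> = 0" using b by simp
      finally have "\<forall>x\<in>B. ?c x = 0" by (rule key[OF t])
      then show False using b(1) by auto
    qed
    show "independent (?f ` B)"
    proof (rule independent_if_scalars_zero)
      fix c y assume s: "(\<Sum>x\<in>?f ` B. scale (c x) x) = 0" and y: "y \<in> ?f ` B"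
      then have "(\<Sum>b\<in>B. scale (c (?f b)) (?f b)) = 0" by (simp add: sum.reindex[OF inj])
      from key[OF t this] y show "c y = 0" by auto
    qed (use B(1) in simp)
  qed
  have fin: "finite ((\<lambda>l. - (1 / l)) ` {l. poly (char_poly G) l = 0})"
    using poly_roots_finite[OF nz] by simp
  show ?thesis
  proof (rule finite_subset[OF _ fin], rule subsetI)
    fix t assume "t \<in> {t. t \<noteq> 0 \<and> \<not> (inj_on (\<lambda>b. b + scale t (g b)) B \<and> independent ((\<lambda>b. b + scale t (g b)) ` B))}"
    then have "t \<noteq> 0" "poly (char_poly G) (- (1 / t)) = 0" using ind by auto
    then show "t \<in> (\<lambda>l. - (1 / l)) ` {l. poly (char_poly G) l = 0}"
      by (intro image_eqI[of _ _ "- (1 / t)"]) auto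
  qed
qed

lemma independent_card_le_finite_dim:
  assumes "finite_dim S" "independent B" "B \<subseteq> S"
  shows "card B \<le> dim S"
proof -
  have "dim B = card B" by (rule dim_eq_card_independent[OF assms(2)])
  then show ?thesis using finite_dim_dim_mono[OF assms(1,3)] by simp
qed

lemma dim_insert_not_in_span:
  assumes "finite_dim T" "S \<subseteq> T" "x \<in> T" "x \<notin> span S"
  shows "dim (insert x S) = Suc (dim S)"
proof -
  obtain B where B: "B \<subseteq> S" "independent B" "S \<subseteq> span B" "card B = dim S"
    by (rule basis_exists)
  have sp: "span B = span S"
    using span_minimal[OF B(3) subspace_span] span_mono[OF B(1)] by auto
  have fB: "finite B" using finite_dim_independent[OF assms(1) B(2)] B(1) assms(2) by auto
  have x: "x \<notin> span B" using sp assms(4) by simp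
  then have "x \<notin> B" using span_base by auto
  have "dim (insert x S) = card (insert x B)"
  proof (rule dim_unique)
    show "insert x B \<subseteq> insert x S" using B(1) by auto
    show "insert x S \<subseteq> span (insert x B)" using B(3) span_mono[of B "insert x B"] span_base[of x "insert x B"] by auto
    show "independent (insert x B)" using independent_insertI[OF x B(2)] .
  qed simp
  then show ?thesis using fB \<open>x \<notin> B\<close> B(4) by simp
qed

text \<open>Turns functionals that kill \<open>S\<close> into a bound on its codimension:
  \<open>F a\<close> separates \<open>m a\<close> from \<open>S\<close> and from all earlier
  \<open>m b\<close>, so each step raises the dimension by one.\<close>

lemma triangular_codim:
  assumes T: "finite_dim T" and S: "S \<subseteq> T" and m: "\<And>a. a < n \<Longrightarrow> m a \<in> T"
    and F: "\<And>a. a < n \<Longrightarrow> Vector_Spaces.linear scale (*) (F a)"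
    and FS: "\<And>a x. a < n \<Longrightarrow> x \<in> S \<Longrightarrow> F a x = 0"
    and tri: "\<And>a b. a < n \<Longrightarrow> b < a \<Longrightarrow> F a (m b) = 0" "\<And>a. a < n \<Longrightarrow> F a (m a) \<noteq> 0"
  shows "dim S + n \<le> dim T"
proof -
  have "dim (S \<union> m ` {..<k}) = dim S + k" if "k \<le> n" for k
    using that
  proof (induction k)
    case (Suc k)
    then have k: "k < n" by simp
    have "m k \<notin> span (S \<union> m ` {..<k})"
    proof
      assume *: "m k \<in> span (S \<union> m ` {..<k})"
      have "F k (m k) = 0"
        by (rule functional.linear_eq_0_on_span[OF F[OF k] _ *]) (use FS[OF k] tri(1)[OF k] in auto)
      with tri(2)[OF k] show False by simp
    qed
    then have "dim (insert (m k) (S \<union> m ` {..<k})) = Suc (dim (S \<union> m ` {..<k}))"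
      using S m Suc.prems by (intro dim_insert_not_in_span[OF T]) auto
    moreover have "insert (m k) (S \<union> m ` {..<k}) = S \<union> m ` {..<Suc k}"
      by (auto simp: lessThan_Suc)
    ultimately show ?case using Suc by simp
  qed simp
  from this[of n] finite_dim_dim_mono[OF T, of "S \<union> m ` {..<n}"] S m show ?thesis by auto
qed

lemma dim_le_add_card:
  assumes "finite_dim S" "finite M" "T \<subseteq> span (S \<union> M)"
  shows "dim T \<le> dim S + card M"
proof -
  obtain B where B: "B \<subseteq> S" "independent B" "S \<subseteq> span B" "card B = dim S"
    by (rule basis_exists)
  have fB: "finite B" using finite_dim_independent[OF assms(1) B(2,1)] .
  have "S \<union> M \<subseteq> span (B \<union> M)"
    using B(3) span_mono[of B "B \<union> M"] span_superset[of "B \<union> M"] by auto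
  then have "T \<subseteq> span (B \<union> M)" using span_minimal[OF _ subspace_span] assms(3) by blast
  then have "dim T \<le> card (B \<union> M)" using fB assms(2) by (intro dim_le_card) auto
  also have "\<dots> \<le> dim S + card M" using card_Un_le[of B M] B(4) by simp
  finally show ?thesis .
qed

end

lemma rep_action_closed:
  assumes "x \<in> level_algebra r" "w \<in> rep_space r"
  shows "rep_action N x w \<in> rep_space r"
proof -
  have "t < 3 \<and> i < r (Suc t mod 3) \<and> j < r t" if nz: "rep_action N x w (t, i, j) \<noteq> 0" for t i j
  proof -
    have t: "t < 3" using nz by (auto simp: rep_action_def split: if_splits)
    have "mm N (arrow x (Suc t mod 3)) (arrow w t) i j \<noteq> 0 \<or> mm N (arrow w t) (arrow x t) i j \<noteq> 0"
      using nz by (auto simp: rep_action_def split: if_splits)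
    then obtain l where "x (Suc t mod 3, i, l) * w (t, l, j) \<noteq> 0 \<or> w (t, i, l) * x (t, l, j) \<noteq> 0"
      unfolding mm_def arrow_def by (meson sum.neutral)
    then consider "x (Suc t mod 3, i, l) \<noteq> 0" "w (t, l, j) \<noteq> 0" | "w (t, i, l) \<noteq> 0" "x (t, l, j) \<noteq> 0"
      by auto
    then show ?thesis
      using assms t by cases (auto simp: level_algebra_def rep_space_def)
  qed
  then show ?thesis by (auto simp: rep_space_def)
qed

text \<open>First-order deformation: if \<open>\<xi>\<close> annihilates \<open>v\<close>, then \<open>\<xi> \<cdot> (v + t u) = t (\<xi> \<cdot> u)\<close>.\<close>

lemma orbit_deformation:
  fixes v u :: "nat \<times> nat \<times> nat \<Rightarrow> 'k::field"
  assumes v: "v \<in> rep_space r" and u: "u \<in> rep_space r"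
  shows "finite {t. t \<noteq> 0 \<and> fun_space.dim (orbit r (v + fscale t u)) < fun_space.dim (double_orbit r v u)}"
proof -
  let ?N = "total_dim r"
  let ?O = "(\<lambda>x. rep_action ?N x u) ` stabiliser r v"
  have sub: "fun_space.subspace (orbit r w)" for w :: "nat \<times> nat \<times> nat \<Rightarrow> 'k"
    unfolding orbit_def by (rule subspace_action_image[OF subspace_level_algebra])
  have sO: "fun_space.subspace ?O" by (rule subspace_action_image[OF subspace_stabiliser])
  obtain B where B: "B \<subseteq> orbit r v \<union> ?O" "fun_space.independent B" "orbit r v \<union> ?O \<subseteq> fun_space.span B"
    by (rule fun_space.maximal_independent_subset)
  have inrep: "orbit r v \<union> ?O \<subseteq> rep_space r"
    using rep_action_closed[OF _ v] rep_action_closed[OF _ u] by (auto simp: orbit_def stabiliser_def)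
  have fB: "finite B"
    using fun_space.finite_dim_independent[OF finite_dim_rep_space B(2)] B(1) inrep by blast
  have "double_orbit r v u \<subseteq> fun_space.span B"
    using B(3) by (auto simp: double_orbit_def intro!: fun_space.span_add)
  then have dim_le: "fun_space.dim (double_orbit r v u) \<le> card B"
    using fB by (rule fun_space.dim_le_card)
  have "\<forall>b\<in>orbit r v. \<exists>x. x \<in> level_algebra r \<and> b = rep_action ?N x v" by (auto simp: orbit_def)
  then obtain X where X: "\<And>b. b \<in> orbit r v \<Longrightarrow> X b \<in> level_algebra r \<and> b = rep_action ?N (X b) v"
    by (auto simp: bchoice_iff)
  \<comment> \<open>A basis vector \<open>X b v\<close> of the orbit moves to
    \<open>X b (v + t u)\<close>. A basis vector \<open>x u\<close> with \<open>x\<close> in the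
    stabiliser need not move, being the image of \<open>v + t u\<close> under
    \<open>x / t\<close>.\<close>
  define g where "g b = (if b \<in> orbit r v then rep_action ?N (X b) u else 0)" for b
  show ?thesis
  proof (rule finite_subset[OF _ fun_space.independent_perturbation[OF fB B(2), of g]], rule subsetI)
    fix t assume "t \<in> {t. t \<noteq> 0 \<and> fun_space.dim (orbit r (v + fscale t u)) < fun_space.dim (double_orbit r v u)}"
    then have t: "t \<noteq> 0" "fun_space.dim (orbit r (v + fscale t u)) < card B" using dim_le by auto
    let ?w = "v + fscale t u"
    have "(\<lambda>b. b + fscale t (g b)) ` B \<subseteq> orbit r ?w"
    proof
      fix y assume "y \<in> (\<lambda>b. b + fscale t (g b)) ` B"
      then obtain b where b: "b \<in> B" "y = b + fscale t (g b)" by auto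
      show "y \<in> orbit r ?w"
      proof (cases "b \<in> orbit r v")
        case True
        then have "y = rep_action ?N (X b) ?w"
          using X[OF True] unfolding b(2) g_def by (simp add: rep_action_linear)
        then show ?thesis using X[OF True] by (auto simp: orbit_def)
      next
        case False
        then obtain x where x: "x \<in> stabiliser r v" "b = rep_action ?N x u" using b(1) B(1) by auto
        have "y = rep_action ?N (fscale (1 / t) x) ?w"
          using x t(1) False unfolding b(2) g_def
          by (simp add: rep_action_linear stabiliser_def)
        moreover have "fscale (1 / t) x \<in> level_algebra r"
          using x(1) by (simp add: stabiliser_def fun_space.subspace_scale[OF subspace_level_algebra])
        ultimately show ?thesis by (auto simp: orbit_def)
      qed
    qed
    moreover have "?w \<in> rep_space r"
      using v u fun_space.subspace_add[OF subspace_rep_space] fun_space.subspace_scale[OF subspace_rep_space] by blast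
    then have "orbit r ?w \<subseteq> rep_space r"
      using rep_action_closed by (auto simp: orbit_def)
    then have "fun_space.finite_dim (orbit r ?w)"
      using fun_space.finite_dim_subset[OF finite_dim_rep_space] by blast
    ultimately have lt: "card ((\<lambda>b. b + fscale t (g b)) ` B) < card B"
      if "fun_space.independent ((\<lambda>b. b + fscale t (g b)) ` B)"
      using fun_space.independent_card_le_finite_dim[OF _ that] t(2) by fastforce
    have "\<not> (inj_on (\<lambda>b. b + fscale t (g b)) B \<and> fun_space.independent ((\<lambda>b. b + fscale t (g b)) ` B))"
    proof
      assume *: "inj_on (\<lambda>b. b + fscale t (g b)) B \<and> fun_space.independent ((\<lambda>b. b + fscale t (g b)) ` B)"
      from lt[OF conjunct2[OF *]] card_image[OF conjunct1[OF *]] show False by simp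
    qed
    then show "t \<in> {t. t \<noteq> 0 \<and> \<not> (inj_on (\<lambda>b. b + fscale t (g b)) B \<and>
        fun_space.independent ((\<lambda>b. b + fscale t (g b)) ` B))}" using t(1) by simp
  qed
qed

definition max_orbit_dim :: "'k::field itself \<Rightarrow> (nat \<Rightarrow> nat) \<Rightarrow> nat" where
  "max_orbit_dim _ r = Max ((\<lambda>w. fun_space.dim (orbit r w :: (nat \<times> nat \<times> nat \<Rightarrow> 'k) set)) ` rep_space r)"

lemma orbit_subset: "w \<in> rep_space r \<Longrightarrow> orbit r w \<subseteq> rep_space r"
  using rep_action_closed by (auto simp: orbit_def)

lemma double_orbit_subset: "v \<in> rep_space r \<Longrightarrow> u \<in> rep_space r \<Longrightarrow> double_orbit r v u \<subseteq> rep_space r"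
  unfolding double_orbit_def orbit_def stabiliser_def
  by (auto intro!: fun_space.subspace_add[OF subspace_rep_space] rep_action_closed)

lemma finite_orbit_dims:
  "finite ((\<lambda>w. fun_space.dim (orbit r w :: (nat \<times> nat \<times> nat \<Rightarrow> 'k::field) set)) ` rep_space r)"
  by (rule finite_subset[of _ "{..fun_space.dim (rep_space r :: (nat \<times> nat \<times> nat \<Rightarrow> 'k) set)}"])
    (use fun_space.finite_dim_dim_mono[OF finite_dim_rep_space orbit_subset] in auto)

lemma orbit_dim_le_max:
  "w \<in> rep_space r \<Longrightarrow> fun_space.dim (orbit r w :: (nat \<times> nat \<times> nat \<Rightarrow> 'k::field) set) \<le> max_orbit_dim TYPE('k) r"
  unfolding max_orbit_dim_def by (rule Max_ge[OF finite_orbit_dims]) auto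

lemma max_orbit_dim_attained:
  obtains w :: "nat \<times> nat \<times> nat \<Rightarrow> 'k::field"
  where "w \<in> rep_space r" "fun_space.dim (orbit r w) = max_orbit_dim TYPE('k) r"
proof -
  have "max_orbit_dim TYPE('k) r \<in> (\<lambda>w. fun_space.dim (orbit r w :: (nat \<times> nat \<times> nat \<Rightarrow> 'k) set)) ` rep_space r"
    unfolding max_orbit_dim_def
    by (rule Max_in[OF finite_orbit_dims]) (use fun_space.subspace_0[OF subspace_rep_space] in blast)
  then show ?thesis using that by auto
qed

text \<open>The exceptional parameters of the deformation are finite in number, so a field of
  characteristic zero contains another one, and the orbit there is bounded by the maximum.\<close>

lemma double_orbit_dim_le_max:
  fixes v u :: "nat \<times> nat \<times> nat \<Rightarrow> 'k::field_char_0"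
  assumes v: "v \<in> rep_space r" and u: "u \<in> rep_space r"
  shows "fun_space.dim (double_orbit r v u) \<le> max_orbit_dim TYPE('k) r"
proof -
  let ?bad = "{t. t \<noteq> 0 \<and> fun_space.dim (orbit r (v + fscale t u)) < fun_space.dim (double_orbit r v u)}"
  have "finite (insert 0 ?bad)" using orbit_deformation[OF v u] by simp
  then obtain t where t: "t \<notin> insert 0 ?bad" using ex_new_if_finite[OF infinite_UNIV_char_0] by blast
  have "v + fscale t u \<in> rep_space r"
    using v u fun_space.subspace_add[OF subspace_rep_space] fun_space.subspace_scale[OF subspace_rep_space] by blast
  from orbit_dim_le_max[OF this] t show ?thesis by auto
qed

text \<open>Equality of the two maxima reduces to one inequality, the other being
  \<open>double_orbit_dim_le_max\<close>. From here on upper and lower bounds for generic orbits can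
  be used separately.\<close>

theorem GIB_iff_max_orbit_dim:
  fixes \<zeta> :: "'k::field_char_0"
  assumes z: "primitive_root_of_unity 3 \<zeta>"
    and inner: "inner_automorphism_with_multiplicities n \<zeta> [r0, r1, r2] \<theta>"
  defines "r \<equiv> \<lambda>t. [r0, r1, r2] ! t"
  shows "automorphism_has_GIB n \<zeta> \<theta> \<longleftrightarrow>
    (\<forall>v\<in>rep_space r :: (nat \<times> nat \<times> nat \<Rightarrow> 'k) set. \<exists>u\<in>rep_space r.
      max_orbit_dim TYPE('k) r \<le> fun_space.dim (double_orbit r v u))"
proof -
  have "max_orbit_dim TYPE('k) r = Max ((\<lambda>u. fun_space.dim (double_orbit r v u)) ` rep_space r) \<longleftrightarrow>
      (\<exists>u\<in>rep_space r. max_orbit_dim TYPE('k) r \<le> fun_space.dim (double_orbit r v u))"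
    if v: "v \<in> rep_space r" for v :: "nat \<times> nat \<times> nat \<Rightarrow> 'k"
  proof -
    let ?S = "(\<lambda>u. fun_space.dim (double_orbit r v u)) ` rep_space r"
    have le: "x \<le> max_orbit_dim TYPE('k) r" if "x \<in> ?S" for x
      using that double_orbit_dim_le_max[OF v] by auto
    then have fin: "finite ?S" by (meson finite_nat_set_iff_bounded_le)
    have ne: "?S \<noteq> {}" using fun_space.subspace_0[OF subspace_rep_space] by blast
    show ?thesis
    proof
      assume "max_orbit_dim TYPE('k) r = Max ?S"
      then show "\<exists>u\<in>rep_space r. max_orbit_dim TYPE('k) r \<le> fun_space.dim (double_orbit r v u)"
        using Max_in[OF fin ne] by auto
    next
      assume "\<exists>u\<in>rep_space r. max_orbit_dim TYPE('k) r \<le> fun_space.dim (double_orbit r v u)"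
      then show "max_orbit_dim TYPE('k) r = Max ?S"
        using le fin ne by (intro antisym) (auto simp: Max_ge_iff)
    qed
  qed
  then show ?thesis
    unfolding automorphism_has_GIB_iff[OF z inner, folded r_def] max_orbit_dim_def[of "TYPE('k)", symmetric]
    by simp
qed

section \<open>Commuting functionals\<close>

lemma mm_assoc: "mm N (mm N A B) C = mm N A (mm N B C)"
proof (intro ext)
  fix i j
  have "mm N (mm N A B) C i j = (\<Sum>l<N. \<Sum>k<N. A i k * B k l * C l j)"
    by (simp add: mm_def sum_distrib_right)
  also have "\<dots> = (\<Sum>k<N. \<Sum>l<N. A i k * B k l * C l j)" by (rule sum.swap)
  also have "\<dots> = mm N A (mm N B C) i j" by (simp add: mm_def sum_distrib_left mult.assoc)
  finally show "mm N (mm N A B) C i j = mm N A (mm N B C) i j" .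
qed

lemma mm_distrib:
  "mm N (A + B) C = mm N A C + mm N B C" "mm N C (A + B) = mm N C A + mm N C B"
  "mm N (A - B) C = mm N A C - mm N B C" "mm N C (A - B) = mm N C A - mm N C B"
  "mm N (- A) C = - mm N A C" "mm N C (- A) = - mm N C A"
  "mm N 0 C = 0" "mm N C 0 = 0"
  by (simp_all add: mm_def fun_eq_iff algebra_simps sum.distrib sum_subtractf sum_negf)

lemma supp_mm: "supp a b A \<Longrightarrow> supp b c B \<Longrightarrow> supp a c (mm N A B)"
  unfolding supp_def mm_def by (metis (no_types, lifting) mult_eq_0_iff sum.neutral mult_zero_left mult_zero_right)

lemma supp_ops:
  "supp a b 0" "supp a b A \<Longrightarrow> supp a b (- A)"
  "supp a b A \<Longrightarrow> supp a b B \<Longrightarrow> supp a b (A + B)"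
  "supp a b A \<Longrightarrow> supp a b B \<Longrightarrow> supp a b (A - B)"
  for A B :: "nat \<Rightarrow> nat \<Rightarrow> 'k::ab_group_add"
  unfolding supp_def by auto (metis add.left_neutral diff_self)+

definition tr :: "nat \<Rightarrow> (nat \<Rightarrow> nat \<Rightarrow> 'k::comm_ring_1) \<Rightarrow> 'k" where
  "tr N A = (\<Sum>i<N. A i i)"

lemma tr_ops: "tr N (A + B) = tr N A + tr N B" "tr N (A - B) = tr N A - tr N B" "tr N (- A) = - tr N A"
  "tr N 0 = 0"
  by (simp_all add: tr_def sum.distrib sum_subtractf sum_negf)

lemma tr_mm_commute: "tr N (mm N A B) = tr N (mm N B A)"
  unfolding tr_def mm_def by (subst sum.swap) (simp add: mult.commute)

definition matrix_unit :: "nat \<Rightarrow> nat \<Rightarrow> nat \<Rightarrow> nat \<Rightarrow> 'k::zero_neq_one" where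
  "matrix_unit i j = (\<lambda>k l. if k = i \<and> l = j then 1 else 0)"

lemma supp_matrix_unit: "i < a \<Longrightarrow> j < b \<Longrightarrow> supp a b (matrix_unit i j)"
  by (auto simp: supp_def matrix_unit_def)

lemma tr_matrix_unit:
  assumes "i < N" "j < N"
  shows "tr N (mm N (matrix_unit i j) A) = (A j i :: 'k::comm_ring_1)"
proof -
  have "tr N (mm N (matrix_unit i j) A) = (\<Sum>k<N. \<Sum>l<N. if l = j then if k = i then A j i else 0 else 0)"
    unfolding tr_def mm_def matrix_unit_def by (intro sum.cong) auto
  then show ?thesis using assms by simp
qed

text \<open>Matrix units inside the admissible shape recover every entry of \<open>K\<close>;
  outside that shape \<open>K\<close> vanishes by its support.\<close>

lemma tr_mm_nondegenerate:
  assumes "supp a b K" "a \<le> N" "b \<le> N" and 0: "\<And>A. supp b a A \<Longrightarrow> tr N (mm N A K) = (0 :: 'k::comm_ring_1)"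
  shows "K = 0"
proof (intro ext)
  fix j i
  show "K j i = 0 j i"
  proof (cases "j < a \<and> i < b")
    case True
    then show ?thesis
      using 0[OF supp_matrix_unit[of i b j a]] tr_matrix_unit[of i N j K] assms(2,3) by simp
  qed (use assms(1) in \<open>auto simp: supp_def\<close>)
qed

definition mk_rep :: "(nat \<Rightarrow> nat \<Rightarrow> 'k::zero) \<Rightarrow> (nat \<Rightarrow> nat \<Rightarrow> 'k) \<Rightarrow> (nat \<Rightarrow> nat \<Rightarrow> 'k) \<Rightarrow> nat \<times> nat \<times> nat \<Rightarrow> 'k" where
  "mk_rep x y z = (\<lambda>(t, i, j). if t = 0 then x i j else if t = 1 then y i j else if t = 2 then z i j else 0)"

lemma arrow_mk_rep [simp]:
  "arrow (mk_rep x y z) 0 = x" "arrow (mk_rep x y z) (Suc 0) = y" "arrow (mk_rep x y z) 2 = z"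
  by (simp_all add: arrow_def mk_rep_def)

lemma mk_rep_simps [simp]:
  "mk_rep x y z (0, i, j) = x i j" "mk_rep x y z (Suc 0, i, j) = y i j" "mk_rep x y z (2, i, j) = z i j"
  "\<not> t < 3 \<Longrightarrow> mk_rep x y z (t, i, j) = 0"
  by (simp_all add: mk_rep_def)

lemma all_mk_rep:
  "(\<forall>t i j. mk_rep x y z (t, i, j) \<noteq> 0 \<longrightarrow> P t i j) \<longleftrightarrow>
    (\<forall>i j. x i j \<noteq> 0 \<longrightarrow> P 0 i j) \<and> (\<forall>i j. y i j \<noteq> 0 \<longrightarrow> P 1 i j) \<and> (\<forall>i j. z i j \<noteq> 0 \<longrightarrow> P 2 i j)"
proof
  assume *: "\<forall>t i j. mk_rep x y z (t, i, j) \<noteq> 0 \<longrightarrow> P t i j"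
  show "(\<forall>i j. x i j \<noteq> 0 \<longrightarrow> P 0 i j) \<and> (\<forall>i j. y i j \<noteq> 0 \<longrightarrow> P 1 i j) \<and> (\<forall>i j. z i j \<noteq> 0 \<longrightarrow> P 2 i j)"
    using spec[OF *, of 0] spec[OF *, of 1] spec[OF *, of 2] by simp
next
  assume *: "(\<forall>i j. x i j \<noteq> 0 \<longrightarrow> P 0 i j) \<and> (\<forall>i j. y i j \<noteq> 0 \<longrightarrow> P 1 i j) \<and> (\<forall>i j. z i j \<noteq> 0 \<longrightarrow> P 2 i j)"
  have "P t i j" if nz: "mk_rep x y z (t, i, j) \<noteq> 0" for t i j
  proof -
    have "t < 3" using nz mk_rep_simps(4) by blast
    then consider "t = 0" | "t = 1" | "t = 2" by (auto simp: less_3_iff)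
    then show ?thesis using * nz by cases simp_all
  qed
  then show "\<forall>t i j. mk_rep x y z (t, i, j) \<noteq> 0 \<longrightarrow> P t i j" by blast
qed

abbreviation dims :: "nat \<Rightarrow> nat \<Rightarrow> nat \<Rightarrow> nat \<Rightarrow> nat" where
  "dims r0 r1 r2 \<equiv> (\<lambda>t. [r0, r1, r2] ! t)"

lemma total_dim_dims [simp]: "total_dim (dims r0 r1 r2) = r0 + r1 + r2"
  by (simp add: total_dim_def)

lemma mod_3_simps [simp]: "Suc 0 mod 3 = Suc 0" "Suc (Suc 0) mod 3 = 2" "Suc 2 mod 3 = 0"
  by simp_all

lemma mk_rep_mem:
  "mk_rep x y z \<in> rep_space (dims r0 r1 r2) \<longleftrightarrow> supp r1 r0 x \<and> supp r2 r1 y \<and> supp r0 r2 z"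
  "mk_rep x y z \<in> level_algebra (dims r0 r1 r2) \<longleftrightarrow> supp r0 r0 x \<and> supp r1 r1 y \<and> supp r2 r2 z"
  unfolding rep_space_def level_algebra_def mem_Collect_eq all_mk_rep supp_def by simp_all

lemma rep_cases:
  assumes "v \<in> rep_space (dims r0 r1 r2)"
  obtains x y z where "v = mk_rep x y z" "supp r1 r0 x" "supp r2 r1 y" "supp r0 r2 z"
proof (rule that[of "arrow v 0" "arrow v 1" "arrow v 2"])
  have z: "v (t, i, j) = 0" if "\<not> t < 3" for t i j using assms that by (auto simp: rep_space_def)
  show "v = mk_rep (arrow v 0) (arrow v 1) (arrow v 2)"
    by (rule ext) (auto simp: mk_rep_def arrow_def intro!: z)
  then have "mk_rep (arrow v 0) (arrow v 1) (arrow v 2) \<in> rep_space (dims r0 r1 r2)" using assms by simp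
  then show "supp r1 r0 (arrow v 0)" "supp r2 r1 (arrow v 1)" "supp r0 r2 (arrow v 2)"
    by (auto simp: mk_rep_mem)
qed

lemma level_cases:
  assumes "v \<in> level_algebra (dims r0 r1 r2)"
  obtains a b c where "v = mk_rep a b c" "supp r0 r0 a" "supp r1 r1 b" "supp r2 r2 c"
proof (rule that[of "arrow v 0" "arrow v 1" "arrow v 2"])
  have z: "v (t, i, j) = 0" if "\<not> t < 3" for t i j using assms that by (auto simp: level_algebra_def)
  show "v = mk_rep (arrow v 0) (arrow v 1) (arrow v 2)"
    by (rule ext) (auto simp: mk_rep_def arrow_def intro!: z)
  then have "mk_rep (arrow v 0) (arrow v 1) (arrow v 2) \<in> level_algebra (dims r0 r1 r2)" using assms by simp
  then show "supp r0 r0 (arrow v 0)" "supp r1 r1 (arrow v 1)" "supp r2 r2 (arrow v 2)"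
    by (auto simp: mk_rep_mem)
qed

lemma rep_action_mk_rep:
  "rep_action N (mk_rep a b c) (mk_rep x y z) =
    mk_rep (mm N b x - mm N x a) (mm N c y - mm N y b) (mm N a z - mm N z c)"
proof (rule ext)
  fix p :: "nat \<times> nat \<times> nat"
  obtain t i j where p: "p = (t, i, j)" by (cases p)
  show "rep_action N (mk_rep a b c) (mk_rep x y z) p =
      mk_rep (mm N b x - mm N x a) (mm N c y - mm N y b) (mm N a z - mm N z c) p"
    unfolding p by (cases "t < 3") (auto simp: rep_action_def less_3_iff)
qed

text \<open>The trace pairing. It identifies the dual of the representation space with triples of
  maps against the arrows, \<open>p\<close> from vertex 1 to 0, \<open>q\<close> from 2 to 1 and
  \<open>s\<close> from 0 to 2.\<close>

definition pairing :: "nat \<Rightarrow> (nat \<Rightarrow> nat \<Rightarrow> 'k::comm_ring_1) \<Rightarrow> (nat \<Rightarrow> nat \<Rightarrow> 'k) \<Rightarrow> (nat \<Rightarrow> nat \<Rightarrow> 'k)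
    \<Rightarrow> (nat \<times> nat \<times> nat \<Rightarrow> 'k) \<Rightarrow> 'k" where
  "pairing N p q s v = tr N (mm N p (arrow v 0)) + tr N (mm N q (arrow v 1)) + tr N (mm N s (arrow v 2))"

lemma pairing_mk_rep:
  "pairing N p q s (mk_rep x y z) = tr N (mm N p x) + tr N (mm N q y) + tr N (mm N s z)"
  by (simp add: pairing_def)

lemma pairing_action:
  "pairing N p q s (rep_action N (mk_rep a b c) (mk_rep x y z)) =
    tr N (mm N a (mm N z s - mm N p x)) + tr N (mm N b (mm N x p - mm N q y))
    + tr N (mm N c (mm N y q - mm N s z))"
proof -
  have cyc: "tr N (mm N A (mm N B C)) = tr N (mm N B (mm N C A))" for A B C :: "nat \<Rightarrow> nat \<Rightarrow> 'a"
    using tr_mm_commute[of N A "mm N B C"] by (simp add: mm_assoc)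
  show ?thesis
    unfolding rep_action_mk_rep pairing_mk_rep
    using cyc[of p b x] cyc[of p x a] cyc[of q c y] cyc[of q y b] cyc[of s a z] cyc[of s z c]
      cyc[of x a p] cyc[of y b q] cyc[of z c s]
    by (simp add: mm_distrib tr_ops)
qed

lemma pairing_linear: "Vector_Spaces.linear fscale (*) (pairing N p q s)"
  unfolding Vector_Spaces.linear_iff
proof (intro conjI allI)
  show "vector_space (fscale :: 'a \<Rightarrow> (nat \<times> nat \<times> nat \<Rightarrow> 'a) \<Rightarrow> nat \<times> nat \<times> nat \<Rightarrow> 'a)"
    by (rule fun_space.vector_space_axioms)
  show "vector_space ((*) :: 'a \<Rightarrow> 'a \<Rightarrow> 'a)" by (rule fun_space.functional.vs2.vector_space_axioms)
next
  fix v w :: "nat \<times> nat \<times> nat \<Rightarrow> 'a" and c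
  have "arrow (v + w) t = arrow v t + arrow w t" for t by (simp add: arrow_def fun_eq_iff)
  then show "pairing N p q s (v + w) = pairing N p q s v + pairing N p q s w"
    by (simp add: pairing_def mm_distrib tr_ops)
  have "tr N (mm N P (arrow (fscale c v) t)) = c * tr N (mm N P (arrow v t))" for P t
    unfolding tr_def arrow_linear mm_add(4) sum_distrib_left ..
  then show "pairing N p q s (fscale c v) = c * pairing N p q s v"
    by (simp add: pairing_def distrib_left)
qed

lemma functional_eq_pairing:
  fixes f :: "(nat \<times> nat \<times> nat \<Rightarrow> 'k::field) \<Rightarrow> 'k"
  assumes f: "Vector_Spaces.linear fscale (*) f"
  obtains p q s where "supp r0 r1 p" "supp r1 r2 q" "supp r2 r0 s"
    "\<And>v. v \<in> rep_space (dims r0 r1 r2) \<Longrightarrow> f v = pairing (r0 + r1 + r2) p q s v"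
proof -
  let ?N = "r0 + r1 + r2"
  let ?e = "\<lambda>p. f (\<lambda>j. if j = p then 1 else 0)"
  \<comment> \<open>The indices are transposed here: the trace pairs the entry \<open>(j, i)\<close>
    of the form with the entry \<open>(i, j)\<close> of the arrow.\<close>
  define P where "P a b t = (\<lambda>j i. if j < a \<and> i < b then ?e (t, i, j) else 0)" for a b and t :: nat
  have fm: "f (mk_rep x y z) = tr ?N (mm ?N (P r0 r1 0) x) + tr ?N (mm ?N (P r1 r2 1) y) + tr ?N (mm ?N (P r2 r0 2) z)"
    if s: "supp r1 r0 x" "supp r2 r1 y" "supp r0 r2 z" for x y z
  proof -
    let ?I = "{0,1,2::nat} \<times> {..<?N} \<times> {..<?N}"
    have "mk_rep x y z = (\<Sum>i\<in>?I. fscale (mk_rep x y z i) (\<lambda>j. if j = i then 1 else 0))"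
    proof (rule unit_expansion)
      fix i :: "nat \<times> nat \<times> nat" assume "i \<notin> ?I"
      then show "mk_rep x y z i = 0"
        using s by (cases i) (auto simp: mk_rep_def suppD)
    qed simp
    then have "f (mk_rep x y z) = f (\<Sum>i\<in>?I. fscale (mk_rep x y z i) (\<lambda>j. if j = i then 1 else 0))"
      by (rule arg_cong)
    also have "\<dots> = (\<Sum>i\<in>?I. mk_rep x y z i * ?e i)"
      by (simp only: fun_space.functional.linear_sum[OF f] fun_space.functional.linear_scale[OF f])
    also have "\<dots> = (\<Sum>t\<in>{0,1,2}. \<Sum>i<?N. \<Sum>j<?N. mk_rep x y z (t, i, j) * ?e (t, i, j))"
      unfolding sum.cartesian_product by (rule sum.cong) auto
    also have "\<dots> = tr ?N (mm ?N x (P r0 r1 0)) + tr ?N (mm ?N y (P r1 r2 1)) + tr ?N (mm ?N z (P r2 r0 2))"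
    proof -
      have "(\<Sum>i<?N. \<Sum>j<?N. A i j * ?e (t, i, j)) = tr ?N (mm ?N A (P b a t))" if "supp a b A" for A a b t
        unfolding tr_def mm_def P_def by (intro sum.cong refl) (use that in \<open>auto simp: supp_def\<close>)
      from this[OF s(1), of 0] this[OF s(2), of 1] this[OF s(3), of 2] show ?thesis
        by (simp add: mk_rep_def add.assoc)
    qed
    finally show ?thesis by (simp add: tr_mm_commute[of _ x] tr_mm_commute[of _ y] tr_mm_commute[of _ z])
  qed
  show ?thesis
  proof (rule that)
    show "supp r0 r1 (P r0 r1 0)" "supp r1 r2 (P r1 r2 1)" "supp r2 r0 (P r2 r0 2)"
      by (auto simp: supp_def P_def split: if_splits)
    show "f v = pairing ?N (P r0 r1 0) (P r1 r2 1) (P r2 r0 2) v" if "v \<in> rep_space (dims r0 r1 r2)" for v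
      using that by (auto elim!: rep_cases simp: fm pairing_mk_rep)
  qed
qed

definition commuting :: "nat \<Rightarrow> (nat \<Rightarrow> nat \<Rightarrow> 'k::comm_ring_1) \<Rightarrow> (nat \<Rightarrow> nat \<Rightarrow> 'k) \<Rightarrow> (nat \<Rightarrow> nat \<Rightarrow> 'k)
    \<Rightarrow> (nat \<Rightarrow> nat \<Rightarrow> 'k) \<Rightarrow> (nat \<Rightarrow> nat \<Rightarrow> 'k) \<Rightarrow> (nat \<Rightarrow> nat \<Rightarrow> 'k) \<Rightarrow> bool" where
  "commuting N x y z p q s \<longleftrightarrow> mm N p x = mm N z s \<and> mm N x p = mm N q y \<and> mm N y q = mm N s z"

text \<open>The infinitesimal condition: \<open>(p + \<epsilon> p', q + \<epsilon> q', s + \<epsilon> s')\<close> commutes with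
  \<open>(x + \<epsilon> x', y + \<epsilon> y', z + \<epsilon> z')\<close> modulo \<open>\<epsilon>\<^sup>2\<close>.\<close>

definition commuting_tangent where
  "commuting_tangent N x y z x' y' z' p q s p' q' s' \<longleftrightarrow> commuting N x y z p q s \<and>
    mm N p x' + mm N p' x = mm N z' s + mm N z s' \<and>
    mm N x' p + mm N x p' = mm N q y' + mm N q' y \<and>
    mm N y' q + mm N y q' = mm N s z' + mm N s' z"

text \<open>The primed arrows form the direction \<open>u\<close>, and \<open>M\<close> is a set of
  at most \<open>m\<close> vectors meant to complete \<open>q v + q_v u\<close> to the whole space.
  The condition says that no non-zero form kills both, and it avoids any mention of
  stabilisers.\<close>

definition good_point where
  "good_point m r0 r1 r2 x y z \<longleftrightarrow> (\<exists>x' y' z' M.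
     supp r1 r0 x' \<and> supp r2 r1 y' \<and> supp r0 r2 z' \<and>
     finite M \<and> card M \<le> m \<and> M \<subseteq> rep_space (dims r0 r1 r2) \<and>
     (\<forall>p q s p' q' s'. supp r0 r1 p \<longrightarrow> supp r1 r2 q \<longrightarrow> supp r2 r0 s \<longrightarrow>
        supp r0 r1 p' \<longrightarrow> supp r1 r2 q' \<longrightarrow> supp r2 r0 s' \<longrightarrow>
        commuting_tangent (r0 + r1 + r2) x y z x' y' z' p q s p' q' s' \<longrightarrow>
        (\<forall>v\<in>M. pairing (r0 + r1 + r2) p q s v = 0) \<longrightarrow> p = 0 \<and> q = 0 \<and> s = 0))"

text \<open>Otherwise some form separates a vector from \<open>q v + q_v u\<close> and
  \<open>M\<close>. Killing \<open>q v\<close> makes it commute with \<open>v\<close>, and killing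
  \<open>q_v u\<close> provides the first-order part, so it satisfies
  \<open>commuting_tangent\<close> and must be zero.\<close>

theorem good_point_dim:
  fixes x y z :: "nat \<Rightarrow> nat \<Rightarrow> 'k::field"
  assumes good: "good_point m r0 r1 r2 x y z" and s: "supp r1 r0 x" "supp r2 r1 y" "supp r0 r2 z"
  defines "r \<equiv> dims r0 r1 r2"
  obtains u where "u \<in> rep_space r"
    "fun_space.dim (rep_space r :: (nat \<times> nat \<times> nat \<Rightarrow> 'k) set) \<le> fun_space.dim (double_orbit r (mk_rep x y z) u) + m"
proof -
  let ?N = "r0 + r1 + r2" and ?v = "mk_rep x y z"
  obtain x' y' z' M where s': "supp r1 r0 x'" "supp r2 r1 y'" "supp r0 r2 z'"
    and M: "finite M" "card M \<le> m" "M \<subseteq> rep_space r"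
    and crit: "\<And>p q s p' q' s'. supp r0 r1 p \<Longrightarrow> supp r1 r2 q \<Longrightarrow> supp r2 r0 s \<Longrightarrow>
        supp r0 r1 p' \<Longrightarrow> supp r1 r2 q' \<Longrightarrow> supp r2 r0 s' \<Longrightarrow>
        commuting_tangent ?N x y z x' y' z' p q s p' q' s' \<Longrightarrow>
        (\<forall>v\<in>M. pairing ?N p q s v = 0) \<Longrightarrow> p = 0 \<and> q = 0 \<and> s = 0"
    using good unfolding good_point_def r_def by blast
  let ?u = "mk_rep x' y' z'"
  have v: "?v \<in> rep_space r" and u: "?u \<in> rep_space r" using s s' by (simp_all add: r_def mk_rep_mem)
  have N: "total_dim r = ?N" by (simp add: r_def)
  have "rep_space r \<subseteq> fun_space.span (double_orbit r ?v ?u \<union> M)"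
  proof (rule ccontr)
    assume "\<not> ?thesis"
    then obtain w where w: "w \<in> rep_space r" "w \<notin> fun_space.span (double_orbit r ?v ?u \<union> M)" by auto
    obtain f where f: "Vector_Spaces.linear fscale (*) f"
      "\<And>y. y \<in> fun_space.span (double_orbit r ?v ?u \<union> M) \<Longrightarrow> f y = 0" "f w = 1"
      using fun_space.separating_functional[OF fun_space.subspace_span w(2)] by blast
    obtain p q s where pqs: "supp r0 r1 p" "supp r1 r2 q" "supp r2 r0 s"
      "\<And>v. v \<in> rep_space r \<Longrightarrow> f v = pairing ?N p q s v"
      using functional_eq_pairing[OF f(1)] unfolding r_def by blast
    have D0: "f y = 0" if "y \<in> double_orbit r ?v ?u" for y
      using that f(2) fun_space.span_base by blast
    have in1: "rep_action ?N \<xi> ?v \<in> double_orbit r ?v ?u" if "\<xi> \<in> level_algebra r" for \<xi>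
      using that fun_space.subspace_0[OF subspace_stabiliser[of r ?v]]
      unfolding double_orbit_def orbit_def N by (force intro: exI[of _ 0] image_eqI[of _ _ 0])
    have in2: "rep_action ?N \<xi> ?u \<in> double_orbit r ?v ?u" if "\<xi> \<in> stabiliser r ?v" for \<xi>
      using that fun_space.subspace_0[OF subspace_level_algebra[of r]]
      unfolding double_orbit_def orbit_def N by (force intro: exI[of _ 0] image_eqI[of _ _ 0])
    have E0: "pairing ?N p q s (rep_action ?N \<xi> ?v) = 0" if "\<xi> \<in> level_algebra r" for \<xi>
      using D0[OF in1[OF that]] pqs(4)[OF rep_action_closed[OF that v]] by simp
    \<comment> \<open>The map from \<xi> to the value of \<open>f\<close> at \<open>\<xi> u\<close>
      vanishes on the stabiliser, which is the kernel of the map from \<xi> to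
      \<open>\<xi> v\<close>.\<close>
    obtain f' where f': "Vector_Spaces.linear fscale (*) f'"
      "\<And>\<xi>. \<xi> \<in> level_algebra r \<Longrightarrow> f (rep_action ?N \<xi> ?u) = f' (rep_action ?N \<xi> ?v)"
    proof (rule fun_space.factor_functional[OF subspace_level_algebra[of r], of "\<lambda>\<xi>. rep_action ?N \<xi> ?v" "\<lambda>\<xi>. f (rep_action ?N \<xi> ?u)"])
      show "f (rep_action ?N \<xi> ?u) = 0" if "\<xi> \<in> level_algebra r" "rep_action ?N \<xi> ?v = 0" for \<xi>
        using D0[OF in2] that by (simp add: stabiliser_def N)
    qed (simp_all add: rep_action_linear fun_space.functional.linear_add[OF f(1)]
        fun_space.functional.linear_scale[OF f(1)])
    obtain p' q' s' where pqs': "supp r0 r1 p'" "supp r1 r2 q'" "supp r2 r0 s'"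
      "\<And>v. v \<in> rep_space r \<Longrightarrow> f' v = pairing ?N p' q' s' v"
      using functional_eq_pairing[OF f'(1)] unfolding r_def by blast
    have D1: "pairing ?N p q s (rep_action ?N \<xi> ?u) = pairing ?N p' q' s' (rep_action ?N \<xi> ?v)"
      if "\<xi> \<in> level_algebra r" for \<xi>
      using f'(2)[OF that] pqs(4)[OF rep_action_closed[OF that u]] pqs'(4)[OF rep_action_closed[OF that v]] by simp
    have lev: "mk_rep a 0 0 \<in> level_algebra r" "mk_rep 0 b 0 \<in> level_algebra r" "mk_rep 0 0 c \<in> level_algebra r"
      if "supp r0 r0 a \<or> supp r1 r1 b \<or> supp r2 r2 c" "supp r0 r0 a" "supp r1 r1 b" "supp r2 r2 c"
      for a b c :: "nat \<Rightarrow> nat \<Rightarrow> 'k"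
      using that by (simp_all add: r_def mk_rep_mem supp_ops)
    note sm = supp_mm[where N="?N"] supp_ops
    have "mm ?N z s - mm ?N p x = 0"
      by (rule tr_mm_nondegenerate[of r0 r0 _ ?N])
        (use E0[of "mk_rep _ 0 0"] in \<open>auto intro!: sm intro: pqs(1-3) \<open>supp r1 r0 x\<close> \<open>supp r0 r2 z\<close>
          simp: pairing_action mm_distrib tr_ops r_def mk_rep_mem supp_ops\<close>)
    moreover have "mm ?N x p - mm ?N q y = 0"
      by (rule tr_mm_nondegenerate[of r1 r1 _ ?N])
        (use E0[of "mk_rep 0 _ 0"] in \<open>auto intro!: sm intro: pqs(1-3) \<open>supp r1 r0 x\<close> \<open>supp r2 r1 y\<close>
          simp: pairing_action mm_distrib tr_ops r_def mk_rep_mem supp_ops\<close>)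
    moreover have "mm ?N y q - mm ?N s z = 0"
      by (rule tr_mm_nondegenerate[of r2 r2 _ ?N])
        (use E0[of "mk_rep 0 0 _"] in \<open>auto intro!: sm intro: pqs(1-3) \<open>supp r2 r1 y\<close> \<open>supp r0 r2 z\<close>
          simp: pairing_action mm_distrib tr_ops r_def mk_rep_mem supp_ops\<close>)
    ultimately have "commuting ?N x y z p q s" by (simp add: commuting_def)
    moreover have "(mm ?N z' s - mm ?N p x') - (mm ?N z s' - mm ?N p' x) = 0"
      by (rule tr_mm_nondegenerate[of r0 r0 _ ?N])
        (use D1[of "mk_rep _ 0 0"] in \<open>auto intro!: sm intro: pqs(1-3) pqs'(1-3) s' \<open>supp r1 r0 x\<close> \<open>supp r0 r2 z\<close>
          simp: pairing_action mm_distrib tr_ops r_def mk_rep_mem supp_ops\<close>)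
    moreover have "(mm ?N x' p - mm ?N q y') - (mm ?N x p' - mm ?N q' y) = 0"
      by (rule tr_mm_nondegenerate[of r1 r1 _ ?N])
        (use D1[of "mk_rep 0 _ 0"] in \<open>auto intro!: sm intro: pqs(1-3) pqs'(1-3) s' \<open>supp r1 r0 x\<close> \<open>supp r2 r1 y\<close>
          simp: pairing_action mm_distrib tr_ops r_def mk_rep_mem supp_ops\<close>)
    moreover have "(mm ?N y' q - mm ?N s z') - (mm ?N y q' - mm ?N s' z) = 0"
      by (rule tr_mm_nondegenerate[of r2 r2 _ ?N])
        (use D1[of "mk_rep 0 0 _"] in \<open>auto intro!: sm intro: pqs(1-3) pqs'(1-3) s' \<open>supp r2 r1 y\<close> \<open>supp r0 r2 z\<close>
          simp: pairing_action mm_distrib tr_ops r_def mk_rep_mem supp_ops\<close>)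
    \<comment> \<open>The factor satisfies \<open>w (\<xi> u) = w' (\<xi> v)\<close>, while
      \<open>commuting_tangent\<close> has both contributions with a plus sign, hence the
      negation.\<close>
    ultimately have "commuting_tangent ?N x y z x' y' z' p q s (- p') (- q') (- s')"
      unfolding commuting_tangent_def by (simp add: mm_distrib algebra_simps)
    moreover have "\<forall>v\<in>M. pairing ?N p q s v = 0"
    proof
      fix v assume v: "v \<in> M"
      then have "f v = 0" by (intro f(2) fun_space.span_base) auto
      then show "pairing ?N p q s v = 0" using pqs(4) M(3) v by auto
    qed
    ultimately have "p = 0 \<and> q = 0 \<and> s = 0"
      using pqs(1-3) pqs'(1-3) by (intro crit) (auto intro: supp_ops)
    then have "f w = 0" using pqs(4)[OF w(1)] by (simp add: pairing_def mm_distrib tr_ops)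
    with f(3) show False by simp
  qed
  then have "fun_space.dim (rep_space r :: (nat \<times> nat \<times> nat \<Rightarrow> 'k) set) \<le> fun_space.dim (double_orbit r ?v ?u) + card M"
    using fun_space.dim_le_add_card[OF fun_space.finite_dim_subset[OF finite_dim_rep_space double_orbit_subset[OF v u]] M(1)] by blast
  then show ?thesis using M(2) by (intro that[OF u]) simp
qed

section \<open>Base change, transposition and rotation\<close>

definition idm :: "nat \<Rightarrow> nat \<Rightarrow> nat \<Rightarrow> 'k::zero_neq_one" where
  "idm n = (\<lambda>i j. if i = j \<and> i < n then 1 else 0)"

lemma supp_idm: "supp n n (idm n)"
  by (auto simp: supp_def idm_def)

lemma mm_idm:
  assumes "supp a b A"
  shows "a \<le> N \<Longrightarrow> mm N (idm a) A = A" "b \<le> N \<Longrightarrow> mm N A (idm b) = A"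
proof -
  show "mm N (idm a) A = A" if "a \<le> N"
  proof (intro ext)
    fix i j
    have "mm N (idm a) A i j = (\<Sum>l<N. if l = i then if i < a then A i j else 0 else 0)"
      unfolding mm_def idm_def by (intro sum.cong) auto
    then show "mm N (idm a) A i j = A i j" using that assms by (auto simp: supp_def)
  qed
  show "mm N A (idm b) = A" if "b \<le> N"
  proof (intro ext)
    fix i j
    have "mm N A (idm b) i j = (\<Sum>l<N. if l = j then if j < b then A i j else 0 else 0)"
      unfolding mm_def idm_def by (intro sum.cong) auto
    then show "mm N A (idm b) i j = A i j" using that assms by (auto simp: supp_def)
  qed
qed

text \<open>The condition in \<open>good_point\<close> with the product bound \<open>N\<close>
  decoupled from the dimensions, so that a representation on a smaller frame can be tested with the
  bound of the large one.\<close>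

definition rigid where
  "rigid N r0 r1 r2 x y z x' y' z' M \<longleftrightarrow>
    (\<forall>p q s p' q' s'. supp r0 r1 p \<longrightarrow> supp r1 r2 q \<longrightarrow> supp r2 r0 s \<longrightarrow>
        supp r0 r1 p' \<longrightarrow> supp r1 r2 q' \<longrightarrow> supp r2 r0 s' \<longrightarrow>
        commuting_tangent N x y z x' y' z' p q s p' q' s' \<longrightarrow>
        (\<forall>v\<in>M. pairing N p q s v = 0) \<longrightarrow> p = 0 \<and> q = 0 \<and> s = 0)"

lemma good_point_iff_rigid:
  "good_point m r0 r1 r2 x y z \<longleftrightarrow> (\<exists>x' y' z' M.
     supp r1 r0 x' \<and> supp r2 r1 y' \<and> supp r0 r2 z' \<and>
     finite M \<and> card M \<le> m \<and> M \<subseteq> rep_space (dims r0 r1 r2) \<and> rigid (r0 + r1 + r2) r0 r1 r2 x y z x' y' z' M)"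
  unfolding good_point_def rigid_def ..

text \<open>\<open>E\<close>, \<open>F\<close>, \<open>H\<close> are frames at the three vertices
  and the primed matrices their inverses, for \<open>H\<close> possibly only a left inverse: the
  frame at vertex 2 may span a proper subspace.\<close>

definition base_change where
  "base_change N E E' F F' H H' v =
    mk_rep (mm N F (mm N (arrow v 0) E')) (mm N H (mm N (arrow v 1) F')) (mm N E (mm N (arrow v 2) H'))"

lemma pairing_base_change:
  "pairing N p q s (base_change N E E' F F' H H' v) =
    pairing N (mm N E' (mm N p F)) (mm N F' (mm N q H)) (mm N H' (mm N s E)) v"
proof -
  have "tr N (mm N p (mm N F (mm N A E'))) = tr N (mm N (mm N E' (mm N p F)) A)" for p F A E' :: "nat \<Rightarrow> nat \<Rightarrow> 'a"
    using tr_mm_commute[of N "mm N p (mm N F A)" E'] by (simp add: mm_assoc)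
  then show ?thesis by (simp add: pairing_def base_change_def)
qed

text \<open>The condition on \<open>Y\<close>, \<open>Y'\<close>, \<open>A\<close>, \<open>A'\<close> says that \<open>Y + \<epsilon> Y'\<close> is injective and \<open>A + \<epsilon> A'\<close> is
  surjective to first order; it controls the part of the functional that lives off the image of \<open>H\<close>.\<close>

lemma rigid_base_change:
  fixes E E' F F' H H' X Y A X' Y' A' :: "nat \<Rightarrow> nat \<Rightarrow> 'k::field"
  assumes le: "r0 \<le> N" "r1 \<le> N" "a \<le> N" "b \<le> N"
    and sE: "supp r0 r0 E" "supp r0 r0 E'" and sF: "supp r1 r1 F" "supp r1 r1 F'" and sH: "supp a b H" "supp b a H'"
    and E: "mm N E E' = idm r0" "mm N E' E = idm r0" and F: "mm N F F' = idm r1" "mm N F' F = idm r1"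
    and H: "mm N H' H = idm b"
    and s: "supp r1 r0 X" "supp b r1 Y" "supp r0 b A" and s': "supp r1 r0 X'" "supp b r1 Y'" "supp r0 b A'"
    and full: "mm N H H' = idm a \<or>
       (\<forall>\<phi> \<phi>'. supp r1 a \<phi> \<longrightarrow> supp r1 a \<phi>' \<longrightarrow> mm N Y \<phi> = 0 \<longrightarrow> mm N Y' \<phi> + mm N Y \<phi>' = 0 \<longrightarrow> \<phi> = 0) \<and>
       (\<forall>\<psi> \<psi>'. supp a r0 \<psi> \<longrightarrow> supp a r0 \<psi>' \<longrightarrow> mm N \<psi> A = 0 \<longrightarrow> mm N \<psi> A' + mm N \<psi>' A = 0 \<longrightarrow> \<psi> = 0)"
    and M: "M \<subseteq> rep_space (dims r0 r1 b)"
    and rig: "rigid N r0 r1 b X Y A X' Y' A' M"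
  shows "rigid N r0 r1 a (mm N F (mm N X E')) (mm N H (mm N Y F')) (mm N E (mm N A H'))
    (mm N F (mm N X' E')) (mm N H (mm N Y' F')) (mm N E (mm N A' H')) (base_change N E E' F F' H H' ` M)"
  unfolding rigid_def
proof (intro allI impI)
  fix p q s p' q' s'
  define x y z x' y' z' where xyz: "x = mm N F (mm N X E')" "y = mm N H (mm N Y F')" "z = mm N E (mm N A H')"
    "x' = mm N F (mm N X' E')" "y' = mm N H (mm N Y' F')" "z' = mm N E (mm N A' H')"
  assume sp: "supp r0 r1 p" "supp r1 a q" "supp a r0 s" and sp': "supp r0 r1 p'" "supp r1 a q'" "supp a r0 s'"
    and ct: "commuting_tangent N (mm N F (mm N X E')) (mm N H (mm N Y F')) (mm N E (mm N A H'))
      (mm N F (mm N X' E')) (mm N H (mm N Y' F')) (mm N E (mm N A' H')) p q s p' q' s'"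
    and M0: "\<forall>v\<in>base_change N E E' F F' H H' ` M. pairing N p q s v = 0"
  note sm = supp_mm[where N=N] supp_ops
  note ct = ct[folded xyz, unfolded commuting_tangent_def commuting_def]
  have c: "mm N p x = mm N z s" "mm N x p = mm N q y" "mm N y q = mm N s z"
    and c': "mm N p x' + mm N p' x = mm N z' s + mm N z s'" "mm N x' p + mm N x p' = mm N q y' + mm N q' y"
      "mm N y' q + mm N y q' = mm N s z' + mm N s' z" using ct by auto
  have idl: "mm N (idm r0) (mm N U V) = mm N U V" if "supp r0 c U" for U V :: "nat \<Rightarrow> nat \<Rightarrow> 'k" and c
    using mm_idm(1)[OF that le(1)] by (metis mm_assoc)
  have canc: "mm N E' (mm N E W) = mm N (idm r0) W" "mm N F' (mm N F W) = mm N (idm r1) W" "mm N H' (mm N H W) = mm N (idm b) W"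
    "mm N E (mm N E' W) = mm N (idm r0) W" "mm N F (mm N F' W) = mm N (idm r1) W"
    for W by (simp_all add: mm_assoc[symmetric] E F H)
  have xE: "mm N x E = mm N F X" "mm N x' E = mm N F X'" "mm N y F = mm N H Y" "mm N y' F = mm N H Y'"
    "mm N z H = mm N E A" "mm N z' H = mm N E A'"
    by (simp_all add: xyz mm_assoc E F H mm_idm(2)[OF s(1) le(1)] mm_idm(2)[OF s'(1) le(1)] mm_idm(2)[OF s(2) le(2)]
        mm_idm(2)[OF s'(2) le(2)] mm_idm(2)[OF s(3) le(4)] mm_idm(2)[OF s'(3) le(4)])
  have Ex: "mm N F' x = mm N X E'" "mm N F' x' = mm N X' E'" "mm N H' y = mm N Y F'" "mm N H' y' = mm N Y' F'"
    "mm N E' z = mm N A H'" "mm N E' z' = mm N A' H'"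
    by (simp_all add: xyz canc mm_idm(1)[OF sm(1)[OF s(1) sE(2)] le(2)] mm_idm(1)[OF sm(1)[OF s'(1) sE(2)] le(2)]
        mm_idm(1)[OF sm(1)[OF s(2) sF(2)] le(4)] mm_idm(1)[OF sm(1)[OF s'(2) sF(2)] le(4)]
        mm_idm(1)[OF sm(1)[OF s(3) sH(2)] le(1)] mm_idm(1)[OF sm(1)[OF s'(3) sH(2)] le(1)])
  have Ex': "mm N X (mm N E' W) = mm N F' (mm N x W)" "mm N X' (mm N E' W) = mm N F' (mm N x' W)"
    "mm N Y (mm N F' W) = mm N H' (mm N y W)" "mm N Y' (mm N F' W) = mm N H' (mm N y' W)"
    "mm N A (mm N H' W) = mm N E' (mm N z W)" "mm N A' (mm N H' W) = mm N E' (mm N z' W)" for W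
    by (simp_all add: mm_assoc[symmetric] Ex)
  \<comment> \<open>The functional in the coordinates of the frames. Rigidity of the small
    representation will kill it, which settles \<open>p\<close> at once but for \<open>q\<close> and
    \<open>s\<close> only the part seen by \<open>H\<close> and \<open>H'\<close>.\<close>
  let ?p = "mm N E' (mm N p F)" and ?q = "mm N F' (mm N q H)" and ?s = "mm N H' (mm N s E)"
  let ?p' = "mm N E' (mm N p' F)" and ?q' = "mm N F' (mm N q' H)" and ?s' = "mm N H' (mm N s' E)"
  have cW: "mm N p (mm N x W) = mm N z (mm N s W)" "mm N x (mm N p W) = mm N q (mm N y W)" "mm N y (mm N q W) = mm N s (mm N z W)" for W
    by (simp_all add: mm_assoc[symmetric] c)
  have cm: "commuting N X Y A ?p ?q ?s"
    unfolding commuting_def by (simp add: mm_assoc Ex' xE[symmetric] cW)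
  have "mm N ?p X' + mm N ?p' X = mm N E' (mm N (mm N p x' + mm N p' x) E)"
    by (simp add: mm_assoc xE mm_distrib)
  also have "\<dots> = mm N A' ?s + mm N A ?s'" unfolding c' by (simp add: mm_assoc Ex' mm_distrib)
  finally have 1: "mm N ?p X' + mm N ?p' X = mm N A' ?s + mm N A ?s'" .
  have "mm N X' ?p + mm N X ?p' = mm N F' (mm N (mm N x' p + mm N x p') F)"
    by (simp add: mm_assoc Ex' mm_distrib)
  also have "\<dots> = mm N ?q Y' + mm N ?q' Y" unfolding c' by (simp add: mm_assoc xE mm_distrib)
  finally have 2: "mm N X' ?p + mm N X ?p' = mm N ?q Y' + mm N ?q' Y" .
  have "mm N Y' ?q + mm N Y ?q' = mm N H' (mm N (mm N y' q + mm N y q') H)"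
    by (simp add: mm_assoc Ex' mm_distrib)
  also have "\<dots> = mm N ?s A' + mm N ?s' A" unfolding c' by (simp add: mm_assoc xE mm_distrib)
  finally have 3: "mm N Y' ?q + mm N Y ?q' = mm N ?s A' + mm N ?s' A" .
  from cm 1 2 3
  have "commuting_tangent N X Y A X' Y' A' ?p ?q ?s ?p' ?q' ?s'" by (simp add: commuting_tangent_def)
  moreover have "\<forall>v\<in>M. pairing N ?p ?q ?s v = 0" using M0 by (simp add: pairing_base_change)
  ultimately have hat0: "?p = 0" "?q = 0" "?s = 0"
    using rig[unfolded rigid_def, rule_format, of ?p ?q ?s ?p' ?q' ?s']
    by (auto intro!: sm(1) sE sF sH sp sp')
  have "p = mm N E (mm N ?p F')"
    by (simp add: mm_assoc canc F mm_idm(2)[OF sp(1) le(2)] mm_idm(1)[OF sp(1) le(1)])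
  then have p0: "p = 0" by (simp add: hat0 mm_distrib)
  have "mm N q H = mm N F ?q" by (simp add: canc mm_idm(1)[OF sm(1)[OF sp(2) sH(1)] le(2)])
  then have qH: "mm N q H = 0" by (simp only: hat0 mm_distrib)
  have "mm N H' s = mm N ?s E'" by (simp add: mm_assoc E mm_idm(2)[OF sp(3) le(1)])
  then have Hs: "mm N H' s = 0" by (simp only: hat0 mm_distrib)
  have "q = 0 \<and> s = 0"
    using full
  proof (elim disjE conjE)
    assume HH: "mm N H H' = idm a"
    have "q = mm N (mm N q H) H'" by (simp add: mm_assoc HH mm_idm(2)[OF sp(2) le(3)])
    moreover have "s = mm N H (mm N H' s)" by (simp add: mm_assoc[symmetric] HH mm_idm(1)[OF sp(3) le(3)])
    ultimately show ?thesis by (simp only: qH Hs mm_distrib)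
  next
    assume inj: "\<forall>\<phi> \<phi>'. supp r1 a \<phi> \<longrightarrow> supp r1 a \<phi>' \<longrightarrow> mm N Y \<phi> = 0 \<longrightarrow> mm N Y' \<phi> + mm N Y \<phi>' = 0 \<longrightarrow> \<phi> = 0"
      and sur: "\<forall>\<psi> \<psi>'. supp a r0 \<psi> \<longrightarrow> supp a r0 \<psi>' \<longrightarrow> mm N \<psi> A = 0 \<longrightarrow> mm N \<psi> A' + mm N \<psi>' A = 0 \<longrightarrow> \<psi> = 0"
    \<comment> \<open>The projection onto a complement of the image of \<open>H\<close>. From
      \<open>q H = 0\<close> and \<open>H' s = 0\<close> follow \<open>q C = q\<close> and
      \<open>C s = s\<close>: what is left of the functional lives on this complement.\<close>
    define C where "C = idm a - mm N H H'"
    have sC: "supp a a C" unfolding C_def by (intro supp_ops supp_idm sm(1)[OF sH])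
    have HC: "mm N H' C = 0" "mm N C H = 0"
      by (simp_all add: C_def mm_distrib mm_assoc canc H mm_idm[OF sH(1)] mm_idm[OF sH(2)] le)
    have qC: "mm N q C = q" by (simp add: C_def mm_distrib mm_assoc[symmetric] qH mm_idm(2)[OF sp(2) le(3)])
    have Cs: "mm N C s = s" by (simp add: C_def mm_distrib mm_assoc Hs mm_idm(1)[OF sp(3) le(3)])
    \<comment> \<open>Up to the frame \<open>F\<close>, \<phi> is \<open>q\<close>. Multiplying the
      third pair of equations by \<open>H'\<close> on the left and \<open>C\<close> on the right
      removes \<open>s\<close>, and first-order injectivity gives \<open>q = 0\<close>; surjectivity
      then does the same for \<open>s\<close>.\<close>
    define \<phi> \<phi>' where "\<phi> = mm N F' q" and "\<phi>' = mm N F' (mm N q' C)"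
    have "mm N Y \<phi> = mm N H' (mm N s z)" by (simp add: \<phi>_def Ex' c)
    then have Y0: "mm N Y \<phi> = 0" by (simp add: mm_assoc[symmetric] Hs mm_distrib)
    have "mm N Y' \<phi> + mm N Y \<phi>' = mm N H' (mm N (mm N y' q + mm N y q') C)"
      by (simp add: \<phi>_def \<phi>'_def Ex' mm_distrib mm_assoc qC)
    also have "\<dots> = mm N (mm N H' s) (mm N z' C) + mm N H' (mm N s' (mm N z C))"
      unfolding c' by (simp add: mm_distrib mm_assoc)
    also have "\<dots> = 0" by (simp only: Hs mm_distrib) (simp add: xyz mm_assoc HC mm_distrib)
    finally have "mm N Y' \<phi> + mm N Y \<phi>' = 0" .
    then have "\<phi> = 0" using inj Y0 sm(1)[OF sF(2) sp(2)] sm(1)[OF sF(2) sm(1)[OF sp'(2) sC]]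
      unfolding \<phi>_def \<phi>'_def by blast
    moreover have "q = mm N F \<phi>" by (simp add: \<phi>_def canc mm_idm(1)[OF sp(2) le(2)])
    ultimately have q0: "q = 0" by (simp add: mm_distrib)
    have "mm N (mm N s E) A = mm N (mm N s z) H" by (simp add: mm_assoc xE)
    also have "\<dots> = 0" by (simp add: c(3)[symmetric] q0 mm_distrib)
    finally have A0: "mm N (mm N s E) A = 0" .
    have Cy: "mm N C (mm N y W) = 0" for W by (simp add: xyz mm_assoc[symmetric] HC mm_distrib)
    have "mm N (mm N s E) A' + mm N (mm N C (mm N s' E)) A = mm N (mm N (mm N C s) E) A' + mm N (mm N C (mm N s' E)) A"
      by (simp only: Cs)
    also have "\<dots> = mm N C (mm N (mm N s z' + mm N s' z) H)"
      by (simp add: mm_assoc xE mm_distrib)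
    also have "\<dots> = 0" unfolding c'(3)[symmetric] by (simp add: q0 mm_distrib mm_assoc Cy)
    finally have "mm N s E = 0"
      using sur A0 sm(1)[OF sp(3) sE(1)] sm(1)[OF sC sm(1)[OF sp'(3) sE(1)]] by blast
    moreover have "s = mm N (mm N s E) E'" by (simp add: mm_assoc E mm_idm(2)[OF sp(3) le(1)])
    ultimately show ?thesis using q0 by (simp add: mm_distrib)
  qed
  then show "p = 0 \<and> q = 0 \<and> s = 0" using p0 by simp
qed

lemma good_point_base_change:
  fixes E E' F F' H H' X Y A X' Y' A' :: "nat \<Rightarrow> nat \<Rightarrow> 'k::field"
  assumes "supp r0 r0 E" "supp r0 r0 E'" "supp r1 r1 F" "supp r1 r1 F'" "supp a b H" "supp b a H'"
    and "mm N E E' = idm r0" "mm N E' E = idm r0" and "mm N F F' = idm r1" "mm N F' F = idm r1"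
    and "mm N H' H = idm b"
    and "supp r1 r0 X" "supp b r1 Y" "supp r0 b A" and "supp r1 r0 X'" "supp b r1 Y'" "supp r0 b A'"
    and "mm N H H' = idm a \<or>
       (\<forall>\<phi> \<phi>'. supp r1 a \<phi> \<longrightarrow> supp r1 a \<phi>' \<longrightarrow> mm N Y \<phi> = 0 \<longrightarrow> mm N Y' \<phi> + mm N Y \<phi>' = 0 \<longrightarrow> \<phi> = 0) \<and>
       (\<forall>\<psi> \<psi>'. supp a r0 \<psi> \<longrightarrow> supp a r0 \<psi>' \<longrightarrow> mm N \<psi> A = 0 \<longrightarrow> mm N \<psi> A' + mm N \<psi>' A = 0 \<longrightarrow> \<psi> = 0)"
    and M: "M \<subseteq> rep_space (dims r0 r1 b)" "finite M" "card M \<le> m"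
    and "rigid N r0 r1 b X Y A X' Y' A' M" and N: "N = r0 + r1 + a" "b \<le> N"
  shows "good_point m r0 r1 a (mm N F (mm N X E')) (mm N H (mm N Y F')) (mm N E (mm N A H'))"
  unfolding good_point_iff_rigid
proof (intro exI conjI)
  show "rigid (r0 + r1 + a) r0 r1 a (mm N F (mm N X E')) (mm N H (mm N Y F')) (mm N E (mm N A H'))
    (mm N F (mm N X' E')) (mm N H (mm N Y' F')) (mm N E (mm N A' H')) (base_change N E E' F F' H H' ` M)"
    unfolding N(1)[symmetric]
    by (rule rigid_base_change[OF _ _ _ N(2) assms(1-18) M(1) assms(22)]) (simp_all add: N(1))
  show "card (base_change N E E' F F' H H' ` M) \<le> m" using card_image_le[OF M(2)] M(3) le_trans by blast
  show "base_change N E E' F F' H H' ` M \<subseteq> rep_space (dims r0 r1 a)"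
    using M(1) assms(1-6) by (auto elim!: rep_cases simp: base_change_def mk_rep_mem intro!: supp_mm)
qed (use M(2) assms(1-6,12-17) in \<open>auto intro!: supp_mm\<close>)

definition transposed :: "(nat \<Rightarrow> nat \<Rightarrow> 'k) \<Rightarrow> nat \<Rightarrow> nat \<Rightarrow> 'k" where
  "transposed A = (\<lambda>i j. A j i)"

lemma transposed_simps:
  "transposed (transposed A) = A" "supp a b (transposed A) \<longleftrightarrow> supp b a A"
  "transposed (A + B) = transposed A + transposed B" "transposed A = 0 \<longleftrightarrow> A = 0"
  "mm N (transposed A) (transposed B) = transposed (mm N B A)" "tr N (transposed A) = tr N A"
  "transposed A = transposed B \<longleftrightarrow> A = B"
  by (auto simp: transposed_def supp_def fun_eq_iff mm_def tr_def mult.commute)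

lemma commuting_tangent_transposed:
  "commuting_tangent N (transposed x) (transposed z) (transposed y) (transposed x') (transposed z') (transposed y')
     (transposed p) (transposed s) (transposed q) (transposed p') (transposed s') (transposed q') \<longleftrightarrow>
   commuting_tangent N x y z x' y' z' p q s p' q' s'"
  unfolding commuting_tangent_def commuting_def transposed_simps(5) transposed_simps(3)[symmetric] transposed_simps(7)
  by (auto simp: add.commute)

text \<open>Duality of the cyclic quiver: transposition reverses all arrows. Vertices 0 and 1 change
  places, so \<open>x\<close> stays where it is and \<open>y\<close> and \<open>z\<close> are
  exchanged.\<close>

lemma good_point_transpose:
  fixes x y z :: "nat \<Rightarrow> nat \<Rightarrow> 'k::field"
  assumes "good_point m r1 r0 r2 (transposed x) (transposed z) (transposed y)"
  shows "good_point m r0 r1 r2 x y z"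
proof -
  let ?N = "r0 + r1 + r2"
  have N: "r1 + r0 + r2 = ?N" by simp
  obtain x' y' z' M where s: "supp r0 r1 x'" "supp r2 r0 y'" "supp r1 r2 z'"
    and M: "finite M" "card M \<le> m" "M \<subseteq> rep_space (dims r1 r0 r2)"
    and rig: "rigid ?N r1 r0 r2 (transposed x) (transposed z) (transposed y) x' y' z' M"
    using assms unfolding good_point_iff_rigid N by auto
  let ?T = "\<lambda>v. mk_rep (transposed (arrow v 0)) (transposed (arrow v 2)) (transposed (arrow v 1))"
  have pair: "pairing ?N p q s (?T v) = pairing ?N (transposed p) (transposed s) (transposed q) v" for p q s :: "nat \<Rightarrow> nat \<Rightarrow> 'k" and v
  proof -
    have "tr ?N (mm ?N A (transposed B)) = tr ?N (mm ?N (transposed A) B)" for A B :: "nat \<Rightarrow> nat \<Rightarrow> 'k"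
      by (subst transposed_simps(1)[of A, symmetric], subst transposed_simps(5))
        (simp only: transposed_simps(6) tr_mm_commute[of _ B])
    then show ?thesis by (simp add: pairing_def)
  qed
  show ?thesis unfolding good_point_iff_rigid
  proof (intro exI conjI)
    show "rigid ?N r0 r1 r2 x y z (transposed x') (transposed z') (transposed y') (?T ` M)"
      unfolding rigid_def
    proof (intro allI impI)
      fix p q s p' q' s'
      assume sp: "supp r0 r1 p" "supp r1 r2 q" "supp r2 r0 s" "supp r0 r1 p'" "supp r1 r2 q'" "supp r2 r0 s'"
        and ct: "commuting_tangent ?N x y z (transposed x') (transposed z') (transposed y') p q s p' q' s'"
        and M0: "\<forall>v\<in>?T ` M. pairing ?N p q s v = 0"
      have "transposed p = 0 \<and> transposed s = 0 \<and> transposed q = 0"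
      proof (rule rig[unfolded rigid_def, rule_format])
        show "commuting_tangent ?N (transposed x) (transposed z) (transposed y) x' y' z'
            (transposed p) (transposed s) (transposed q) (transposed p') (transposed s') (transposed q')"
          using ct commuting_tangent_transposed[of ?N x z y "transposed x'" "transposed y'" "transposed z'" p s q p' s' q']
          by (simp only: transposed_simps(1))
        show "pairing ?N (transposed p) (transposed s) (transposed q) v = 0" if "v \<in> M" for v
          using M0 that pair by simp
      qed (use sp in \<open>simp_all add: transposed_simps\<close>)
      then show "p = 0 \<and> q = 0 \<and> s = 0" by (simp add: transposed_simps)
    qed
    show "card (?T ` M) \<le> m" using card_image_le[OF M(1)] M(2) le_trans by blast
    show "?T ` M \<subseteq> rep_space (dims r0 r1 r2)"
      using M(3) by (auto elim!: rep_cases simp: mk_rep_mem transposed_simps)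
  qed (use s M(1) in \<open>simp_all add: transposed_simps\<close>)
qed

definition dims_GIB :: "'k::field itself \<Rightarrow> (nat \<Rightarrow> nat) \<Rightarrow> bool" where
  "dims_GIB _ r \<longleftrightarrow> (\<forall>v\<in>rep_space r :: (nat \<times> nat \<times> nat \<Rightarrow> 'k) set. \<exists>u\<in>rep_space r.
     max_orbit_dim TYPE('k) r \<le> fun_space.dim (double_orbit r v u))"

definition rotated :: "(nat \<times> nat \<times> nat \<Rightarrow> 'k::zero) \<Rightarrow> nat \<times> nat \<times> nat \<Rightarrow> 'k" where
  "rotated v = (\<lambda>(t, i, j). if t < 3 then v (Suc t mod 3, i, j) else 0)"

lemma rotated_mk_rep: "rotated (mk_rep x y z) = mk_rep y z x"
  by (auto simp: rotated_def mk_rep_def fun_eq_iff less_3_iff)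

lemma rotated_linear: "rotated (v + w) = rotated v + rotated w" "rotated (fscale c v) = fscale c (rotated v)"
  for v w :: "nat \<times> nat \<times> nat \<Rightarrow> 'k::field"
  by (auto simp: rotated_def fun_eq_iff fscale_def)

lemma rotated_rep_space: "rotated ` rep_space (dims r0 r1 r2) = rep_space (dims r1 r2 r0)"
proof (intro subset_antisym subsetI)
  fix v assume "v \<in> rep_space (dims r1 r2 r0)"
  then obtain y z x where v: "v = mk_rep y z x" "supp r2 r1 y" "supp r0 r2 z" "supp r1 r0 x" by (rule rep_cases)
  then show "v \<in> rotated ` rep_space (dims r0 r1 r2)"
    by (auto simp: mk_rep_mem rotated_mk_rep intro!: image_eqI[of _ _ "mk_rep x y z"])
qed (auto elim!: rep_cases simp: mk_rep_mem rotated_mk_rep)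

lemma rotated_level_algebra: "rotated ` level_algebra (dims r0 r1 r2) = level_algebra (dims r1 r2 r0)"
proof (intro subset_antisym subsetI)
  fix v assume "v \<in> level_algebra (dims r1 r2 r0)"
  then obtain y z x where v: "v = mk_rep y z x" "supp r1 r1 y" "supp r2 r2 z" "supp r0 r0 x" by (rule level_cases)
  then show "v \<in> rotated ` level_algebra (dims r0 r1 r2)"
    by (auto simp: mk_rep_mem rotated_mk_rep intro!: image_eqI[of _ _ "mk_rep x y z"])
qed (auto elim!: level_cases simp: mk_rep_mem rotated_mk_rep)

lemma rotated_action:
  assumes "a \<in> level_algebra (dims r0 r1 r2)" "v \<in> rep_space (dims r0 r1 r2)"
  shows "rep_action N (rotated a) (rotated v) = rotated (rep_action N a v)"
  using assms by (auto elim!: rep_cases level_cases simp: rotated_mk_rep rep_action_mk_rep)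

lemma rotated_eq_0: "v \<in> rep_space (dims r0 r1 r2) \<Longrightarrow> rotated v = 0 \<longleftrightarrow> v = 0"
proof (elim rep_cases)
  fix x y z assume v: "v = mk_rep x y z"
  have "mk_rep A B C = 0 \<longleftrightarrow> A = 0 \<and> B = 0 \<and> C = 0" for A B C :: "nat \<Rightarrow> nat \<Rightarrow> 'a"
  proof
    assume "mk_rep A B C = 0"
    then have "arrow (mk_rep A B C) t = 0" for t by (simp add: arrow_def fun_eq_iff)
    from this[of 0] this[of 1] this[of 2] show "A = 0 \<and> B = 0 \<and> C = 0" by simp
  qed (simp add: mk_rep_def fun_eq_iff)
  then show "rotated v = 0 \<longleftrightarrow> v = 0" by (auto simp: v rotated_mk_rep)
qed

lemma dim_rotated:
  fixes S :: "(nat \<times> nat \<times> nat \<Rightarrow> 'k::field) set"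
  assumes S: "S \<subseteq> rep_space (dims r0 r1 r2)" "fun_space.subspace S"
  shows "fun_space.dim (rotated ` S) = fun_space.dim S"
proof -
  have "Vector_Spaces.linear fscale fscale (rotated :: (nat \<times> nat \<times> nat \<Rightarrow> 'k) \<Rightarrow> _)"
    unfolding Vector_Spaces.linear_iff using fun_space.vector_space_axioms by (simp add: rotated_linear)
  from fun_space.dim_kernel_image[OF this S(2) fun_space.finite_dim_subset[OF finite_dim_rep_space S(1)] fun_space.subspace_single_0]
  have "fun_space.dim S = fun_space.dim {0 :: nat \<times> nat \<times> nat \<Rightarrow> 'k} + fun_space.dim (rotated ` S)"
    using S rotated_eq_0 fun_space.subspace_0 by blast
  moreover have "fun_space.dim {0 :: nat \<times> nat \<times> nat \<Rightarrow> 'k} = 0"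
    using fun_space.dim_le_card[of "{0 :: nat \<times> nat \<times> nat \<Rightarrow> 'k}" "{}"] by simp
  ultimately show ?thesis by simp
qed

lemma subspace_orbit: "fun_space.subspace (orbit r v)"
  unfolding orbit_def by (rule subspace_action_image[OF subspace_level_algebra])

lemma subspace_double_orbit: "fun_space.subspace (double_orbit r v u)"
  unfolding double_orbit_def
  by (rule fun_space.subspace_sums[OF subspace_orbit subspace_action_image[OF subspace_stabiliser]])

lemma rotated_orbit:
  assumes v: "v \<in> rep_space (dims r0 r1 r2)"
  shows "orbit (dims r1 r2 r0) (rotated v) = rotated ` orbit (dims r0 r1 r2) v"
proof -
  have N: "r1 + r2 + r0 = r0 + r1 + r2" by simp
  show ?thesis
    unfolding orbit_def rotated_level_algebra[of r0 r1 r2, symmetric] image_image total_dim_dims N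
    using rotated_action[OF _ v] by (intro image_cong refl) blast
qed

lemma rotated_stabiliser:
  assumes v: "v \<in> rep_space (dims r0 r1 r2)"
  shows "stabiliser (dims r1 r2 r0) (rotated v) = rotated ` stabiliser (dims r0 r1 r2) v"
proof -
  have N: "r1 + r2 + r0 = r0 + r1 + r2" by simp
  have "rep_action (r0 + r1 + r2) (rotated a) (rotated v) = 0 \<longleftrightarrow> rep_action (r0 + r1 + r2) a v = 0"
    if "a \<in> level_algebra (dims r0 r1 r2)" for a
    using rotated_action[OF that v] rotated_eq_0[OF rep_action_closed[OF that v]] by simp
  then show ?thesis
    unfolding stabiliser_def rotated_level_algebra[of r0 r1 r2, symmetric] total_dim_dims N by auto
qed

lemma rotated_double_orbit:
  assumes v: "v \<in> rep_space (dims r0 r1 r2)" and u: "u \<in> rep_space (dims r0 r1 r2)"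
  shows "double_orbit (dims r1 r2 r0) (rotated v) (rotated u) = rotated ` double_orbit (dims r0 r1 r2) v u"
proof -
  have N: "r1 + r2 + r0 = r0 + r1 + r2" by simp
  have *: "(\<lambda>x. rep_action (r0 + r1 + r2) x (rotated u)) ` rotated ` stabiliser (dims r0 r1 r2) v =
      rotated ` (\<lambda>x. rep_action (r0 + r1 + r2) x u) ` stabiliser (dims r0 r1 r2) v"
    unfolding image_image using rotated_action[OF _ u]
    by (intro image_cong refl) (auto simp: stabiliser_def)
  have sums: "{a + b |a b. a \<in> rotated ` A \<and> b \<in> rotated ` B} = rotated ` {a + b |a b. a \<in> A \<and> b \<in> B}"
    for A B :: "(nat \<times> nat \<times> nat \<Rightarrow> 'a) set"
    by (auto simp: image_def rotated_linear(1), metis rotated_linear(1), blast)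
  show ?thesis
    unfolding double_orbit_def rotated_orbit[OF v] rotated_stabiliser[OF v] total_dim_dims N * sums ..
qed

lemma max_orbit_dim_rotated: "max_orbit_dim TYPE('k::field) (dims r1 r2 r0) = max_orbit_dim TYPE('k) (dims r0 r1 r2)"
  unfolding max_orbit_dim_def rotated_rep_space[of r0 r1 r2, symmetric] image_image
  using dim_rotated[OF orbit_subset subspace_orbit] by (intro arg_cong[of _ _ Max] image_cong refl) (simp add: rotated_orbit)

text \<open>The rotation of the quiver identifies representation spaces, algebras, stabilisers and
  orbits; dimensions agree because it is injective on representations.\<close>

theorem dims_GIB_rotated: "dims_GIB TYPE('k::field) (dims r1 r2 r0) \<longleftrightarrow> dims_GIB TYPE('k) (dims r0 r1 r2)"
proof -
  have "fun_space.dim (double_orbit (dims r1 r2 r0) (rotated v) (rotated u)) = fun_space.dim (double_orbit (dims r0 r1 r2) v u)"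
    if "v \<in> rep_space (dims r0 r1 r2)" "u \<in> rep_space (dims r0 r1 r2)" for v u :: "nat \<times> nat \<times> nat \<Rightarrow> 'k"
    using dim_rotated[OF double_orbit_subset[OF that] subspace_double_orbit] rotated_double_orbit[OF that] by simp
  then show ?thesis
    unfolding dims_GIB_def rotated_rep_space[of r0 r1 r2, symmetric] max_orbit_dim_rotated[of r1 r2 r0] ball_simps bex_simps
    by simp
qed

section \<open>Dimension vectors \<open>(2, 2, a)\<close>\<close>

definition mat2 :: "'k::zero \<Rightarrow> 'k \<Rightarrow> 'k \<Rightarrow> 'k \<Rightarrow> nat \<Rightarrow> nat \<Rightarrow> 'k" where
  "mat2 a b c d = (\<lambda>i j. if i = 0 \<and> j = 0 then a else if i = 0 \<and> j = 1 then b
     else if i = 1 \<and> j = 0 then c else if i = 1 \<and> j = 1 then d else 0)"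

lemma supp_mat2: "supp 2 2 (mat2 a b c d)"
  by (auto simp: supp_def mat2_def split: if_splits)

lemma mat2_cases:
  assumes "supp 2 2 A"
  obtains a b c d where "A = mat2 a b c d"
proof (rule that[of "A 0 0" "A 0 1" "A 1 0" "A 1 1"])
  show "A = mat2 (A 0 0) (A 0 1) (A 1 0) (A 1 1)"
  proof (intro ext)
    fix i j
    have "A i j = 0" if "\<not> (i < 2 \<and> j < 2)" using assms that by (auto simp: supp_def)
    then show "A i j = mat2 (A 0 0) (A 0 1) (A 1 0) (A 1 1) i j"
      by (auto simp: mat2_def less_2_cases_iff)
  qed
qed

lemma mat2_eq: "mat2 a b c d = mat2 a' b' c' d' \<longleftrightarrow> a = a' \<and> b = b' \<and> c = c' \<and> d = d'"
proof
  assume "mat2 a b c d = mat2 a' b' c' d'"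
  then have "mat2 a b c d i j = mat2 a' b' c' d' i j" for i j by simp
  from this[of 0 0] this[of 0 1] this[of 1 0] this[of 1 1]
  show "a = a' \<and> b = b' \<and> c = c' \<and> d = d'" by (simp add: mat2_def)
qed simp

lemma mat2_eq_0: "mat2 a b c d = 0 \<longleftrightarrow> a = 0 \<and> b = 0 \<and> c = 0 \<and> d = 0"
proof -
  have "mat2 0 0 0 0 = (0 :: nat \<Rightarrow> nat \<Rightarrow> 'a)" by (simp add: mat2_def fun_eq_iff)
  then show ?thesis using mat2_eq[of a b c d 0 0 0 0] by metis
qed

lemma mm_mat2:
  assumes "2 \<le> N"
  shows "mm N (mat2 a b c d) (mat2 a' b' c' d') = mat2 (a * a' + b * c') (a * b' + b * d') (c * a' + d * c') (c * b' + d * d')"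
proof (intro ext)
  fix i j
  show "mm N (mat2 a b c d) (mat2 a' b' c' d') i j =
      mat2 (a * a' + b * c') (a * b' + b * d') (c * a' + d * c') (c * b' + d * d') i j"
    unfolding mm_supp_left[OF supp_mat2 assms] by (auto simp: mat2_def numeral_2_eq_2)
qed

lemma mat2_ops: "mat2 a b c d + mat2 a' b' c' d' = mat2 (a + a') (b + b') (c + c') (d + d' :: 'k::monoid_add)"
  by (auto simp: mat2_def fun_eq_iff)

lemma tr_mat2: "2 \<le> N \<Longrightarrow> tr N (mat2 a b c d) = a + d"
proof -
  assume N: "2 \<le> N"
  have "tr N (mat2 a b c d) = (\<Sum>i<2. mat2 a b c d i i)"
    unfolding tr_def by (rule sum.mono_neutral_right) (use N in \<open>auto simp: mat2_def\<close>)
  then show ?thesis by (simp add: mat2_def numeral_2_eq_2)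
qed

text \<open>Replaces matrices by scalar unknowns, so that rigidity of a concrete representation
  becomes a linear system that simplification can solve.\<close>

lemma rigid_mat2:
  assumes N: "2 \<le> N" "x = mat2 x1 x2 x3 x4" "y = mat2 y1 y2 y3 y4" "z = mat2 z1 z2 z3 z4"
    "x' = mat2 x1' x2' x3' x4'" "y' = mat2 y1' y2' y3' y4'" "z' = mat2 z1' z2' z3' z4'"
    and crit: "\<And>p1 p2 p3 p4 q1 q2 q3 q4 s1 s2 s3 s4 p1' p2' p3' p4' q1' q2' q3' q4' s1' s2' s3' s4' :: 'k::comm_ring_1.
      commuting_tangent N x y z x' y' z' (mat2 p1 p2 p3 p4) (mat2 q1 q2 q3 q4) (mat2 s1 s2 s3 s4)
        (mat2 p1' p2' p3' p4') (mat2 q1' q2' q3' q4') (mat2 s1' s2' s3' s4') \<Longrightarrow>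
      \<forall>v\<in>M. pairing N (mat2 p1 p2 p3 p4) (mat2 q1 q2 q3 q4) (mat2 s1 s2 s3 s4) v = 0 \<Longrightarrow>
      p1 = 0 \<and> p2 = 0 \<and> p3 = 0 \<and> p4 = 0 \<and> q1 = 0 \<and> q2 = 0 \<and> q3 = 0 \<and> q4 = 0 \<and> s1 = 0 \<and> s2 = 0 \<and> s3 = 0 \<and> s4 = 0"
  shows "rigid N 2 2 2 x y z x' y' z' M"
  unfolding rigid_def
proof (intro allI impI)
  fix p q s p' q' s' :: "nat \<Rightarrow> nat \<Rightarrow> 'k"
  assume sp: "supp 2 2 p" "supp 2 2 q" "supp 2 2 s" "supp 2 2 p'" "supp 2 2 q'" "supp 2 2 s'"
    and *: "commuting_tangent N x y z x' y' z' p q s p' q' s'" "\<forall>v\<in>M. pairing N p q s v = 0"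
  show "p = 0 \<and> q = 0 \<and> s = 0"
  proof -
    obtain p1 p2 p3 p4 where p: "p = mat2 p1 p2 p3 p4" by (rule mat2_cases[OF sp(1)])
    obtain q1 q2 q3 q4 where q: "q = mat2 q1 q2 q3 q4" by (rule mat2_cases[OF sp(2)])
    obtain s1 s2 s3 s4 where s: "s = mat2 s1 s2 s3 s4" by (rule mat2_cases[OF sp(3)])
    obtain p1' p2' p3' p4' where p': "p' = mat2 p1' p2' p3' p4'" by (rule mat2_cases[OF sp(4)])
    obtain q1' q2' q3' q4' where q': "q' = mat2 q1' q2' q3' q4'" by (rule mat2_cases[OF sp(5)])
    obtain s1' s2' s3' s4' where s': "s' = mat2 s1' s2' s3' s4'" by (rule mat2_cases[OF sp(6)])
    show ?thesis using crit[OF *[unfolded p q s p' q' s']] by (simp add: p q s mat2_eq_0)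
  qed
qed

definition scaled :: "'k::comm_ring_1 \<Rightarrow> (nat \<Rightarrow> nat \<Rightarrow> 'k) \<Rightarrow> nat \<Rightarrow> nat \<Rightarrow> 'k" where
  "scaled c A = (\<lambda>i j. c * A i j)"

lemma scaled_simps:
  "mm N (scaled c A) B = scaled c (mm N A B)" "mm N A (scaled c B) = scaled c (mm N A B)"
  "scaled c (A + B) = scaled c A + scaled c B" "tr N (scaled c A) = c * tr N A" "scaled 1 A = A"
  "scaled c 0 = 0"
  by (simp_all add: scaled_def mm_def tr_def fun_eq_iff sum_distrib_left mult_ac distrib_left)

lemma supp_scaled: "supp a b A \<Longrightarrow> supp a b (scaled c A)"
  unfolding supp_def scaled_def by (metis mult_zero_right)

lemma scaled_eq_0: "c \<noteq> 0 \<Longrightarrow> scaled c A = 0 \<longleftrightarrow> A = 0" for c :: "'k::field"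
  by (auto simp: scaled_def fun_eq_iff)

text \<open>Rescaling an arrow is compensated by rescaling the opposite component of the form.
  Non-zero entries may thus be normalised to 1.\<close>

lemma rigid_scaled:
  fixes a b c :: "'k::field"
  assumes nz: "a \<noteq> 0" "b \<noteq> 0" "c \<noteq> 0" and rig: "rigid N r0 r1 r2 x y z x' y' z' M"
  shows "rigid N r0 r1 r2 (scaled a x) (scaled b y) (scaled c z) (scaled a x') (scaled b y') (scaled c z')
    ((\<lambda>v. mk_rep (scaled a (arrow v 0)) (scaled b (arrow v 1)) (scaled c (arrow v 2))) ` M)"
  unfolding rigid_def
proof (intro allI impI)
  fix p q s p' q' s'
  assume sp: "supp r0 r1 p" "supp r1 r2 q" "supp r2 r0 s" "supp r0 r1 p'" "supp r1 r2 q'" "supp r2 r0 s'"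
    and ct: "commuting_tangent N (scaled a x) (scaled b y) (scaled c z) (scaled a x') (scaled b y') (scaled c z') p q s p' q' s'"
    and M0: "\<forall>v\<in>(\<lambda>v. mk_rep (scaled a (arrow v 0)) (scaled b (arrow v 1)) (scaled c (arrow v 2))) ` M. pairing N p q s v = 0"
  have "scaled a p = 0 \<and> scaled b q = 0 \<and> scaled c s = 0"
  proof (rule rig[unfolded rigid_def, rule_format])
    show "commuting_tangent N x y z x' y' z' (scaled a p) (scaled b q) (scaled c s) (scaled a p') (scaled b q') (scaled c s')"
      using ct unfolding commuting_tangent_def commuting_def scaled_simps .
    show "pairing N (scaled a p) (scaled b q) (scaled c s) v = 0" if "v \<in> M" for v
      using M0 that by (simp add: pairing_def scaled_simps)
  qed (use sp in \<open>simp_all add: supp_scaled\<close>)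
  then show "p = 0 \<and> q = 0 \<and> s = 0" using nz by (simp add: scaled_eq_0)
qed

text \<open>The bits record which entries are present in \<open>v\<close>; the direction supplies
  the missing ones, so that all six basis vectors form one cycle \<open>V\<close>. The forms
  commuting with \<open>V\<close> are spanned by its second and fifth power, and the two test
  vectors are the fourth power of \<open>V\<close> and \<open>V\<close> itself, dual to them under
  the trace.\<close>

lemma rigid_swap_corner:
  fixes a0 a1 b0 b1 :: "'k::field_char_0"
  assumes N: "2 \<le> N" and bits: "a0 \<in> {0, 1}" "a1 \<in> {0, 1}" "b0 \<in> {0, 1}" "b1 \<in> {0, 1}"
  shows "rigid N 2 2 2 (mat2 a0 0 0 a1) (mat2 b0 0 0 b1) (mat2 0 0 1 0)
      (mat2 (1 - a0) 0 0 (1 - a1)) (mat2 (1 - b0) 0 0 (1 - b1)) (mat2 0 1 0 0)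
      {mk_rep (mat2 1 0 0 1) (mat2 1 0 0 1) (mat2 0 1 1 0), mk_rep (mat2 0 1 1 0) (mat2 0 1 1 0) (mat2 1 0 0 1)}"
    and "rigid N 2 2 2 (mat2 a0 0 0 a1) (mat2 b0 0 0 b1) (mat2 0 1 0 0)
      (mat2 (1 - a0) 0 0 (1 - a1)) (mat2 (1 - b0) 0 0 (1 - b1)) (mat2 0 0 1 0)
      {mk_rep (mat2 1 0 0 1) (mat2 1 0 0 1) (mat2 0 1 1 0), mk_rep (mat2 0 1 1 0) (mat2 0 1 1 0) (mat2 1 0 0 1)}"
    and "rigid N 2 2 2 (mat2 a0 0 0 a1) (mat2 b0 0 0 b1) (mat2 0 0 0 0)
      (mat2 (1 - a0) 0 0 (1 - a1)) (mat2 (1 - b0) 0 0 (1 - b1)) (mat2 0 1 1 0)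
      {mk_rep (mat2 1 0 0 1) (mat2 1 0 0 1) (mat2 0 1 1 0), mk_rep (mat2 0 1 1 0) (mat2 0 1 1 0) (mat2 1 0 0 1)}"
proof -
  note defs = commuting_tangent_def commuting_def pairing_mk_rep mm_mat2[OF N] mat2_ops mat2_eq tr_mat2[OF N] ball_simps
  show "rigid N 2 2 2 (mat2 a0 0 0 a1) (mat2 b0 0 0 b1) (mat2 0 0 1 0)
      (mat2 (1 - a0) 0 0 (1 - a1)) (mat2 (1 - b0) 0 0 (1 - b1)) (mat2 0 1 0 0)
      {mk_rep (mat2 1 0 0 1) (mat2 1 0 0 1) (mat2 0 1 1 0), mk_rep (mat2 0 1 1 0) (mat2 0 1 1 0) (mat2 1 0 0 1)}"
  proof (rule rigid_mat2[OF N refl refl refl refl refl refl], goal_cases)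
    case 1
    show ?case using bits by (elim insertE emptyE; hypsubst; use 1[unfolded defs] in clarsimp)
  qed
  show "rigid N 2 2 2 (mat2 a0 0 0 a1) (mat2 b0 0 0 b1) (mat2 0 1 0 0)
      (mat2 (1 - a0) 0 0 (1 - a1)) (mat2 (1 - b0) 0 0 (1 - b1)) (mat2 0 0 1 0)
      {mk_rep (mat2 1 0 0 1) (mat2 1 0 0 1) (mat2 0 1 1 0), mk_rep (mat2 0 1 1 0) (mat2 0 1 1 0) (mat2 1 0 0 1)}"
  proof (rule rigid_mat2[OF N refl refl refl refl refl refl], goal_cases)
    case 1
    show ?case using bits by (elim insertE emptyE; hypsubst; use 1[unfolded defs] in clarsimp)
  qed
  show "rigid N 2 2 2 (mat2 a0 0 0 a1) (mat2 b0 0 0 b1) (mat2 0 0 0 0)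
      (mat2 (1 - a0) 0 0 (1 - a1)) (mat2 (1 - b0) 0 0 (1 - b1)) (mat2 0 1 1 0)
      {mk_rep (mat2 1 0 0 1) (mat2 1 0 0 1) (mat2 0 1 1 0), mk_rep (mat2 0 1 1 0) (mat2 0 1 1 0) (mat2 1 0 0 1)}"
  proof (rule rigid_mat2[OF N refl refl refl refl refl refl], goal_cases)
    case 1
    show ?case using bits by (elim insertE emptyE; hypsubst; use 1[unfolded defs] in clarsimp)
  qed
qed

text \<open>The factor \<open>2\<close> makes the monodromies of the two 3-cycles differ, so that nothing commutes off the diagonal.\<close>

lemma rigid_diag_corner:
  fixes a0 a1 b0 b1 :: "'k::field_char_0"
  assumes N: "2 \<le> N" and bits: "a0 \<in> {0, 1}" "a1 \<in> {0, 1}" "b0 \<in> {0, 1}" "b1 \<in> {0, 1}"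
    and nz: "a0 \<noteq> 0 \<or> a1 \<noteq> 0" "b0 \<noteq> 0 \<or> b1 \<noteq> 0"
  shows "rigid N 2 2 2 (mat2 a0 0 0 a1) (mat2 b0 0 0 b1) (mat2 1 0 0 0)
      (mat2 (1 - a0) 0 0 (1 - a1)) (mat2 (1 - b0) 0 0 (1 - b1)) (mat2 0 0 0 2)
      {mk_rep (mat2 1 0 0 0) (mat2 1 0 0 0) (mat2 1 0 0 0), mk_rep (mat2 0 0 0 1) (mat2 0 0 0 1) (mat2 0 0 0 1)}"
    and "rigid N 2 2 2 (mat2 a0 0 0 a1) (mat2 b0 0 0 b1) (mat2 0 0 0 1)
      (mat2 (1 - a0) 0 0 (1 - a1)) (mat2 (1 - b0) 0 0 (1 - b1)) (mat2 2 0 0 0)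
      {mk_rep (mat2 1 0 0 0) (mat2 1 0 0 0) (mat2 1 0 0 0), mk_rep (mat2 0 0 0 1) (mat2 0 0 0 1) (mat2 0 0 0 1)}"
proof -
  note defs = commuting_tangent_def commuting_def pairing_mk_rep mm_mat2[OF N] mat2_ops mat2_eq tr_mat2[OF N] ball_simps
  show "rigid N 2 2 2 (mat2 a0 0 0 a1) (mat2 b0 0 0 b1) (mat2 1 0 0 0)
      (mat2 (1 - a0) 0 0 (1 - a1)) (mat2 (1 - b0) 0 0 (1 - b1)) (mat2 0 0 0 2)
      {mk_rep (mat2 1 0 0 0) (mat2 1 0 0 0) (mat2 1 0 0 0), mk_rep (mat2 0 0 0 1) (mat2 0 0 0 1) (mat2 0 0 0 1)}"
  proof (rule rigid_mat2[OF N refl refl refl refl refl refl], goal_cases)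
    case 1
    show ?case using bits nz by (elim insertE emptyE; hypsubst; use 1[unfolded defs] in clarsimp)
  qed
  show "rigid N 2 2 2 (mat2 a0 0 0 a1) (mat2 b0 0 0 b1) (mat2 0 0 0 1)
      (mat2 (1 - a0) 0 0 (1 - a1)) (mat2 (1 - b0) 0 0 (1 - b1)) (mat2 2 0 0 0)
      {mk_rep (mat2 1 0 0 0) (mat2 1 0 0 0) (mat2 1 0 0 0), mk_rep (mat2 0 0 0 1) (mat2 0 0 0 1) (mat2 0 0 0 1)}"
  proof (rule rigid_mat2[OF N refl refl refl refl refl refl], goal_cases)
    case 1
    show ?case using bits nz by (elim insertE emptyE; hypsubst; use 1[unfolded defs] in clarsimp)
  qed
qed

definition munit :: "'k::zero \<Rightarrow> nat \<Rightarrow> nat \<Rightarrow> nat \<Rightarrow> nat \<Rightarrow> 'k" where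
  "munit c d i = (\<lambda>a b. if a = d \<and> b = i then c else 0)"

lemma supp_munit: "d < a \<Longrightarrow> i < b \<Longrightarrow> supp a b (munit c d i)"
  by (auto simp: munit_def supp_def)

lemma mm_munit:
  assumes "i < N" "d < N"
  shows "mm N F (munit c d i) a b = (if b = i then F a d * c else 0)"
    and "mm N (munit c d i) E a b = (if a = d then c * E i b else 0)"
    and "mm N F (mm N (munit c d i) E) a b = F a d * c * E i b"
proof -
  have 1: "mm N (munit c d i) E a b = (if a = d then c * E i b else 0)" for a b
  proof -
    have "mm N (munit c d i) E a b = (\<Sum>l<N. if l = i then if a = d then c * E i b else 0 else 0)"
      unfolding mm_def munit_def by (intro sum.cong) auto
    then show ?thesis using assms by simp
  qed
  show "mm N (munit c d i) E a b = (if a = d then c * E i b else 0)" by (rule 1)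
  have "mm N F (munit c d i) a b = (\<Sum>l<N. if l = d then if b = i then F a d * c else 0 else 0)"
    unfolding mm_def munit_def by (intro sum.cong) auto
  then show "mm N F (munit c d i) a b = (if b = i then F a d * c else 0)" using assms by simp
  have "mm N F (mm N (munit c d i) E) a b = (\<Sum>l<N. if l = d then F a d * c * E i b else 0)"
    unfolding mm_def[of N F] 1 by (intro sum.cong) auto
  then show "mm N F (mm N (munit c d i) E) a b = F a d * c * E i b" using assms by simp
qed

lemma mm_mat2_entry:
  assumes "2 \<le> N"
  shows "mm N (mat2 a b c d) B i j = (if i = 0 then a * B 0 j + b * B 1 j else if i = 1 then c * B 0 j + d * B 1 j else 0)"
    and "mm N B (mat2 a b c d) i j = (if j = 0 then B i 0 * a + B i 1 * c else if j = 1 then B i 0 * b + B i 1 * d else 0)"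
  unfolding mm_supp_left[OF supp_mat2 assms] mm_supp_right[OF supp_mat2 assms] by (auto simp: mat2_def numeral_2_eq_2)

lemma mm_mat2_eq_0:
  assumes "2 \<le> N"
  shows "mm N (mat2 a b c d) B = 0 \<longleftrightarrow> (\<forall>j. a * B 0 j + b * B 1 j = 0 \<and> c * B 0 j + d * B 1 j = 0)"
    and "mm N B (mat2 a b c d) = 0 \<longleftrightarrow> (\<forall>i. B i 0 * a + B i 1 * c = 0 \<and> B i 0 * b + B i 1 * d = 0)"
    and "mm N (mat2 a b c d) B + mm N (mat2 a' b' c' d') B' = 0 \<longleftrightarrow>
      (\<forall>j. a * B 0 j + b * B 1 j + (a' * B' 0 j + b' * B' 1 j) = 0 \<and> c * B 0 j + d * B 1 j + (c' * B' 0 j + d' * B' 1 j) = 0)"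
    and "mm N B (mat2 a b c d) + mm N B' (mat2 a' b' c' d') = 0 \<longleftrightarrow>
      (\<forall>i. B i 0 * a + B i 1 * c + (B' i 0 * a' + B' i 1 * c') = 0 \<and> B i 0 * b + B i 1 * d + (B' i 0 * b' + B' i 1 * d') = 0)"
  using assms by (auto simp: fun_eq_iff mm_mat2_entry split: if_splits)

lemma supp_eq_0_iff: "supp a b A \<Longrightarrow> A = 0 \<longleftrightarrow> (\<forall>i<a. \<forall>j<b. A i j = 0)"
  by (auto simp: supp_def fun_eq_iff)

text \<open>Each diagonal entry of the deformed matrix is 1 or \<epsilon>: the zeroth-order equation
  kills the rows of \<phi> of the first kind and the first-order equation those of the
  second.\<close>

lemma bits_injective:
  fixes \<phi> :: "nat \<Rightarrow> nat \<Rightarrow> 'k::field"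
  assumes "2 \<le> N" "b0 \<in> {0, 1}" "b1 \<in> {0, 1}" "supp 2 a \<phi>" "mm N (mat2 b0 0 0 b1) \<phi> = 0"
    "mm N (mat2 (1 - b0) 0 0 (1 - b1)) \<phi> + mm N (mat2 b0 0 0 b1) \<phi>' = 0"
  shows "\<phi> = 0"
proof -
  have "\<phi> 0 j = 0 \<and> \<phi> 1 j = 0" for j
    using assms(2,3) spec[OF assms(5)[unfolded mm_mat2_eq_0[OF assms(1)]], of j]
      spec[OF assms(6)[unfolded mm_mat2_eq_0[OF assms(1)]], of j] by (elim insertE emptyE) simp_all
  then show ?thesis using assms(4) by (simp add: supp_eq_0_iff less_2_cases_iff)
qed

text \<open>On a field this rule is \<open>a * (b * x) = a * b * x\<close>, which loops with \<open>mult_ac\<close>.\<close>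

declare fun_space.functional.vs2.scale_scale [simp del]

section \<open>Frames adapted to a vector and a covector\<close>

text \<open>Two independent vectors, the columns of \<open>G\<close>, with a dual pair of covectors,
  the rows of \<open>G'\<close>. For \<open>n = 2\<close> this is a basis, otherwise a plane
  together with a projection onto it.\<close>

definition frame2 :: "nat \<Rightarrow> nat \<Rightarrow> (nat \<Rightarrow> nat \<Rightarrow> 'k::comm_ring_1) \<Rightarrow> (nat \<Rightarrow> nat \<Rightarrow> 'k) \<Rightarrow> bool" where
  "frame2 N n G G' \<longleftrightarrow> supp n 2 G \<and> supp 2 n G' \<and> mm N G' G = idm 2"

definition dot :: "nat \<Rightarrow> (nat \<Rightarrow> 'k::comm_ring_1) \<Rightarrow> (nat \<Rightarrow> 'k) \<Rightarrow> 'k" where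
  "dot n c g = (\<Sum>l<n. c l * g l)"

lemma dot_unit: "j < n \<Longrightarrow> dot n c (\<lambda>l. if l = j then k else 0) = c j * k"
  "j < n \<Longrightarrow> dot n (\<lambda>l. if l = j then k else 0) c = k * c j"
proof -
  assume j: "j < n"
  have "dot n c (\<lambda>l. if l = j then k else 0) = (\<Sum>l<n. if l = j then c j * k else 0)"
    unfolding dot_def by (intro sum.cong) auto
  then show "dot n c (\<lambda>l. if l = j then k else 0) = c j * k" using j by simp
  have "dot n (\<lambda>l. if l = j then k else 0) c = (\<Sum>l<n. if l = j then k * c j else 0)"
    unfolding dot_def by (intro sum.cong) auto
  then show "dot n (\<lambda>l. if l = j then k else 0) c = k * c j" using j by simp
qed

lemma dot_linear:
  "dot n (\<lambda>l. a l + b l) g = dot n a g + dot n b g" "dot n (\<lambda>l. a l - b l) g = dot n a g - dot n b g"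
  "dot n (\<lambda>l. k * a l) g = k * dot n a g" "dot n (\<lambda>l. a l * k) g = dot n a g * k"
  "dot n c (\<lambda>l. a l + b l) = dot n c a + dot n c b" "dot n c (\<lambda>l. a l - b l) = dot n c a - dot n c b"
  "dot n c (\<lambda>l. k * a l) = k * dot n c a" "dot n c (\<lambda>l. a l * k) = dot n c a * k"
  by (simp_all add: dot_def sum.distrib sum_subtractf sum_distrib_left sum_distrib_right algebra_simps)

lemma dot_divide: "dot n (\<lambda>l. a l / k) g = dot n a g / k" "dot n c (\<lambda>l. a l / k) = dot n c a / k"
  for a :: "nat \<Rightarrow> 'k::field"
  by (simp_all only: divide_inverse dot_linear)

definition cols2 :: "(nat \<Rightarrow> 'k::zero) \<Rightarrow> (nat \<Rightarrow> 'k) \<Rightarrow> nat \<Rightarrow> nat \<Rightarrow> 'k" where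
  "cols2 g0 g1 = (\<lambda>i j. if j = 0 then g0 i else if j = 1 then g1 i else 0)"

lemma frame2_cols:
  assumes "n \<le> N" "\<And>i. \<not> i < n \<Longrightarrow> g0 i = 0" "\<And>i. \<not> i < n \<Longrightarrow> g1 i = 0" "\<And>i. \<not> i < n \<Longrightarrow> c0 i = 0" "\<And>i. \<not> i < n \<Longrightarrow> c1 i = 0"
    and "dot n c0 g0 = 1" "dot n c0 g1 = 0" "dot n c1 g0 = 0" "dot n c1 g1 = 1"
  shows "frame2 N n (cols2 g0 g1) (transposed (cols2 c0 c1))"
proof -
  have z: "g0 i \<noteq> 0 \<Longrightarrow> i < n" "g1 i \<noteq> 0 \<Longrightarrow> i < n" "c0 i \<noteq> 0 \<Longrightarrow> i < n" "c1 i \<noteq> 0 \<Longrightarrow> i < n" for i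
    using assms(2-5)[of i] by blast+
  have s: "supp n 2 (cols2 g0 g1)" "supp 2 n (transposed (cols2 c0 c1))"
    using z by (auto simp: supp_def cols2_def transposed_def split: if_splits)
  have "mm N (transposed (cols2 c0 c1)) (cols2 g0 g1) i j = idm 2 i j" for i j
    unfolding mm_supp_left[OF s(2) assms(1)]
    using assms(6-9)
    by (cases "i = 0 \<or> i = 1"; cases "j = 0 \<or> j = 1") (auto simp: dot_def cols2_def transposed_def idm_def)
  then show ?thesis using s by (simp add: frame2_def fun_eq_iff)
qed

lemma frame2_swap:
  assumes "frame2 N n G G'" "2 \<le> N"
  shows "frame2 N n (cols2 (\<lambda>i. G i 1) (\<lambda>i. G i 0)) (transposed (cols2 (\<lambda>i. G' 1 i) (\<lambda>i. G' 0 i)))"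
proof -
  let ?S = "mat2 0 1 1 (0 :: 'a)"
  have 1: "cols2 (\<lambda>i. G i 1) (\<lambda>i. G i 0) = mm N G ?S"
    by (auto simp: fun_eq_iff mm_mat2_entry[OF assms(2)] cols2_def)
  have 2: "transposed (cols2 (\<lambda>i. G' 1 i) (\<lambda>i. G' 0 i)) = mm N ?S G'"
    by (auto simp: fun_eq_iff mm_mat2_entry[OF assms(2)] cols2_def transposed_def)
  have i2: "idm 2 = mat2 1 0 0 (1 :: 'a)" by (auto simp: idm_def mat2_def fun_eq_iff)
  have "mm N (mm N ?S G') (mm N G ?S) = mm N ?S (mm N (mm N G' G) ?S)" by (simp add: mm_assoc)
  also have "\<dots> = idm 2" using assms by (simp add: frame2_def i2 mm_mat2)
  finally show ?thesis unfolding 1 2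
    using assms(1) supp_mm[OF _ supp_mat2[of 0 1 1 "0 :: 'a"]] supp_mm[OF supp_mat2[of 0 1 1 "0 :: 'a"]] by (auto simp: frame2_def)
qed

text \<open>A left inverse of a 2 x 2 matrix is a right inverse: with \<open>D\<close> the
  determinant, the entries of \<open>G'\<close> times \<open>D\<close> are those of the adjugate of
  \<open>G\<close>.\<close>

lemma frame2_square:
  fixes G :: "nat \<Rightarrow> nat \<Rightarrow> 'k::field"
  assumes "frame2 N 2 G G'" "2 \<le> N"
  shows "mm N G G' = idm 2"
proof -
  have i2: "idm 2 = mat2 1 0 0 (1 :: 'k)" by (auto simp: idm_def mat2_def fun_eq_iff)
  obtain a b c d where G: "G = mat2 a b c d" using assms(1) mat2_cases unfolding frame2_def by blast
  obtain a' b' c' d' where G': "G' = mat2 a' b' c' d'" using assms(1) mat2_cases unfolding frame2_def by blast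
  have e: "a' * a + b' * c = 1" "a' * b + b' * d = 0" "c' * a + d' * c = 0" "c' * b + d' * d = 1"
    using assms unfolding frame2_def G G' mm_mat2[OF assms(2)] i2 mat2_eq by auto
  have "a * a' + b * c' = 1 \<and> a * b' + b * d' = 0 \<and> c * a' + d * c' = 0 \<and> c * b' + d * d' = 1"
  proof -
    define D where "D = a * d - b * c"
    have "a' * D = d * (a' * a + b' * c) - c * (a' * b + b' * d)" "b' * D = a * (a' * b + b' * d) - b * (a' * a + b' * c)"
      "c' * D = d * (c' * a + d' * c) - c * (c' * b + d' * d)" "d' * D = a * (c' * b + d' * d) - b * (c' * a + d' * c)"
      unfolding D_def by (simp_all add: algebra_simps)
    then have D: "a' * D = d" "b' * D = - b" "c' * D = - c" "d' * D = a" by (simp_all add: e)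
    have "D * (a' * d' - b' * c') = (a' * D) * d' - (b' * D) * c'" by (simp add: algebra_simps)
    also have "\<dots> = 1" unfolding D using e(4) by (simp add: mult_ac add_ac)
    finally have D0: "D \<noteq> 0" by auto
    have "D * (a * a' + b * c' - 1) = a * (a' * D) + b * (c' * D) - D" "D * (a * b' + b * d') = a * (b' * D) + b * (d' * D)"
      "D * (c * a' + d * c') = c * (a' * D) + d * (c' * D)" "D * (c * b' + d * d' - 1) = c * (b' * D) + d * (d' * D) - D"
      by (simp_all add: algebra_simps)
    then have "D * (a * a' + b * c' - 1) = 0" "D * (a * b' + b * d') = 0" "D * (c * a' + d * c') = 0" "D * (c * b' + d * d' - 1) = 0"
      unfolding D by (simp_all add: D_def mult_ac)
    then show ?thesis using D0 by simp
  qed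
  then show ?thesis unfolding G G' mm_mat2[OF assms(2)] i2 mat2_eq .
qed

text \<open>The vector lies on the line of frame vector \<open>d\<close> and the covector on the
  line of dual vector \<open>i\<close>, zero multiples being allowed. For non-zero \<open>v\<close>
  and \<phi> the indices agree exactly when \<phi> does not vanish on \<open>v\<close>.\<close>

definition adapted :: "nat \<Rightarrow> nat \<Rightarrow> (nat \<Rightarrow> 'k::comm_ring_1) \<Rightarrow> (nat \<Rightarrow> 'k) \<Rightarrow> nat \<Rightarrow> nat \<Rightarrow> bool" where
  "adapted N n v \<phi> d i \<longleftrightarrow> (\<exists>G G' k k'. frame2 N n G G' \<and> (\<forall>j. v j = k * G j d) \<and> (\<forall>j. \<phi> j = k' * G' i j))"

lemma adapted_swap:
  assumes "adapted N n v \<phi> d i" "2 \<le> N" "d < 2" "i < 2"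
  shows "adapted N n v \<phi> (1 - d) (1 - i)"
proof -
  obtain G G' k k' where *: "frame2 N n G G'" "\<forall>j. v j = k * G j d" "\<forall>j. \<phi> j = k' * G' i j"
    using assms(1) unfolding adapted_def by blast
  show ?thesis unfolding adapted_def
    by (rule exI[of _ "cols2 (\<lambda>i. G i 1) (\<lambda>i. G i 0)"], rule exI[of _ "transposed (cols2 (\<lambda>i. G' 1 i) (\<lambda>i. G' 0 i))"],
        rule exI[of _ k], rule exI[of _ k'])
      (use *(2,3) assms(3,4) frame2_swap[OF *(1) assms(2)] in \<open>auto simp: cols2_def transposed_def less_2_cases_iff\<close>)
qed

text \<open>If \<phi> is non-zero on \<open>v\<close>, the frame is completed inside the kernel of
  \<phi>. If \<phi> vanishes on \<open>v\<close>, the second vector is one on which \<phi> takes the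
  value 1, and the first covector is corrected by a multiple of \<phi> to vanish there.\<close>

lemma adapted_nonzero:
  fixes v \<phi> :: "nat \<Rightarrow> 'k::field"
  assumes n: "2 \<le> n" "n \<le> N" and v: "\<And>i. \<not> i < n \<Longrightarrow> v i = 0" "v \<noteq> 0" and \<phi>: "\<And>i. \<not> i < n \<Longrightarrow> \<phi> i = 0" "\<phi> \<noteq> 0"
  shows "adapted N n v \<phi> 0 0 \<or> adapted N n v \<phi> 0 1"
proof (cases "dot n \<phi> v = 0")
  case False
  let ?k = "dot n \<phi> v"
  \<comment> \<open>The projection onto the kernel of \<phi> along \<open>v\<close>. It is non-zero
    because \<open>n \<ge> 2\<close>, and a non-zero entry supplies both the second vector (a
    column) and its covector (a normalised row).\<close>
  define P where "P i j = (if i = j then 1 else 0) - v i * \<phi> j / ?k" for i j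
  have "\<exists>k<n. \<exists>l<n. P k l \<noteq> 0"
  proof (rule ccontr)
    assume "\<not> ?thesis"
    then have "P k l = 0" if "k < 2" "l < 2" for k l using that n(1) by auto
    from this[of 0 0] this[of 0 1] this[of 1 0] this[of 1 1] show False by (auto simp: P_def)
  qed
  then obtain k l where kl: "k < n" "l < n" "P k l \<noteq> 0" by blast
  define g1 where "g1 i = (if i < n then P i l else 0)" for i
  define c1 where "c1 j = (if j < n then P k j / P k l else 0)" for j
  have g1: "g1 = (\<lambda>i. (if i = l then 1 else 0) - v i * (\<phi> l / ?k))"
    using kl v(1) by (auto simp: g1_def P_def fun_eq_iff)
  have c1: "c1 = (\<lambda>j. ((if j = k then 1 else 0) - (v k / ?k) * \<phi> j) * (1 / P k l))"
    using kl \<phi>(1) by (auto simp: c1_def P_def fun_eq_iff)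
  have "dot n c1 v = 0" using False kl by (simp add: c1 dot_linear dot_divide dot_unit)
  moreover have "dot n \<phi> g1 = 0" using False kl by (simp add: g1 dot_linear dot_divide dot_unit)
  moreover have "dot n c1 g1 = c1 l" using \<open>dot n c1 v = 0\<close> kl(2) by (simp add: g1 dot_linear dot_divide dot_unit)
  then have "dot n c1 g1 = 1" using kl by (simp add: c1_def)
  ultimately have "frame2 N n (cols2 v g1) (transposed (cols2 (\<lambda>j. \<phi> j / ?k) c1))"
    using False by (intro frame2_cols n v(1)) (auto simp: \<phi>(1) g1_def c1_def divide_inverse dot_linear)
  then have "adapted N n v \<phi> 0 0" unfolding adapted_def
    by (rule_tac exI[of _ "cols2 v g1"], rule_tac exI[of _ "transposed (cols2 (\<lambda>j. \<phi> j / ?k) c1)"], rule_tac exI[of _ 1], rule_tac exI[of _ ?k])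
      (use False in \<open>simp add: cols2_def transposed_def\<close>)
  then show ?thesis ..
next
  case True
  obtain j where j: "\<phi> j \<noteq> 0" "j < n" using \<phi> by (auto simp: fun_eq_iff)
  obtain l where l: "v l \<noteq> 0" "l < n" using v by (auto simp: fun_eq_iff)
  define g1 where "g1 = (\<lambda>i. if i = j then 1 / \<phi> j else 0)"
  define c where "c = (if l = j then 1 / (\<phi> j * v l) else 0)"
  define c0 where "c0 = (\<lambda>i. (if i = l then 1 / v l else 0) - c * \<phi> i)"
  have "dot n c0 v = 1" "dot n \<phi> g1 = 1" "dot n c0 g1 = 0"
    using True j l by (simp_all add: c0_def g1_def dot_linear dot_unit c_def)
  then have "frame2 N n (cols2 v g1) (transposed (cols2 c0 \<phi>))"
    using True j l by (intro frame2_cols n v(1) \<phi>(1)) (auto simp: g1_def c0_def \<phi>(1))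
  then have "adapted N n v \<phi> 0 1" unfolding adapted_def
    by (rule_tac exI[of _ "cols2 v g1"], rule_tac exI[of _ "transposed (cols2 c0 \<phi>)"], rule_tac exI[of _ 1], rule_tac exI[of _ 1])
      (simp add: cols2_def transposed_def)
  then show ?thesis ..
qed

text \<open>Swapping the two frame vectors turns a position \<open>(d, i)\<close> into
  \<open>(1 - d, 1 - i)\<close>, so one index can be prescribed. A zero vector or covector is
  replaced by a dummy, after which the index belonging to it is free and both can be
  prescribed.\<close>

lemma adapted_frame:
  fixes v \<phi> :: "nat \<Rightarrow> 'k::field"
  assumes n: "2 \<le> n" "n \<le> N" and v: "\<And>i. \<not> i < n \<Longrightarrow> v i = 0" and \<phi>: "\<And>i. \<not> i < n \<Longrightarrow> \<phi> i = 0"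
  shows "i < 2 \<Longrightarrow> \<exists>d<2. adapted N n v \<phi> d i"
    and "d < 2 \<Longrightarrow> \<exists>i<2. adapted N n v \<phi> d i"
    and "v = 0 \<or> \<phi> = 0 \<Longrightarrow> d < 2 \<Longrightarrow> i < 2 \<Longrightarrow> adapted N n v \<phi> d i"
proof -
  have N: "2 \<le> N" using n by simp
  let ?e = "\<lambda>i. if i = 0 then 1 else 0 :: 'k"
  define w where "w = (if v = 0 then ?e else v)"
  define \<psi> where "\<psi> = (if \<phi> = 0 then ?e else \<phi>)"
  have w: "w i = 0" if "\<not> i < n" for i using that n v by (auto simp: w_def)
  have \<psi>: "\<psi> i = 0" if "\<not> i < n" for i using that n \<phi> by (auto simp: \<psi>_def)
  have nz: "w \<noteq> 0" "\<psi> \<noteq> 0" by (auto simp: w_def \<psi>_def fun_eq_iff)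
  have "adapted N n w \<psi> 0 0 \<or> adapted N n w \<psi> 0 1" by (rule adapted_nonzero[OF n w nz(1) \<psi> nz(2)])
  then have "adapted N n w \<psi> 0 0 \<and> adapted N n w \<psi> 1 1 \<or> adapted N n w \<psi> 0 1 \<and> adapted N n w \<psi> 1 0"
    using adapted_swap[OF _ N, of n w \<psi> 0 0] adapted_swap[OF _ N, of n w \<psi> 0 1] by auto
  then have ex: "\<exists>d<2. adapted N n w \<psi> d i" "\<exists>j<2. adapted N n w \<psi> i j" if "i < 2" for i
    using that less_2_cases[of i] by (auto simp: less_2_cases_iff)
  have to: "adapted N n v \<phi> d i" if ad: "adapted N n w \<psi> d' i'" and that: "v = 0 \<or> d = d'" "\<phi> = 0 \<or> i = i'" for d d' i i'
  proof -
    obtain G G' k k' where *: "frame2 N n G G'" "\<forall>j. w j = k * G j d'" "\<forall>j. \<psi> j = k' * G' i' j"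
      using ad unfolding adapted_def by blast
    show ?thesis unfolding adapted_def
    proof (rule exI[of _ G], rule exI[of _ G'], rule exI[of _ "if v = 0 then 0 else k"],
        rule exI[of _ "if \<phi> = 0 then 0 else k'"], intro conjI allI)
      show "v j = (if v = 0 then 0 else k) * G j d" for j using * that(1) by (auto simp: w_def)
      show "\<phi> j = (if \<phi> = 0 then 0 else k') * G' i j" for j using * that(2) by (auto simp: \<psi>_def)
    qed (rule *(1))
  qed
  show "\<exists>d<2. adapted N n v \<phi> d i" if "i < 2" using ex(1)[OF that] to by blast
  show "\<exists>i<2. adapted N n v \<phi> d i" if "d < 2" using ex(2)[OF that] to by blast
  show "adapted N n v \<phi> d i" if "v = 0 \<or> \<phi> = 0" "d < 2" "i < 2"
    using ex(1)[OF that(3)] ex(2)[OF that(2)] that(1) to by blast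
qed

lemma corner_good:
  fixes E E' F F' H H' X Y A X' Y' A' :: "nat \<Rightarrow> nat \<Rightarrow> 'k::field"
  assumes fr: "frame2 N 2 E E'" "frame2 N 2 F F'" "frame2 N a H H'" and N: "N = 2 + 2 + a"
    and nz: "\<alpha> \<noteq> 0" "\<beta> \<noteq> 0" "\<gamma> \<noteq> 0"
    and s: "supp 2 2 X" "supp 2 2 Y" "supp 2 2 A" "supp 2 2 X'" "supp 2 2 Y'" "supp 2 2 A'"
    and inj: "\<And>\<phi> \<phi>'. supp 2 a \<phi> \<Longrightarrow> supp 2 a \<phi>' \<Longrightarrow> mm N Y \<phi> = 0 \<Longrightarrow> mm N Y' \<phi> + mm N Y \<phi>' = 0 \<Longrightarrow> \<phi> = 0"
    and sur: "\<And>\<psi> \<psi>'. supp a 2 \<psi> \<Longrightarrow> supp a 2 \<psi>' \<Longrightarrow> mm N \<psi> A = 0 \<Longrightarrow> mm N \<psi> A' + mm N \<psi>' A = 0 \<Longrightarrow> \<psi> = 0"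
    and M: "M \<subseteq> rep_space (dims 2 2 2)" "finite M" "card M \<le> 2" and rig: "rigid N 2 2 2 X Y A X' Y' A' M"
  shows "good_point 2 2 2 a (mm N F (mm N (scaled \<alpha> X) E')) (mm N H (mm N (scaled \<beta> Y) F')) (mm N E (mm N (scaled \<gamma> A) H'))"
proof (rule good_point_base_change[OF _ _ _ _ _ _ _ _ _ _ _ _ _ _ _ _ _ _ _ _ _ rigid_scaled[OF nz rig] N])
  have "2 \<le> N" using N by simp
  then show "mm N E E' = idm 2" "mm N F F' = idm 2" using frame2_square[OF fr(1)] frame2_square[OF fr(2)] by auto
  show "mm N H H' = idm a \<or>
      (\<forall>\<phi> \<phi>'. supp 2 a \<phi> \<longrightarrow> supp 2 a \<phi>' \<longrightarrow> mm N (scaled \<beta> Y) \<phi> = 0 \<longrightarrow>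
         mm N (scaled \<beta> Y') \<phi> + mm N (scaled \<beta> Y) \<phi>' = 0 \<longrightarrow> \<phi> = 0) \<and>
      (\<forall>\<psi> \<psi>'. supp a 2 \<psi> \<longrightarrow> supp a 2 \<psi>' \<longrightarrow> mm N \<psi> (scaled \<gamma> A) = 0 \<longrightarrow>
         mm N \<psi> (scaled \<gamma> A') + mm N \<psi>' (scaled \<gamma> A) = 0 \<longrightarrow> \<psi> = 0)"
    using inj sur unfolding scaled_simps(1,2) scaled_simps(3)[symmetric] scaled_eq_0[OF nz(2)] scaled_eq_0[OF nz(3)] by blast
  show "card ((\<lambda>v. mk_rep (scaled \<alpha> (arrow v 0)) (scaled \<beta> (arrow v 1)) (scaled \<gamma> (arrow v 2))) ` M) \<le> 2"
    using card_image_le[OF M(2)] M(3) le_trans by blast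
  show "(\<lambda>v. mk_rep (scaled \<alpha> (arrow v 0)) (scaled \<beta> (arrow v 1)) (scaled \<gamma> (arrow v 2))) ` M \<subseteq> rep_space (dims 2 2 2)"
    using M(1) by (auto elim!: rep_cases simp: mk_rep_mem supp_scaled)
qed (use fr s M(2) N in \<open>simp_all add: frame2_def supp_scaled\<close>)

text \<open>A 0/1 diagonal up to a non-zero factor. The factor stays non-zero even for the zero
  matrix, so that it can always be removed by \<open>rigid_scaled\<close>.\<close>

definition diag_shape :: "(nat \<Rightarrow> nat \<Rightarrow> 'k::comm_ring_1) \<Rightarrow> bool" where
  "diag_shape X \<longleftrightarrow> (\<exists>\<alpha> a0 a1. \<alpha> \<noteq> 0 \<and> a0 \<in> {0, 1} \<and> a1 \<in> {0, 1} \<and> X = scaled \<alpha> (mat2 a0 0 0 a1))"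

lemma diag_shape_munit: "i < 2 \<Longrightarrow> diag_shape (munit c i i)"
proof -
  assume "i < 2"
  then have i: "i = 0 \<or> i = 1" by auto
  show ?thesis
  proof (cases "c = 0")
    case True
    then have "munit c i i = scaled 1 (mat2 0 0 0 0)" by (auto simp: munit_def scaled_def mat2_def fun_eq_iff)
    then show ?thesis unfolding diag_shape_def by (metis insertI1 zero_neq_one)
  next
    case False
    have *: "munit c 0 0 = scaled c (mat2 1 0 0 0)" "munit c 1 1 = scaled c (mat2 0 0 0 1)"
      by (auto simp: munit_def scaled_def mat2_def fun_eq_iff)
    show ?thesis using i False unfolding diag_shape_def
    proof (elim disjE)
      assume i: "i = 0"
      show "\<exists>\<alpha> a0 a1. \<alpha> \<noteq> 0 \<and> a0 \<in> {0, 1} \<and> a1 \<in> {0, 1} \<and> munit c i i = scaled \<alpha> (mat2 a0 0 0 a1)"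
        unfolding i * using False by (intro exI[of _ c] exI[of _ 1] exI[of _ 0]) simp
    next
      assume i: "i = 1"
      show "\<exists>\<alpha> a0 a1. \<alpha> \<noteq> 0 \<and> a0 \<in> {0, 1} \<and> a1 \<in> {0, 1} \<and> munit c i i = scaled \<alpha> (mat2 a0 0 0 a1)"
        unfolding i * using False by (intro exI[of _ c] exI[of _ 0] exI[of _ 1]) simp
    qed
  qed
qed

lemma diag_shape_idm: "diag_shape (idm 2)"
proof -
  have "idm 2 = scaled 1 (mat2 1 0 0 (1 :: 'a))" by (auto simp: idm_def mat2_def scaled_def fun_eq_iff)
  then show ?thesis unfolding diag_shape_def by (intro exI[of _ 1] exI) auto
qed

text \<open>For \<open>d \<noteq> c\<close> the entry of \<open>z\<close> is off the diagonal and
  the deformation is one 6-cycle, whatever the bits. For \<open>d = c\<close> there are two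
  3-cycles, and \<open>rigid_diag_corner\<close> then asks each of \<open>X\<close> and
  \<open>Y\<close> to carry a non-zero entry already; hence the hypothesis on vanishing
  arrows.\<close>

lemma monomial_good:
  fixes E E' F F' H H' X Y :: "nat \<Rightarrow> nat \<Rightarrow> 'k::field_char_0"
  assumes fr: "frame2 N 2 E E'" "frame2 N 2 F F'" "frame2 N a H H'" and N: "N = 2 + 2 + a"
    and XY: "diag_shape X" "diag_shape Y" and dc: "d < 2" "c < 2" and nz: "X = 0 \<or> Y = 0 \<or> g = 0 \<Longrightarrow> d \<noteq> c"
  shows "good_point 2 2 2 a (mm N F (mm N X E')) (mm N H (mm N Y F')) (mm N E (mm N (munit g d c) H'))"
proof -
  have N2: "2 \<le> N" using N by simp
  obtain \<alpha> a0 a1 where X: "\<alpha> \<noteq> 0" "a0 \<in> {0, 1}" "a1 \<in> {0, 1}" "X = scaled \<alpha> (mat2 a0 0 0 a1)"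
    using XY(1) unfolding diag_shape_def by blast
  obtain \<beta> b0 b1 where Y: "\<beta> \<noteq> 0" "b0 \<in> {0, 1}" "b1 \<in> {0, 1}" "Y = scaled \<beta> (mat2 b0 0 0 b1)"
    using XY(2) unfolding diag_shape_def by blast
  note bits = X(2,3) Y(2,3)
  have card2: "card {x, y} \<le> 2" for x y :: "nat \<times> nat \<times> nat \<Rightarrow> 'k" by (simp add: card_insert_if)
  have key: "good_point 2 2 2 a (mm N F (mm N X E')) (mm N H (mm N Y F')) (mm N E (mm N (munit g d c) H'))"
    if "munit g d c = scaled \<gamma> (mat2 z1 z2 z3 z4)" "\<gamma> \<noteq> 0"
      and rig: "rigid N 2 2 2 (mat2 a0 0 0 a1) (mat2 b0 0 0 b1) (mat2 z1 z2 z3 z4)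
        (mat2 (1 - a0) 0 0 (1 - a1)) (mat2 (1 - b0) 0 0 (1 - b1)) (mat2 z1' z2' z3' z4') {v, w}"
      and vw: "v \<in> rep_space (dims 2 2 2)" "w \<in> rep_space (dims 2 2 2)"
      and sur: "\<And>\<psi> \<psi>'. supp a 2 \<psi> \<Longrightarrow> supp a 2 \<psi>' \<Longrightarrow> mm N \<psi> (mat2 z1 z2 z3 z4) = 0 \<Longrightarrow>
        mm N \<psi> (mat2 z1' z2' z3' z4') + mm N \<psi>' (mat2 z1 z2 z3 z4) = 0 \<Longrightarrow> \<psi> = 0"
    for \<gamma> z1 z2 z3 z4 z1' z2' z3' z4' v w
    unfolding X(4) Y(4) that(1)
    by (rule corner_good[OF fr N X(1) Y(1) that(2) supp_mat2 supp_mat2 supp_mat2 supp_mat2 supp_mat2 supp_mat2 _ sur _ _ card2 rig])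
      (use vw bits_injective[OF N2 bits(3,4)] in auto)
  have mem: "mk_rep (mat2 x1 x2 x3 x4) (mat2 y1 y2 y3 y4) (mat2 z1 z2 z3 z4) \<in> rep_space (dims 2 2 2)"
    for x1 x2 x3 x4 y1 y2 y3 y4 z1 z2 z3 z4 :: 'k by (simp add: mk_rep_mem supp_mat2)
  have ps: "\<psi> = 0" if "supp a 2 \<psi>" "\<And>i. \<psi> i 0 = 0 \<and> \<psi> i 1 = 0" for \<psi> :: "nat \<Rightarrow> nat \<Rightarrow> 'k"
    using that by (simp add: supp_eq_0_iff less_2_cases_iff)
  consider "g = 0" | "g \<noteq> 0" "d = 1" "c = 0" | "g \<noteq> 0" "d = 0" "c = 1" | "g \<noteq> 0" "d = 0" "c = 0" "X \<noteq> 0" "Y \<noteq> 0"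
    | "g \<noteq> 0" "d = 1" "c = 1" "X \<noteq> 0" "Y \<noteq> 0"
    using dc nz by (auto simp: less_2_cases_iff)
  then show ?thesis
  proof cases
    case 1
    then have "munit g d c = scaled 1 (mat2 0 0 0 0)" by (auto simp: munit_def scaled_def mat2_def fun_eq_iff)
    then show ?thesis
      by (rule key[OF _ one_neq_zero rigid_swap_corner(3)[OF N2 bits] mem mem]) (rule ps, auto simp: mm_mat2_eq_0[OF N2])
  next
    case 2
    then have "munit g d c = scaled g (mat2 0 0 1 0)" by (auto simp: munit_def scaled_def mat2_def fun_eq_iff)
    then show ?thesis
      by (rule key[OF _ 2(1) rigid_swap_corner(1)[OF N2 bits] mem mem]) (rule ps, auto simp: mm_mat2_eq_0[OF N2])
  next
    case 3
    then have "munit g d c = scaled g (mat2 0 1 0 0)" by (auto simp: munit_def scaled_def mat2_def fun_eq_iff)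
    then show ?thesis
      by (rule key[OF _ 3(1) rigid_swap_corner(2)[OF N2 bits] mem mem]) (rule ps, auto simp: mm_mat2_eq_0[OF N2])
  next
    case 4
    then have nz': "a0 \<noteq> 0 \<or> a1 \<noteq> 0" "b0 \<noteq> 0 \<or> b1 \<noteq> 0"
      unfolding X(4) Y(4) scaled_eq_0[OF X(1)] scaled_eq_0[OF Y(1)] mat2_eq_0 by auto
    have "munit g d c = scaled g (mat2 1 0 0 0)" using 4 by (auto simp: munit_def scaled_def mat2_def fun_eq_iff)
    then show ?thesis
      by (rule key[OF _ 4(1) rigid_diag_corner(1)[OF N2 bits nz'] mem mem]) (rule ps, auto simp: mm_mat2_eq_0[OF N2])
  next
    case 5
    then have nz': "a0 \<noteq> 0 \<or> a1 \<noteq> 0" "b0 \<noteq> 0 \<or> b1 \<noteq> 0"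
      unfolding X(4) Y(4) scaled_eq_0[OF X(1)] scaled_eq_0[OF Y(1)] mat2_eq_0 by auto
    have "munit g d c = scaled g (mat2 0 0 0 1)" using 5 by (auto simp: munit_def scaled_def mat2_def fun_eq_iff)
    then show ?thesis
      by (rule key[OF _ 5(1) rigid_diag_corner(2)[OF N2 bits nz'] mem mem]) (rule ps, auto simp: mm_mat2_eq_0[OF N2])
  qed
qed

section \<open>A third basis vector at vertex 2\<close>

definition mat3 :: "'k::zero \<Rightarrow> 'k \<Rightarrow> 'k \<Rightarrow> 'k \<Rightarrow> 'k \<Rightarrow> 'k \<Rightarrow> 'k \<Rightarrow> 'k \<Rightarrow> 'k \<Rightarrow> nat \<Rightarrow> nat \<Rightarrow> 'k" where
  "mat3 a b c d e f g h k = (\<lambda>i j.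
     if i = 0 then if j = 0 then a else if j = 1 then b else if j = 2 then c else 0
     else if i = 1 then if j = 0 then d else if j = 1 then e else if j = 2 then f else 0
     else if i = 2 then if j = 0 then g else if j = 1 then h else if j = 2 then k else 0 else 0)"

lemma supp_mat3: "supp 3 3 (mat3 a b c d e f g h k)"
  by (auto simp: supp_def mat3_def split: if_splits)

lemma mat3_cases:
  assumes "supp r c A" "r \<le> 3" "c \<le> 3"
  obtains "A = mat3 (A 0 0) (A 0 1) (A 0 2) (A 1 0) (A 1 1) (A 1 2) (A 2 0) (A 2 1) (A 2 2)"
proof -
  have "A i j = mat3 (A 0 0) (A 0 1) (A 0 2) (A 1 0) (A 1 1) (A 1 2) (A 2 0) (A 2 1) (A 2 2) i j" for i j
  proof (cases "i < 3 \<and> j < 3")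
    case True
    then show ?thesis by (auto simp: mat3_def less_3_iff)
  next
    case False
    then have "A i j = 0" using assms(2,3) by (intro suppD[OF assms(1)]) auto
    then show ?thesis using False suppD[OF supp_mat3 False] by metis
  qed
  then have "A = mat3 (A 0 0) (A 0 1) (A 0 2) (A 1 0) (A 1 1) (A 1 2) (A 2 0) (A 2 1) (A 2 2)" by (intro ext)
  then show ?thesis by (rule that)
qed

lemma mat3_eq: "mat3 a b c d e f g h k = mat3 a' b' c' d' e' f' g' h' k' \<longleftrightarrow>
  a = a' \<and> b = b' \<and> c = c' \<and> d = d' \<and> e = e' \<and> f = f' \<and> g = g' \<and> h = h' \<and> k = k'"
proof
  assume "mat3 a b c d e f g h k = mat3 a' b' c' d' e' f' g' h' k'"
  then have "mat3 a b c d e f g h k i j = mat3 a' b' c' d' e' f' g' h' k' i j" for i j by simp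
  from this[of 0 0] this[of 0 1] this[of 0 2] this[of 1 0] this[of 1 1] this[of 1 2] this[of 2 0] this[of 2 1] this[of 2 2]
  show "a = a' \<and> b = b' \<and> c = c' \<and> d = d' \<and> e = e' \<and> f = f' \<and> g = g' \<and> h = h' \<and> k = k'" by (simp add: mat3_def)
qed simp

lemma mm_mat3:
  assumes "3 \<le> N"
  shows "mm N (mat3 a b c d e f g h k) (mat3 a' b' c' d' e' f' g' h' k') =
    mat3 (a * a' + b * d' + c * g') (a * b' + b * e' + c * h') (a * c' + b * f' + c * k')
      (d * a' + e * d' + f * g') (d * b' + e * e' + f * h') (d * c' + e * f' + f * k')
      (g * a' + h * d' + k * g') (g * b' + h * e' + k * h') (g * c' + h * f' + k * k')"
proof -
  have 3: "{..<3} = {0, 1, 2::nat}" by auto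
  have *: "mm N (mat3 a b c d e f g h k) B i j = mat3 a b c d e f g h k i 0 * B 0 j
      + mat3 a b c d e f g h k i 1 * B 1 j + mat3 a b c d e f g h k i 2 * B 2 j" for B i j
    unfolding mm_supp_left[OF supp_mat3 assms] 3 by (simp add: add.assoc)
  show ?thesis unfolding fun_eq_iff * by (simp add: mat3_def)
qed

lemma mat3_ops: "mat3 a b c d e f g h k + mat3 a' b' c' d' e' f' g' h' k' =
  mat3 (a + a') (b + b') (c + c') (d + d') (e + e') (f + f') (g + g') (h + h') (k + k' :: 'k::monoid_add)"
  by (simp add: mat3_def fun_eq_iff)

lemma tr_mat3: "3 \<le> N \<Longrightarrow> tr N (mat3 a b c d e f g h k) = a + e + k"
proof -
  assume N: "3 \<le> N"
  have "tr N (mat3 a b c d e f g h k) = (\<Sum>i<3. mat3 a b c d e f g h k i i)"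
    unfolding tr_def by (rule sum.mono_neutral_right) (use N in \<open>auto simp: mat3_def\<close>)
  then show ?thesis by (simp add: mat3_def eval_nat_numeral)
qed

lemma mat3_special: "mat2 a b c d = mat3 a b 0 c d 0 0 0 0" "munit e 0 2 = mat3 0 0 e 0 0 0 0 0 0"
  "idm 2 = mat3 1 0 0 0 1 0 0 0 0" "0 = mat3 0 0 0 0 0 0 0 0 0"
  by (auto simp: mat2_def mat3_def munit_def idm_def fun_eq_iff)

text \<open>Here \<open>y\<close> is the inclusion of the first two basis vectors of vertex 2 and
  \<open>z\<close> is supported on the third. No frame of the image of \<open>y\<close> can express
  such a \<open>z\<close>, so the small model has dimension 3 at this vertex; the deformation of
  \<open>z\<close> closes the cycle through the image of \<open>y\<close>.\<close>

lemma rigid_third_vector: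
  fixes a0 a1 :: "'k::field_char_0"
  assumes N: "3 \<le> N" and bits: "a0 \<in> {0, 1}" "a1 \<in> {0, 1}"
  shows "rigid N 2 2 3 (mat2 a0 0 0 a1) (idm 2) (munit 1 0 2) (mat2 (1 - a0) 0 0 (1 - a1)) 0 (mat2 0 1 1 0)
    {mk_rep 0 0 (mat2 0 0 1 0), mk_rep 0 0 (mat2 1 0 0 1)}"
  unfolding rigid_def
proof (intro allI impI)
  fix p q s p' q' s' :: "nat \<Rightarrow> nat \<Rightarrow> 'k"
  assume sp: "supp 2 2 p" "supp 2 3 q" "supp 3 2 s" "supp 2 2 p'" "supp 2 3 q'" "supp 3 2 s'"
    and ct: "commuting_tangent N (mat2 a0 0 0 a1) (idm 2) (munit 1 0 2) (mat2 (1 - a0) 0 0 (1 - a1)) 0 (mat2 0 1 1 0) p q s p' q' s'"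
    and M0: "\<forall>v\<in>{mk_rep 0 0 (mat2 0 0 1 0), mk_rep 0 0 (mat2 1 0 0 1)}. pairing N p q s v = 0"
  obtain p1 p2 p3 p4 where p: "p = mat2 p1 p2 p3 p4" by (rule mat2_cases[OF sp(1)])
  obtain p1' p2' p3' p4' where p': "p' = mat2 p1' p2' p3' p4'" by (rule mat2_cases[OF sp(4)])
  have q: "q = mat3 (q 0 0) (q 0 1) (q 0 2) (q 1 0) (q 1 1) (q 1 2) 0 0 0"
    by (rule mat3_cases[OF sp(2)]) (use sp(2) in \<open>simp_all add: suppD\<close>)
  have q': "q' = mat3 (q' 0 0) (q' 0 1) (q' 0 2) (q' 1 0) (q' 1 1) (q' 1 2) 0 0 0"
    by (rule mat3_cases[OF sp(5)]) (use sp(5) in \<open>simp_all add: suppD\<close>)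
  have s: "s = mat3 (s 0 0) (s 0 1) 0 (s 1 0) (s 1 1) 0 (s 2 0) (s 2 1) 0"
    by (rule mat3_cases[OF sp(3)]) (use sp(3) in \<open>simp_all add: suppD\<close>)
  have s': "s' = mat3 (s' 0 0) (s' 0 1) 0 (s' 1 0) (s' 1 1) 0 (s' 2 0) (s' 2 1) 0"
    by (rule mat3_cases[OF sp(6)]) (use sp(6) in \<open>simp_all add: suppD\<close>)
  obtain q1 q2 q3 q4 q5 q6 where q: "q = mat3 q1 q2 q3 q4 q5 q6 0 0 0" using q by blast
  obtain q1' q2' q3' q4' q5' q6' where q': "q' = mat3 q1' q2' q3' q4' q5' q6' 0 0 0" using q' by blast
  obtain s1 s2 s3 s4 s5 s6 where s: "s = mat3 s1 s2 0 s3 s4 0 s5 s6 0" using s by blast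
  obtain s1' s2' s3' s4' s5' s6' where s': "s' = mat3 s1' s2' 0 s3' s4' 0 s5' s6' 0" using s' by blast
  note eqs = ct[unfolded commuting_tangent_def commuting_def p q s p' q' s' mat3_special mm_mat3[OF N] mat3_ops mat3_eq]
    M0[unfolded ball_simps pairing_mk_rep p q s mat3_special mm_mat3[OF N] tr_mat3[OF N]]
  show "p = 0 \<and> q = 0 \<and> s = 0"
    unfolding p q s mat3_special mat3_eq using bits by (elim insertE emptyE; hypsubst; use eqs in clarsimp)
qed

section \<open>Assembling frames around the cycle\<close>

definition outer :: "(nat \<Rightarrow> 'k::comm_ring_1) \<Rightarrow> (nat \<Rightarrow> 'k) \<Rightarrow> nat \<Rightarrow> nat \<Rightarrow> 'k" where
  "outer v \<phi> = (\<lambda>i j. v i * \<phi> j)"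

lemma mm_outer:
  "mm N A (outer v \<phi>) = outer (\<lambda>i. \<Sum>l<N. A i l * v l) \<phi>"
  "mm N (outer v \<phi>) A = outer v (\<lambda>j. \<Sum>l<N. \<phi> l * A l j)"
  by (simp_all add: outer_def mm_def fun_eq_iff sum_distrib_left sum_distrib_right mult_ac)

lemma outer_frame:
  assumes "\<forall>j. v j = k * G j d" "\<forall>j. \<phi> j = k' * G' i j" "d < N" "i < N"
  shows "outer v \<phi> = mm N G (mm N (munit (k * k') d i) G')"
  using assms by (simp add: fun_eq_iff outer_def mm_munit mult_ac)

lemma supp_outer: "(\<And>i. \<not> i < a \<Longrightarrow> v i = 0) \<Longrightarrow> (\<And>j. \<not> j < b \<Longrightarrow> \<phi> j = 0) \<Longrightarrow> supp a b (outer v \<phi>)"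
  unfolding supp_def outer_def by (metis mult_zero_left mult_zero_right)

text \<open>Either some 2 x 2 minor is non-zero and Cramer's rule gives a left inverse, or all
  minors vanish and one non-zero entry writes \<open>y\<close> as an outer product. The factors are
  chosen to vanish together, so that \<open>y = 0\<close> needs no separate case later.\<close>

lemma rank_one_or_frame:
  fixes y :: "nat \<Rightarrow> nat \<Rightarrow> 'k::field"
  assumes y: "supp a 2 y" and N: "a \<le> N"
  obtains L where "frame2 N a y L"
  | h \<eta> where "\<And>i. \<not> i < a \<Longrightarrow> h i = 0" "\<And>j. \<not> j < 2 \<Longrightarrow> \<eta> j = 0" "h = 0 \<longleftrightarrow> \<eta> = 0" "y = outer h \<eta>"
proof -
  have out: "y i j = 0" if "\<not> i < a \<or> \<not> j < 2" for i j using that y by (auto simp: suppD)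
  show thesis
  proof (cases "\<exists>i<a. \<exists>j<a. y i 0 * y j 1 - y j 0 * y i 1 \<noteq> 0")
    case True
    then obtain i j where ij: "i < a" "j < a" "y i 0 * y j 1 - y j 0 * y i 1 \<noteq> 0" by blast
    define D where "D = y i 0 * y j 1 - y j 0 * y i 1"
    define c0 where "c0 = (\<lambda>l. (if l = i then y j 1 / D else 0) - (if l = j then y i 1 / D else 0))"
    define c1 where "c1 = (\<lambda>l. (if l = j then y i 0 / D else 0) - (if l = i then y j 0 / D else 0))"
    have D: "D \<noteq> 0" using ij by (simp add: D_def)
    have yc: "y = cols2 (\<lambda>i. y i 0) (\<lambda>i. y i 1)" using out by (auto simp: cols2_def fun_eq_iff)
    have "frame2 N a (cols2 (\<lambda>i. y i 0) (\<lambda>i. y i 1)) (transposed (cols2 c0 c1))"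
    proof (rule frame2_cols[OF N])
      have *: "dot a c0 g = (y j 1 * g i - y i 1 * g j) / D" "dot a c1 g = (y i 0 * g j - y j 0 * g i) / D" for g
        using ij by (simp_all add: c0_def c1_def dot_linear dot_unit diff_divide_distrib)
      show "dot a c0 (\<lambda>i. y i 0) = 1" "dot a c1 (\<lambda>i. y i 1) = 1" using D by (simp_all add: * D_def mult_ac)
      show "dot a c0 (\<lambda>i. y i 1) = 0" "dot a c1 (\<lambda>i. y i 0) = 0" by (simp_all add: * mult_ac)
    qed (use ij out in \<open>auto simp: c0_def c1_def\<close>)
    then show thesis using that(1) yc by metis
  next
    case minors: False
    have m: "y i 0 * y j 1 = y j 0 * y i 1" for i j
      using minors out[of i] out[of j] by (cases "i < a \<and> j < a") auto
    show thesis
    proof (cases "y = 0")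
      case True
      then show thesis by (intro that(2)[of 0 0]) (auto simp: outer_def fun_eq_iff)
    next
      case False
      then obtain k l where kl: "y k l \<noteq> 0" by (auto simp: fun_eq_iff)
      then have kl': "k < a" "l < 2" using y by (auto simp: supp_def)
      have "y i j = y i l * (y k j / y k l)" for i j
      proof (cases "j < 2")
        case True
        then have "y i j * y k l = y i l * y k j"
          using m[of i k] m[of k i] kl'(2) by (auto simp: less_2_cases_iff mult_ac)
        then show ?thesis using kl by (simp add: field_simps)
      qed (simp add: out)
      then have "y = outer (\<lambda>i. y i l) (\<lambda>j. y k j / y k l)" unfolding outer_def by (intro ext)
      moreover have "(\<lambda>i. y i l) \<noteq> 0" "(\<lambda>j. y k j / y k l) \<noteq> 0" using kl by (auto simp: fun_eq_iff)
      ultimately show thesis by (intro that(2)[of "\<lambda>i. y i l" "\<lambda>j. y k j / y k l"]) (auto simp: out)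
    qed
  qed
qed

lemma frame2_compose:
  fixes F :: "nat \<Rightarrow> nat \<Rightarrow> 'k::field"
  assumes "frame2 N 2 F F'" "frame2 N a y L" "2 \<le> N"
  shows "frame2 N a (mm N y F) (mm N F' L)" "mm N (mm N y F) (mm N (idm 2) F') = y"
proof -
  have s: "supp 2 2 F" "supp 2 2 F'" "supp a 2 y" "supp 2 a L" and i: "mm N F' F = idm 2" "mm N L y = idm 2"
    using assms by (auto simp: frame2_def)
  have "mm N (mm N F' L) (mm N y F) = mm N F' (mm N (mm N L y) F)" by (simp add: mm_assoc)
  also have "\<dots> = idm 2" by (simp add: i mm_idm(1)[OF s(1) assms(3)])
  finally show "frame2 N a (mm N y F) (mm N F' L)" using s supp_mm by (auto simp: frame2_def)
  have "mm N (mm N y F) (mm N (idm 2) F') = mm N y (mm N F F')"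
    by (simp add: mm_idm(1)[OF s(2) assms(3)] mm_assoc)
  then show "mm N (mm N y F) (mm N (idm 2) F') = y"
    by (simp add: frame2_square[OF assms(1,3)] mm_idm(2)[OF s(3) assms(3)])
qed

lemma idm2_nonzero: "idm 2 \<noteq> (0 :: nat \<Rightarrow> nat \<Rightarrow> 'k::zero_neq_one)"
proof
  assume "idm 2 = (0 :: nat \<Rightarrow> nat \<Rightarrow> 'k)"
  then have "idm 2 0 0 = (0 :: 'k)" by simp
  then show False by (simp add: idm_def)
qed

text \<open>The hypothesis says that \<zeta> divided by \<open>k\<close> acts on the image of
  \<open>y F\<close> as dual vector number \<open>c\<close> should. It may therefore replace that
  row of the left inverse \<open>F' L\<close>.\<close>

lemma row_through_injection:
  fixes F F' y L :: "nat \<Rightarrow> nat \<Rightarrow> 'k::field"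
  assumes F: "frame2 N 2 F F'" and y: "frame2 N a y L" and N: "2 \<le> N" and c: "c < 2" and k: "k \<noteq> 0"
    and \<zeta>: "\<And>j. \<not> j < a \<Longrightarrow> \<zeta> j = 0" and \<phi>: "\<And>j. (\<Sum>l<N. \<zeta> l * y l j) = k * F' c j"
  obtains H' where "frame2 N a (mm N y F) H'" "\<And>j. \<zeta> j = k * H' c j"
proof -
  let ?H' = "\<lambda>i j. if i = c then \<zeta> j / k else mm N F' L i j"
  have row: "\<zeta> j = k * ?H' c j" for j using k by simp
  have fc: "frame2 N a (mm N y F) (mm N F' L)" by (rule frame2_compose[OF F y N])
  have "mm N ?H' (mm N y F) i b = idm 2 i b" for i b
  proof (cases "i = c")
    case True
    have "mm N ?H' (mm N y F) i b = mm N (\<lambda>i j. \<zeta> j) (mm N y F) i b / k"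
      unfolding mm_def[of N _ "mm N y F"] True by (simp add: sum_divide_distrib)
    also have "\<dots> = mm N (mm N (\<lambda>i j. \<zeta> j) y) F i b / k" by (simp add: mm_assoc)
    also have "\<dots> = (\<Sum>l<N. F' c l * F l b)"
      unfolding mm_def[of N _ F] using k by (simp add: mm_def \<phi> sum_divide_distrib)
    also have "\<dots> = mm N F' F i b" by (simp add: mm_def True)
    finally show ?thesis using F by (simp add: frame2_def)
  next
    case False
    then have "mm N ?H' (mm N y F) i b = mm N (mm N F' L) (mm N y F) i b" by (simp add: mm_def[of N _ "mm N y F"])
    then show ?thesis using fc by (simp add: frame2_def)
  qed
  moreover have "supp 2 a ?H'" using fc c \<zeta> by (auto simp: frame2_def supp_def)
  ultimately have "frame2 N a (mm N y F) ?H'" using fc by (simp add: frame2_def fun_eq_iff)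
  then show thesis using row by (rule that)
qed

text \<open>As \<zeta> kills the image of \<open>y\<close>, a vector \<open>h\<close> with \<zeta>
  equal to 1 on it is adjoined as third frame vector. The multiple of \<zeta> by \<open>w\<close>
  corrects the old covectors so that they vanish on \<open>h\<close>.\<close>

lemma third_vector_good:
  fixes E E' F F' y L X :: "nat \<Rightarrow> nat \<Rightarrow> 'k::field_char_0"
  assumes E: "frame2 N 2 E E'" and F: "frame2 N 2 F F'" and y: "frame2 N a y L" and X: "diag_shape X"
    and n: "\<forall>j. n j = k * E j 0" "n \<noteq> 0" and \<zeta>: "\<And>j. \<not> j < a \<Longrightarrow> \<zeta> j = 0" "\<zeta> \<noteq> 0"
    and \<phi>: "\<And>j. (\<Sum>l<N. \<zeta> l * y l j) = 0" and N: "N = 2 + 2 + a"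
  shows "good_point 2 2 2 a (mm N F (mm N X E')) y (outer n \<zeta>)"
proof -
  have N3: "3 \<le> N" "2 \<le> N" "a \<le> N" using N by auto
  have k: "k \<noteq> 0" using n by (auto simp: fun_eq_iff)
  have s: "supp 2 2 E" "supp 2 2 E'" "supp 2 2 F" "supp 2 2 F'" "supp a 2 y" "supp 2 a L"
    and i: "mm N E' E = idm 2" "mm N F' F = idm 2" "mm N L y = idm 2" using E F y by (auto simp: frame2_def)
  obtain \<alpha> a0 a1 where X: "\<alpha> \<noteq> 0" "a0 \<in> {0, 1}" "a1 \<in> {0, 1}" "X = scaled \<alpha> (mat2 a0 0 0 a1)"
    using X unfolding diag_shape_def by blast
  obtain l where l: "\<zeta> l \<noteq> 0" using \<zeta>(2) by (auto simp: fun_eq_iff)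
  then have la: "l < a" using \<zeta>(1) by blast
  define h where "h = (\<lambda>i. if i = l then 1 / \<zeta> l else 0)"
  define e where "e = (\<lambda>i::nat. if i = 2 then 1 else 0 :: 'k)"
  have \<zeta>h: "(\<Sum>l<N. \<zeta> l * h l) = 1"
    using dot_unit(1)[of l N \<zeta> "1 / \<zeta> l"] l la N3 by (simp add: dot_def h_def)
  have e: "(\<Sum>l<N. e l * B l j) = B 2 j" "(\<Sum>l<N. A j l * e l) = A j 2" for A B :: "nat \<Rightarrow> nat \<Rightarrow> 'k" and j
    using dot_unit(2)[of 2 N 1 "\<lambda>l. B l j"] dot_unit(1)[of 2 N "\<lambda>l. A j l" 1] N3 by (simp_all add: dot_def e_def)
  have ee: "(\<Sum>l<N. e l * e l) = 1" using e(1)[of "\<lambda>l j. e l" 0] by (simp add: e_def)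
  have eh: "(\<Sum>l<N. \<zeta> l * mm N y F l j) = 0" for j
  proof -
    have "(\<Sum>l<N. \<zeta> l * mm N y F l j) = mm N (mm N (\<lambda>i. \<zeta>) y) F 0 j" by (simp add: mm_assoc) (simp add: mm_def)
    then show ?thesis by (simp add: mm_def \<phi>)
  qed
  define w where "w = (\<lambda>i. \<Sum>l<N. mm N F' L i l * h l)"
  define H where "H = mm N y F + outer h e"
  define H' where "H' = mm N F' L - outer w \<zeta> + outer e \<zeta>"
  have fl: "mm N (mm N F' L) (mm N y F) = idm 2" "supp 2 a (mm N F' L)" "supp a 2 (mm N y F)"
    using frame2_compose(1)[OF F y N3(2)] by (auto simp: frame2_def)
  have w0: "w i = 0" if "\<not> i < 2" for i unfolding w_def using that fl(2) by (simp add: suppD)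
  have sw: "supp 2 a (outer w \<zeta>)" by (rule supp_outer) (use w0 \<zeta> in auto)
  have H'2: "H' 2 j = \<zeta> j" for j
    using fl(2) by (simp add: H'_def outer_def suppD w0 e_def)
  have hw: "(\<Sum>l<N. mm N F' L i l * h l) = w i" for i by (simp add: w_def)
  have o0: "outer u (\<lambda>j. 0) = 0" for u :: "nat \<Rightarrow> 'k" by (simp add: outer_def fun_eq_iff)
  have id3: "idm 2 + outer e e = idm 3" by (auto simp: idm_def outer_def e_def fun_eq_iff)
  have ou: "mm N (outer u \<zeta>) (outer h e) = outer u e" for u
    unfolding mm_outer(1) by (simp add: outer_def fun_eq_iff mult.assoc sum_distrib_left[symmetric] \<zeta>h)
  have ou0: "mm N (outer u \<zeta>) (mm N y F) = 0" for u unfolding mm_outer(2) eh o0 ..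
  have "mm N (mm N F' L) (outer h e) = outer w e" unfolding mm_outer(1) hw ..
  then have H'H: "mm N H' H = idm 3"
    unfolding H_def H'_def mm_distrib ou ou0 fl(1) by (simp add: id3)
  have le3: "supp a 3 (mm N y F)" "supp 3 a (mm N F' L)" "supp 3 a (outer w \<zeta>)"
    using fl(2,3) sw by (fastforce simp: supp_def)+
  have sH: "supp a 3 H" unfolding H_def
    by (intro supp_ops le3 supp_outer) (use la in \<open>auto simp: h_def e_def\<close>)
  have sH': "supp 3 a H'" unfolding H'_def
    by (intro supp_ops le3 supp_outer) (use \<zeta> in \<open>auto simp: e_def\<close>)
  have "mm N (outer h e) (mm N (idm 2) F') = 0"
    unfolding mm_idm(1)[OF s(4) N3(2)] mm_outer(2) e(1) using s(4) by (simp add: suppD o0)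
  then have y': "y = mm N H (mm N (idm 2) F')"
    using frame2_compose(2)[OF F y N3(2)] by (simp add: H_def mm_distrib)
  have z': "outer n \<zeta> = mm N E (mm N (scaled k (munit 1 0 2)) H')"
    unfolding scaled_simps using N3 n by (simp add: fun_eq_iff outer_def scaled_def mm_munit H'2 mult_ac)
  have card2: "card ((\<lambda>v. mk_rep (scaled \<alpha> (arrow v 0)) (scaled 1 (arrow v 1)) (scaled k (arrow v 2))) ` {v, w}) \<le> 2"
    for v w :: "nat \<times> nat \<times> nat \<Rightarrow> 'k"
    using card_image_le[of "{v, w}" "\<lambda>v. mk_rep (scaled \<alpha> (arrow v 0)) (scaled 1 (arrow v 1)) (scaled k (arrow v 2))"]
      card_insert_le_m1[of 2 "{w}" v] by simp
  have s23: "supp 2 3 (mat2 b1 b2 b3 b4)" for b1 b2 b3 b4 :: 'k using supp_mat2[of b1 b2 b3 b4] by (fastforce simp: supp_def)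
  have s32: "supp 3 2 (idm 2 :: nat \<Rightarrow> nat \<Rightarrow> 'k)" using supp_idm[of 2] by (fastforce simp: supp_def idm_def)
  show ?thesis
    unfolding X(4) y' z'
  proof (subst scaled_simps(5)[of "idm 2", symmetric],
      rule good_point_base_change[OF s(1-4) sH sH' frame2_square[OF E N3(2)] i(1) frame2_square[OF F N3(2)] i(2) H'H
        _ _ _ _ _ _ _ _ _ card2 rigid_scaled[OF X(1) one_neq_zero k rigid_third_vector[OF N3(1) X(2,3)]] N N3(1)])
    show "mm N H H' = idm a \<or>
      (\<forall>\<phi> \<phi>' :: nat \<Rightarrow> nat \<Rightarrow> 'k. supp 2 a \<phi> \<longrightarrow> supp 2 a \<phi>' \<longrightarrow> mm N (scaled 1 (idm 2)) \<phi> = 0 \<longrightarrow>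
         mm N (scaled 1 0) \<phi> + mm N (scaled 1 (idm 2)) \<phi>' = 0 \<longrightarrow> \<phi> = 0) \<and>
      (\<forall>\<psi> \<psi>'. supp a 2 \<psi> \<longrightarrow> supp a 2 \<psi>' \<longrightarrow> mm N \<psi> (scaled k (munit 1 0 2)) = 0 \<longrightarrow>
         mm N \<psi> (scaled k (mat2 0 1 1 0)) + mm N \<psi>' (scaled k (munit 1 0 2)) = 0 \<longrightarrow> \<psi> = 0)"
    proof (intro disjI2 conjI allI impI)
      fix \<phi> \<phi>' :: "nat \<Rightarrow> nat \<Rightarrow> 'k"
      assume "supp 2 a \<phi>" "mm N (scaled 1 (idm 2)) \<phi> = 0" "mm N (scaled 1 0) \<phi> + mm N (scaled 1 (idm 2)) \<phi>' = 0"
      then show "\<phi> = 0" by (simp add: scaled_simps mm_idm(1)[OF _ N3(2)])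
    next
      fix \<psi> \<psi>' :: "nat \<Rightarrow> nat \<Rightarrow> 'k"
      assume sp: "supp a 2 \<psi>" and 0: "mm N \<psi> (scaled k (munit 1 0 2)) = 0"
        "mm N \<psi> (scaled k (mat2 0 1 1 0)) + mm N \<psi>' (scaled k (munit 1 0 2)) = 0"
      have 1: "mm N \<psi> (munit 1 0 2) = 0" "mm N \<psi> (mat2 0 1 1 0) + mm N \<psi>' (munit 1 0 2) = 0"
        using 0 unfolding scaled_simps(1,2) scaled_simps(3)[symmetric] scaled_eq_0[OF k] by auto
      have "\<psi> i 0 = 0 \<and> \<psi> i 1 = 0" for i
        using fun_cong[OF fun_cong[OF 1(1)], of i 2] fun_cong[OF fun_cong[OF 1(2)], of i 0] N3
        by (simp add: mm_munit mm_mat2_entry)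
      then show "\<psi> = 0" using sp by (simp add: supp_eq_0_iff less_2_cases_iff)
    qed
  qed (auto simp: mk_rep_mem supp_scaled supp_mat2 s23 s32 supp_munit supp_ops)
qed

text \<open>The frame at vertex 2 is the image under \<open>y\<close> of the one at vertex 1, with a
  covector matched to \<zeta>. In these frames \<open>y\<close> is the identity and \<open>z\<close>
  has a single entry.\<close>

lemma injection_good:
  fixes E E' F F' y L X :: "nat \<Rightarrow> nat \<Rightarrow> 'k::field_char_0"
  assumes E: "frame2 N 2 E E'" and F: "frame2 N 2 F F'" and y: "frame2 N a y L" and X: "diag_shape X"
    and n: "\<forall>j. n j = k * E j d" "n \<noteq> 0" and \<zeta>: "\<And>j. \<not> j < a \<Longrightarrow> \<zeta> j = 0"
    and \<phi>: "\<And>j. (\<Sum>l<N. \<zeta> l * y l j) = k' * F' c j" "k' \<noteq> 0"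
    and dc: "d < 2" "c < 2" "X = 0 \<Longrightarrow> d \<noteq> c" and N: "N = 2 + 2 + a"
  shows "good_point 2 2 2 a (mm N F (mm N X E')) y (outer n \<zeta>)"
proof -
  have N2: "2 \<le> N" using N by simp
  obtain H' where H': "frame2 N a (mm N y F) H'" "\<And>j. \<zeta> j = k' * H' c j"
    using row_through_injection[OF F y N2 dc(2) \<phi>(2) \<zeta> \<phi>(1)] by blast
  have z: "outer n \<zeta> = mm N E (mm N (munit (k * k') d c) H')"
    by (rule outer_frame) (use n H'(2) dc N in auto)
  have y': "y = mm N (mm N y F) (mm N (idm 2) F')" using frame2_compose(2)[OF F y N2] by simp
  have "k \<noteq> 0" using n by (auto simp: fun_eq_iff)
  then have "X = 0 \<or> idm 2 = (0 :: nat \<Rightarrow> nat \<Rightarrow> 'k) \<or> k * k' = 0 \<Longrightarrow> d \<noteq> c" using dc(3) \<phi>(2) idm2_nonzero by auto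
  from monomial_good[OF E F H'(1) N X diag_shape_idm dc(1,2) this]
  show ?thesis unfolding z y'[symmetric] .
qed

lemma adapted_frame_all:
  fixes v \<phi> :: "nat \<Rightarrow> 'k::field"
  assumes "2 \<le> n" "n \<le> N" "\<forall>i. \<not> i < n \<longrightarrow> v i = 0" "\<forall>i. \<not> i < n \<longrightarrow> \<phi> i = 0"
  shows "i < 2 \<Longrightarrow> \<exists>d<2. adapted N n v \<phi> d i"
    and "d < 2 \<Longrightarrow> \<exists>i<2. adapted N n v \<phi> d i"
    and "v = 0 \<or> \<phi> = 0 \<Longrightarrow> d < 2 \<Longrightarrow> i < 2 \<Longrightarrow> adapted N n v \<phi> d i"
  by (rule adapted_frame; use assms in blast)+

lemma munit_eq_0: "munit c d i = 0 \<Longrightarrow> c = 0"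
proof -
  assume "munit c d i = 0"
  then have "munit c d i d i = 0" by simp
  then show "c = 0" by (simp add: munit_def)
qed

text \<open>An arrow of rank at most one leaves a vector at its target and a covector at its source;
  each vertex thus carries at most one of each, and an adapted frame makes all arrows monomial. An
  invertible \<open>x\<close> or injective \<open>y\<close> instead carries a frame to the next
  vertex. Where an arrow vanishes, one index is free, which allows \<open>d \<noteq> c\<close> as
  \<open>monomial_good\<close> requires.\<close>

theorem rank_one_return_good:
  fixes x y :: "nat \<Rightarrow> nat \<Rightarrow> 'k::field_char_0"
  assumes a: "2 \<le> a" and sx: "supp 2 2 x" and sy: "supp a 2 y"
    and n: "\<And>i. \<not> i < 2 \<Longrightarrow> n i = 0" and \<zeta>: "\<And>i. \<not> i < a \<Longrightarrow> \<zeta> i = 0" and nz: "n = 0 \<longleftrightarrow> \<zeta> = 0"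
  shows "good_point 2 2 2 a x y (outer n \<zeta>)"
proof -
  define N where N: "N = 2 + 2 + a"
  have N2: "2 \<le> N" "a \<le> N" "2 \<le> (2::nat)" and lN: "l < 2 \<Longrightarrow> l < N" for l using N by auto
  have kz: "v = 0" if "\<forall>j. v j = k * u j" "k = 0" for v u :: "nat \<Rightarrow> 'k" and k using that by (auto simp: fun_eq_iff)
  \<comment> \<open>The covector \<zeta> pulled back along \<open>y\<close>; for injective
    \<open>y\<close> its vanishing decides whether a third basis vector is needed.\<close>
  define \<phi> where "\<phi> = (\<lambda>j. \<Sum>l<N. \<zeta> l * y l j)"
  have \<phi>2: "\<phi> j = 0" if "\<not> j < 2" for j unfolding \<phi>_def using that sy by (simp add: suppD)
  have flip: "1 - c < 2 \<and> 1 - c \<noteq> c" if "c < 2" for c :: nat using that by (auto simp: less_2_cases_iff)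
  have z0: "outer n \<zeta> = mm N E (mm N (munit 0 0 1) H')" if "\<zeta> = 0" for E H'
    using that N by (simp add: fun_eq_iff outer_def mm_munit)
  show ?thesis
  proof (rule rank_one_or_frame[OF sx N2(1)])
    fix f \<xi> assume f: "\<And>i. \<not> i < 2 \<Longrightarrow> f i = 0" "\<And>j. \<not> j < 2 \<Longrightarrow> \<xi> j = 0" "f = 0 \<longleftrightarrow> \<xi> = 0" "x = outer f \<xi>"
    show ?thesis
    proof (rule rank_one_or_frame[OF sy N2(2)])
      fix h \<eta> assume h: "\<And>i. \<not> i < a \<Longrightarrow> h i = 0" "\<And>j. \<not> j < 2 \<Longrightarrow> \<eta> j = 0" "h = 0 \<longleftrightarrow> \<eta> = 0" "y = outer h \<eta>"
      have ad10: "\<forall>i. \<not> i < 2 \<longrightarrow> f i = 0" "\<forall>i. \<not> i < 2 \<longrightarrow> \<eta> i = 0" using f(1) h(2) by blast+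
      note ad1 = adapted_frame_all[of 2 N f \<eta>, OF N2(3,1) ad10]
      have ad00: "\<forall>i. \<not> i < 2 \<longrightarrow> n i = 0" "\<forall>i. \<not> i < 2 \<longrightarrow> \<xi> i = 0" using n f(2) by blast+
      note ad0 = adapted_frame_all[of 2 N n \<xi>, OF N2(3,1) ad00]
      have ad20: "\<forall>i. \<not> i < a \<longrightarrow> h i = 0" "\<forall>i. \<not> i < a \<longrightarrow> \<zeta> i = 0" using h(1) \<zeta> by blast+
      note ad2 = adapted_frame_all[of a N h \<zeta>, OF a N2(2) ad20]
      obtain i1 where i1: "i1 < 2" "adapted N 2 f \<eta> 0 i1" using ad1(2)[of 0] by auto
      \<comment> \<open>At a vertex where the vector or covector vanishes every pair of indices is
        adapted, so \<open>d\<close> or \<open>c\<close> can be chosen to differ from the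
        other.\<close>
      have "\<exists>d c. d < 2 \<and> c < 2 \<and> adapted N 2 n \<xi> d 0 \<and> adapted N a h \<zeta> i1 c \<and> (\<xi> = 0 \<or> h = 0 \<or> \<zeta> = 0 \<longrightarrow> d \<noteq> c)"
      proof (cases "\<xi> = 0")
        case True
        obtain c where c: "c < 2" "adapted N a h \<zeta> i1 c" using ad2(2)[OF i1(1)] by blast
        then show ?thesis using ad0(3)[of "1 - c" 0] True flip[of c] zero_less_numeral by metis
      next
        case False
        obtain d where d: "d < 2" "adapted N 2 n \<xi> d 0" using ad0(1)[of 0] by auto
        obtain c where c: "c < 2" "adapted N a h \<zeta> i1 c" using ad2(2)[OF i1(1)] by blast
        show ?thesis
        proof (cases "h = 0 \<or> \<zeta> = 0")
          case True
          then show ?thesis using ad2(3)[of i1 "1 - d"] i1 d flip[of d] by metis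
        next
          case False2: False
          then show ?thesis using False d c by blast
        qed
      qed
      then obtain d c where dc: "d < 2" "c < 2" and A: "adapted N 2 n \<xi> d 0" "adapted N a h \<zeta> i1 c"
        and bad: "\<xi> = 0 \<or> h = 0 \<or> \<zeta> = 0 \<longrightarrow> d \<noteq> c" by blast
      obtain E E' kn k\<xi> where E: "frame2 N 2 E E'" "\<forall>j. n j = kn * E j d" "\<forall>j. \<xi> j = k\<xi> * E' 0 j"
        using A(1) unfolding adapted_def by blast
      obtain F F' kf k\<eta> where F: "frame2 N 2 F F'" "\<forall>j. f j = kf * F j 0" "\<forall>j. \<eta> j = k\<eta> * F' i1 j"
        using i1(2) unfolding adapted_def by blast
      obtain H H' kh k\<zeta> where H: "frame2 N a H H'" "\<forall>j. h j = kh * H j i1" "\<forall>j. \<zeta> j = k\<zeta> * H' c j"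
        using A(2) unfolding adapted_def by blast
      have forms: "x = mm N F (mm N (munit (kf * k\<xi>) 0 0) E')" "y = mm N H (mm N (munit (kh * k\<eta>) i1 i1) F')"
        "outer n \<zeta> = mm N E (mm N (munit (kn * k\<zeta>) d c) H')"
        unfolding f(4) h(4) using E F H dc i1(1) N by (auto intro!: outer_frame)
      have "d \<noteq> c" if "munit (kf * k\<xi>) 0 0 = (0 :: nat \<Rightarrow> nat \<Rightarrow> 'k) \<or> munit (kh * k\<eta>) i1 i1 = (0 :: nat \<Rightarrow> nat \<Rightarrow> 'k) \<or> kn * k\<zeta> = 0"
      proof -
        have "kf = 0 \<or> k\<xi> = 0 \<or> kh = 0 \<or> k\<eta> = 0 \<or> kn = 0 \<or> k\<zeta> = 0" using that munit_eq_0 mult_eq_0_iff by blast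
        then have "f = 0 \<or> \<xi> = 0 \<or> h = 0 \<or> \<eta> = 0 \<or> n = 0 \<or> \<zeta> = 0"
          using kz[OF F(2)] kz[OF E(3)] kz[OF H(2)] kz[OF F(3)] kz[OF E(2)] kz[OF H(3)] by blast
        then show ?thesis using bad f(3) h(3) nz by blast
      qed
      then show ?thesis unfolding forms
        by (intro monomial_good[OF E(1) F(1) H(1) N diag_shape_munit diag_shape_munit dc]) (use i1 in auto)
    next
      \<comment> \<open>Now \<open>y\<close> is injective while \<open>x\<close> has rank at most
        one; the frame at vertex 2 is transported from vertex 1.\<close>
      fix L assume y: "frame2 N a y L"
      have good: "good_point 2 2 2 a x y (outer n \<zeta>)" if EF: "frame2 N 2 E E'" "frame2 N 2 F F'"
        and x: "x = mm N F (mm N (munit k i i) E')" "i < 2" and z: "\<zeta> = 0" for E E' F F' k i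
      proof -
        have y': "y = mm N (mm N y F) (mm N (idm 2) F')" using frame2_compose(2)[OF EF(2) y N2(1)] by simp
        have "good_point 2 2 2 a (mm N F (mm N (munit k i i) E')) (mm N (mm N y F) (mm N (idm 2) F')) (mm N E (mm N (munit 0 0 1) (mm N F' L)))"
          by (rule monomial_good[OF EF frame2_compose(1)[OF EF(2) y N2(1)] N diag_shape_munit[OF x(2)] diag_shape_idm]) auto
        then show ?thesis unfolding x(1)[symmetric] y'[symmetric] z0[OF z, of E "mm N F' L", symmetric] .
      qed
      have ad00: "\<forall>i. \<not> i < 2 \<longrightarrow> n i = 0" "\<forall>i. \<not> i < 2 \<longrightarrow> \<xi> i = 0" using n f(2) by blast+
      note ad0 = adapted_frame_all[of 2 N n \<xi>, OF N2(3,1) ad00]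
      have ad10: "\<forall>i. \<not> i < 2 \<longrightarrow> f i = 0" "\<forall>i. \<not> i < 2 \<longrightarrow> \<phi> i = 0" using f(1) \<phi>2 by blast+
      note ad1 = adapted_frame_all[of 2 N f \<phi>, OF N2(3,1) ad10]
      consider "\<zeta> = 0" | "\<zeta> \<noteq> 0" "\<phi> \<noteq> 0" | "\<zeta> \<noteq> 0" "\<phi> = 0" by blast
      then show ?thesis
      proof cases
        case 1
        obtain d where "adapted N 2 n \<xi> d 0" using ad0(1)[of 0] by auto
        then obtain E E' k\<xi> where E: "frame2 N 2 E E'" "\<forall>j. \<xi> j = k\<xi> * E' 0 j" unfolding adapted_def by blast
        obtain i where "adapted N 2 f \<phi> 0 i" using ad1(2)[of 0] by auto
        then obtain F F' kf where F: "frame2 N 2 F F'" "\<forall>j. f j = kf * F j 0" unfolding adapted_def by blast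
        have "x = mm N F (mm N (munit (kf * k\<xi>) 0 0) E')" unfolding f(4) using E F N by (auto intro!: outer_frame)
        then show ?thesis by (rule good[OF E(1) F(1) _ _ 1]) simp
      next
        case 2
        obtain c where c: "c < 2" "adapted N 2 f \<phi> 0 c" using ad1(2)[of 0] by auto
        obtain F F' kf k\<phi> where F: "frame2 N 2 F F'" "\<forall>j. f j = kf * F j 0" "\<forall>j. \<phi> j = k\<phi> * F' c j"
          using c(2) unfolding adapted_def by blast
        have "\<exists>d<2. adapted N 2 n \<xi> d 0 \<and> (\<xi> = 0 \<longrightarrow> d \<noteq> c)"
          using ad0(1)[of 0] ad0(3)[of "1 - c" 0] flip[OF c(1)] zero_less_numeral by metis
        then obtain d where d: "d < 2" "adapted N 2 n \<xi> d 0" "\<xi> = 0 \<longrightarrow> d \<noteq> c" by blast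
        obtain E E' kn k\<xi> where E: "frame2 N 2 E E'" "\<forall>j. n j = kn * E j d" "\<forall>j. \<xi> j = k\<xi> * E' 0 j"
          using d(2) unfolding adapted_def by blast
        have x: "x = mm N F (mm N (munit (kf * k\<xi>) 0 0) E')" unfolding f(4) using E F N by (auto intro!: outer_frame)
        have "d \<noteq> c" if "munit (kf * k\<xi>) 0 0 = (0 :: nat \<Rightarrow> nat \<Rightarrow> 'k)"
        proof -
          have "kf = 0 \<or> k\<xi> = 0" using fun_cong[OF fun_cong[OF that], of 0 0] by (simp add: munit_def)
          then have "\<xi> = 0" using kz[OF F(2)] kz[OF E(3)] f(3) by blast
          then show ?thesis using d(3) by blast
        qed
        moreover have "k\<phi> \<noteq> 0" using kz[OF F(3)] 2(2) by blast
        ultimately show ?thesis unfolding x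
          using F(3)[unfolded \<phi>_def] 2(1) nz
          by (intro injection_good[OF E(1) F(1) y diag_shape_munit E(2) _ \<zeta> _ _ d(1) c(1) _ N]) auto
      next
        case 3
        obtain i where i: "i < 2" "adapted N 2 n \<xi> 0 i" using ad0(2)[of 0] by auto
        obtain E E' kn k\<xi> where E: "frame2 N 2 E E'" "\<forall>j. n j = kn * E j 0" "\<forall>j. \<xi> j = k\<xi> * E' i j"
          using i(2) unfolding adapted_def by blast
        have "adapted N 2 f \<phi> i 0" using ad1(3)[of i 0] 3(2) i(1) by simp
        then obtain F F' kf where F: "frame2 N 2 F F'" "\<forall>j. f j = kf * F j i" unfolding adapted_def by blast
        have x: "x = mm N F (mm N (munit (kf * k\<xi>) i i) E')" unfolding f(4) using E F N i by (auto intro!: outer_frame)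
        show ?thesis unfolding x
          using 3 nz by (intro third_vector_good[OF E(1) F(1) y diag_shape_munit[OF i(1)] E(2) _ \<zeta> _ _ N])
            (auto simp: \<phi>_def fun_eq_iff)
      qed
    qed
  next
    \<comment> \<open>Now \<open>x\<close> is invertible, so the frame at vertex 1 is the image of
      the one at vertex 0 and covectors are pulled back along \<open>x\<close> as well.\<close>
    fix K assume x: "frame2 N 2 x K"
    have xK: "mm N x K = idm 2" by (rule frame2_square[OF x N2(1)])
    have xx: "x = mm N (mm N x E) (mm N (idm 2) E')" "frame2 N 2 (mm N x E) (mm N E' K)" if "frame2 N 2 E E'" for E E'
      using frame2_compose[OF that x N2(1)] by auto
    show ?thesis
    proof (rule rank_one_or_frame[OF sy N2(2)])
      fix h \<eta> assume h: "\<And>i. \<not> i < a \<Longrightarrow> h i = 0" "\<And>j. \<not> j < 2 \<Longrightarrow> \<eta> j = 0" "h = 0 \<longleftrightarrow> \<eta> = 0" "y = outer h \<eta>"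
      define \<xi> where "\<xi> = (\<lambda>j. \<Sum>l<N. \<eta> l * x l j)"
      have \<xi>_sum: "(\<Sum>l<N. \<eta> l * x l j) = \<xi> j" for j by (simp add: \<xi>_def)
      have \<xi>2: "\<xi> j = 0" if "\<not> j < 2" for j unfolding \<xi>_def using that sx by (simp add: suppD)
      have ad00: "\<forall>i. \<not> i < 2 \<longrightarrow> n i = 0" "\<forall>i. \<not> i < 2 \<longrightarrow> \<xi> i = 0" using n \<xi>2 by blast+
      note ad0 = adapted_frame_all[of 2 N n \<xi>, OF N2(3,1) ad00]
      have ad20: "\<forall>i. \<not> i < a \<longrightarrow> h i = 0" "\<forall>i. \<not> i < a \<longrightarrow> \<zeta> i = 0" using h(1) \<zeta> by blast+
      note ad2 = adapted_frame_all[of a N h \<zeta>, OF a N2(2) ad20]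
      obtain d where d: "d < 2" "adapted N 2 n \<xi> d 0" using ad0(1)[of 0] by auto
      have "\<exists>c<2. adapted N a h \<zeta> 0 c \<and> (h = 0 \<or> \<zeta> = 0 \<longrightarrow> d \<noteq> c)"
        using ad2(2)[of 0] ad2(3)[of 0 "1 - d"] flip[OF d(1)] zero_less_numeral by metis
      then obtain c where c: "c < 2" "adapted N a h \<zeta> 0 c" "h = 0 \<or> \<zeta> = 0 \<longrightarrow> d \<noteq> c" by blast
      obtain E E' kn k\<xi> where E: "frame2 N 2 E E'" "\<forall>j. n j = kn * E j d" "\<forall>j. \<xi> j = k\<xi> * E' 0 j"
        using d(2) unfolding adapted_def by blast
      obtain H H' kh k\<zeta> where H: "frame2 N a H H'" "\<forall>j. h j = kh * H j 0" "\<forall>j. \<zeta> j = k\<zeta> * H' c j"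
        using c(2) unfolding adapted_def by blast
      have \<eta>: "\<forall>j. \<eta> j = k\<xi> * mm N E' K 0 j"
      proof
        fix j
        have "supp 2 2 (\<lambda>i j. if i = 0 then \<eta> j else 0)" using h(2) by (auto simp: supp_def)
        then have "mm N (\<lambda>i j. if i = 0 then \<eta> j else 0) (mm N x K) = (\<lambda>i j. if i = 0 then \<eta> j else 0)"
          unfolding xK by (rule mm_idm(2)[OF _ N2(1)])
        then have "mm N (mm N (\<lambda>i j. if i = 0 then \<eta> j else 0) x) K 0 j = \<eta> j" by (simp add: mm_assoc)
        then show "\<eta> j = k\<xi> * mm N E' K 0 j"
          using E(3) by (simp add: mm_def \<xi>_sum sum_distrib_left mult.assoc)
      qed
      have y': "y = mm N H (mm N (munit (kh * k\<xi>) 0 0) (mm N E' K))"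
        unfolding h(4) using H \<eta> N by (auto intro!: outer_frame)
      have z': "outer n \<zeta> = mm N E (mm N (munit (kn * k\<zeta>) d c) H')"
        using E H d c N by (auto intro!: outer_frame)
      have "d \<noteq> c" if "idm 2 = (0 :: nat \<Rightarrow> nat \<Rightarrow> 'k) \<or> munit (kh * k\<xi>) 0 0 = (0 :: nat \<Rightarrow> nat \<Rightarrow> 'k) \<or> kn * k\<zeta> = 0"
      proof -
        have "kh * k\<xi> = 0 \<or> kn * k\<zeta> = 0"
          using that idm2_nonzero munit_eq_0 by blast
        then have "kh = 0 \<or> k\<xi> = 0 \<or> kn = 0 \<or> k\<zeta> = 0" by auto
        then have "h = 0 \<or> \<eta> = 0 \<or> n = 0 \<or> \<zeta> = 0"
          using kz[OF H(2)] kz[OF \<eta>] kz[OF E(2)] kz[OF H(3)] by blast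
        then show ?thesis using c(3) h(3) nz by blast
      qed
      then have "good_point 2 2 2 a (mm N (mm N x E) (mm N (idm 2) E')) (mm N H (mm N (munit (kh * k\<xi>) 0 0) (mm N E' K)))
          (mm N E (mm N (munit (kn * k\<zeta>) d c) H'))"
        by (intro monomial_good[OF E(1) xx(2)[OF E(1)] H(1) N diag_shape_idm diag_shape_munit d(1) c(1)]) auto
      then show ?thesis unfolding xx(1)[OF E(1), symmetric] y'[symmetric] z'[symmetric] .
    next
      fix L assume y: "frame2 N a y L"
      define \<xi> where "\<xi> = (\<lambda>j. \<Sum>l<N. \<phi> l * x l j)"
      have \<xi>_sum: "(\<Sum>l<N. \<phi> l * x l j) = \<xi> j" for j by (simp add: \<xi>_def)
      have \<xi>2: "\<xi> j = 0" if "\<not> j < 2" for j unfolding \<xi>_def using that sx by (simp add: suppD)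
      have ad00: "\<forall>i. \<not> i < 2 \<longrightarrow> n i = 0" "\<forall>i. \<not> i < 2 \<longrightarrow> \<xi> i = 0" using n \<xi>2 by blast+
      note ad0 = adapted_frame_all[of 2 N n \<xi>, OF N2(3,1) ad00]
      have *: "adapted N 2 n \<xi> 0 0 \<or> adapted N 2 n \<xi> 0 1"
        using ad0(2)[of 0] by (auto simp: less_2_cases_iff)
      consider "\<zeta> = 0" | "\<zeta> \<noteq> 0" "\<phi> \<noteq> 0" | "\<zeta> \<noteq> 0" "\<phi> = 0" by blast
      then show ?thesis
      proof cases
        case 1
        obtain E E' :: "nat \<Rightarrow> nat \<Rightarrow> 'k" where E: "frame2 N 2 E E'" using * unfolding adapted_def by blast
        have y': "y = mm N (mm N y (mm N x E)) (mm N (idm 2) (mm N E' K))"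
          using frame2_compose(2)[OF xx(2)[OF E] y N2(1)] by simp
        have "good_point 2 2 2 a (mm N (mm N x E) (mm N (idm 2) E')) (mm N (mm N y (mm N x E)) (mm N (idm 2) (mm N E' K)))
            (mm N E (mm N (munit 0 0 1) (mm N (mm N E' K) L)))"
          by (rule monomial_good[OF E xx(2)[OF E] frame2_compose(1)[OF xx(2)[OF E] y N2(1)] N diag_shape_idm diag_shape_idm]) auto
        then show ?thesis
          unfolding xx(1)[OF E, symmetric] y'[symmetric] z0[OF 1, of E "mm N (mm N E' K) L", symmetric] .
      next
        case 2
        obtain d where d: "d < 2" "adapted N 2 n \<xi> d 0" using ad0(1)[of 0] by auto
        obtain E E' kn k\<xi> where E: "frame2 N 2 E E'" "\<forall>j. n j = kn * E j d" "\<forall>j. \<xi> j = k\<xi> * E' 0 j"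
          using d(2) unfolding adapted_def by blast
        have \<phi>': "\<forall>j. \<phi> j = k\<xi> * mm N E' K 0 j"
        proof
          fix j
          have "supp 2 2 (\<lambda>i j. if i = 0 then \<phi> j else 0)" using \<phi>2 by (auto simp: supp_def)
          then have "mm N (\<lambda>i j. if i = 0 then \<phi> j else 0) (mm N x K) = (\<lambda>i j. if i = 0 then \<phi> j else 0)"
            unfolding xK by (rule mm_idm(2)[OF _ N2(1)])
          then have "mm N (mm N (\<lambda>i j. if i = 0 then \<phi> j else 0) x) K 0 j = \<phi> j" by (simp add: mm_assoc)
          then show "\<phi> j = k\<xi> * mm N E' K 0 j"
            using E(3) by (simp add: mm_def \<xi>_sum sum_distrib_left mult.assoc)
        qed
        have "k\<xi> \<noteq> 0" using kz[OF \<phi>'] 2(2) by blast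
        then have "good_point 2 2 2 a (mm N (mm N x E) (mm N (idm 2) E')) y (outer n \<zeta>)"
          using \<phi>'[unfolded \<phi>_def] 2(1) nz idm2_nonzero
          by (intro injection_good[OF E(1) xx(2)[OF E(1)] y diag_shape_idm E(2) _ \<zeta> _ _ d(1) _ _ N, where c = 0]) auto
        then show ?thesis unfolding xx(1)[OF E(1), symmetric] .
      next
        case 3
        obtain i where "adapted N 2 n \<xi> 0 i" using * by blast
        then obtain E E' kn where E: "frame2 N 2 E E'" "\<forall>j. n j = kn * E j 0" unfolding adapted_def by blast
        have "good_point 2 2 2 a (mm N (mm N x E) (mm N (idm 2) E')) y (outer n \<zeta>)"
          using 3 nz by (intro third_vector_good[OF E(1) xx(2)[OF E(1)] y diag_shape_idm E(2) _ \<zeta> _ _ N])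
            (auto simp: \<phi>_def fun_eq_iff)
        then show ?thesis unfolding xx(1)[OF E(1), symmetric] .
      qed
    qed
  qed
qed

section \<open>Two-cycles of 2 x 2 matrices\<close>

text \<open>The analogue of \<open>rigid\<close> for two vertices with \<open>x\<close> in one
  direction and \<open>g\<close> in the other; \<open>p\<close> is opposite to \<open>x\<close> and
  \<open>h\<close> to \<open>g\<close>. It models \<open>V\<^sub>0\<close> and
  \<open>V\<^sub>1\<close> with the composite return map \<open>g = z y\<close>.\<close>

definition two_cycle_rigid where
  "two_cycle_rigid N x g x' g' M \<longleftrightarrow> (\<forall>p h p' h'. supp 2 2 p \<longrightarrow> supp 2 2 h \<longrightarrow> supp 2 2 p' \<longrightarrow> supp 2 2 h' \<longrightarrow>
     mm N p x = mm N g h \<longrightarrow> mm N x p = mm N h g \<longrightarrow>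
     mm N p x' + mm N p' x = mm N g' h + mm N g h' \<longrightarrow> mm N x' p + mm N x p' = mm N h g' + mm N h' g \<longrightarrow>
     (\<forall>(A, B)\<in>M. tr N (mm N p A) + tr N (mm N h B) = 0) \<longrightarrow> p = 0 \<and> h = 0)"

definition two_cycle_good where
  "two_cycle_good N x g \<longleftrightarrow> (\<exists>x' g' M. supp 2 2 x' \<and> supp 2 2 g' \<and> finite M \<and> card M \<le> 2 \<and>
     (\<forall>(A, B)\<in>M. supp 2 2 A \<and> supp 2 2 B) \<and> two_cycle_rigid N x g x' g' M)"

lemma two_cycle_good_swap:
  assumes "two_cycle_good N g x"
  shows "two_cycle_good N x g"
proof -
  obtain x' g' M where *: "supp 2 2 x'" "supp 2 2 g'" "finite M" "card M \<le> 2"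
    "\<forall>(A, B)\<in>M. supp 2 2 A \<and> supp 2 2 B" "two_cycle_rigid N g x g' x' M"
    using assms unfolding two_cycle_good_def by blast
  have "two_cycle_rigid N x g x' g' (prod.swap ` M)"
    unfolding two_cycle_rigid_def
  proof (intro allI impI)
    fix p h p' h'
    assume a: "supp 2 2 p" "supp 2 2 h" "supp 2 2 p'" "supp 2 2 h'" "mm N p x = mm N g h" "mm N x p = mm N h g"
      "mm N p x' + mm N p' x = mm N g' h + mm N g h'" "mm N x' p + mm N x p' = mm N h g' + mm N h' g"
      and M: "\<forall>(A, B)\<in>prod.swap ` M. tr N (mm N p A) + tr N (mm N h B) = 0"
    have "\<forall>(A, B)\<in>M. tr N (mm N h A) + tr N (mm N p B) = 0" using M by (auto simp: add.commute)
    then show "p = 0 \<and> h = 0"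
      using *(6)[unfolded two_cycle_rigid_def, rule_format, of h p h' p'] a by auto
  qed
  then show ?thesis unfolding two_cycle_good_def
    using *(1-5) card_image_le[OF *(3), of prod.swap]
    by (intro exI[of _ x'] exI[of _ g'] exI[of _ "prod.swap ` M"]) auto
qed

text \<open>The centraliser of a non-scalar 2 x 2 matrix is two-dimensional. Which two entries
  determine its elements depends on which of \<open>b\<close>, \<open>c\<close>,
  \<open>a - d\<close> is non-zero.\<close>

lemma nonscalar_centraliser:
  fixes a b c d :: "'k::field"
  assumes N: "2 \<le> N" and ns: "\<not> (b = 0 \<and> c = 0 \<and> a = d)"
  obtains i j i' j' where "i < 2" "j < 2" "i' < 2" "j' < 2"
    "\<forall>K. supp 2 2 K \<longrightarrow> mm N (mat2 a b c d) K = mm N K (mat2 a b c d) \<longrightarrow> K i j = 0 \<longrightarrow> K i' j' = 0 \<longrightarrow> K = 0"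
proof -
  have *: "K = 0" if K: "supp 2 2 K" "mm N (mat2 a b c d) K = mm N K (mat2 a b c d)"
    and 0: "b \<noteq> 0 \<and> K 0 0 = 0 \<and> K 0 1 = 0 \<or> c \<noteq> 0 \<and> K 1 0 = 0 \<and> K 1 1 = 0 \<or> b = 0 \<and> c = 0 \<and> a \<noteq> d \<and> K 0 0 = 0 \<and> K 1 1 = 0" for K
  proof -
    obtain k1 k2 k3 k4 where k: "K = mat2 k1 k2 k3 k4" by (rule mat2_cases[OF K(1)])
    have "a * k1 + b * k3 = k1 * a + k2 * c" "a * k2 + b * k4 = k1 * b + k2 * d" "c * k1 + d * k3 = k3 * a + k4 * c"
      using K(2) unfolding k mm_mat2[OF N] mat2_eq by auto
    then show ?thesis using 0 unfolding k mat2_eq_0 by (auto simp: mat2_def)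
  qed
  consider "b \<noteq> 0" | "c \<noteq> 0" | "b = 0" "c = 0" "a \<noteq> d" using ns by blast
  then show ?thesis
  proof cases
    case 1 then show ?thesis using * by (intro that[of 0 0 0 1]) auto
  next
    case 2 then show ?thesis using * by (intro that[of 1 0 1 1]) auto
  next
    case 3 then show ?thesis using * by (intro that[of 0 0 1 1]) auto
  qed
qed

text \<open>For invertible \<open>x\<close> with inverse \<open>K\<close>, the matrix
  \<open>h K\<close> commutes with \<open>x g\<close> and determines the form. If \<open>x g\<close>
  is not scalar, two entries suffice. If it is scalar, \<open>g\<close> is deformed so that
  \<open>x g\<close> acquires the first-order part diag(1, 2), and the first-order equation forces
  commutation with that instead.\<close>

lemma two_cycle_good_invertible:
  fixes x g :: "nat \<Rightarrow> nat \<Rightarrow> 'k::field_char_0"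
  assumes x: "frame2 N 2 x K" and g: "supp 2 2 g" and N: "2 \<le> N"
  shows "two_cycle_good N x g"
proof -
  have i: "mm N x K = idm 2" "mm N K x = idm 2" and s: "supp 2 2 x" "supp 2 2 K"
    using frame2_square[OF x N] x by (auto simp: frame2_def)
  have canc: "mm N x (mm N K W) = W" "mm N K (mm N x W) = W" if "supp 2 c W" for c W
    using mm_idm(1)[OF that N] by (simp_all add: mm_assoc[symmetric] i)
  have id0: "mm N (idm 2) W = W" "mm N W (idm 2) = W" if "supp 2 2 W" for W :: "nat \<Rightarrow> nat \<Rightarrow> 'k"
    using mm_idm[OF that] N by auto
  obtain a b c d where G: "mm N x g = mat2 a b c d" by (rule mat2_cases[OF supp_mm[OF s(1) g]])
  define g' where "g' = (if b = 0 \<and> c = 0 \<and> a = d then mm N K (mat2 1 0 0 2) else 0)"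
  obtain a' b' c' d' where T: "\<not> (b' = 0 \<and> c' = 0 \<and> a' = d')"
    "(if b = 0 \<and> c = 0 \<and> a = d then mat2 1 0 0 2 else mat2 a b c d) = mat2 a' b' c' d'"
  proof (cases "b = 0 \<and> c = 0 \<and> a = d")
    case True then show ?thesis by (intro that[of 0 0 1 2]) simp_all
  next
    case False then show ?thesis by (intro that[of b c a d]) auto
  qed
  obtain k l k' l' where kl: "k < 2" "l < 2" "k' < 2" "l' < 2"
    "\<forall>C. supp 2 2 C \<longrightarrow> mm N (mat2 a' b' c' d') C = mm N C (mat2 a' b' c' d') \<longrightarrow> C k l = 0 \<longrightarrow> C k' l' = 0 \<longrightarrow> C = 0"
    using nonscalar_centraliser[OF N T(1)] by blast
  define M where "M = {(0 :: nat \<Rightarrow> nat \<Rightarrow> 'k, mm N K (matrix_unit l k)), (0, mm N K (matrix_unit l' k'))}"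
  have sg': "supp 2 2 g'" unfolding g'_def by (auto intro!: supp_mm s supp_mat2 supp_ops)
  have "two_cycle_rigid N x g 0 g' M"
    unfolding two_cycle_rigid_def
  proof (intro allI impI)
    fix p h p' h'
    assume sp: "supp 2 2 p" "supp 2 2 h" "supp 2 2 p'" "supp 2 2 h'"
      and e: "mm N p x = mm N g h" "mm N x p = mm N h g"
        "mm N p 0 + mm N p' x = mm N g' h + mm N g h'" "mm N 0 p + mm N x p' = mm N h g' + mm N h' g"
      and M0: "\<forall>(A, B)\<in>M. tr N (mm N p A) + tr N (mm N h B) = 0"
    let ?C = "mm N h K"
    have sC: "supp 2 2 ?C" by (rule supp_mm[OF sp(2) s(2)])
    have CG: "mm N (mm N x g) ?C = mm N ?C (mm N x g)"
    proof -
      have "mm N (mm N x g) ?C = mm N x (mm N (mm N g h) K)" by (simp add: mm_assoc)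
      also have "\<dots> = mm N x p" by (simp add: e(1)[symmetric] mm_assoc i id0 sp)
      also have "\<dots> = mm N ?C (mm N x g)" by (simp add: e(2) mm_assoc canc[OF g])
      finally show ?thesis .
    qed
    have comm: "mm N (mat2 a' b' c' d') ?C = mm N ?C (mat2 a' b' c' d')"
    proof (cases "b = 0 \<and> c = 0 \<and> a = d")
      case False
      then show ?thesis using CG T(2) G by auto
    next
      case True
      have D: "mm N x g' = mat2 1 0 0 2" "mat2 a' b' c' d' = mat2 1 0 0 2"
        using True T(2) by (auto simp: g'_def canc[OF supp_mat2])
      have s1: "mm N g' h + mm N g h' = mm N p' x" using e(3) by (simp add: mm_distrib)
      have "mm N x (mm N (mm N g' h + mm N g h') K) = mm N x p'"
        unfolding s1 by (simp add: mm_assoc i id0 sp)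
      also have "\<dots> = mm N ?C (mm N x g') + mm N (mm N h' K) (mm N x g)"
        using e(4) by (simp add: mm_distrib mm_assoc canc[OF sg'] canc[OF g])
      finally have "mm N (mm N x g') ?C + mm N (mm N x g) (mm N h' K) = mm N ?C (mm N x g') + mm N (mm N h' K) (mm N x g)"
        by (simp add: mm_distrib mm_assoc)
      moreover have "mm N (mm N x g) W = mm N W (mm N x g)" if "supp 2 2 W" for W
      proof -
        have "mm N x g = scaled a (idm 2)" unfolding G using True by (auto simp: mat2_def scaled_def idm_def fun_eq_iff)
        then show ?thesis by (simp add: scaled_simps id0 that)
      qed
      from this[OF supp_mm[OF sp(4) s(2)]] calculation show ?thesis unfolding D by simp
    qed
    have "tr N (mm N ?C (matrix_unit j i)) = ?C i j" if "i < 2" "j < 2" for i j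
      using tr_matrix_unit[of j N i ?C] that N by (simp add: tr_mm_commute)
    then have "?C k l = 0" "?C k' l' = 0" using M0 kl by (simp_all add: M_def mm_assoc mm_distrib tr_ops)
    then have C0: "?C = 0" using kl(5) sC comm by blast
    have "h = mm N ?C x" by (simp add: mm_assoc i id0 sp)
    then have h0: "h = 0" by (simp add: C0 mm_distrib)
    have "p = mm N (mm N p x) K" by (simp add: mm_assoc i id0 sp)
    then show "p = 0 \<and> h = 0" using h0 by (simp add: e(1) mm_distrib)
  qed
  moreover have "finite M" "card M \<le> 2" unfolding M_def by (simp_all add: card_insert_if)
  moreover have "\<forall>(A, B)\<in>M. supp 2 2 A \<and> supp 2 2 B"
    unfolding M_def by (auto intro!: supp_ops supp_mm s supp_matrix_unit kl)
  ultimately show ?thesis unfolding two_cycle_good_def using sg' supp_ops(1) by blast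
qed

text \<open>A two-cycle is a representation whose \<open>y\<close> is the identity. Given
  \<open>h\<close>, the triple is completed by \<open>q = h g\<close> and \<open>s = h\<close>, and
  a deformation of \<open>y\<close> is absorbed into that of \<open>g\<close> as
  \<open>z' + g y'\<close>.\<close>

lemma two_cycle_good_of_good_point:
  fixes x g :: "nat \<Rightarrow> nat \<Rightarrow> 'k::field"
  assumes good: "good_point 2 2 2 2 x (idm 2) g" and s: "supp 2 2 x" "supp 2 2 g" and N: "2 \<le> N"
  shows "two_cycle_good N x g"
proof -
  obtain x' y' z' M where s': "supp 2 2 x'" "supp 2 2 y'" "supp 2 2 z'"
    and M: "finite M" "card M \<le> 2" "M \<subseteq> rep_space (dims 2 2 2)" and rig: "rigid 6 2 2 2 x (idm 2) g x' y' z' M"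
    using good unfolding good_point_iff_rigid by auto
  have mN: "mm 6 A B = mm N A B" if "supp 2 2 A" for A B :: "nat \<Rightarrow> nat \<Rightarrow> 'k"
    by (intro ext) (use mm_supp_left[OF that, of 6] mm_supp_left[OF that N] in simp)
  have tN: "tr 6 A = tr N A" if "supp 2 2 A" for A :: "nat \<Rightarrow> nat \<Rightarrow> 'k"
    using that by (elim mat2_cases) (simp add: tr_mat2 N)
  let ?f = "\<lambda>v. (arrow v 0, mm N g (arrow v 1) + arrow v 2)"
  have sM: "supp 2 2 (arrow v 0) \<and> supp 2 2 (arrow v 1) \<and> supp 2 2 (arrow v 2)" if "v \<in> M" for v
  proof -
    have "v \<in> rep_space (dims 2 2 2)" using that M(3) by blast
    then show ?thesis by (auto elim!: rep_cases)
  qed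
  have id: "mm N (idm 2) W = W" "mm N W (idm 2) = W" if "supp 2 2 W" for W :: "nat \<Rightarrow> nat \<Rightarrow> 'k"
    using mm_idm[OF that] N by auto
  note sm = supp_mm[where N=N] supp_ops
  have sm2: "supp 2 2 A \<Longrightarrow> supp 2 2 B \<Longrightarrow> supp 2 2 (mm N A B)" for A B :: "nat \<Rightarrow> nat \<Rightarrow> 'k" by (rule supp_mm)
  have "two_cycle_rigid N x g x' (z' + mm N g y') (?f ` M)"
    unfolding two_cycle_rigid_def
  proof (intro allI impI)
    fix p h p' h'
    assume sp: "supp 2 2 p" "supp 2 2 h" "supp 2 2 p'" "supp 2 2 h'"
      and e: "mm N p x = mm N g h" "mm N x p = mm N h g"
        "mm N p x' + mm N p' x = mm N (z' + mm N g y') h + mm N g h'"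
        "mm N x' p + mm N x p' = mm N h (z' + mm N g y') + mm N h' g"
      and M0: "\<forall>(A, B)\<in>?f ` M. tr N (mm N p A) + tr N (mm N h B) = 0"
    have sq: "supp 2 2 (mm N h g)" "supp 2 2 (mm N h z' + mm N h' g)" "supp 2 2 (h' + mm N y' h)"
      by (intro sm2 supp_ops sp s s')+
    have "p = 0 \<and> mm N h g = 0 \<and> h = 0"
    proof (rule rig[unfolded rigid_def, rule_format, OF sp(1) sq(1) sp(2) sp(3) sq(2) sq(3)])
      show "commuting_tangent 6 x (idm 2) g x' y' z' p (mm N h g) h p' (mm N h z' + mm N h' g) (h' + mm N y' h)"
        unfolding commuting_tangent_def commuting_def
        using e by (simp add: mN s s' sp sq supp_idm id sm2 supp_ops mm_distrib mm_assoc add_ac)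
      fix v assume v: "v \<in> M"
      then have "tr N (mm N p (arrow v 0)) + tr N (mm N h (mm N g (arrow v 1) + arrow v 2)) = 0" using M0 by auto
      then show "pairing 6 p (mm N h g) h v = 0"
        using sM[OF v] by (simp add: pairing_def mN tN sp s sq sm2 supp_ops mm_distrib tr_ops mm_assoc add_ac)
    qed
    then show "p = 0 \<and> h = 0" by simp
  qed
  moreover have "card (?f ` M) \<le> 2" using card_image_le[OF M(1)] M(2) le_trans by blast
  moreover have "\<forall>(A, B)\<in>?f ` M. supp 2 2 A \<and> supp 2 2 B"
    using sM by (auto intro!: sm s)
  ultimately show ?thesis unfolding two_cycle_good_def
    using s'(1) sm(4)[OF s'(3) sm(1)[OF s(2) s'(2)]] M(1) by blast
qed

text \<open>If neither map is invertible, \<open>g\<close> has rank at most one, and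
  \<open>rank_one_return_good\<close> applies with the identity as second arrow.\<close>

lemma two_cycle_always_good:
  fixes x g :: "nat \<Rightarrow> nat \<Rightarrow> 'k::field_char_0"
  assumes s: "supp 2 2 x" "supp 2 2 g" and N: "2 \<le> N"
  shows "two_cycle_good N x g"
proof (rule rank_one_or_frame[OF s(1) N])
  show ?thesis if "frame2 N 2 x L" for L by (rule two_cycle_good_invertible[OF that s(2) N])
next
  show ?thesis
  proof (rule rank_one_or_frame[OF s(2) N])
    show ?thesis if "frame2 N 2 g L" for L
      by (rule two_cycle_good_swap[OF two_cycle_good_invertible[OF that s(1) N]])
    show ?thesis if "\<And>i. \<not> i < 2 \<Longrightarrow> n i = 0" "\<And>j. \<not> j < 2 \<Longrightarrow> \<phi> j = 0" "n = 0 \<longleftrightarrow> \<phi> = 0" "g = outer n \<phi>" for n \<phi>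
      using rank_one_return_good[of 2 x "idm 2" n \<phi>] that s supp_idm[of 2]
      by (intro two_cycle_good_of_good_point s N) auto
  qed
qed

text \<open>Put \<open>h = L t\<close>, with \<open>t\<close> the third component. Injectivity of
  \<open>y\<close> and surjectivity of \<open>z\<close> turn \<open>y q = t z\<close> into
  \<open>q = h z\<close> and \<open>t = y h\<close>, so the form comes from the two-cycle of
  \<open>x\<close> and \<open>z y\<close>. Deforming \<open>z\<close> by \<open>g' L\<close> deforms
  \<open>z y\<close> by \<open>g'\<close>.\<close>

lemma injective_surjective_good:
  fixes x y z L R :: "nat \<Rightarrow> nat \<Rightarrow> 'k::field_char_0"
  assumes s: "supp 2 2 x" "supp a 2 y" "supp 2 a z" "supp 2 a L" "supp a 2 R"
    and i: "mm N L y = idm 2" "mm N z R = idm 2" and N: "N = 2 + 2 + a"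
  shows "good_point 2 2 2 a x y z"
proof -
  have N2: "2 \<le> N" "a \<le> N" using N by auto
  obtain x' g' M where s': "supp 2 2 x'" "supp 2 2 g'" and M: "finite M" "card M \<le> 2" "\<forall>(A, B)\<in>M. supp 2 2 A \<and> supp 2 2 B"
    and rig: "two_cycle_rigid N x (mm N z y) x' g' M"
    using two_cycle_always_good[OF s(1) supp_mm[OF s(3,2)] N2(1)] unfolding two_cycle_good_def by blast
  have idL: "mm N L (mm N y W) = W" "mm N z (mm N R W) = W" if "supp 2 c W" for c W
    using mm_idm(1)[OF that N2(1)] by (simp_all add: mm_assoc[symmetric] i)
  have idR: "mm N W (mm N L y) = W" "mm N W (mm N z R) = W" if "supp c 2 W" for c W
    unfolding i using mm_idm(2)[OF that N2(1)] by auto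
  let ?f = "\<lambda>(A, B). mk_rep A 0 (mm N B L)"
  note sm = supp_mm[where N=N] supp_ops
  show ?thesis unfolding good_point_iff_rigid
  proof (intro exI conjI)
    show "rigid (2 + 2 + a) 2 2 a x y z x' 0 (mm N g' L) (?f ` M)"
      unfolding rigid_def N[symmetric]
    proof (intro allI impI)
      fix p q t p' q' t'
      assume sp: "supp 2 2 p" "supp 2 a q" "supp a 2 t" "supp 2 2 p'" "supp 2 a q'" "supp a 2 t'"
        and ct: "commuting_tangent N x y z x' 0 (mm N g' L) p q t p' q' t'"
        and M0: "\<forall>v\<in>?f ` M. pairing N p q t v = 0"
      have e: "mm N p x = mm N z t" "mm N x p = mm N q y" "mm N y q = mm N t z"
        "mm N p x' + mm N p' x = mm N (mm N g' L) t + mm N z t'" "mm N x' p + mm N x p' = mm N q' y"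
        "mm N y q' = mm N t (mm N g' L) + mm N t' z"
        using ct unfolding commuting_tangent_def commuting_def by (simp_all add: mm_distrib)
      define h k where "h = mm N L t" and "k = mm N L t'"
      have sh: "supp 2 2 h" "supp 2 2 k" unfolding h_def k_def by (rule supp_mm[OF s(4) sp(3)], rule supp_mm[OF s(4) sp(6)])
      have q: "q = mm N h z" using idL(1)[OF sp(2)] e(3) by (simp add: h_def mm_assoc)
      have t: "t = mm N y h"
      proof -
        have "t = mm N (mm N t z) R" using idR(2)[OF sp(3)] by (simp add: mm_assoc)
        also have "\<dots> = mm N y (mm N q R)" by (simp add: e(3)[symmetric] mm_assoc)
        also have "\<dots> = mm N y h" unfolding q using idR(2)[OF sh(1)] by (simp add: mm_assoc)
        finally show ?thesis .
      qed
      have q': "q' = mm N h (mm N g' L) + mm N k z"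
        using idL(1)[OF sp(5)] e(6) by (simp add: h_def k_def mm_distrib mm_assoc)
      have "mm N y q' = mm N y (mm N h (mm N g' L)) + mm N t' z" using e(6) by (simp add: t mm_assoc)
      then have "mm N y (mm N k z) = mm N t' z" unfolding q' mm_distrib by simp
      then have "mm N (mm N y (mm N k z)) R = mm N (mm N t' z) R" by simp
      then have t': "t' = mm N y k" using idR(2)[OF sp(6)] idR(2)[OF sh(2)] by (simp add: mm_assoc)
      have "p = 0 \<and> h = 0"
      proof (rule rig[unfolded two_cycle_rigid_def, rule_format, OF sp(1) sh(1) sp(4) sh(2)])
        show "mm N p x = mm N (mm N z y) h" using e(1) by (simp add: t mm_assoc)
        show "mm N x p = mm N h (mm N z y)" using e(2) by (simp add: q mm_assoc)
        show "mm N p x' + mm N p' x = mm N g' h + mm N (mm N z y) k" using e(4) by (simp add: h_def t' mm_assoc)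
        show "mm N x' p + mm N x p' = mm N h g' + mm N k (mm N z y)"
          using e(5) idR(1)[OF s'(2)] by (simp add: q' mm_assoc mm_distrib)
        show "case AB of (A, B) \<Rightarrow> tr N (mm N p A) + tr N (mm N h B) = 0" if "AB \<in> M" for AB
        proof -
          have "tr N (mm N t (mm N B L)) = tr N (mm N h B)" for B
            using tr_mm_commute[of N "mm N t B" L] by (simp add: h_def mm_assoc)
          then show ?thesis using M0 that by (auto simp: pairing_mk_rep mm_distrib tr_ops split: prod.splits)
        qed
      qed
      then show "p = 0 \<and> q = 0 \<and> t = 0" by (simp add: q t mm_distrib)
    qed
    show "card (?f ` M) \<le> 2" using card_image_le[OF M(1)] M(2) le_trans by blast
    show "?f ` M \<subseteq> rep_space (dims 2 2 a)" using M(3) s by (auto simp: mk_rep_mem intro!: sm)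
  qed (use M s s' in \<open>auto intro!: sm\<close>)
qed

text \<open>Transposition exchanges \<open>y\<close> and \<open>z\<close>, so a rank-one
  \<open>y\<close> reduces to a rank-one \<open>z\<close>; if neither has rank at most one,
  \<open>y\<close> is injective and \<open>z\<close> surjective.\<close>

theorem good_point_2_2:
  fixes x y z :: "nat \<Rightarrow> nat \<Rightarrow> 'k::field_char_0"
  assumes a: "2 \<le> a" and s: "supp 2 2 x" "supp a 2 y" "supp 2 a z"
  shows "good_point 2 2 2 a x y z"
proof -
  define N where N: "N = 2 + 2 + a"
  have aN: "a \<le> N" using N by simp
  have sz: "supp a 2 (transposed z)" using s(3) by (simp add: transposed_simps)
  have to: "transposed (outer h n) = outer n h" for h n :: "nat \<Rightarrow> 'k"
    by (auto simp: transposed_def outer_def fun_eq_iff mult.commute)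
  show ?thesis
  proof (rule rank_one_or_frame[OF sz aN])
    fix \<zeta> n assume z: "\<And>i. \<not> i < a \<Longrightarrow> \<zeta> i = 0" "\<And>j. \<not> j < 2 \<Longrightarrow> n j = 0" "\<zeta> = 0 \<longleftrightarrow> n = 0" "transposed z = outer \<zeta> n"
    have "z = outer n \<zeta>" using z(4) by (metis to transposed_simps(1))
    then show ?thesis using rank_one_return_good[OF a s(1,2), of n \<zeta>] z(1-3) by simp
  next
    fix R assume R: "frame2 N a (transposed z) R"
    show ?thesis
    proof (rule rank_one_or_frame[OF s(2) aN])
      fix h \<eta> assume y: "\<And>i. \<not> i < a \<Longrightarrow> h i = 0" "\<And>j. \<not> j < 2 \<Longrightarrow> \<eta> j = 0" "h = 0 \<longleftrightarrow> \<eta> = 0" "y = outer h \<eta>"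
      have ty: "transposed y = outer \<eta> h" by (simp add: y(4) to)
      have "supp 2 2 (transposed x)" using s(1) by (simp add: transposed_simps(2))
      then have "good_point 2 2 2 a (transposed x) (transposed z) (transposed y)"
        unfolding ty by (rule rank_one_return_good[OF a _ sz]) (use y(1-3) in auto)
      then show ?thesis by (rule good_point_transpose)
    next
      fix L assume L: "frame2 N a y L"
      have "mm N z (transposed R) = transposed (mm N R (transposed z))"
        using transposed_simps(5)[of N "transposed z" R] by (simp add: transposed_simps(1))
      then have "mm N z (transposed R) = transposed (idm 2)" using R by (simp add: frame2_def)
      moreover have "transposed (idm 2) = (idm 2 :: nat \<Rightarrow> nat \<Rightarrow> 'k)" by (auto simp: transposed_def idm_def fun_eq_iff)
      ultimately show ?thesis
        using L R s by (intro injective_surjective_good[OF s _ _ _ _ N, of L "transposed R"]) (auto simp: frame2_def transposed_simps)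
    qed
  qed
qed

section \<open>Dimension vectors \<open>(a, b, 1)\<close> and \<open>(a, b, 0)\<close>\<close>

text \<open>The equations of \<open>commuting_tangent\<close> at vertices 0 and 1, entry by entry,
  for \<open>x = idm k\<close>, \<open>x' = idm a - idm k\<close> and for \<open>y'\<close>,
  \<open>z'\<close> the unit at index 0. As vertex 2 carries a line, \<open>q\<close>,
  \<open>s\<close>, \<open>y\<close>, \<open>z\<close> are vectors. The assumption
  \<open>reach\<close> is arranged beforehand by renumbering the basis at vertex 1.\<close>

locale path_system =
  fixes a b k :: nat and p p' :: "nat \<Rightarrow> nat \<Rightarrow> 'k::field" and q q' s s' y z :: "nat \<Rightarrow> 'k"
  assumes ab: "1 \<le> a" "a \<le> b" "k \<le> a"
    and supp_p: "\<And>i j. \<not> (i < a \<and> j < b) \<Longrightarrow> p i j = 0"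
    and supp_q: "\<And>i. \<not> i < b \<Longrightarrow> q i = 0" and supp_s: "\<And>j. \<not> j < a \<Longrightarrow> s j = 0"
    and supp_y: "\<And>j. \<not> j < b \<Longrightarrow> y j = 0" and supp_z: "\<And>i. \<not> i < a \<Longrightarrow> z i = 0"
    and E1: "\<And>i j. (if j < k then p i j else 0) = z i * s j"
    and E2: "\<And>i j. (if i < k then p i j else 0) = q i * y j"
    and D1: "\<And>i j. (if j < k then p' i j else if j < a then p i j else 0) = (if i = 0 then s j else 0) + z i * s' j"
    and D2: "\<And>i j. (if i < k then p' i j else if i < a then p i j else 0) = (if j = 0 then q i else 0) + q' i * y j"
    and reach: "\<And>j. y j \<noteq> 0 \<Longrightarrow> k < a \<Longrightarrow> \<exists>j<a. y j \<noteq> 0"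
begin

lemma E1': "j < k \<Longrightarrow> p i j = z i * s j" "k \<le> j \<Longrightarrow> z i * s j = 0"
  using E1[where i=i and j=j] by auto

lemma E2': "i < k \<Longrightarrow> p i j = q i * y j" "k \<le> i \<Longrightarrow> q i * y j = 0"
  using E2[where i=i and j=j] by auto

lemma D1': "j < k \<Longrightarrow> p' i j = (if i = 0 then s j else 0) + z i * s' j"
  "k \<le> j \<Longrightarrow> j < a \<Longrightarrow> p i j = (if i = 0 then s j else 0) + z i * s' j"
  using D1[where i=i and j=j] by auto

lemma D2': "i < k \<Longrightarrow> p' i j = (if j = 0 then q i else 0) + q' i * y j"
  "k \<le> i \<Longrightarrow> i < a \<Longrightarrow> p i j = (if j = 0 then q i else 0) + q' i * y j"
  "a \<le> i \<Longrightarrow> (if j = 0 then q i else 0) + q' i * y j = 0"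
  using D2[where i=i and j=j] ab by (auto simp: not_less)

text \<open>Elimination of \<open>p'\<close>: the square \<open>i, j < k\<close> is where both
  first-order equations determine it.\<close>

lemma corner: "i < k \<Longrightarrow> j < k \<Longrightarrow> (if i = 0 then s j else 0) + z i * s' j = (if j = 0 then q i else 0) + q' i * y j"
  using D1'(1)[where i=i and j=j] D2'(1)[where i=i and j=j] by simp

lemma p_zero:
  assumes "\<And>i. q i = 0" "\<And>i j. k \<le> i \<Longrightarrow> i < a \<Longrightarrow> q' i * y j = 0"
  shows "p = 0"
proof (intro ext)
  fix i j
  consider "i < k" | "k \<le> i" "i < a" | "\<not> i < a" by (meson not_less)
  then show "p i j = 0 i j"
    by cases (use assms E2'(1)[of i j] D2'(2)[of i j] supp_p[of i j] in \<open>simp_all split: if_splits\<close>)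
qed

text \<open>The columns of \<open>p\<close> with index below \<open>a\<close> are multiples of
  \<open>z\<close> and all its rows are multiples of \<open>y\<close>, so one entry where both are
  non-zero detects \<open>p\<close>.\<close>

lemma vanish_both:
  assumes nz: "z i0 \<noteq> 0" "y j0 \<noteq> 0" "j0 < a" and m: "p i0 j0 = 0"
  shows "p = 0 \<and> q = 0 \<and> s = 0"
proof -
  have s0: "s j = 0" if "k \<le> j" for j using E1'(2)[OF that, of i0] nz by simp
  have q0: "q i = 0" if "k \<le> i" for i using E2'(2)[OF that, of j0] nz by simp
  define \<nu> where "\<nu> i = (if i < k then q i else if i < a then q' i else 0)" for i
  define \<mu> where "\<mu> j = (if j < k then s j else s' j)" for j
  have pn: "p i j = \<nu> i * y j" for i j
    using E2'(1)[of i j] D2'(2)[of i j] q0[of i] supp_p[of i j] by (auto simp: \<nu>_def not_less)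
  have pm: "p i j = z i * \<mu> j" if "j < a" for i j
    using E1'(1)[of j i] D1'(2)[of j i] s0[of j] that by (auto simp: \<mu>_def not_less)
  have "\<nu> i0 = 0" using pn[of i0 j0] m nz by simp
  have "\<mu> j0 = 0" using pm[OF nz(3), of i0] m nz by simp
  have "\<nu> i = 0" for i using pn[of i j0] pm[OF nz(3), of i] \<open>\<mu> j0 = 0\<close> nz by simp
  then have p0: "p = 0" by (simp add: fun_eq_iff pn)
  have "s j = 0" for j
    using E1'(1)[of j i0] s0[of j] p0 nz by (cases "j < k") (auto split: if_splits)
  moreover have "q i = 0" for i
    using E2'(1)[of i j0] q0[of i] p0 nz by (cases "i < k") (auto split: if_splits)
  ultimately show ?thesis using p0 by (simp add: fun_eq_iff)
qed

lemma vanish_full_rank: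
  assumes nz: "z i0 \<noteq> 0" "k = a" "\<And>j. j < a \<Longrightarrow> y j = 0" and m: "q i0 = 0"
  shows "p = 0 \<and> q = 0 \<and> s = 0"
proof -
  have i0: "i0 < a" using nz(1) supp_z by blast
  have y0: "y 0 = 0" using nz(3)[of 0] ab by simp
  have s0: "s j = 0" for j
    using E1'(1)[of j i0] E1'(2)[of j i0] E2'(1)[of i0 j] nz i0 by (cases "j < k") (auto split: if_splits)
  have c: "z i * s' 0 = q i" if "i < k" for i
    using corner[of i 0] that nz(2) ab s0 y0 by (simp split: if_splits)
  have "s' 0 = 0" using i0 nz m c[of i0] by auto
  then have "q i = 0" for i using c[of i] D2'(3)[of i 0] y0 nz(2) by (cases "i < k") (auto split: if_splits)
  moreover have "p = 0" by (rule p_zero) (use calculation nz(2) in auto)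
  ultimately show ?thesis by (simp add: s0 fun_eq_iff)
qed

lemma vanish_z_inside:
  assumes y: "\<And>j. y j = 0" and z: "z i0 \<noteq> 0" "i0 < k \<or> k = 0" and m: "q i0 = 0"
  shows "p = 0 \<and> q = 0 \<and> s = 0"
proof -
  have q1: "q i = 0" if "a \<le> i" for i using D2'(3)[OF that, of 0] y by simp
  have s0: "s j = 0" for j
    using E1'(1)[of j i0] E1'(2)[of j i0] E2'(1)[of i0 j] y z by (cases "j < k") (auto split: if_splits)
  have "z i0 * s' 0 = 0"
    using corner[of i0 0] D1'(2)[of 0 i0] D2'(2)[of i0 0] supp_z[of i0] z ab y s0 m by (cases "k = 0") (auto split: if_splits)
  then have s'0: "s' 0 = 0" using z by simp
  have q0: "q i = 0" for i
  proof (cases "i < k")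
    case True
    then show ?thesis using corner[of i 0] s0 y s'0 by (simp split: if_splits)
  next
    case False
    then show ?thesis
      using q1[of i] D2'(2)[of i 0] D1'(2)[of 0 i] E1'(1)[of 0 i] s0 s'0 y ab by (cases "k = 0"; cases "i < a") (auto split: if_splits)
  qed
  have "p = 0" by (rule p_zero) (simp_all add: q0 y)
  then show ?thesis using q0 s0 by (simp add: fun_eq_iff)
qed

lemma vanish_z_outside:
  assumes y: "\<And>j. y j = 0" and z: "\<And>i. i < k \<Longrightarrow> z i = 0" "z i0 \<noteq> 0" and k: "0 < k" and m: "s 0 = 0"
  shows "p = 0 \<and> q = 0 \<and> s = 0"
proof -
  have q1: "q i = 0" if "a \<le> i" for i using D2'(3)[OF that, of 0] y by simp
  have s0: "s j = 0" for j
    using corner[of 0 j] E1'(2)[of j i0] y z k m by (cases "j = 0"; cases "j < k") (auto split: if_splits)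
  have q0: "q i = 0" for i
    using corner[of i 0] q1[of i] D2'(2)[of i 0] E1'(1)[of 0 i] s0 y z(1)[of i] k
    by (cases "i < k"; cases "i < a") (auto split: if_splits)
  have "p = 0" by (rule p_zero) (simp_all add: q0 y)
  then show ?thesis using q0 s0 by (simp add: fun_eq_iff)
qed

lemma vanish_y_inside:
  assumes z: "\<And>i. z i = 0" and y: "y j0 \<noteq> 0" "j0 < a" "j0 < k \<or> k = 0" and m: "s j0 = 0"
  shows "p = 0 \<and> q = 0 \<and> s = 0"
proof -
  have q1: "q i = 0" if "k \<le> i" for i using E2'(2)[OF that, of j0] y by simp
  have q0: "q i = 0" for i
    using q1[of i] E2'(1)[of i j0] E1'(1)[of j0 i] z y by (cases "i < k") (auto split: if_splits)
  have q'0: "q' i = 0" if "i < a" "k \<le> i" for i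
    using D2'(2)[OF that(2,1), of j0] E1'(1)[of j0 i] D1'(2)[of j0 i] q0[of i] z y m by (cases "k = 0") (auto split: if_splits)
  have p0: "p = 0" by (rule p_zero) (simp_all add: q0 q'0)
  have q'00: "q' 0 = 0"
    using corner[of 0 j0] q'0[of 0] q0 z y m ab by (cases "k = 0") (auto split: if_splits)
  have "s j = 0" for j
    using corner[of 0 j] D1'(2)[of j 0] supp_s[of j] q'00 q0 z p0 by (cases "j < k"; cases "j < a") (auto split: if_splits)
  then show ?thesis using p0 q0 by (simp add: fun_eq_iff)
qed

lemma vanish_y_outside:
  assumes z: "\<And>i. z i = 0" and y: "\<And>j. j < k \<Longrightarrow> y j = 0" "y j0 \<noteq> 0" and k: "0 < k" and m: "q 0 = 0"
  shows "p = 0 \<and> q = 0 \<and> s = 0"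
proof -
  have q0: "q i = 0" for i
    using E2'(2)[of i j0] corner[of i 0] y z k m by (cases "i = 0"; cases "i < k") (auto split: if_splits)
  have q'0: "q' i = 0" if i: "i < a" "k \<le> i" for i
  proof -
    \<comment> \<open>A coordinate with \<open>k \<le> j < a\<close>: there both first-order
      equations involve \<open>p\<close> rather than \<open>p'\<close>, and comparing them kills
      \<open>q'\<close>.\<close>
    obtain j where j: "j < a" "y j \<noteq> 0" using reach[OF y(2)] i by auto
    then have "k \<le> j" using y(1)[of j] by (meson not_less)
    then show ?thesis using D2'(2)[OF i(2,1), of j] D1'(2)[of j i] j i k q0[of i] z by simp
  qed
  have p0: "p = 0" by (rule p_zero) (simp_all add: q0 q'0)
  have "s j = 0" for j
    using corner[of 0 j] D1'(2)[of j 0] supp_s[of j] y(1)[of j] k q0 z p0 by (cases "j < k"; cases "j < a") (auto split: if_splits)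
  then show ?thesis using p0 q0 by (simp add: fun_eq_iff)
qed

lemma vanish_neither:
  assumes z: "\<And>i. z i = 0" and y: "\<And>j. y j = 0" and m: "s 0 = 0"
  shows "p = 0 \<and> q = 0 \<and> s = 0"
proof -
  have q1: "q i = 0" if "a \<le> i" for i using D2'(3)[OF that, of 0] y by simp
  have s0: "s j = 0" for j
  proof (cases "j < k")
    case True
    then show ?thesis using corner[of 0 j] y z m by (cases "j = 0") (auto split: if_splits)
  next
    case False
    then show ?thesis
      using D1'(2)[of j 0] E2'(1)[of 0 j] D2'(2)[of 0 j] supp_s[of j] ab z y m by (cases "j = 0"; cases "j < a"; cases "k = 0") (auto split: if_splits)
  qed
  have q0: "q i = 0" for i
  proof (cases "i < k")
    case True
    then show ?thesis using corner[of i 0] s0 y z by (simp split: if_splits)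
  next
    case False
    then show ?thesis
      using q1[of i] D2'(2)[of i 0] D1'(2)[of 0 i] E1'(1)[of 0 i] s0 z y ab by (cases "k = 0"; cases "i < a") (auto split: if_splits)
  qed
  have "p = 0" by (rule p_zero) (simp_all add: q0 y)
  then show ?thesis using q0 s0 by (simp add: fun_eq_iff)
qed

end

text \<open>The triples \<open>(0, i, j)\<close>, \<open>(1, i, j)\<close>, \<open>(2, i, j)\<close> stand for the entries \<open>p i j\<close>, \<open>q i\<close>, \<open>s j\<close>.  Each disjunct
  is the hypothesis of one of the vanishing lemmas above.\<close>

definition path_coordinate :: "nat \<Rightarrow> nat \<Rightarrow> (nat \<Rightarrow> 'k::zero) \<Rightarrow> (nat \<Rightarrow> 'k) \<Rightarrow> nat \<times> nat \<times> nat \<Rightarrow> bool" where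
  "path_coordinate a k y z = (\<lambda>(t, i, j).
     t = 0 \<and> z i \<noteq> 0 \<and> y j \<noteq> 0 \<and> j < a \<and> i < a \<or>
     t = 1 \<and> i < a \<and> (z i \<noteq> 0 \<and> k = a \<and> (\<forall>j<a. y j = 0) \<or> z i \<noteq> 0 \<and> (\<forall>j. y j = 0) \<and> (i < k \<or> k = 0) \<or>
       i = 0 \<and> 0 < k \<and> (\<forall>i. z i = 0) \<and> (\<forall>j<k. y j = 0) \<and> (\<exists>j. y j \<noteq> 0)) \<or>
     t = 2 \<and> j < a \<and> (j = 0 \<and> 0 < k \<and> (\<forall>j. y j = 0) \<and> (\<forall>i<k. z i = 0) \<and> (\<exists>i. z i \<noteq> 0) \<or>
       (\<forall>i. z i = 0) \<and> y j \<noteq> 0 \<and> (j < k \<or> k = 0) \<or> j = 0 \<and> (\<forall>i. z i = 0) \<and> (\<forall>j. y j = 0)))"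

lemma path_coordinate_exists:
  assumes "1 \<le> a" "k \<le> a" "\<And>i. \<not> i < a \<Longrightarrow> z i = 0" "\<And>j. y j \<noteq> 0 \<Longrightarrow> k < a \<Longrightarrow> \<exists>j<a. y j \<noteq> (0 :: 'k::zero)"
  shows "\<exists>m. path_coordinate a k y z m"
proof -
  have T: "\<exists>m. path_coordinate a k y z m" if "path_coordinate a k y z (t, i, j)" for t i j using that by blast
  show ?thesis
  proof (cases "\<forall>i. z i = 0")
    case z: True
    show ?thesis
    proof (cases "\<forall>j. y j = 0")
      case True
      then show ?thesis using z assms(1) by (intro T[of 2 0 0]) (simp add: path_coordinate_def)
    next
      case False
      then obtain j0 where j0: "y j0 \<noteq> 0" by blast
      show ?thesis
      proof (cases "0 < k \<and> (\<forall>j<k. y j = 0)")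
        case True
        then show ?thesis using z j0 assms(1) by (intro T[of 1 0 0]) (auto simp: path_coordinate_def)
      next
        case c: False
        have "\<exists>j<a. y j \<noteq> 0 \<and> (j < k \<or> k = 0)"
          using c assms(1,2) assms(4)[OF j0] by (cases "k = 0") (auto intro: less_le_trans)
        then obtain j where "j < a" "y j \<noteq> 0" "j < k \<or> k = 0" by blast
        then show ?thesis using z by (intro T[of 2 0 j]) (auto simp: path_coordinate_def)
      qed
    qed
  next
    case False
    then obtain i0 where i0: "z i0 \<noteq> 0" by blast
    then have i0a: "i0 < a" using assms(3) by blast
    show ?thesis
    proof (cases "\<exists>j<a. y j \<noteq> 0")
      case True
      then obtain j where "j < a" "y j \<noteq> 0" by blast
      then show ?thesis using i0 i0a by (intro T[of 0 i0 j]) (simp add: path_coordinate_def)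
    next
      case y: False
      show ?thesis
      proof (cases "k = a")
        case True
        then show ?thesis using y i0 i0a by (intro T[of 1 i0 0]) (auto simp: path_coordinate_def)
      next
        case False
        then have y0: "\<forall>j. y j = 0" using y assms(2,4) by (meson le_neq_implies_less)
        show ?thesis
        proof (cases "0 < k \<and> (\<forall>i<k. z i = 0)")
          case True
          then show ?thesis using y0 i0 assms(1) by (intro T[of 2 0 0]) (auto simp: path_coordinate_def)
        next
          case c: False
          have "\<exists>i<a. z i \<noteq> 0 \<and> (i < k \<or> k = 0)"
            using c assms(2) i0 i0a by (cases "k = 0") (auto intro: less_le_trans)
          then obtain i where "i < a" "z i \<noteq> 0" "i < k \<or> k = 0" by blast
          then show ?thesis using y0 by (intro T[of 1 i 0]) (auto simp: path_coordinate_def)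
        qed
      qed
    qed
  qed
qed

context path_system
begin

lemma vanish:
  assumes m: "path_coordinate a k y z (t, i, j)" and v: "(if t = 0 then p i j else if t = 1 then q i else s j) = 0"
  shows "p = 0 \<and> q = 0 \<and> s = 0"
proof -
  consider "t = 0" | "t = 1" | "t = 2" using m by (auto simp: path_coordinate_def)
  then show ?thesis
  proof cases
    case 1
    then show ?thesis using m v by (intro vanish_both[of i j]) (auto simp: path_coordinate_def)
  next
    case 2
    then have qi: "q i = 0" using v by simp
    consider "z i \<noteq> 0" "k = a" "\<forall>j<a. y j = 0" | "z i \<noteq> 0" "\<forall>j. y j = 0" "i < k \<or> k = 0"
      | j0 where "i = 0" "0 < k" "\<forall>i. z i = 0" "\<forall>j<k. y j = 0" "y j0 \<noteq> 0"
      using m 2 unfolding path_coordinate_def by auto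
    then show ?thesis
    proof cases
      case 1 then show ?thesis using qi by (intro vanish_full_rank[of i]) auto
    next
      case 2 then show ?thesis using qi by (intro vanish_z_inside[of i]) auto
    next
      case 3 then show ?thesis using qi by (intro vanish_y_outside[of j0]) auto
    qed
  next
    case 3
    then have sj: "s j = 0" using v by simp
    consider i0 where "j = 0" "0 < k" "\<forall>j. y j = 0" "\<forall>i<k. z i = 0" "z i0 \<noteq> 0"
      | "\<forall>i. z i = 0" "y j \<noteq> 0" "j < a" "j < k \<or> k = 0" | "j = 0" "\<forall>i. z i = 0" "\<forall>j. y j = 0"
      using m 3 unfolding path_coordinate_def by auto
    then show ?thesis
    proof cases
      case 1 then show ?thesis using sj by (intro vanish_z_outside[of i0]) auto
    next
      case 2 then show ?thesis using sj by (intro vanish_y_inside[of j]) auto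
    next
      case 3 then show ?thesis using sj by (intro vanish_neither) auto
    qed
  qed
qed

end

section \<open>Rank normal form by elimination\<close>

definition inverse_pair :: "nat \<Rightarrow> nat \<Rightarrow> (nat \<Rightarrow> nat \<Rightarrow> 'k::comm_ring_1) \<Rightarrow> (nat \<Rightarrow> nat \<Rightarrow> 'k) \<Rightarrow> bool" where
  "inverse_pair N n F F' \<longleftrightarrow> supp n n F \<and> supp n n F' \<and> mm N F F' = idm n \<and> mm N F' F = idm n"

lemma inverse_pair_idm: "n \<le> N \<Longrightarrow> inverse_pair N n (idm n) (idm n)"
  by (simp add: inverse_pair_def supp_idm mm_idm(1)[OF supp_idm])

lemma inverse_pair_mm:
  assumes "inverse_pair N n F F'" "inverse_pair N n P P'" "n \<le> N"
  shows "inverse_pair N n (mm N P F) (mm N F' P')"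
proof -
  have s: "supp n n F" "supp n n F'" "supp n n P" "supp n n P'"
    and i: "mm N F F' = idm n" "mm N F' F = idm n" "mm N P P' = idm n" "mm N P' P = idm n"
    using assms by (auto simp: inverse_pair_def)
  have "mm N (mm N P F) (mm N F' P') = mm N P (mm N (mm N F F') P')"
    "mm N (mm N F' P') (mm N P F) = mm N F' (mm N (mm N P' P) F)" by (simp_all add: mm_assoc)
  then show ?thesis
    using s by (simp add: inverse_pair_def i mm_idm(1)[OF s(4) assms(3)] mm_idm(1)[OF s(1) assms(3)] supp_mm)
qed

definition has_rank_form where
  "has_rank_form N b a x \<longleftrightarrow> (\<exists>F F' E E' m. inverse_pair N b F F' \<and> inverse_pair N a E E' \<and> m \<le> a \<and> m \<le> b \<and>
     x = mm N F (mm N (idm m) E'))"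

lemma has_rank_form_transport:
  assumes "has_rank_form N b a x" "inverse_pair N b P P'" "inverse_pair N a Q Q'" "a \<le> N" "b \<le> N"
  shows "has_rank_form N b a (mm N P (mm N x Q'))"
proof -
  obtain F F' E E' m where *: "inverse_pair N b F F'" "inverse_pair N a E E'" "m \<le> a" "m \<le> b"
    "x = mm N F (mm N (idm m) E')"
    using assms(1) unfolding has_rank_form_def by blast
  have "mm N P (mm N x Q') = mm N (mm N P F) (mm N (idm m) (mm N E' Q'))" by (simp add: *(5) mm_assoc)
  then show ?thesis
    using inverse_pair_mm[OF *(1) assms(2,5)] inverse_pair_mm[OF *(2) assms(3,4)] *(3,4)
    unfolding has_rank_form_def by blast
qed

lemma inverse_pair_transposed:
  assumes "inverse_pair N n F F'"
  shows "inverse_pair N n (transposed F') (transposed F)"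
proof -
  have "transposed (idm n) = (idm n :: nat \<Rightarrow> nat \<Rightarrow> 'a)" by (auto simp: transposed_def idm_def fun_eq_iff)
  then show ?thesis using assms by (simp add: inverse_pair_def transposed_simps(2,5))
qed

definition swap_matrix :: "nat \<Rightarrow> nat \<Rightarrow> nat \<Rightarrow> nat \<Rightarrow> nat \<Rightarrow> 'k::zero_neq_one" where
  "swap_matrix n k l = (\<lambda>i j. if i < n \<and> j = Transposition.transpose k l i then 1 else 0)"

lemma swap_matrix:
  assumes "k < n" "l < n" "n \<le> N"
  shows "supp n n (swap_matrix n k l)"
    and "mm N (swap_matrix n k l) A i j = (if i < n then A (Transposition.transpose k l i) j else 0)"
    and "mm N A (swap_matrix n k l) i j = (if j < n then A i (Transposition.transpose k l j) else 0)"
proof -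
  have lt: "Transposition.transpose k l i < n \<longleftrightarrow> i < n" for i
    using assms by (auto simp: Transposition.transpose_def)
  show "supp n n (swap_matrix n k l)" by (auto simp: supp_def swap_matrix_def lt)
  have "mm N (swap_matrix n k l) A i j = (\<Sum>h<N. if h = Transposition.transpose k l i then if i < n then A h j else 0 else 0)"
    unfolding mm_def swap_matrix_def by (intro sum.cong) auto
  then show "mm N (swap_matrix n k l) A i j = (if i < n then A (Transposition.transpose k l i) j else 0)"
    using lt[of i] assms(3) by auto
  have "mm N A (swap_matrix n k l) i j = (\<Sum>h<N. if h = Transposition.transpose k l j then if j < n then A i h else 0 else 0)"
    unfolding mm_def swap_matrix_def using lt[of j]
    by (intro sum.cong) auto
  then show "mm N A (swap_matrix n k l) i j = (if j < n then A i (Transposition.transpose k l j) else 0)"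
    using lt[of j] assms(3) by auto
qed

lemma inverse_pair_swap:
  assumes "k < n" "l < n" "n \<le> N"
  shows "inverse_pair N n (swap_matrix n k l) (swap_matrix n k l :: nat \<Rightarrow> nat \<Rightarrow> 'k::comm_ring_1)"
proof -
  have lt: "Transposition.transpose k l i < n \<longleftrightarrow> i < n" for i
    using assms by (auto simp: Transposition.transpose_def)
  have "mm N (swap_matrix n k l) (swap_matrix n k l) i j = (idm n i j :: 'k)" for i j
    unfolding swap_matrix(2)[OF assms] by (auto simp: swap_matrix_def idm_def lt)
  then show ?thesis using swap_matrix(1)[OF assms] by (simp add: inverse_pair_def fun_eq_iff)
qed

definition column_matrix :: "nat \<Rightarrow> nat \<Rightarrow> (nat \<Rightarrow> 'k::comm_ring_1) \<Rightarrow> nat \<Rightarrow> nat \<Rightarrow> 'k" where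
  "column_matrix n k w = (\<lambda>i j. idm n i j + (if j = k then w i else 0))"

lemma mm_column_matrix:
  assumes "k < n" "n \<le> N" "supp n c A"
  shows "mm N (column_matrix n k w) A i j = A i j + w i * A k j"
proof -
  have "mm N (column_matrix n k w) A i j = mm N (idm n) A i j + (\<Sum>l<N. if l = k then w i * A k j else 0)"
    unfolding mm_def column_matrix_def distrib_right sum.distrib
    by (intro arg_cong2[of _ _ _ _ "(+)"] refl sum.cong) auto
  then show ?thesis using assms mm_idm(1)[OF assms(3,2)] by simp
qed

lemma supp_column_matrix: "k < n \<Longrightarrow> (\<And>i. \<not> i < n \<Longrightarrow> w i = 0) \<Longrightarrow> supp n n (column_matrix n k w)"
proof -
  assume k: "k < n" and w: "\<And>i. \<not> i < n \<Longrightarrow> w i = 0"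
  have "i < n" if "w i \<noteq> 0" for i using w that by blast
  then show ?thesis using k by (auto simp: supp_def column_matrix_def idm_def split: if_splits)
qed

text \<open>A column matrix is \<open>1 + w e\<close>, with \<open>e\<close> the coordinate form
  number \<open>k\<close>. The product of two of them is \<open>1 + (w + w' + w (w' k)) e\<close>,
  which explains the two equations.\<close>

lemma inverse_pair_column:
  assumes k: "k < n" "n \<le> N" and w: "\<And>i. \<not> i < n \<Longrightarrow> w i = 0" "\<And>i. \<not> i < n \<Longrightarrow> w' i = 0"
    and inv: "\<And>i. w i + w' i + w i * w' k = 0" "\<And>i. w i + w' i + w' i * w k = 0"
  shows "inverse_pair N n (column_matrix n k w) (column_matrix n k w')"
proof -
  have s: "supp n n (column_matrix n k w)" "supp n n (column_matrix n k w')"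
    by (rule supp_column_matrix[OF k(1) w(1)], assumption, rule supp_column_matrix[OF k(1) w(2)], assumption)
  have "mm N (column_matrix n k w) (column_matrix n k w') i j = idm n i j" for i j
    unfolding mm_column_matrix[OF k s(2)] using inv(1)[of i] k
    by (auto simp: column_matrix_def idm_def algebra_simps)
  moreover have "mm N (column_matrix n k w') (column_matrix n k w) i j = idm n i j" for i j
    unfolding mm_column_matrix[OF k s(1)] using inv(2)[of i] k
    by (auto simp: column_matrix_def idm_def algebra_simps)
  ultimately show ?thesis using s by (simp add: inverse_pair_def fun_eq_iff)
qed

text \<open>With pivot \<open>D\<close>, the column \<open>u\<close> has \<open>u k = D - 1\<close>
  and its partner is \<open>w = - u / D\<close>; these identities make the two column matrices
  mutually inverse.\<close>

lemma elimination_coefficients: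
  fixes U D :: "'k::field"
  assumes "D \<noteq> 0"
  shows "U + - U / D + U * (- (D - 1) / D) = 0" "U + - U / D + - U / D * (D - 1) = 0"
proof -
  have 1: "- (D - 1) / D = 1 / D - 1" using assms by (simp add: diff_divide_distrib)
  show "U + - U / D + U * (- (D - 1) / D) = 0" unfolding 1 by (simp add: right_diff_distrib)
  have "- U / D * (D - 1) = U * (- (D - 1) / D)"
    by (simp only: times_divide_eq_right times_divide_eq_left mult_minus_left mult_minus_right minus_divide_left)
  then show "U + - U / D + - U / D * (D - 1) = 0" unfolding 1 by (simp add: right_diff_distrib)
qed

text \<open>Gaussian elimination with \<open>k\<close> pivots done. A remaining non-zero entry is
  swapped to position \<open>(k, k)\<close>, its column and row are cleared, and all operations are
  undone by \<open>has_rank_form_transport\<close>.\<close>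

lemma rank_form_step:
  fixes x :: "nat \<Rightarrow> nat \<Rightarrow> 'k::field"
  assumes le: "a \<le> N" "b \<le> N" and "supp b a x" "\<And>i j. i < k \<or> j < k \<Longrightarrow> x i j = idm k i j" "k \<le> a" "k \<le> b"
  shows "has_rank_form N b a x"
  using assms(3-)
proof (induction "a - k" arbitrary: x k rule: less_induct)
  case less
  note sx = less.prems(1) and xk = less.prems(2) and kab = less.prems(3,4)
  show ?case
  proof (cases "\<forall>i j. k \<le> i \<and> k \<le> j \<longrightarrow> x i j = 0")
    case True
    have "x i j = idm k i j" for i j using xk[of i j] True by (cases "i < k \<or> j < k") (auto simp: idm_def)
    then have x: "x = idm k" by (intro ext)
    have "x = mm N (idm b) (mm N (idm k) (idm a))"
      unfolding x using mm_idm[OF sx] le unfolding x by simp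
    then show ?thesis unfolding has_rank_form_def
      using inverse_pair_idm[OF le(1)] inverse_pair_idm[OF le(2)] kab by blast
  next
    case False
    then obtain i0 j0 where ij: "k \<le> i0" "k \<le> j0" "x i0 j0 \<noteq> 0" by blast
    then have lt: "i0 < b" "j0 < a" using sx by (auto simp: supp_def)
    then have k: "k < a" "k < b" using ij by auto
    let ?\<sigma> = "Transposition.transpose k i0" and ?\<tau> = "Transposition.transpose k j0"
    let ?S = "swap_matrix b k i0" and ?T = "swap_matrix a k j0"
    define x1 where "x1 = mm N ?S (mm N x ?T)"
    have x1e: "x1 i j = x (?\<sigma> i) (?\<tau> j)" for i j
    proof -
      have "x1 i j = (if i < b then if j < a then x (?\<sigma> i) (?\<tau> j) else 0 else 0)"
        unfolding x1_def swap_matrix(2)[OF k(2) lt(1) le(2)] swap_matrix(3)[OF k(1) lt(2) le(1)] by simp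
      moreover have "?\<sigma> i < b \<longleftrightarrow> i < b" "?\<tau> j < a \<longleftrightarrow> j < a" using k lt by (auto simp: Transposition.transpose_def)
      ultimately show ?thesis using sx by (auto simp: suppD)
    qed
    have sx1: "supp b a x1" unfolding x1_def
      by (rule supp_mm[OF swap_matrix(1)[OF k(2) lt(1) le(2)] supp_mm[OF sx swap_matrix(1)[OF k(1) lt(2) le(1)]]])
    have x1k: "x1 i j = (if i = j then 1 else 0)" if "i < k \<or> j < k" for i j
      unfolding x1e using that ij xk[of "?\<sigma> i" "?\<tau> j"] by (auto simp: Transposition.transpose_def idm_def split: if_splits)
    let ?d = "x1 k k"
    have d: "?d \<noteq> 0" using ij by (simp add: x1e)
    \<comment> \<open>The column matrix of \<open>u\<close> has column \<open>k\<close> of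
      \<open>x1\<close> as its own column \<open>k\<close>; its inverse therefore turns that column
      into a unit vector.\<close>
    define u where "u i = x1 i k - (if i = k then 1 else 0)" for i
    define w where "w i = - u i / ?d" for i
    have uk: "u k = ?d - 1" by (simp add: u_def)
    have uw: "inverse_pair N b (column_matrix b k u) (column_matrix b k w)"
    proof (rule inverse_pair_column[OF k(2) le(2)])
      show "u i + w i + u i * w k = 0" "u i + w i + w i * u k = 0" for i
        using elimination_coefficients[OF d, of "u i"] by (simp_all add: w_def uk)
      show "u i = 0" "w i = 0" if "\<not> i < b" for i using that sx1 k by (auto simp: u_def w_def suppD)
    qed
    define x2 where "x2 = mm N (column_matrix b k w) x1"
    have x2e: "x2 i j = x1 i j + w i * x1 k j" for i j unfolding x2_def by (rule mm_column_matrix[OF k(2) le(2) sx1])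
    have x2k: "x2 i k = (if i = k then 1 else 0)" for i using d by (simp add: x2e w_def u_def)
    have sx2: "supp b a x2" unfolding x2_def using uw sx1 by (auto simp: inverse_pair_def intro: supp_mm)
    \<comment> \<open>Row \<open>k\<close> away from the pivot. It is cleared from the right, by the
      transpose of a column matrix.\<close>
    define v where "v j = x2 k j - (if j = k then 1 else 0)" for j
    have vk: "v k = 0" by (simp add: v_def x2k)
    have vv: "inverse_pair N a (column_matrix a k v) (column_matrix a k (\<lambda>j. - v j))"
    proof (rule inverse_pair_column[OF k(1) le(1)])
      show "v i = 0" "- v i = 0" if "\<not> i < a" for i using that sx2 k by (auto simp: v_def suppD)
    qed (simp_all add: vk)
    define x3 where "x3 = mm N x2 (transposed (column_matrix a k (\<lambda>j. - v j)))"
    have "transposed x3 = mm N (column_matrix a k (\<lambda>j. - v j)) (transposed x2)"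
      unfolding x3_def using transposed_simps(5)[of N "transposed (column_matrix a k (\<lambda>j. - v j))" x2]
      by (simp add: transposed_simps(1))
    then have "transposed x3 j i = transposed x2 j i - v j * transposed x2 k i" for i j
      using mm_column_matrix[OF k(1) le(1), of b "transposed x2" "\<lambda>j. - v j" j i] sx2 by (simp add: transposed_simps(2))
    then have x3e: "x3 i j = x2 i j - v j * x2 i k" for i j by (simp add: transposed_def)
    have sx3: "supp b a x3" unfolding x3_def using vv sx2
      by (auto simp: inverse_pair_def transposed_simps(2) intro: supp_mm)
    have wk: "w i = 0" if "i < k" for i using that x1k[of i k] by (simp add: w_def u_def)
    have x3i: "x3 i j = x1 i j + w i * x1 k j" if "i \<noteq> k" for i j
      unfolding x3e x2k using that x2e[of i j] by simp
    have x3k: "x3 i j = idm (Suc k) i j" if lk: "i < Suc k \<or> j < Suc k" for i j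
    proof -
      consider "i = k" | "j = k" | "i < k" "i \<noteq> k" "j \<noteq> k" | "j < k" "i \<noteq> k" "j \<noteq> k" "k < i"
        using lk by (cases "i = k"; cases "j = k"; cases "i < k") auto
      then show ?thesis
      proof cases
        case 1 then show ?thesis by (auto simp: x3e x2k v_def idm_def)
      next
        case 2 then show ?thesis by (auto simp: x3e x2k vk idm_def)
      next
        case 3 then show ?thesis using wk[of i] x1k[of i j] x3i[of i j] by (auto simp: idm_def)
      next
        case 4 then show ?thesis using x1k[of i j] x1k[of k j] x3i[of i j] by (auto simp: idm_def)
      qed
    qed
    have r3: "has_rank_form N b a x3" by (rule less.hyps[OF _ sx3 x3k]) (use k in auto)
    have "has_rank_form N b a (mm N (column_matrix b k u) (mm N x3 (transposed (column_matrix a k v))))"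
      by (rule has_rank_form_transport[OF r3 uw inverse_pair_transposed[OF vv] le])
    moreover have "mm N x3 (transposed (column_matrix a k v)) = x2"
    proof -
      have "mm N (transposed (column_matrix a k (\<lambda>j. - v j))) (transposed (column_matrix a k v)) = transposed (idm a)"
        using vv by (simp add: transposed_simps(5) inverse_pair_def)
      moreover have "transposed (idm a) = (idm a :: nat \<Rightarrow> nat \<Rightarrow> 'k)" by (auto simp: transposed_def idm_def fun_eq_iff)
      ultimately show ?thesis by (simp add: x3_def mm_assoc mm_idm(2)[OF sx2 le(1)])
    qed
    moreover have "mm N (column_matrix b k u) x2 = x1"
    proof -
      have "mm N (column_matrix b k u) (column_matrix b k w) = idm b" using uw by (simp add: inverse_pair_def)
      then show ?thesis by (simp add: x2_def mm_assoc[symmetric] mm_idm(1)[OF sx1 le(2)])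
    qed
    ultimately have r1: "has_rank_form N b a x1" by simp
    have S: "inverse_pair N b ?S (?S :: nat \<Rightarrow> nat \<Rightarrow> 'k)" "inverse_pair N a ?T (?T :: nat \<Rightarrow> nat \<Rightarrow> 'k)"
      by (intro inverse_pair_swap k lt le)+
    have "mm N ?S (mm N x1 ?T) = mm N (mm N ?S ?S) (mm N x (mm N ?T ?T))" by (simp add: x1_def mm_assoc)
    also have "\<dots> = x" using S mm_idm[OF sx] le by (simp add: inverse_pair_def)
    finally show ?thesis using has_rank_form_transport[OF r1 S le] by simp
  qed
qed

lemma rank_form:
  fixes x :: "nat \<Rightarrow> nat \<Rightarrow> 'k::field"
  assumes "a \<le> N" "b \<le> N" "supp b a x"
  obtains F F' E E' m where "inverse_pair N b F F'" "inverse_pair N a E E'" "m \<le> a" "m \<le> b"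
    "x = mm N F (mm N (idm m) E')"
  using rank_form_step[OF assms, of 0] unfolding has_rank_form_def by auto

lemma mm_idm_entry:
  assumes "k \<le> N"
  shows "mm N A (idm k) i j = (if j < k then A i j else 0)" "mm N (idm k) A i j = (if i < k then A i j else 0)"
proof -
  have "mm N A (idm k) i j = (\<Sum>l<N. if l = j then if j < k then A i j else 0 else 0)"
    unfolding mm_def idm_def by (intro sum.cong) auto
  then show "mm N A (idm k) i j = (if j < k then A i j else 0)" using assms by simp
  have "mm N (idm k) A i j = (\<Sum>l<N. if l = i then if i < k then A i j else 0 else 0)"
    unfolding mm_def idm_def by (intro sum.cong) auto
  then show "mm N (idm k) A i j = (if i < k then A i j else 0)" using assms by simp
qed

section \<open>Good points for a line or zero at vertex 2\<close>

lemma rigid_path: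
  fixes Y Z :: "nat \<Rightarrow> nat \<Rightarrow> 'k::field"
  assumes ab: "1 \<le> a" "a \<le> b" "k \<le> a" and s: "supp 1 b Y" "supp a 1 Z"
    and reach: "\<And>j. Y 0 j \<noteq> 0 \<Longrightarrow> k < a \<Longrightarrow> \<exists>j<a. Y 0 j \<noteq> 0" and N: "a \<le> N" "b \<le> N" "1 \<le> N"
  obtains M where "finite M" "card M \<le> 1" "M \<subseteq> rep_space (dims a b 1)"
    "rigid N a b 1 (idm k) Y Z (idm a - idm k) (munit 1 0 0) (munit 1 0 0) M"
proof -
  let ?y = "Y 0" and ?z = "\<lambda>i. Z i 0"
  obtain t i j where m: "path_coordinate a k ?y ?z (t, i, j)"
    using path_coordinate_exists[of a k ?z ?y] ab reach s(2) by (auto simp: suppD)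
  \<comment> \<open>The single test vector. By the transposition in the trace pairing,
    \<open>matrix_unit j i\<close> reads the entry \<open>p i j\<close>, and similarly for
    \<open>q\<close> and \<open>s\<close>.\<close>
  define w :: "nat \<times> nat \<times> nat \<Rightarrow> 'k" where
    "w = (if t = 0 then mk_rep (matrix_unit j i) 0 0 else if t = 1 then mk_rep 0 (matrix_unit 0 i) 0 else mk_rep 0 0 (matrix_unit j 0))"
  have lt: "i < a" if "t = 0 \<or> t = 1" using m that by (auto simp: path_coordinate_def)
  have lt2: "j < a" if "t = 0 \<or> t = 2" using m that by (auto simp: path_coordinate_def)
  have t: "t = 0 \<or> t = 1 \<or> t = 2" using m by (auto simp: path_coordinate_def)
  have wm: "w \<in> rep_space (dims a b 1)"
    using t lt lt2 ab by (auto simp: w_def mk_rep_mem supp_ops intro!: supp_matrix_unit)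
  have "rigid N a b 1 (idm k) Y Z (idm a - idm k) (munit 1 0 0) (munit 1 0 0) {w}"
    unfolding rigid_def
  proof (intro allI impI)
    fix p q s p' q' s'
    assume sp: "supp a b p" "supp b 1 q" "supp 1 a s" "supp a b p'" "supp b 1 q'" "supp 1 a s'"
      and ct: "commuting_tangent N (idm k) Y Z (idm a - idm k) (munit 1 0 0) (munit 1 0 0) p q s p' q' s'"
      and w0: "\<forall>v\<in>{w}. pairing N p q s v = 0"
    have rank1: "mm N A B i j = A i 0 * B 0 j" if "supp c 1 A" for A B :: "nat \<Rightarrow> nat \<Rightarrow> 'k" and c i j
      using mm_supp_left[OF that N(3), of B i j] by simp
    note e = ct[unfolded commuting_tangent_def commuting_def]
    have c: "mm N p (idm k) = mm N Z s" "mm N (idm k) p = mm N q Y"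
      "mm N p (idm a - idm k) + mm N p' (idm k) = mm N (munit 1 0 0) s + mm N Z s'"
      "mm N (idm a - idm k) p + mm N (idm k) p' = mm N q (munit 1 0 0) + mm N q' Y" using e by auto
    have kN: "k \<le> N" using ab N by simp
    interpret path_system a b k p p' "\<lambda>i. q i 0" "\<lambda>i. q' i 0" "\<lambda>j. s 0 j" "\<lambda>j. s' 0 j" ?y ?z
    proof
      fix i j
      show "(if j < k then p i j else 0) = Z i 0 * s 0 j"
        using fun_cong[OF fun_cong[OF c(1)], of i j] by (simp add: mm_idm_entry kN rank1[OF s(2)])
      show "(if i < k then p i j else 0) = q i 0 * Y 0 j"
        using fun_cong[OF fun_cong[OF c(2)], of i j] by (simp add: mm_idm_entry kN rank1[OF sp(2)])
      show "(if j < k then p' i j else if j < a then p i j else 0) = (if i = 0 then s 0 j else 0) + Z i 0 * s' 0 j"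
        using fun_cong[OF fun_cong[OF c(3)], of i j] ab N(3)
        by (simp add: mm_distrib mm_idm_entry kN N(1) mm_munit rank1[OF s(2)] split: if_splits)
      show "(if i < k then p' i j else if i < a then p i j else 0) = (if j = 0 then q i 0 else 0) + q' i 0 * Y 0 j"
        using fun_cong[OF fun_cong[OF c(4)], of i j] ab N(3)
        by (simp add: mm_distrib mm_idm_entry kN N(1) mm_munit rank1[OF sp(5)] split: if_splits)
    qed (use sp s ab reach in \<open>auto simp: suppD\<close>)
    have "pairing N p q s w = (if t = 0 then p i j else if t = 1 then q i 0 else s 0 j)"
    proof -
      have mu: "tr N (mm N A (matrix_unit l h)) = A h l" if "l < N" "h < N" for A :: "nat \<Rightarrow> nat \<Rightarrow> 'k" and l h
        using tr_matrix_unit[OF that, of A] by (simp add: tr_mm_commute)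
      show ?thesis using t lt lt2 N by (auto simp: w_def pairing_mk_rep mm_distrib tr_ops mu)
    qed
    then have "(if t = 0 then p i j else if t = 1 then q i 0 else s 0 j) = 0" using w0 by simp
    note van = vanish[OF m this]
    have "q i j = 0" for i j using van suppD[OF sp(2), of i j] by (cases "j = 0") (auto simp: fun_eq_iff)
    moreover have "s i j = 0" for i j using van suppD[OF sp(3), of i j] by (cases "i = 0") (auto simp: fun_eq_iff)
    ultimately show "p = 0 \<and> q = 0 \<and> s = 0" using van by (simp add: fun_eq_iff)
  qed
  then show ?thesis using wm by (intro that[of "{w}"]) auto
qed

lemma good_point_1_le:
  fixes x y z :: "nat \<Rightarrow> nat \<Rightarrow> 'k::field"
  assumes ab: "1 \<le> a" "a \<le> b" and s: "supp b a x" "supp 1 b y" "supp a 1 z"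
  shows "good_point 1 a b 1 x y z"
proof -
  define N where N: "N = a + b + 1"
  have le: "a \<le> N" "b \<le> N" "1 \<le> N" using N by auto
  obtain F F' E E' k where F: "inverse_pair N b F F'" and E: "inverse_pair N a E E'" and k: "k \<le> a" "k \<le> b"
    and x: "x = mm N F (mm N (idm k) E')" by (rule rank_form[OF le(1,2) s(1)])
  obtain G G' where G: "inverse_pair N b G G'" "x = mm N G (mm N (idm k) E')"
    and reach: "\<And>j. mm N y G 0 j \<noteq> 0 \<Longrightarrow> k < a \<Longrightarrow> \<exists>j<a. mm N y G 0 j \<noteq> 0"
  proof (cases "k < a \<and> (\<exists>j. mm N y F 0 j \<noteq> 0) \<and> (\<forall>j<a. mm N y F 0 j = 0)")
    case False
    then show thesis using F x that by blast
  next
    case True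
    then obtain j where j: "mm N y F 0 j \<noteq> 0" "a \<le> j" by (meson not_less)
    have "supp 1 b (mm N y F)" using F s(2) by (auto simp: inverse_pair_def intro: supp_mm)
    then have jb: "j < b" using j(1) suppD by blast
    \<comment> \<open>If \<open>y\<close> vanishes on the first \<open>a\<close> basis vectors but
      not at \<open>j \<ge> a\<close>, exchanging the vectors \<open>k\<close> and \<open>j\<close>
      establishes \<open>reach\<close>. Both lie outside the image of \<open>idm k\<close>, so
      \<open>x\<close> keeps its normal form.\<close>
    let ?S = "swap_matrix b k j :: nat \<Rightarrow> nat \<Rightarrow> 'k"
    have kb: "k < b" using True ab by simp
    have S: "inverse_pair N b ?S ?S" by (rule inverse_pair_swap[OF kb jb le(2)])
    have "mm N ?S (idm k) = idm k"
      by (intro ext) (use True j kb in \<open>auto simp: swap_matrix(2)[OF kb jb le(2)] idm_def Transposition.transpose_def\<close>)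
    then have "mm N F (mm N (idm k) E') = mm N (mm N F ?S) (mm N (idm k) E')"
      by (metis mm_assoc)
    moreover have "mm N y (mm N F ?S) 0 k \<noteq> 0"
      unfolding mm_assoc[symmetric] swap_matrix(3)[OF kb jb le(2)] using j kb by simp
    ultimately show thesis
      using that[OF inverse_pair_mm[OF S F le(2)]] x True by auto
  qed
  have sG: "supp b b G" "supp b b G'" "mm N G G' = idm b" "mm N G' G = idm b" using G by (auto simp: inverse_pair_def)
  have sE: "supp a a E" "supp a a E'" "mm N E E' = idm a" "mm N E' E = idm a" using E by (auto simp: inverse_pair_def)
  have sY: "supp 1 b (mm N y G)" "supp a 1 (mm N E' z)" using supp_mm[OF s(2) sG(1)] supp_mm[OF sE(2) s(3)] by auto
  obtain M where M: "finite M" "card M \<le> 1" "M \<subseteq> rep_space (dims a b 1)"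
    "rigid N a b 1 (idm k) (mm N y G) (mm N E' z) (idm a - idm k) (munit 1 0 0) (munit 1 0 0) M"
    by (rule rigid_path[OF ab k(1) sY reach le])
  have y': "y = mm N (idm 1) (mm N (mm N y G) G')"
    using mm_idm(1)[OF s(2) le(3)] mm_idm(2)[OF s(2) le(2)] by (simp add: mm_assoc sG)
  have z': "z = mm N E (mm N (mm N E' z) (idm 1))"
  proof -
    have "mm N E (mm N (mm N E' z) (idm 1)) = mm N (mm N E E') (mm N z (idm 1))" by (simp add: mm_assoc)
    then show ?thesis using mm_idm(1)[OF s(3) le(1)] mm_idm(2)[OF s(3) le(3)] by (simp add: sE)
  qed
  have si: "supp b a (idm k :: nat \<Rightarrow> nat \<Rightarrow> 'k)" "supp b a (idm a - idm k :: nat \<Rightarrow> nat \<Rightarrow> 'k)"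
    using ab k by (auto simp: supp_def idm_def split: if_splits)
  have i1: "mm N (idm 1) (idm 1) = (idm 1 :: nat \<Rightarrow> nat \<Rightarrow> 'k)" by (rule mm_idm(1)[OF supp_idm le(3)])
  have "good_point 1 a b 1 (mm N G (mm N (idm k) E')) (mm N (idm 1) (mm N (mm N y G) G')) (mm N E (mm N (mm N E' z) (idm 1)))"
    by (rule good_point_base_change[OF sE(1,2) sG(1,2) supp_idm supp_idm sE(3,4) sG(3,4) i1 si(1) sY si(2) _ _ disjI1[OF i1]
          M(3,1,2,4) N le(3)]) (use ab in \<open>auto intro: supp_munit\<close>)
  then show ?thesis unfolding G(2)[symmetric] y'[symmetric] z'[symmetric] .
qed

theorem good_point_1:
  fixes x y z :: "nat \<Rightarrow> nat \<Rightarrow> 'k::field"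
  assumes ab: "1 \<le> a" "1 \<le> b" and s: "supp b a x" "supp 1 b y" "supp a 1 z"
  shows "good_point 1 a b 1 x y z"
proof (cases "a \<le> b")
  case True
  then show ?thesis by (rule good_point_1_le[OF ab(1) _ s])
next
  case False
  then show ?thesis using ab s
    by (rule_tac good_point_transpose, rule_tac good_point_1_le) (simp_all only: transposed_simps(2) linear not_le less_imp_le)
qed

text \<open>The deformed \<open>x\<close> has entries 1 or \<epsilon> in all \<open>a\<close>
  diagonal places, so the commutation relations kill \<open>p\<close> to first order; the other
  components have no entries.\<close>

lemma good_point_0_le:
  fixes x y z :: "nat \<Rightarrow> nat \<Rightarrow> 'k::field"
  assumes ab: "a \<le> b" and s: "supp b a x" "supp 0 b y" "supp a 0 z"
  shows "good_point 0 a b 0 x y z"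
proof -
  define N where N: "N = a + b + 0"
  have le: "a \<le> N" "b \<le> N" using N by auto
  obtain F F' E E' k where F: "inverse_pair N b F F'" and E: "inverse_pair N a E E'" and k: "k \<le> a" "k \<le> b"
    and x: "x = mm N F (mm N (idm k) E')" by (rule rank_form[OF le(1,2) s(1)])
  have sF: "supp b b F" "supp b b F'" "mm N F F' = idm b" "mm N F' F = idm b" using F by (auto simp: inverse_pair_def)
  have sE: "supp a a E" "supp a a E'" "mm N E E' = idm a" "mm N E' E = idm a" using E by (auto simp: inverse_pair_def)
  have z0: "A = 0" if "supp 0 c A \<or> supp c 0 A" for A :: "nat \<Rightarrow> nat \<Rightarrow> 'k" and c using that by (auto simp: supp_eq_0_iff)
  have i0: "idm 0 = (0 :: nat \<Rightarrow> nat \<Rightarrow> 'k)" by (simp add: idm_def fun_eq_iff)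
  have si: "supp b a (idm k :: nat \<Rightarrow> nat \<Rightarrow> 'k)" "supp b a (idm a - idm k :: nat \<Rightarrow> nat \<Rightarrow> 'k)"
    using ab k by (auto simp: supp_def idm_def split: if_splits)
  have kN: "k \<le> N" using k le by simp
  have rig: "rigid N a b 0 (idm k) 0 0 (idm a - idm k) 0 (0 :: nat \<Rightarrow> nat \<Rightarrow> 'k) {}"
    unfolding rigid_def
  proof (intro allI impI)
    fix p q s p' q' s' :: "nat \<Rightarrow> nat \<Rightarrow> 'k"
    assume sp: "supp a b p" "supp b 0 q" "supp 0 a s" "supp a b p'" "supp b 0 q'" "supp 0 a s'"
      and ct: "commuting_tangent N (idm k) 0 0 (idm a - idm k) 0 0 p q s p' q' s'"
    have c: "mm N (idm k) p = 0" "mm N (idm a - idm k) p + mm N (idm k) p' = 0"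
      using ct[unfolded commuting_tangent_def commuting_def] by (simp_all add: mm_distrib(7,8))
    have "p i j = 0" for i j
      using fun_cong[OF fun_cong[OF c(1)], of i j] fun_cong[OF fun_cong[OF c(2)], of i j] suppD[OF sp(1), of i j]
      by (auto simp: mm_distrib mm_idm_entry kN le split: if_splits)
    then show "p = 0 \<and> q = 0 \<and> s = 0" using z0[of b q] z0[of a s] sp by (simp add: fun_eq_iff)
  qed
  have "good_point 0 a b 0 (mm N F (mm N (idm k) E')) (mm N (idm 0) (mm N 0 F')) (mm N E (mm N 0 (idm 0)))"
    by (rule good_point_base_change[OF sE(1,2) sF(1,2) supp_idm supp_idm sE(3,4) sF(3,4) _ si(1) _ _ si(2) _ _ disjI1 _ _ _ rig N])
      (simp_all add: i0 mm_distrib supp_ops)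
  then show ?thesis using z0[of b y] z0[of a z] s by (simp add: x[symmetric] mm_distrib i0)
qed

theorem good_point_0:
  fixes x y z :: "nat \<Rightarrow> nat \<Rightarrow> 'k::field"
  assumes s: "supp b a x" "supp 0 b y" "supp a 0 z"
  shows "good_point 0 a b 0 x y z"
proof (cases "a \<le> b")
  case True
  then show ?thesis by (rule good_point_0_le[OF _ s])
next
  case False
  then show ?thesis using s
    by (rule_tac good_point_transpose, rule_tac good_point_0_le) (simp_all only: transposed_simps(2) linear not_le less_imp_le)
qed

section \<open>Generic orbits\<close>

lemma commuting_kills_orbit:
  assumes "commuting (r0 + r1 + r2) x y z p q s" "w \<in> orbit (dims r0 r1 r2) (mk_rep x y z)"
  shows "pairing (r0 + r1 + r2) p q s w = 0"
  using assms unfolding orbit_def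
  by (auto elim!: level_cases simp: pairing_action commuting_def mm_distrib tr_ops)

text \<open>The explicit point \<open>w1\<close> need not have a large orbit. On the line joining it
  to a point \<open>w0\<close> of largest orbit, \<open>w1 + s w0\<close> and
  \<open>w0 + w1 / s\<close> have the same tangent space for \<open>s \<noteq> 0\<close>; almost
  every such point keeps the maximal dimension and satisfies the open condition on \<open>D\<close>,
  which holds near \<open>w1\<close>.\<close>

lemma max_orbit_dim_le:
  fixes w1 :: "nat \<times> nat \<times> nat \<Rightarrow> 'k::field_char_0"
  assumes w1: "w1 \<in> rep_space r"
    and key: "\<And>w0. w0 \<in> rep_space r \<Longrightarrow> \<exists>D. poly D 0 \<noteq> 0 \<and> (\<forall>s. poly D s \<noteq> 0 \<longrightarrow>
      fun_space.dim (orbit r (w1 + fscale s w0)) + m \<le> fun_space.dim (rep_space r :: (nat \<times> nat \<times> nat \<Rightarrow> 'k) set))"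
  shows "max_orbit_dim TYPE('k) r + m \<le> fun_space.dim (rep_space r :: (nat \<times> nat \<times> nat \<Rightarrow> 'k) set)"
proof -
  obtain w0 :: "nat \<times> nat \<times> nat \<Rightarrow> 'k" where w0: "w0 \<in> rep_space r" "fun_space.dim (orbit r w0) = max_orbit_dim TYPE('k) r"
    by (rule max_orbit_dim_attained)
  obtain D where D: "poly D 0 \<noteq> 0"
    "\<And>s. poly D s \<noteq> 0 \<Longrightarrow> fun_space.dim (orbit r (w1 + fscale s w0)) + m \<le> fun_space.dim (rep_space r :: (nat \<times> nat \<times> nat \<Rightarrow> 'k) set)"
    using key[OF w0(1)] by blast
  let ?bad = "{t. t \<noteq> 0 \<and> fun_space.dim (orbit r (w0 + fscale t w1)) < fun_space.dim (double_orbit r w0 w1)}"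
  have D0: "D \<noteq> 0" using D(1) by auto
  have "finite (insert 0 (inverse ` ?bad \<union> {s. poly D s = 0}))"
    using orbit_deformation[OF w0(1) w1] poly_roots_finite[OF D0] by auto
  then obtain s where s: "s \<notin> insert 0 (inverse ` ?bad \<union> {s. poly D s = 0})"
    using ex_new_if_finite[OF infinite_UNIV_char_0] by blast
  then have s0: "s \<noteq> 0" "poly D s \<noteq> 0" by auto
  have "inverse s \<notin> ?bad"
  proof
    assume "inverse s \<in> ?bad"
    from imageI[OF this, of inverse] have "s \<in> inverse ` ?bad" by simp
    then show False using s by blast
  qed
  then have ge: "fun_space.dim (double_orbit r w0 w1) \<le> fun_space.dim (orbit r (w0 + fscale (inverse s) w1))"
    using s0 by auto
  have "orbit r w0 \<subseteq> double_orbit r w0 w1"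
    unfolding double_orbit_def using fun_space.subspace_0[OF subspace_stabiliser[of r w0]]
    by (force intro: image_eqI[of _ _ 0])
  then have "fun_space.dim (orbit r w0) \<le> fun_space.dim (double_orbit r w0 w1)"
    by (rule fun_space.finite_dim_dim_mono[OF fun_space.finite_dim_subset[OF finite_dim_rep_space double_orbit_subset[OF w0(1) w1]]])
  moreover have "orbit r (w0 + fscale (inverse s) w1) \<subseteq> orbit r (w1 + fscale s w0)"
  proof
    fix y assume "y \<in> orbit r (w0 + fscale (inverse s) w1)"
    then obtain x where x: "x \<in> level_algebra r" "y = rep_action (total_dim r) x (w0 + fscale (inverse s) w1)"
      unfolding orbit_def by blast
    have "w0 + fscale (inverse s) w1 = fscale (inverse s) (w1 + fscale s w0)"
      using s0 by (simp add: fun_eq_iff fscale_def distrib_left mult.assoc[symmetric])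
    moreover have "rep_action N x (fscale c v) = rep_action N (fscale c x) v" for N c and v :: "nat \<times> nat \<times> nat \<Rightarrow> 'k"
      by (simp add: rep_action_linear)
    ultimately have "y = rep_action (total_dim r) (fscale (inverse s) x) (w1 + fscale s w0)"
      using x(2) by simp
    then show "y \<in> orbit r (w1 + fscale s w0)"
      using fun_space.subspace_scale[OF subspace_level_algebra x(1)] unfolding orbit_def by blast
  qed
  then have "fun_space.dim (orbit r (w0 + fscale (inverse s) w1)) \<le> fun_space.dim (orbit r (w1 + fscale s w0))"
    by (rule fun_space.finite_dim_dim_mono[OF fun_space.finite_dim_subset[OF finite_dim_rep_space
          orbit_subset[OF fun_space.subspace_add[OF subspace_rep_space w1 fun_space.subspace_scale[OF subspace_rep_space w0(1)]]]]])
  ultimately show ?thesis using ge D(2)[OF s0(2)] w0(2) by simp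
qed

lemma poly_mm: "(\<lambda>i j. poly (mm N A B i j) s) = mm N (\<lambda>i j. poly (A i j) s) (\<lambda>i j. poly (B i j) s)"
  by (simp add: mm_def poly_sum fun_eq_iff)

definition pencil :: "(nat \<Rightarrow> nat \<Rightarrow> 'k::comm_ring_1) \<Rightarrow> (nat \<Rightarrow> nat \<Rightarrow> 'k) \<Rightarrow> nat \<Rightarrow> nat \<Rightarrow> 'k poly" where
  "pencil A B = (\<lambda>i j. [:A i j, B i j:])"

lemma poly_pencil: "(\<lambda>i j. poly (pencil A B i j) s) = A + scaled s B" "(\<lambda>i j. poly (pencil A B i j) 0) = A"
  by (simp_all add: pencil_def scaled_def fun_eq_iff)

lemma pencil_rep:
  "mk_rep x1 y1 z1 + fscale s (mk_rep x0 y0 z0) = mk_rep (x1 + scaled s x0) (y1 + scaled s y0) (z1 + scaled s z0)"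
  by (rule ext) (auto simp: mk_rep_def fscale_def scaled_def split: prod.splits)

text \<open>The square of \<open>v\<close> is a form commuting with \<open>v\<close>, and
  \<open>D\<close> is one of its entries along the line. It is non-zero at the starting point, where
  \<open>y\<close> and \<open>z\<close> compose to a matrix unit.\<close>

lemma max_orbit_dim_1:
  assumes "1 \<le> r0" "1 \<le> r1" "1 \<le> r2"
  shows "max_orbit_dim TYPE('k::field_char_0) (dims r0 r1 r2) + 1 \<le> fun_space.dim (rep_space (dims r0 r1 r2) :: (nat \<times> nat \<times> nat \<Rightarrow> 'k) set)"
proof (rule max_orbit_dim_le)
  let ?N = "r0 + r1 + r2" and ?e = "matrix_unit 0 0 :: nat \<Rightarrow> nat \<Rightarrow> 'k"
  have e: "supp a b ?e" if "1 \<le> a" "1 \<le> b" for a b using that by (intro supp_matrix_unit) auto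
  show w1: "mk_rep 0 ?e ?e \<in> rep_space (dims r0 r1 r2)" using assms e by (simp add: mk_rep_mem supp_ops)
  fix w0 :: "nat \<times> nat \<times> nat \<Rightarrow> 'k" assume w0: "w0 \<in> rep_space (dims r0 r1 r2)"
  obtain x0 y0 z0 where w0e: "w0 = mk_rep x0 y0 z0" by (rule rep_cases[OF w0])
  define D where "D = mm ?N (pencil ?e z0) (pencil ?e y0) 0 0"
  have De: "poly D s = mm ?N (?e + scaled s z0) (?e + scaled s y0) 0 0" for s
    using fun_cong[OF fun_cong[OF poly_mm[of ?N "pencil ?e z0" "pencil ?e y0" s]], of 0 0] by (simp add: D_def poly_pencil)
  have m: "mk_rep ?e 0 0 \<in> rep_space (dims r0 r1 r2)" using assms e by (simp add: mk_rep_mem supp_ops)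
  have "poly D 0 = mm ?N ?e ?e 0 0" by (simp add: De scaled_def zero_fun_def plus_fun_def)
  also have "\<dots> = (\<Sum>l<1. ?e 0 l * ?e l 0)" by (rule mm_supp_left[OF e]) (use assms in auto)
  finally have "poly D 0 \<noteq> 0" by (simp add: matrix_unit_def)
  moreover have "fun_space.dim (orbit (dims r0 r1 r2) (mk_rep 0 ?e ?e + fscale s w0)) + 1
      \<le> fun_space.dim (rep_space (dims r0 r1 r2) :: (nat \<times> nat \<times> nat \<Rightarrow> 'k) set)" if s: "poly D s \<noteq> 0" for s
  proof -
    define x y z where xyz: "x = 0 + scaled s x0" "y = ?e + scaled s y0" "z = ?e + scaled s z0"
    have w: "mk_rep 0 ?e ?e + fscale s w0 = mk_rep x y z" by (simp add: w0e pencil_rep xyz)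
    have ws: "mk_rep x y z \<in> rep_space (dims r0 r1 r2)"
      unfolding w[symmetric] by (intro fun_space.subspace_add[OF subspace_rep_space w1] fun_space.subspace_scale[OF subspace_rep_space w0])
    have c: "commuting ?N x y z (mm ?N z y) (mm ?N x z) (mm ?N y x)" by (simp add: commuting_def mm_assoc)
    have "pairing ?N (mm ?N z y) (mm ?N x z) (mm ?N y x) (mk_rep ?e 0 0) = mm ?N z y 0 0"
      using tr_matrix_unit[of 0 ?N 0 "mm ?N z y"] assms by (simp add: pairing_mk_rep mm_distrib tr_ops tr_mm_commute[of _ _ ?e])
    then have nz: "pairing ?N (mm ?N z y) (mm ?N x z) (mm ?N y x) (mk_rep ?e 0 0) \<noteq> 0" using s by (simp add: De xyz)
    show ?thesis unfolding w
      by (rule fun_space.triangular_codim[of _ _ 1 "\<lambda>_. mk_rep ?e 0 0" "\<lambda>_. pairing ?N (mm ?N z y) (mm ?N x z) (mm ?N y x)",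
            OF finite_dim_rep_space orbit_subset[OF ws] m pairing_linear commuting_kills_orbit[OF c]])
        (use nz in auto)
  qed
  ultimately show "\<exists>D. poly D 0 \<noteq> 0 \<and> (\<forall>s. poly D s \<noteq> 0 \<longrightarrow>
      fun_space.dim (orbit (dims r0 r1 r2) (mk_rep 0 ?e ?e + fscale s w0)) + 1
        \<le> fun_space.dim (rep_space (dims r0 r1 r2) :: (nat \<times> nat \<times> nat \<Rightarrow> 'k) set))" by blast
qed

text \<open>One elimination step with the non-zero determinant brings the two functionals into
  triangular position.\<close>

lemma two_functionals_codim:
  fixes f g :: "(nat \<times> nat \<times> nat \<Rightarrow> 'k::field) \<Rightarrow> 'k"
  assumes T: "fun_space.finite_dim T" "S \<subseteq> T" "m0 \<in> T" "m1 \<in> T"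
    and lin: "Vector_Spaces.linear fscale (*) f" "Vector_Spaces.linear fscale (*) g"
    and S: "\<And>x. x \<in> S \<Longrightarrow> f x = 0 \<and> g x = 0" and det: "f m0 * g m1 - f m1 * g m0 \<noteq> 0"
  shows "fun_space.dim S + 2 \<le> fun_space.dim T"
proof -
  define h where "h = (if f m0 = 0 then g else f)"
  define k where "k = (\<lambda>v. f m0 * g v - g m0 * f v)"
  have lk: "Vector_Spaces.linear fscale (*) k" unfolding k_def
    using fun_space.functional.linear_compose_sub[OF fun_space.functional.linear_compose_scale_right[OF lin(2), of "f m0"]
        fun_space.functional.linear_compose_scale_right[OF lin(1), of "g m0"]] .
  show ?thesis
    by (rule fun_space.triangular_codim[of T S 2 "\<lambda>a. if a = 0 then m0 else m1" "\<lambda>a. if a = 0 then h else k"])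
      (use T lin lk S det in \<open>auto simp: h_def k_def less_2_cases_iff mult.commute split: if_splits\<close>)
qed

text \<open>The second and fifth powers of \<open>v\<close> are commuting forms. At the starting
  point their first components are diag(1, 2) and diag(1, 4), so the determinant \<open>D\<close>
  takes the value 2 there.\<close>

lemma max_orbit_dim_2:
  assumes "2 \<le> r0" "2 \<le> r1" "2 \<le> r2"
  shows "max_orbit_dim TYPE('k::field_char_0) (dims r0 r1 r2) + 2 \<le> fun_space.dim (rep_space (dims r0 r1 r2) :: (nat \<times> nat \<times> nat \<Rightarrow> 'k) set)"
proof (rule max_orbit_dim_le)
  let ?N = "r0 + r1 + r2" and ?i = "mat2 1 0 0 1 :: nat \<Rightarrow> nat \<Rightarrow> 'k" and ?z = "mat2 1 0 0 2 :: nat \<Rightarrow> nat \<Rightarrow> 'k"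
  have N: "2 \<le> ?N" using assms by simp
  have e: "supp a b (mat2 c1 c2 c3 (c4 :: 'k))" if "2 \<le> a" "2 \<le> b" for a b c1 c2 c3 c4
    using that supp_mat2[of c1 c2 c3 c4] by (fastforce simp: supp_def)
  show w1: "mk_rep ?i ?i ?z \<in> rep_space (dims r0 r1 r2)" using assms e by (simp add: mk_rep_mem)
  fix w0 :: "nat \<times> nat \<times> nat \<Rightarrow> 'k" assume w0: "w0 \<in> rep_space (dims r0 r1 r2)"
  obtain x0 y0 z0 where w0e: "w0 = mk_rep x0 y0 z0" by (rule rep_cases[OF w0])
  let ?X = "pencil ?i x0" and ?Y = "pencil ?i y0" and ?Z = "pencil ?z z0"
  define P2 where "P2 = mm ?N ?Z ?Y"
  define P5 where "P5 = mm ?N P2 (mm ?N ?X P2)"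
  define D where "D = P2 0 0 * P5 1 1 - P2 1 1 * P5 0 0"
  define p2 where "p2 s = mm ?N (?z + scaled s z0) (?i + scaled s y0)" for s
  define p5 where "p5 s = mm ?N (p2 s) (mm ?N (?i + scaled s x0) (p2 s))" for s
  have P2: "(\<lambda>i j. poly (P2 i j) s) = p2 s" for s by (simp add: P2_def p2_def poly_mm poly_pencil)
  have P5: "(\<lambda>i j. poly (P5 i j) s) = p5 s" for s by (simp add: P5_def p5_def poly_mm poly_pencil P2)
  have De: "poly D s = p2 s 0 0 * p5 s 1 1 - p2 s 1 1 * p5 s 0 0" for s
    using fun_cong[OF fun_cong[OF P2]] fun_cong[OF fun_cong[OF P5]] by (simp add: D_def)
  have z: "A + scaled 0 B = A" for A B :: "nat \<Rightarrow> nat \<Rightarrow> 'k" by (simp add: scaled_def fun_eq_iff)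
  have "poly D 0 \<noteq> 0" by (simp add: De p5_def p2_def z mm_mat2[OF N]) (simp add: mat2_def)
  moreover have "fun_space.dim (orbit (dims r0 r1 r2) (mk_rep ?i ?i ?z + fscale s w0)) + 2
      \<le> fun_space.dim (rep_space (dims r0 r1 r2) :: (nat \<times> nat \<times> nat \<Rightarrow> 'k) set)" if s: "poly D s \<noteq> 0" for s
  proof -
    define x y z where xyz: "x = ?i + scaled s x0" "y = ?i + scaled s y0" "z = ?z + scaled s z0"
    have w: "mk_rep ?i ?i ?z + fscale s w0 = mk_rep x y z" by (simp add: w0e pencil_rep xyz)
    have ws: "mk_rep x y z \<in> rep_space (dims r0 r1 r2)"
      unfolding w[symmetric] by (intro fun_space.subspace_add[OF subspace_rep_space w1] fun_space.subspace_scale[OF subspace_rep_space w0])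
    have p2: "p2 s = mm ?N z y" by (simp add: p2_def xyz)
    have p5: "p5 s = mm ?N (mm ?N z y) (mm ?N x (mm ?N z y))" by (simp add: p5_def p2 xyz(1))
    let ?f = "pairing ?N (mm ?N z y) (mm ?N x z) (mm ?N y x)"
    let ?g = "pairing ?N (mm ?N (mm ?N z y) (mm ?N x (mm ?N z y))) (mm ?N x (mm ?N z (mm ?N y (mm ?N x z)))) (mm ?N y (mm ?N x (mm ?N z (mm ?N y x))))"
    have c: "commuting ?N x y z (mm ?N z y) (mm ?N x z) (mm ?N y x)"
      "commuting ?N x y z (mm ?N (mm ?N z y) (mm ?N x (mm ?N z y))) (mm ?N x (mm ?N z (mm ?N y (mm ?N x z)))) (mm ?N y (mm ?N x (mm ?N z (mm ?N y x))))"
      by (simp_all add: commuting_def mm_assoc)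
    have pr: "pairing ?N P Q S (mk_rep (matrix_unit i i) 0 0) = P i i" if "i < 2" for P Q S and i
      using tr_matrix_unit[of i ?N i P] that N by (simp add: pairing_mk_rep mm_distrib tr_ops tr_mm_commute[of _ _ "matrix_unit i i"])
    have m: "mk_rep (matrix_unit i i) 0 0 \<in> rep_space (dims r0 r1 r2)" if "i < 2" for i
      using that assms by (simp add: mk_rep_mem supp_ops supp_matrix_unit)
    show ?thesis unfolding w
    proof (rule two_functionals_codim[OF finite_dim_rep_space orbit_subset[OF ws] m m pairing_linear pairing_linear])
      show "?f v = 0 \<and> ?g v = 0" if "v \<in> orbit (dims r0 r1 r2) (mk_rep x y z)" for v
        using commuting_kills_orbit[OF c(1) that] commuting_kills_orbit[OF c(2) that] by blast
      show "?f (mk_rep (matrix_unit 0 0) 0 0) * ?g (mk_rep (matrix_unit 1 1) 0 0)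
          - ?f (mk_rep (matrix_unit 1 1) 0 0) * ?g (mk_rep (matrix_unit 0 0) 0 0) \<noteq> 0"
        using s unfolding De p2 p5 by (simp add: pr)
    qed auto
  qed
  ultimately show "\<exists>D. poly D 0 \<noteq> 0 \<and> (\<forall>s. poly D s \<noteq> 0 \<longrightarrow>
      fun_space.dim (orbit (dims r0 r1 r2) (mk_rep ?i ?i ?z + fscale s w0)) + 2
        \<le> fun_space.dim (rep_space (dims r0 r1 r2) :: (nat \<times> nat \<times> nat \<Rightarrow> 'k) set))" by blast
qed

lemma max_orbit_dim_0: "max_orbit_dim TYPE('k::field) r \<le> fun_space.dim (rep_space r :: (nat \<times> nat \<times> nat \<Rightarrow> 'k) set)"
proof -
  obtain w0 :: "nat \<times> nat \<times> nat \<Rightarrow> 'k" where "w0 \<in> rep_space r" "fun_space.dim (orbit r w0) = max_orbit_dim TYPE('k) r"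
    by (rule max_orbit_dim_attained)
  then show ?thesis using fun_space.finite_dim_dim_mono[OF finite_dim_rep_space orbit_subset] by metis
qed

lemma dims_GIB_if_good_points:
  assumes good: "\<And>x y z :: nat \<Rightarrow> nat \<Rightarrow> 'k::field. supp r1 r0 x \<Longrightarrow> supp r2 r1 y \<Longrightarrow> supp r0 r2 z \<Longrightarrow> good_point m r0 r1 r2 x y z"
    and le: "max_orbit_dim TYPE('k) (dims r0 r1 r2) + m \<le> fun_space.dim (rep_space (dims r0 r1 r2) :: (nat \<times> nat \<times> nat \<Rightarrow> 'k) set)"
  shows "dims_GIB TYPE('k) (dims r0 r1 r2)"
  unfolding dims_GIB_def
proof
  fix v :: "nat \<times> nat \<times> nat \<Rightarrow> 'k" assume v: "v \<in> rep_space (dims r0 r1 r2)"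
  obtain x y z where xyz: "v = mk_rep x y z" "supp r1 r0 x" "supp r2 r1 y" "supp r0 r2 z" by (rule rep_cases[OF v])
  obtain u where "u \<in> rep_space (dims r0 r1 r2)"
    "fun_space.dim (rep_space (dims r0 r1 r2) :: (nat \<times> nat \<times> nat \<Rightarrow> 'k) set) \<le> fun_space.dim (double_orbit (dims r0 r1 r2) (mk_rep x y z) u) + m"
    by (rule good_point_dim[OF good[OF xyz(2-4)] xyz(2-4)])
  then show "\<exists>u\<in>rep_space (dims r0 r1 r2). max_orbit_dim TYPE('k) (dims r0 r1 r2) \<le> fun_space.dim (double_orbit (dims r0 r1 r2) v u)"
    using le xyz(1) by (intro bexI[of _ u]) auto
qed

lemma mm_row_single:
  assumes "\<And>l. A i l = (if l = m then r else 0)" "m < N"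
  shows "mm N A B i j = r * B m j"
proof -
  have "mm N A B i j = (\<Sum>l<N. if l = m then r * B m j else 0)"
    unfolding mm_def by (intro sum.cong) (auto simp: assms(1))
  then show ?thesis using assms(2) by simp
qed

lemma mm_column_single:
  assumes "\<And>l. B l j = (if l = m then r else 0)" "m < N"
  shows "mm N A B i j = A i m * r"
proof -
  have "mm N A B i j = (\<Sum>l<N. if l = m then A i m * r else 0)"
    unfolding mm_def by (intro sum.cong) (auto simp: assms(1))
  then show ?thesis using assms(2) by simp
qed

text \<open>The factors 1, 2, 3, ... on the diagonal of \<open>x\<close> are distinct in
  characteristic zero and force a commuting form to be diagonal on the first \<open>c\<close>
  indices; off this square it vanishes. The \<open>c\<close> diagonal entries of \<open>p\<close>
  give \<open>M\<close>, and \<open>u = 0\<close> is enough.\<close>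

lemma good_point_generic:
  assumes "c \<le> a" "c \<le> b"
  defines "x \<equiv> (\<lambda>i j. if i = j \<and> i < min a b then of_nat (Suc i) else 0 :: 'k::field_char_0)"
  shows "good_point c a b c x (idm c) (idm c)" "supp b a x" "supp c b (idm c)" "supp a c (idm c)"
proof -
  let ?N = "a + b + c"
  show s: "supp b a x" "supp c b (idm c)" "supp a c (idm c)"
    using assms(1,2) by (auto simp: supp_def idm_def x_def split: if_splits)
  have xl: "mm ?N x A i j = (if i < min a b then of_nat (Suc i) * A i j else 0)"
    and xr: "mm ?N A x i j = (if j < min a b then A i j * of_nat (Suc j) else 0)" for A :: "nat \<Rightarrow> nat \<Rightarrow> 'k" and i j
  proof -
    show "mm ?N x A i j = (if i < min a b then of_nat (Suc i) * A i j else 0)"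
    proof (cases "i < min a b")
      case True
      then show ?thesis using mm_row_single[of x i i "of_nat (Suc i)" ?N A j] by (auto simp: x_def)
    next
      case False
      then show ?thesis by (auto simp: mm_def x_def)
    qed
    show "mm ?N A x i j = (if j < min a b then A i j * of_nat (Suc j) else 0)"
    proof (cases "j < min a b")
      case True
      then show ?thesis using mm_column_single[of x j j "of_nat (Suc j)" ?N A i] by (auto simp: x_def)
    next
      case False
      then show ?thesis by (auto simp: mm_def x_def intro!: sum.neutral)
    qed
  qed
  have cN: "c \<le> ?N" by simp
  define M where "M = (\<lambda>i. mk_rep (matrix_unit i i) 0 (0 :: nat \<Rightarrow> nat \<Rightarrow> 'k)) ` {..<c}"
  have rig: "rigid ?N a b c x (idm c) (idm c) 0 0 0 M"
    unfolding rigid_def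
  proof (intro allI impI)
    fix p q s p' q' s'
    assume sp: "supp a b p" "supp b c q" "supp c a s"
      and ct: "commuting_tangent ?N x (idm c) (idm c) 0 0 0 p q s p' q' s'"
      and M0: "\<forall>v\<in>M. pairing ?N p q s v = 0"
    have e: "mm ?N p x = mm ?N (idm c) s" "mm ?N x p = mm ?N q (idm c)" "mm ?N (idm c) q = mm ?N s (idm c)"
      using ct by (auto simp: commuting_tangent_def commuting_def)
    have e1: "(if j < min a b then p i j * of_nat (Suc j) else 0) = (if i < c then s i j else 0)" for i j
      using fun_cong[OF fun_cong[OF e(1)], of i j] unfolding xr mm_idm_entry[OF cN] .
    have e2: "(if i < min a b then of_nat (Suc i) * p i j else 0) = (if j < c then q i j else 0)" for i j
      using fun_cong[OF fun_cong[OF e(2)], of i j] unfolding xl mm_idm_entry[OF cN] .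
    have e3: "(if i < c then q i j else 0) = (if j < c then s i j else 0)" for i j
      using fun_cong[OF fun_cong[OF e(3)], of i j] unfolding mm_idm_entry[OF cN] .
    have diag: "p i i = 0" if "i < c" for i
    proof -
      have "pairing ?N p q s (mk_rep (matrix_unit i i) 0 0) = 0" using M0 that by (auto simp: M_def)
      then show ?thesis using tr_matrix_unit[of i ?N i p] that
        by (simp add: pairing_mk_rep mm_distrib tr_ops tr_mm_commute[of _ _ "matrix_unit i i"])
    qed
    have p0: "p i j = 0" if "i < c" "j < c" for i j
    proof (cases "i = j")
      case False
      have "of_nat (Suc i) * p i j = p i j * of_nat (Suc j)"
        using e1[of j i] e2[of i j] e3[of i j] that assms(1,2) by simp
      then have "p i j * (of_nat i - of_nat j) = 0" by (simp add: algebra_simps)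
      then show ?thesis using False by simp
    qed (use diag that in simp)
    have pz: "p i j = 0" for i j
    proof (cases "i < a \<and> j < b")
      case True
      consider "i < c" "j < c" | "i < min a b" "c \<le> j" | "c \<le> i" "j < min a b" 
        using True assms(1,2) by (cases "i < c"; cases "j < c"; cases "i < min a b") auto
      then show ?thesis
      proof cases
        case 1 then show ?thesis by (rule p0)
      next
        case 2 then show ?thesis using e2[of i j] by (simp add: of_nat_eq_0_iff del: of_nat_Suc)
      next
        case 3 then show ?thesis using e1[of j i] by (simp add: of_nat_eq_0_iff del: of_nat_Suc)
      qed
    qed (use suppD[OF sp(1)] in blast)
    have "q i j = 0" for i j using e2[of i j] suppD[OF sp(2), of i j] by (auto simp: pz split: if_splits)
    moreover have "s i j = 0" for i j using e1[of j i] suppD[OF sp(3), of i j] by (auto simp: pz split: if_splits)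
    ultimately show "p = 0 \<and> q = 0 \<and> s = 0" by (simp add: pz fun_eq_iff)
  qed
  have "M \<subseteq> rep_space (dims a b c)" "finite M" "card M \<le> c"
    using assms(1,2) card_image_le[of "{..<c}" "\<lambda>i. mk_rep (matrix_unit i i) 0 (0 :: nat \<Rightarrow> nat \<Rightarrow> 'k)"]
    by (auto simp: M_def mk_rep_mem supp_ops intro!: supp_matrix_unit)
  then show "good_point c a b c x (idm c) (idm c)"
    unfolding good_point_iff_rigid using rig supp_ops(1) by blast
qed

theorem max_orbit_dim_ge:
  assumes "c \<le> a" "c \<le> b"
  shows "fun_space.dim (rep_space (dims a b c) :: (nat \<times> nat \<times> nat \<Rightarrow> 'k::field_char_0) set) \<le> max_orbit_dim TYPE('k) (dims a b c) + c"
proof -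
  let ?x = "\<lambda>i j. if i = j \<and> i < min a b then of_nat (Suc i) else 0 :: 'k"
  have g: "good_point c a b c ?x (idm c) (idm c)" "supp b a ?x" "supp c b (idm c :: nat \<Rightarrow> nat \<Rightarrow> 'k)" "supp a c (idm c :: nat \<Rightarrow> nat \<Rightarrow> 'k)"
    by (rule good_point_generic[OF assms])+
  obtain u where u: "u \<in> rep_space (dims a b c)" "fun_space.dim (rep_space (dims a b c) :: (nat \<times> nat \<times> nat \<Rightarrow> 'k) set)
      \<le> fun_space.dim (double_orbit (dims a b c) (mk_rep ?x (idm c) (idm c)) u) + c"
    by (rule good_point_dim[OF g])
  have "mk_rep ?x (idm c) (idm c) \<in> rep_space (dims a b c)" using g(2-4) by (simp add: mk_rep_mem)
  from double_orbit_dim_le_max[OF this u(1)] u(2) show ?thesis by simp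
qed

section \<open>Forms that kill \<open>q v + q_v u\<close>\<close>

lemma sum_rearrange:
  fixes a b c d :: "'a::ab_group_add"
  assumes "a + b = c + d"
  shows "c - a = - (d - b)" "a - c = - (b - d)"
proof -
  have "b = c + d - a" using assms by (metis add_diff_cancel_left')
  then show "c - a = - (d - b)" "a - c = - (b - d)" by (simp_all add: algebra_simps)
qed

text \<open>The tangent equations give \<open>w (\<xi> u) = - w' (\<xi> v)\<close>, which is zero
  for \<xi> in the stabiliser. This is the direction needed to disprove GIB.\<close>

lemma tangent_kills_double_orbit:
  fixes x y z :: "nat \<Rightarrow> nat \<Rightarrow> 'k::field"
  assumes ct: "commuting_tangent (r0 + r1 + r2) x y z x' y' z' p q s p' q' s'"
    and w: "w \<in> double_orbit (dims r0 r1 r2) (mk_rep x y z) (mk_rep x' y' z')"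
  shows "pairing (r0 + r1 + r2) p q s w = 0"
proof -
  let ?N = "r0 + r1 + r2"
  obtain g h where gh: "w = g + h" "g \<in> orbit (dims r0 r1 r2) (mk_rep x y z)"
    "h \<in> (\<lambda>\<xi>. rep_action ?N \<xi> (mk_rep x' y' z')) ` stabiliser (dims r0 r1 r2) (mk_rep x y z)"
    using w unfolding double_orbit_def by auto
  then obtain \<xi> where \<xi>: "\<xi> \<in> level_algebra (dims r0 r1 r2)" "rep_action ?N \<xi> (mk_rep x y z) = 0"
    "h = rep_action ?N \<xi> (mk_rep x' y' z')"
    by (auto simp: stabiliser_def)
  obtain a b c where abc: "\<xi> = mk_rep a b c" by (rule level_cases[OF \<xi>(1)])
  have e: "mm ?N z' s - mm ?N p x' = - (mm ?N z s' - mm ?N p' x)" "mm ?N x' p - mm ?N q y' = - (mm ?N x p' - mm ?N q' y)"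
    "mm ?N y' q - mm ?N s z' = - (mm ?N y q' - mm ?N s' z)"
  proof -
    have t: "mm ?N p x' + mm ?N p' x = mm ?N z' s + mm ?N z s'" "mm ?N x' p + mm ?N x p' = mm ?N q y' + mm ?N q' y"
      "mm ?N y' q + mm ?N y q' = mm ?N s z' + mm ?N s' z" using ct by (simp_all only: commuting_tangent_def)
    show "mm ?N z' s - mm ?N p x' = - (mm ?N z s' - mm ?N p' x)" by (rule sum_rearrange(1)[OF t(1)])
    show "mm ?N x' p - mm ?N q y' = - (mm ?N x p' - mm ?N q' y)" by (rule sum_rearrange(2)[OF t(2)])
    show "mm ?N y' q - mm ?N s z' = - (mm ?N y q' - mm ?N s' z)" by (rule sum_rearrange(2)[OF t(3)])
  qed
  have "pairing ?N p q s h = - pairing ?N p' q' s' (rep_action ?N \<xi> (mk_rep x y z))"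
    unfolding \<xi>(3) abc pairing_action e mm_distrib(6) tr_ops by simp
  also have "\<dots> = 0" unfolding \<xi>(2) by (simp add: fun_space.functional.linear_0[OF pairing_linear])
  finally show ?thesis
    using commuting_kills_orbit[OF _ gh(2)] ct unfolding gh(1)
    by (simp add: fun_space.functional.linear_add[OF pairing_linear] commuting_tangent_def)
qed

text \<open>For a commuting form without a known first-order part the vanishing is checked on the
  stabiliser itself, given by three intertwining relations.\<close>

lemma stabiliser_kills_double_orbit:
  fixes x y z :: "nat \<Rightarrow> nat \<Rightarrow> 'k::field"
  assumes c: "commuting (r0 + r1 + r2) x y z p q s"
    and st: "\<And>a b c. supp r0 r0 a \<Longrightarrow> supp r1 r1 b \<Longrightarrow> supp r2 r2 c \<Longrightarrow>
        mm (r0 + r1 + r2) b x = mm (r0 + r1 + r2) x a \<Longrightarrow> mm (r0 + r1 + r2) c y = mm (r0 + r1 + r2) y b \<Longrightarrow>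
        mm (r0 + r1 + r2) a z = mm (r0 + r1 + r2) z c \<Longrightarrow>
        pairing (r0 + r1 + r2) p q s (rep_action (r0 + r1 + r2) (mk_rep a b c) u) = 0"
    and w: "w \<in> double_orbit (dims r0 r1 r2) (mk_rep x y z) u"
  shows "pairing (r0 + r1 + r2) p q s w = 0"
proof -
  let ?N = "r0 + r1 + r2"
  obtain g h where gh: "w = g + h" "g \<in> orbit (dims r0 r1 r2) (mk_rep x y z)"
    "h \<in> (\<lambda>\<xi>. rep_action ?N \<xi> u) ` stabiliser (dims r0 r1 r2) (mk_rep x y z)"
    using w unfolding double_orbit_def by auto
  then obtain \<xi> where \<xi>: "\<xi> \<in> level_algebra (dims r0 r1 r2)" "rep_action ?N \<xi> (mk_rep x y z) = 0" "h = rep_action ?N \<xi> u"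
    by (auto simp: stabiliser_def)
  obtain a b c where abc: "\<xi> = mk_rep a b c" "supp r0 r0 a" "supp r1 r1 b" "supp r2 r2 c" by (rule level_cases[OF \<xi>(1)])
  have "mk_rep A B C = 0 \<Longrightarrow> A = 0 \<and> B = 0 \<and> C = 0" for A B C :: "nat \<Rightarrow> nat \<Rightarrow> 'k"
  proof -
    assume "mk_rep A B C = 0"
    then have "arrow (mk_rep A B C) t = 0" for t by (simp add: arrow_def fun_eq_iff)
    from this[of 0] this[of 1] this[of 2] show "A = 0 \<and> B = 0 \<and> C = 0" by simp
  qed
  from this[OF \<xi>(2)[unfolded abc(1) rep_action_mk_rep]]
  have "mm ?N b x = mm ?N x a" "mm ?N c y = mm ?N y b" "mm ?N a z = mm ?N z c" by auto
  then have "pairing ?N p q s h = 0" unfolding \<xi>(3) abc(1) by (rule st[OF abc(2-4)])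
  then show ?thesis
    using commuting_kills_orbit[OF c gh(2)] unfolding gh(1)
    by (simp add: fun_space.functional.linear_add[OF pairing_linear])
qed

text \<open>The three components of the power \<open>3 j + 2\<close> of \<open>v\<close>: the
  exponents congruent to -1 modulo 3 are those whose components run against the arrows.\<close>

fun power_p where
  "power_p N x y z 0 = mm N z y"
| "power_p N x y z (Suc j) = mm N z (mm N y (mm N x (power_p N x y z j)))"

fun power_q where
  "power_q N x y z 0 = mm N x z"
| "power_q N x y z (Suc j) = mm N x (mm N z (mm N y (power_q N x y z j)))"

fun power_s where
  "power_s N x y z 0 = mm N y x"
| "power_s N x y z (Suc j) = mm N y (mm N x (mm N z (power_s N x y z j)))"

lemma commuting_power: "commuting N x y z (power_p N x y z j) (power_q N x y z j) (power_s N x y z j)"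
proof (induction j)
  case (Suc j)
  then have "mm N (power_p N x y z j) x = mm N z (power_s N x y z j)" "mm N (power_q N x y z j) y = mm N x (power_p N x y z j)"
    "mm N (power_s N x y z j) z = mm N y (power_q N x y z j)"
    by (auto simp: commuting_def)
  then show ?case by (simp add: commuting_def mm_assoc)
qed (simp add: commuting_def mm_assoc)

lemma coeff_mm:
  "(\<lambda>i j. coeff (mm N A B i j) 0) = mm N (\<lambda>i j. coeff (A i j) 0) (\<lambda>i j. coeff (B i j) 0)"
  "(\<lambda>i j. coeff (mm N A B i j) 1) = mm N (\<lambda>i j. coeff (A i j) 0) (\<lambda>i j. coeff (B i j) 1)
    + mm N (\<lambda>i j. coeff (A i j) 1) (\<lambda>i j. coeff (B i j) 0)"
  by (simp_all add: mm_def fun_eq_iff coeff_sum coeff_mult sum.distrib)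

text \<open>Powers of \<open>v + t u\<close> commute with \<open>v + t u\<close>; compare coefficients of \<open>1\<close> and \<open>t\<close>.\<close>

lemma commuting_tangent_power:
  fixes x y z :: "nat \<Rightarrow> nat \<Rightarrow> 'k::field"
  shows "\<exists>p' q' s'. commuting_tangent N x y z x' y' z' (power_p N x y z j) (power_q N x y z j) (power_s N x y z j) p' q' s'"
proof -
  let ?X = "pencil x x'" and ?Y = "pencil y y'" and ?Z = "pencil z z'"
  let ?P = "power_p N ?X ?Y ?Z j" and ?Q = "power_q N ?X ?Y ?Z j" and ?S = "power_s N ?X ?Y ?Z j"
  have pc: "(\<lambda>i j. coeff (pencil A B i j) 0) = A" "(\<lambda>i j. coeff (pencil A B i j) 1) = B" for A B :: "nat \<Rightarrow> nat \<Rightarrow> 'k"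
    by (simp_all add: pencil_def)
  have 0: "(\<lambda>i l. coeff (?P i l) 0) = power_p N x y z j" "(\<lambda>i l. coeff (?Q i l) 0) = power_q N x y z j"
    "(\<lambda>i l. coeff (?S i l) 0) = power_s N x y z j"
    by (induction j) (simp_all add: coeff_mm pc)
  note c = commuting_power[of N ?X ?Y ?Z j, unfolded commuting_def]
  have c0: "commuting N x y z (power_p N x y z j) (power_q N x y z j) (power_s N x y z j)" by (rule commuting_power)
  have ext: "(\<lambda>i l. coeff (A i l) 1) = (\<lambda>i l. coeff (B i l) 1)" if "A = B" for A B :: "nat \<Rightarrow> nat \<Rightarrow> 'k poly" using that by simp
  from c have "mm N ?P ?X = mm N ?Z ?S" "mm N ?X ?P = mm N ?Q ?Y" "mm N ?Y ?Q = mm N ?S ?Z" by auto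
  from this[THEN ext] have
    "mm N (power_p N x y z j) x' + mm N (\<lambda>i l. coeff (?P i l) 1) x = mm N z (\<lambda>i l. coeff (?S i l) 1) + mm N z' (power_s N x y z j)"
    "mm N x (\<lambda>i l. coeff (?P i l) 1) + mm N x' (power_p N x y z j) = mm N (power_q N x y z j) y' + mm N (\<lambda>i l. coeff (?Q i l) 1) y"
    "mm N y (\<lambda>i l. coeff (?Q i l) 1) + mm N y' (power_q N x y z j) = mm N (power_s N x y z j) z' + mm N (\<lambda>i l. coeff (?S i l) 1) z"
    unfolding coeff_mm pc 0 by auto
  then show ?thesis unfolding commuting_tangent_def
    by (intro exI[of _ "\<lambda>i l. coeff (?P i l) 1"] exI[of _ "\<lambda>i l. coeff (?Q i l) 1"] exI[of _ "\<lambda>i l. coeff (?S i l) 1"] conjI c0)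
      (simp_all add: add.commute)
qed

section \<open>Dimension vectors without good index behaviour\<close>

text \<open>The stabiliser of the representation that is the sum of a string of length \<open>3k + 5\<close> starting at vertex \<open>0\<close>
  and a string \<open>1 \<rightarrow> 2 \<rightarrow> 0\<close>, completed by simple summands.\<close>

locale string_stabiliser =
  fixes k :: nat and a b c :: "nat \<Rightarrow> nat \<Rightarrow> 'k::field"
  assumes S1: "\<And>i j. (if j \<le> k + 1 then b i j else 0) = (if i \<le> k + 1 then a i j else 0)"
    and S2: "\<And>i j. (if j \<le> k then c i j else if j = k + 2 then c i (k + 1) else 0) =
      (if i \<le> k then b i j else if i = k + 1 then b (k + 2) j else 0)"
    and S3: "\<And>i j. (if j \<le> k + 1 then a i (j + 1) else 0) = (if 1 \<le> i \<and> i \<le> k + 2 then c (i - 1) j else 0)"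
begin

text \<open>Write \<open>e\<close>, \<open>f\<close>, \<open>g\<close> for the basis vectors at
  vertices 0, 1, 2. The string \<open>A\<close> is
  \<open>e 0, f 0, g 0, ..., e (k + 1), f (k + 1)\<close>, and \<open>B\<close> is
  \<open>f (k + 2), g (k + 1), e (k + 2)\<close>. The two abbreviations are the scalars by which the
  stabiliser acts on the tops of \<open>A\<close> and of \<open>B\<close>.\<close>

abbreviation "\<rho> \<equiv> a 0 0"
abbreviation "\<kappa> \<equiv> b (k + 2) (k + 2)"

text \<open>The stabiliser commutes with \<open>z y x\<close>, which shifts the basis vectors of
  \<open>A\<close> at vertex 0 by one.\<close>

lemma toeplitz: "i \<le> k \<Longrightarrow> j \<le> k \<Longrightarrow> a (Suc i) (Suc j) = a i j"
  using S3[where i="Suc i" and j=j] S2[where i=i and j=j] S1[where i=i and j=j] by simp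

text \<open>No vector in the image of \<open>z\<close> has a component at \<open>e 0\<close>, and
  \<open>x\<close> kills the simple summands but not \<open>e 0\<close>. This and the following row
  and column lemmas supply the scalars at the ends of the strings that enter the evaluation of the
  mixed forms.\<close>

lemma a_row: "a 0 j = (if j = 0 then \<rho> else 0)"
proof (cases j)
  case (Suc l)
  show ?thesis
  proof (cases "l \<le> k + 1")
    case True then show ?thesis using S3[where i=0 and j=l] Suc by simp
  next
    case False then show ?thesis using S1[where i=0 and j=j] Suc by simp
  qed
qed simp

lemma a_upper: "i \<le> j \<Longrightarrow> j \<le> k + 1 \<Longrightarrow> a i j = a 0 (j - i)"
proof (induction i arbitrary: j)
  case (Suc i)
  then obtain l where "j = Suc l" "i \<le> l" by (cases j) auto
  then show ?case using Suc toeplitz[of i l] by simp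
qed simp

lemma b_zero_row: "j \<le> k + 1 \<Longrightarrow> b (k + 2) j = 0"
  using S1[where i="k + 2" and j=j] by simp

lemma c_row: "c (k + 1) j = (if j = k + 1 then \<kappa> else 0)"
proof -
  consider "j \<le> k" | "j = k + 1" | "k + 2 \<le> j" by linarith
  then show ?thesis
  proof cases
    case 1 then show ?thesis using S2[where i="k + 1" and j=j] b_zero_row[of j] by simp
  next
    case 2 then show ?thesis using S2[where i="k + 1" and j="k + 2"] by simp
  next
    case 3 then show ?thesis using S3[where i="k + 2" and j=j] by simp
  qed
qed

lemma c_upper_zero: "i \<le> k + 1 \<Longrightarrow> k + 2 \<le> j \<Longrightarrow> c i j = 0"
  using S3[where i="i + 1" and j=j] by simp

lemma c_lower_zero: "k + 2 \<le> i \<Longrightarrow> j \<le> k + 1 \<Longrightarrow> c i j = 0"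
  using S2[where i=i and j=j] S2[where i=i and j="k + 2"] by (cases "j = k + 1") auto

lemma a_last: "a i (k + 2) = (if i = k + 2 then \<kappa> else 0)"
proof -
  consider "i \<le> k + 1" | "i = k + 2" | "k + 3 \<le> i" by linarith
  then show ?thesis
  proof cases
    case 1 then show ?thesis using S1[where i=i and j="k + 2"] by simp
  next
    case 2 then show ?thesis using S3[where i="k + 2" and j="k + 1"] c_row[of "k + 1"] by simp
  next
    case 3 then show ?thesis using S3[where i=i and j="k + 1"] by simp
  qed
qed

lemma b_row_last: "b (k + 2) j = (if j = k + 2 then \<kappa> else 0)"
proof -
  consider "j \<le> k + 1" | "j = k + 2" | "k + 3 \<le> j" by linarith
  then show ?thesis
  proof cases
    case 1 then show ?thesis using b_zero_row by simp
  next
    case 3 then show ?thesis using S2[where i="k + 1" and j=j] by simp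
  qed simp
qed

lemma c_column: "c i (k + 1) = (if i = k + 1 then \<kappa> else 0)"
proof -
  consider "i \<le> k" | "i = k + 1" | "k + 2 \<le> i" by linarith
  then show ?thesis
  proof cases
    case 1 then show ?thesis using S3[where i="i + 1" and j="k + 1"] a_last[of "i + 1"] by simp
  next
    case 2 then show ?thesis using c_row by simp
  next
    case 3 then show ?thesis using c_lower_zero by simp
  qed
qed

lemma b_row: "b 0 j = (if j = 0 then \<rho> else 0)"
proof -
  consider "j \<le> k + 1" | "j = k + 2" | "k + 3 \<le> j" by linarith
  then show ?thesis
  proof cases
    case 1 then show ?thesis using S1[where i=0 and j=j] a_row[of j] by simp
  next
    case 2 then show ?thesis using S2[where i=0 and j="k + 2"] c_column[of 0] by simp
  next
    case 3 then show ?thesis using S2[where i=0 and j=j] by simp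
  qed
qed

lemma a_column: "a i (k + 1) = (if i = k + 1 then \<rho> else 0)"
proof -
  consider "i \<le> k + 1" | "i = k + 2" | "k + 3 \<le> i" by linarith
  then show ?thesis
  proof cases
    case 1 then show ?thesis using a_upper[of i "k + 1"] a_row[of "k + 1 - i"] by simp
  next
    case 2 then show ?thesis using S3[where i="k + 2" and j=k] c_row[of k] by simp
  next
    case 3 then show ?thesis using S3[where i=i and j=k] by simp
  qed
qed

lemma b_column: "b i (k + 1) = (if i = k + 1 then \<rho> else 0)"
  using S1[where i=i and j="k + 1"] a_column[of i] by (auto split: if_splits)

end

definition string_x :: "nat \<Rightarrow> nat \<Rightarrow> nat \<Rightarrow> 'k::zero_neq_one" where
  "string_x k = (\<lambda>i j. if i = j \<and> j \<le> k + 1 then 1 else 0)"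

text \<open>The shift from \<open>k + 2\<close> to \<open>k + 1\<close> belongs to \<open>B\<close>:
  \<open>A\<close> occupies one basis vector fewer at vertex 2 than at vertex 1.\<close>

definition string_y :: "nat \<Rightarrow> nat \<Rightarrow> nat \<Rightarrow> 'k::zero_neq_one" where
  "string_y k = (\<lambda>i j. if i = j \<and> j \<le> k \<or> i = k + 1 \<and> j = k + 2 then 1 else 0)"

definition string_z :: "nat \<Rightarrow> nat \<Rightarrow> nat \<Rightarrow> 'k::zero_neq_one" where
  "string_z k = (\<lambda>i j. if i = j + 1 \<and> j \<le> k + 1 then 1 else 0)"

lemma string_mm:
  assumes "k + 3 \<le> N"
  shows "mm N (string_x k) A i j = (if i \<le> k + 1 then A i j else 0)"
    and "mm N A (string_x k) i j = (if j \<le> k + 1 then A i j else 0)"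
    and "mm N (string_y k) A i j = (if i \<le> k then A i j else if i = k + 1 then A (k + 2) j else 0)"
    and "mm N A (string_y k) i j = (if j \<le> k then A i j else if j = k + 2 then A i (k + 1) else 0)"
    and "mm N (string_z k) A i j = (if 1 \<le> i \<and> i \<le> k + 2 then A (i - 1) j else 0)"
    and "mm N A (string_z k) i j = (if j \<le> k + 1 then A i (j + 1) else 0)"
proof -
  have row: "mm N B A i j = (if P then A m j else 0)" if "\<And>l. B i l = (if P \<and> l = m then 1 else 0)" "P \<Longrightarrow> m < N" for B m P
    using mm_row_single[of B i m 1 N A j] that by (cases P) (simp_all add: mm_def)
  have col: "mm N A B i j = (if P then A i m else 0)" if "\<And>l. B l j = (if P \<and> l = m then 1 else 0)" "P \<Longrightarrow> m < N" for B m P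
    using mm_column_single[of B j m 1 N A i] that by (cases P) (simp_all add: mm_def)
  show "mm N (string_x k) A i j = (if i \<le> k + 1 then A i j else 0)"
    by (rule row) (use assms in \<open>auto simp: string_x_def\<close>)
  show "mm N A (string_x k) i j = (if j \<le> k + 1 then A i j else 0)"
    by (rule col) (use assms in \<open>auto simp: string_x_def\<close>)
  show "mm N (string_z k) A i j = (if 1 \<le> i \<and> i \<le> k + 2 then A (i - 1) j else 0)"
    by (rule row) (use assms in \<open>auto simp: string_z_def\<close>)
  show "mm N A (string_z k) i j = (if j \<le> k + 1 then A i (j + 1) else 0)"
    by (rule col) (use assms in \<open>auto simp: string_z_def\<close>)
  show "mm N (string_y k) A i j = (if i \<le> k then A i j else if i = k + 1 then A (k + 2) j else 0)"
    using row[of "string_y k" "i \<le> k \<or> i = k + 1" "if i \<le> k then i else k + 2"] assms by (auto simp: string_y_def)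
  show "mm N A (string_y k) i j = (if j \<le> k then A i j else if j = k + 2 then A i (k + 1) else 0)"
  proof -
    consider "j \<le> k" | "j = k + 2" | "\<not> j \<le> k" "j \<noteq> k + 2" by blast
    then show ?thesis
    proof cases
      case 1
      then show ?thesis using mm_column_single[of "string_y k" j j 1 N A i] assms by (auto simp: string_y_def)
    next
      case 2
      then show ?thesis using mm_column_single[of "string_y k" j "k + 1" 1 N A i] assms by (auto simp: string_y_def)
    next
      case 3
      then have "mm N A (string_y k) i j = 0" unfolding mm_def string_y_def by (intro sum.neutral) simp
      then show ?thesis using 3 by simp
    qed
  qed
qed

lemma tr_munit: "i < N \<Longrightarrow> j < N \<Longrightarrow> tr N (mm N (munit r i j) A) = r * A j i"
proof -
  assume ij: "i < N" "j < N"
  have "tr N (mm N (munit r i j) A) = (\<Sum>h<N. if h = i then r * A j i else 0)"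
    unfolding tr_def mm_munit(2)[OF ij(2,1)] by (intro sum.cong) auto
  then show ?thesis using ij by simp
qed

text \<open>The power moves \<open>f 0\<close> along \<open>A\<close> to \<open>e (j + 1)\<close>,
  which lies in \<open>A\<close> since \<open>j \<le> k\<close>. This keeps the powers
  independent.\<close>

lemma string_power:
  assumes "k + 3 \<le> N" "j \<le> k"
  shows "power_p N (string_x k) (string_y k) (string_z k) j i 0 = (if i = Suc j then 1 else 0 :: 'k::field)"
  using assms(2)
proof (induction j arbitrary: i)
  case 0
  then show ?case by (auto simp: string_mm[OF assms(1)] string_y_def)
next
  case (Suc j)
  have *: "power_p N (string_x k) (string_y k) (string_z k) j i 0 = (if i = Suc j then 1 else 0 :: 'k)" for i
    using Suc.IH[of i] Suc.prems by simp
  show ?case using Suc.prems by (auto simp: string_mm[OF assms(1)] *)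
qed

text \<open>First the square of \<open>v\<close> restricted to \<open>B\<close>; next the maps from
  \<open>A\<close> to \<open>B\<close> (coefficient \<mu>) and from \<open>B\<close> to
  \<open>A\<close> (coefficient \<nu>); last, maps from simple summands at vertex 2 to the end of
  \<open>A\<close> (\<alpha>) and from the top of \<open>A\<close> to them (\<beta>).\<close>

lemma string_commuting:
  assumes N: "k + 3 \<le> N"
  shows "commuting N (string_x k) (string_y k) (string_z k) (munit 1 (k + 2) (k + 2)) 0 (0 :: nat \<Rightarrow> nat \<Rightarrow> 'k::field)"
    and "commuting N (string_x k) (string_y k) (string_z k)
      (munit \<mu> (k + 2) 0 + munit \<nu> (k + 1) (k + 2)) (munit \<nu> (k + 1) (k + 1)) (munit \<mu> (k + 1) 0 :: nat \<Rightarrow> nat \<Rightarrow> 'k)"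
    and "(\<And>i. i < k + 2 \<Longrightarrow> \<alpha> i = 0) \<Longrightarrow> (\<And>i. i < k + 2 \<Longrightarrow> \<beta> i = 0) \<Longrightarrow>
      commuting N (string_x k) (string_y k) (string_z k) 0 (\<lambda>i j. if i = k + 1 then \<alpha> j else 0)
        (\<lambda>i j. if j = 0 then \<beta> i else 0 :: 'k)"
  unfolding commuting_def fun_eq_iff string_mm[OF N] by (auto simp: munit_def)

lemma string_stabiliser:
  assumes N: "k + 3 \<le> N"
    and "mm N b (string_x k) = mm N (string_x k) a" "mm N c (string_y k) = mm N (string_y k) b"
      "mm N a (string_z k) = mm N (string_z k) c"
  shows "string_stabiliser k a b c"
proof
  fix i j
  show "(if j \<le> k + 1 then b i j else 0) = (if i \<le> k + 1 then a i j else 0)"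
    using fun_cong[OF fun_cong[OF assms(2)], of i j] unfolding string_mm[OF N] .
  show "(if j \<le> k then c i j else if j = k + 2 then c i (k + 1) else 0) =
      (if i \<le> k then b i j else if i = k + 1 then b (k + 2) j else 0)"
    using fun_cong[OF fun_cong[OF assms(3)], of i j] unfolding string_mm[OF N] .
  show "(if j \<le> k + 1 then a i (j + 1) else 0) = (if 1 \<le> i \<and> i \<le> k + 2 then c (i - 1) j else 0)"
    using fun_cong[OF fun_cong[OF assms(4)], of i j] unfolding string_mm[OF N] .
qed

text \<open>The \<open>k + 1\<close> powers and the forms \<open>F2\<close>, \<open>F3\<close>
  always kill \<open>q v + q_v u\<close>; \<open>e = 1\<close> signals that vertex 2 has room for a
  simple summand, so that \<open>F4\<close> provides one more. Each form is matched with a vector on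
  which it is non-zero.\<close>

theorem string_codim:
  fixes u :: "nat \<times> nat \<times> nat \<Rightarrow> 'k::field"
  assumes r: "k + 3 \<le> r0" "k + 3 \<le> r1" "k + 2 \<le> r2" and u: "u \<in> rep_space (dims r0 r1 r2)"
    and e: "e = 0 \<or> e = 1 \<and> k + 3 \<le> r2"
  defines "v \<equiv> mk_rep (string_x k) (string_y k) (string_z k)"
  shows "v \<in> rep_space (dims r0 r1 r2)"
    and "fun_space.dim (double_orbit (dims r0 r1 r2) v u) + (k + 3 + e) \<le> fun_space.dim (rep_space (dims r0 r1 r2) :: (nat \<times> nat \<times> nat \<Rightarrow> 'k) set)"
proof -
  let ?N = "r0 + r1 + r2"
  let ?x = "string_x k :: nat \<Rightarrow> nat \<Rightarrow> 'k" and ?y = "string_y k :: nat \<Rightarrow> nat \<Rightarrow> 'k" and ?z = "string_z k :: nat \<Rightarrow> nat \<Rightarrow> 'k"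
  have N: "k + 3 \<le> ?N" using r by simp
  obtain x' y' z' where ue: "u = mk_rep x' y' z'" by (rule rep_cases[OF u])
  show vm: "v \<in> rep_space (dims r0 r1 r2)"
    unfolding v_def mk_rep_mem using r by (auto simp: supp_def string_x_def string_y_def string_z_def split: if_splits)
  \<comment> \<open>The entries of \<open>u\<close> read by the maps between \<open>A\<close> and
    \<open>B\<close>. A stabiliser element multiplies them by \<rho> - \<kappa> and \<kappa> -
    \<rho>, so the combination with crosswise coefficients vanishes. If both are zero any
    combination works, and \<mu> = 1 keeps the form non-zero.\<close>
  define uAB where "uAB = x' 0 (k + 2) + z' 0 (k + 1)"
  define uBA where "uBA = x' (k + 2) (k + 1) + y' (k + 1) (k + 1)"
  define \<mu> where "\<mu> = (if uAB = 0 \<and> uBA = 0 then 1 else uBA)"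
  define \<nu> where "\<nu> = uAB"
  \<comment> \<open>The same device for \<open>A\<close> and the simple summands: the coefficients
    of \<open>F4\<close> at entries of \<open>y\<close> come from \<open>z'\<close> and conversely.
    If all of them vanish, a unit at index \<open>k + 2\<close> is used instead, which is in range
    when \<open>e = 1\<close>.\<close>
  define \<alpha> where "\<alpha> i = (if k + 2 \<le> i \<and> i < ?N then z' 0 i else 0)" for i
  define \<beta> where "\<beta> i = (if k + 2 \<le> i \<and> i < ?N then y' i (k + 1) else 0)" for i
  define gen where "gen = (\<exists>i. \<alpha> i \<noteq> 0 \<or> \<beta> i \<noteq> 0)"
  define \<alpha>1 where "\<alpha>1 = \<alpha>"
  define \<beta>1 where "\<beta>1 = (if gen then \<beta> else (\<lambda>i. if i = k + 2 then 1 else 0))"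
  have low: "\<alpha> i = 0" "\<beta> i = 0" "\<alpha>1 i = 0" "\<beta>1 i = 0" if "i < k + 2" for i
    using that by (auto simp: \<alpha>_def \<beta>_def \<alpha>1_def \<beta>1_def)
  define F1 where "F1 j = pairing ?N (power_p ?N ?x ?y ?z j) (power_q ?N ?x ?y ?z j) (power_s ?N ?x ?y ?z j)" for j
  define F2 where "F2 = pairing ?N (munit \<mu> (k + 2) 0 + munit \<nu> (k + 1) (k + 2)) (munit \<nu> (k + 1) (k + 1)) (munit \<mu> (k + 1) 0)"
  define F3 where "F3 = pairing ?N (munit 1 (k + 2) (k + 2)) 0 (0 :: nat \<Rightarrow> nat \<Rightarrow> 'k)"
  define F4 where "F4 = pairing ?N 0 (\<lambda>i j. if i = k + 1 then \<alpha>1 j else 0) (\<lambda>i j. if j = 0 then \<beta>1 i else 0)"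
  have F1z: "F1 j w = 0" if "w \<in> double_orbit (dims r0 r1 r2) v u" for j w
    using commuting_tangent_power[of ?N ?x ?y ?z x' y' z' j] tangent_kills_double_orbit that
    unfolding F1_def v_def ue by blast
  have F2e: "F2 (mk_rep X Y Z) = \<mu> * (X 0 (k + 2) + Z 0 (k + 1)) + \<nu> * (X (k + 2) (k + 1) + Y (k + 1) (k + 1))" for X Y Z
    using r by (simp add: F2_def pairing_mk_rep mm_distrib tr_ops tr_munit distrib_left)
  have F3e: "F3 (mk_rep X Y Z) = X (k + 2) (k + 2)" for X Y Z
    using r by (simp add: F3_def pairing_mk_rep mm_distrib tr_ops tr_munit)
  have F4e: "F4 (mk_rep X Y Z) = (\<Sum>l<?N. \<alpha>1 l * Y l (k + 1)) + (\<Sum>i<?N. \<beta>1 i * Z 0 i)" for X Y Z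
  proof -
    have "tr ?N (mm ?N (\<lambda>i j. if i = k + 1 then \<alpha>1 j else 0) Y) = (\<Sum>i<?N. if i = k + 1 then \<Sum>l<?N. \<alpha>1 l * Y l (k + 1) else 0)"
      unfolding tr_def mm_def by (intro sum.cong) auto
    moreover have "tr ?N (mm ?N (\<lambda>i j. if j = 0 then \<beta>1 i else 0) Z) = (\<Sum>i<?N. \<beta>1 i * Z 0 i)"
    proof -
      have "mm ?N (\<lambda>i j. if j = 0 then \<beta>1 i else 0) Z i i = \<beta>1 i * Z 0 i" for i
        by (rule mm_row_single) (use r in auto)
      then show ?thesis by (simp add: tr_def)
    qed
    ultimately show ?thesis using r by (simp add: F4_def pairing_mk_rep mm_distrib tr_ops)
  qed
  have F3z: "F3 w = 0" if "w \<in> double_orbit (dims r0 r1 r2) v u" for w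
    unfolding F3_def
  proof (rule stabiliser_kills_double_orbit[OF string_commuting(1)[OF N] _ that[unfolded v_def]], fold F3_def)
    fix a b c
    assume "mm ?N b ?x = mm ?N ?x a" "mm ?N c ?y = mm ?N ?y b" "mm ?N a ?z = mm ?N ?z c"
    then interpret string_stabiliser k a b c by (rule string_stabiliser[OF N])
    have lt: "k + 2 < ?N" using r by simp
    show "F3 (rep_action ?N (mk_rep a b c) u) = 0"
      unfolding ue rep_action_mk_rep F3e fun_diff_def mm_row_single[where A=b, OF b_row_last lt] mm_column_single[where B=a, OF a_last lt]
      by (simp add: mult.commute)
  qed
  have F2z: "F2 w = 0" if "w \<in> double_orbit (dims r0 r1 r2) v u" for w
    unfolding F2_def
  proof (rule stabiliser_kills_double_orbit[OF string_commuting(2)[OF N] _ that[unfolded v_def]], fold F2_def)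
    fix a b c
    assume "mm ?N b ?x = mm ?N ?x a" "mm ?N c ?y = mm ?N ?y b" "mm ?N a ?z = mm ?N ?z c"
    then interpret string_stabiliser k a b c by (rule string_stabiliser[OF N])
    have lt: "0 < ?N" "k + 1 < ?N" "k + 2 < ?N" using r by auto
    have "F2 (rep_action ?N (mk_rep a b c) u) = \<mu> * (\<rho> - \<kappa>) * uAB + \<nu> * (\<kappa> - \<rho>) * uBA"
      unfolding ue rep_action_mk_rep F2e fun_diff_def uAB_def uBA_def
        mm_row_single[where A=b, OF b_row lt(1)] mm_column_single[where B=a, OF a_last lt(3)]
        mm_row_single[where A=a, OF a_row lt(1)] mm_column_single[where B=c, OF c_column lt(2)]
        mm_row_single[where A=b, OF b_row_last lt(3)] mm_column_single[where B=a, OF a_column lt(2)]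
        mm_row_single[where A=c, OF c_row lt(2)] mm_column_single[where B=b, OF b_column lt(2)]
      by (simp add: algebra_simps)
    also have "\<dots> = 0" by (simp add: \<mu>_def \<nu>_def algebra_simps)
    finally show "F2 (rep_action ?N (mk_rep a b c) u) = 0" .
  qed
  have F4z: "F4 w = 0" if "w \<in> double_orbit (dims r0 r1 r2) v u" for w
    unfolding F4_def
  proof (rule stabiliser_kills_double_orbit[OF string_commuting(3)[OF N low(3,4)] _ that[unfolded v_def]], fold F4_def)
    fix a b c
    assume "mm ?N b ?x = mm ?N ?x a" "mm ?N c ?y = mm ?N ?y b" "mm ?N a ?z = mm ?N ?z c"
    then interpret string_stabiliser k a b c by (rule string_stabiliser[OF N])
    have lt: "0 < ?N" "k + 1 < ?N" using r by auto
    \<comment> \<open>By \<open>c_lower_zero\<close> the matrix \<open>c\<close> does not lead from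
      the strings into the simple summands, so only indices from \<open>k + 2\<close> on contribute,
      where the column of \<open>y'\<close> is \<beta>.\<close>
    have cy: "\<alpha>1 l * mm ?N c y' l (k + 1) = (\<Sum>m<?N. \<alpha>1 l * c l m * \<beta> m)" for l
    proof -
      have "\<alpha>1 l * (c l m * y' m (k + 1)) = \<alpha>1 l * c l m * \<beta> m" if "m < ?N" for m
      proof (cases "m \<le> k + 1")
        case True
        then have "\<alpha>1 l * c l m = 0" using low(3)[of l] c_lower_zero[of l m] by (cases "l < k + 2") auto
        then show ?thesis by (simp add: mult.assoc[symmetric])
      next
        case False
        then show ?thesis using that by (simp add: \<beta>_def mult.assoc)
      qed
      then show ?thesis unfolding mm_def sum_distrib_left by (intro sum.cong refl) simp
    qed
    have zc: "\<beta>1 i * mm ?N z' c 0 i = (\<Sum>m<?N. \<alpha> m * c m i * \<beta>1 i)" for i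
    proof -
      have "\<beta>1 i * (z' 0 m * c m i) = \<alpha> m * c m i * \<beta>1 i" if "m < ?N" for m
      proof (cases "m \<le> k + 1")
        case True
        then have "c m i * \<beta>1 i = 0" using low(4)[of i] c_upper_zero[of m i] by (cases "i < k + 2") auto
        then show ?thesis using low(2) True by (auto simp: mult_ac)
      next
        case False
        then show ?thesis using that by (simp add: \<alpha>_def mult_ac)
      qed
      then show ?thesis unfolding mm_def sum_distrib_left by (intro sum.cong refl) simp
    qed
    have ab1: "\<alpha>1 l * y' l (k + 1) = \<alpha>1 l * \<beta> l" "\<beta>1 l * z' 0 l = \<beta>1 l * \<alpha> l" if "l < ?N" for l
      using that low(3,4)[of l] by (auto simp: \<alpha>_def \<beta>_def not_le)
    have "F4 (rep_action ?N (mk_rep a b c) u) =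
        (\<Sum>l<?N. \<alpha>1 l * mm ?N c y' l (k + 1) - \<rho> * (\<alpha>1 l * y' l (k + 1))) + (\<Sum>i<?N. \<rho> * (\<beta>1 i * z' 0 i) - \<beta>1 i * mm ?N z' c 0 i)"
      unfolding ue rep_action_mk_rep F4e fun_diff_def
        mm_row_single[where A=a, OF a_row lt(1)] mm_column_single[where B=b, OF b_column lt(2)]
      by (simp add: right_diff_distrib mult_ac)
    also have "\<dots> = (\<Sum>l<?N. (\<Sum>m<?N. \<alpha>1 l * c l m * \<beta> m) - \<rho> * (\<alpha>1 l * \<beta> l)) + (\<Sum>i<?N. \<rho> * (\<beta>1 i * \<alpha> i) - (\<Sum>m<?N. \<alpha> m * c m i * \<beta>1 i))"
      unfolding cy zc using ab1 by (intro arg_cong2[of _ _ _ _ "(+)"] sum.cong refl) auto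
    also have "\<dots> = 0"
    proof (cases gen)
      case True
      then have b: "\<beta>1 = \<beta>" "\<alpha>1 = \<alpha>" by (simp_all add: \<beta>1_def \<alpha>1_def)
      have "(\<Sum>i<?N. \<Sum>m<?N. \<alpha> m * c m i * \<beta> i) = (\<Sum>l<?N. \<Sum>m<?N. \<alpha> l * c l m * \<beta> m)" by (rule sum.swap)
      then show ?thesis by (simp add: b sum_subtractf mult_ac)
    next
      case False
      then have "\<alpha> i = 0" "\<beta> i = 0" "\<alpha>1 i = 0" for i by (auto simp: gen_def \<alpha>1_def)
      then show ?thesis by simp
    qed
    finally show "F4 (rep_action ?N (mk_rep a b c) u) = 0" .
  qed
  define m2 where "m2 = (if \<mu> \<noteq> 0 then mk_rep (matrix_unit 0 (k + 2)) 0 0 else mk_rep (matrix_unit (k + 2) (k + 1)) 0 (0 :: nat \<Rightarrow> nat \<Rightarrow> 'k))"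
  have mn: "\<mu> \<noteq> 0 \<or> \<nu> \<noteq> 0" by (auto simp: \<mu>_def \<nu>_def)
  have F2m2: "F2 m2 \<noteq> 0" using mn by (auto simp: m2_def F2e matrix_unit_def)
  have m2m: "m2 \<in> rep_space (dims r0 r1 r2)"
    using r by (auto simp: m2_def mk_rep_mem supp_ops intro!: supp_matrix_unit)
  have F1e: "F1 j (mk_rep (matrix_unit 0 l) 0 0) = (if l = Suc j then 1 else 0)" if "j \<le> k" "l < ?N" for j l
    using tr_matrix_unit[of 0 ?N l "power_p ?N ?x ?y ?z j"] that r string_power[OF N that(1), where ?'k = 'k]
    by (simp add: F1_def pairing_mk_rep mm_distrib tr_ops tr_mm_commute[of _ _ "matrix_unit 0 l"])
  have "\<exists>m4. m4 \<in> rep_space (dims r0 r1 r2) \<and> F4 m4 \<noteq> 0 \<and> F2 m4 = F2 m4" if e1: "e = 1"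
  proof -
    have c3: "k + 3 \<le> r2" using e e1 by simp
    have sz: "z' 0 i = 0" if "\<not> i < r2" for i
      using u that unfolding ue mk_rep_mem by (auto simp: suppD)
    have sy: "y' i (k + 1) = 0" if "\<not> i < r2" for i
      using u that unfolding ue mk_rep_mem by (auto simp: suppD)
    have "\<exists>i<r2. \<alpha>1 i \<noteq> 0 \<or> \<beta>1 i \<noteq> 0"
    proof (cases gen)
      case True
      then obtain i where i: "\<alpha> i \<noteq> 0 \<or> \<beta> i \<noteq> 0" unfolding gen_def by blast
      then have "i < r2" using sz[of i] sy[of i] by (auto simp: \<alpha>_def \<beta>_def split: if_splits)
      then show ?thesis using i True by (auto simp: \<alpha>1_def \<beta>1_def)
    next
      case False
      then show ?thesis using c3 by (intro exI[of _ "k + 2"]) (simp add: \<beta>1_def)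
    qed
    then obtain i where i: "i < r2" "\<alpha>1 i \<noteq> 0 \<or> \<beta>1 i \<noteq> 0" by blast
    have s1: "(\<Sum>l<?N. \<alpha>1 l * matrix_unit i (k + 1) l (k + 1)) = \<alpha>1 i"
    proof -
      have "(\<Sum>l<?N. \<alpha>1 l * matrix_unit i (k + 1) l (k + 1)) = (\<Sum>l<?N. if l = i then \<alpha>1 i else 0)"
        by (intro sum.cong) (auto simp: matrix_unit_def)
      then show ?thesis using i by simp
    qed
    have s2: "(\<Sum>l<?N. \<beta>1 l * matrix_unit 0 i 0 l) = \<beta>1 i"
    proof -
      have "(\<Sum>l<?N. \<beta>1 l * matrix_unit 0 i 0 l) = (\<Sum>l<?N. if l = i then \<beta>1 i else 0)"
        by (intro sum.cong) (auto simp: matrix_unit_def)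
      then show ?thesis using i by simp
    qed
    show ?thesis
    proof (cases "\<alpha>1 i = 0")
      case False
      have "F4 (mk_rep 0 (matrix_unit i (k + 1)) 0) \<noteq> 0" using False s1 by (simp add: F4e)
      moreover have "mk_rep 0 (matrix_unit i (k + 1)) (0 :: nat \<Rightarrow> nat \<Rightarrow> 'k) \<in> rep_space (dims r0 r1 r2)"
        using i r by (auto simp: mk_rep_mem supp_ops intro!: supp_matrix_unit)
      ultimately show ?thesis by blast
    next
      case True
      have "F4 (mk_rep 0 0 (matrix_unit 0 i)) \<noteq> 0" using True i s2 by (simp add: F4e)
      moreover have "mk_rep 0 0 (matrix_unit 0 i :: nat \<Rightarrow> nat \<Rightarrow> 'k) \<in> rep_space (dims r0 r1 r2)"
        using i r by (auto simp: mk_rep_mem supp_ops intro!: supp_matrix_unit)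
      ultimately show ?thesis by blast
    qed
  qed
  then obtain m4 where m4: "e = 1 \<Longrightarrow> m4 \<in> rep_space (dims r0 r1 r2) \<and> F4 m4 \<noteq> 0" by (cases "e = 1") auto
  \<comment> \<open>The order matters: the later forms \<open>F2\<close>, \<open>F3\<close>,
    \<open>F4\<close> do not see the earlier test vectors, whereas values of the powers on later
    test vectors never enter.\<close>
  define F where "F a = (if a \<le> k then F1 a else if a = k + 1 then F2 else if a = k + 2 then F3 else F4)" for a
  define m where "m a = (if a \<le> k then mk_rep (matrix_unit 0 (Suc a)) 0 0 else if a = k + 1 then m2
    else if a = k + 2 then mk_rep (matrix_unit (k + 2) (k + 2)) 0 0 else m4)" for a
  show "fun_space.dim (double_orbit (dims r0 r1 r2) v u) + (k + 3 + e) \<le> fun_space.dim (rep_space (dims r0 r1 r2) :: (nat \<times> nat \<times> nat \<Rightarrow> 'k) set)"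
  proof (rule fun_space.triangular_codim[OF finite_dim_rep_space double_orbit_subset[OF vm u], of _ m F])
    fix i assume i: "i < k + 3 + e"
    then have ie: "i \<le> k \<or> i = k + 1 \<or> i = k + 2 \<or> i = k + 3 \<and> e = 1" using e by auto
    show "m i \<in> rep_space (dims r0 r1 r2)"
      using ie m2m m4 r by (auto simp: m_def mk_rep_mem supp_ops intro!: supp_matrix_unit)
    show "Vector_Spaces.linear fscale (*) (F i)"
      by (simp add: F_def F1_def F2_def F3_def F4_def pairing_linear)
    show "F i w = 0" if "w \<in> double_orbit (dims r0 r1 r2) v u" for w
      using F1z[OF that] F2z[OF that] F3z[OF that] F4z[OF that] by (simp add: F_def)
    show "F i (m i) \<noteq> 0"
    proof -
      have "matrix_unit l l l l = (1 :: 'k)" for l by (simp add: matrix_unit_def)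
      then show ?thesis using ie F2m2 m4 r F1e[of i "Suc i"] by (auto simp: F_def m_def F3e)
    qed
    show "F i (m j) = 0" if ji: "j < i" for j
    proof -
      have x4: "F4 (mk_rep X 0 0) = 0" for X by (simp add: F4e)
      have m2x: "\<exists>X. m2 = mk_rep X 0 0 \<and> X (k + 2) (k + 2) = 0" unfolding m2_def by (auto simp: matrix_unit_def)
      consider "i \<le> k" | "i = k + 1" | "i = k + 2" | "i = k + 3" using ie by auto
      then show ?thesis
      proof cases
        case 1 then show ?thesis using ji r by (simp add: F_def m_def F1e)
      next
        case 2 then show ?thesis using ji by (simp add: F_def m_def F2e matrix_unit_def)
      next
        case 3 then show ?thesis using ji m2x by (auto simp: F_def m_def F3e matrix_unit_def)
      next
        case 4 then show ?thesis using ji m2x x4 by (auto simp: F_def m_def)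
      qed
    qed
  qed
qed

section \<open>Classification of the dimension vectors\<close>

lemma dims_GIB_0: "dims_GIB TYPE('k::field_char_0) (dims a b 0)"
  by (rule dims_GIB_if_good_points[where m = 0])
    (use good_point_0 max_orbit_dim_0[where r="dims a b 0" and 'k='k] in auto)

text \<open>\<open>good_point_1\<close> asks for positive \<open>a\<close> and \<open>b\<close>;
  otherwise the zero entry is rotated to the last place.\<close>

lemma dims_GIB_1: "dims_GIB TYPE('k::field_char_0) (dims a b 1)"
proof -
  consider "a = 0" | "b = 0" | "1 \<le> a" "1 \<le> b" by linarith
  then show ?thesis
  proof cases
    case 1
    then show ?thesis using dims_GIB_0[of b 1, where 'k='k] dims_GIB_rotated[of b 1 0, where 'k='k] by simp
  next
    case 2
    then show ?thesis
      using dims_GIB_0[of 1 a, where 'k='k] dims_GIB_rotated[of 1 a 0, where 'k='k] dims_GIB_rotated[of 0 1 a, where 'k='k] by simp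
  next
    case 3
    show ?thesis
      by (rule dims_GIB_if_good_points[OF good_point_1[OF 3] max_orbit_dim_1[OF 3 order.refl]])
  qed
qed

lemma dims_GIB_2_2: "dims_GIB TYPE('k::field_char_0) (dims 2 2 a)"
proof -
  consider "a = 0" | "a = 1" | "2 \<le> a" by linarith
  then show ?thesis
  proof cases
    case 1 then show ?thesis using dims_GIB_0 by simp
  next
    case 2 then show ?thesis using dims_GIB_1[of 2 2] by simp
  next
    case 3
    show ?thesis
      by (rule dims_GIB_if_good_points[OF good_point_2_2[OF 3] max_orbit_dim_2[OF order.refl order.refl 3]])
  qed
qed

lemma not_dims_GIB_if_string_codim:
  assumes r: "k + 3 \<le> a" "k + 3 \<le> b" "k + 2 \<le> c" and e: "e = 0 \<or> e = 1 \<and> k + 3 \<le> c"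
    and ge: "fun_space.dim (rep_space (dims a b c) :: (nat \<times> nat \<times> nat \<Rightarrow> 'k::field) set) \<le> max_orbit_dim TYPE('k) (dims a b c) + (k + 2 + e)"
  shows "\<not> dims_GIB TYPE('k) (dims a b c)"
proof
  assume G: "dims_GIB TYPE('k) (dims a b c)"
  let ?v = "mk_rep (string_x k) (string_y k) (string_z k) :: nat \<times> nat \<times> nat \<Rightarrow> 'k"
  have "?v \<in> rep_space (dims a b c)"
    by (rule string_codim(1)[OF r fun_space.subspace_0[OF subspace_rep_space] e])
  then obtain u :: "nat \<times> nat \<times> nat \<Rightarrow> 'k" where u: "u \<in> rep_space (dims a b c)"
    "max_orbit_dim TYPE('k) (dims a b c) \<le> fun_space.dim (double_orbit (dims a b c) ?v u)"
    using G unfolding dims_GIB_def by blast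
  from string_codim(2)[OF r u(1) e] u(2) ge show False by simp
qed

text \<open>With \<open>c = k + 2\<close> and no extra simple summand the codimension is at least
  \<open>k + 3\<close>, while generic orbits have codimension at most \<open>c\<close>.\<close>

lemma not_dims_GIB_min:
  assumes "2 \<le> c" "c < a" "c < b"
  shows "\<not> dims_GIB TYPE('k::field_char_0) (dims a b c)"
proof -
  obtain k where k: "c = k + 2" using assms(1) by (metis add.commute le_Suc_ex)
  show ?thesis
    by (rule not_dims_GIB_if_string_codim[of k a b c 0]) (use assms k max_orbit_dim_ge[of c a b, where 'k='k] in auto)
qed

text \<open>With \<open>a = k + 3\<close> and a simple summand at vertex 2 the codimension is at
  least \<open>k + 4\<close>. The rotation is there because \<open>max_orbit_dim_ge\<close> takes
  the minimum in the last place.\<close>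

lemma not_dims_GIB_two_min:
  assumes "3 \<le> a" "a \<le> c"
  shows "\<not> dims_GIB TYPE('k::field_char_0) (dims a a c)"
proof -
  obtain k where k: "a = k + 3" using assms(1) by (metis add.commute le_Suc_ex)
  have "fun_space.dim (rep_space (dims a c a) :: (nat \<times> nat \<times> nat \<Rightarrow> 'k) set) = fun_space.dim (rep_space (dims a a c) :: (nat \<times> nat \<times> nat \<Rightarrow> 'k) set)"
    using dim_rotated[OF order.refl subspace_rep_space, of a a c, where 'k='k] by (simp add: rotated_rep_space)
  then have "fun_space.dim (rep_space (dims a a c) :: (nat \<times> nat \<times> nat \<Rightarrow> 'k) set) \<le> max_orbit_dim TYPE('k) (dims a a c) + a"
    using max_orbit_dim_ge[of a a c, where 'k='k] max_orbit_dim_rotated[of a c a, where 'k='k] assms by simp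
  then show ?thesis
    by (intro not_dims_GIB_if_string_codim[of k a a c 1]) (use assms k in auto)
qed

theorem dims_GIB_iff:
  fixes r0 r1 r2 :: nat
  defines "T \<equiv> \<lambda>a b c :: nat. c = 0 \<or> c = 1 \<or> a = 2 \<and> b = 2"
  shows "dims_GIB TYPE('k::field_char_0) (dims r0 r1 r2) \<longleftrightarrow> T r0 r1 r2 \<or> T r1 r2 r0 \<or> T r2 r0 r1"
proof -
  let ?G = "\<lambda>a b c. dims_GIB TYPE('k) (dims a b c)"
  have rot: "?G r1 r2 r0 = ?G r0 r1 r2" "?G r2 r0 r1 = ?G r0 r1 r2"
    using dims_GIB_rotated[of r1 r2 r0, where 'k='k] dims_GIB_rotated[of r2 r0 r1, where 'k='k] by auto
  have good: "?G a b c" if "T a b c" for a b c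
    using that dims_GIB_0[of a b] dims_GIB_1[of a b] dims_GIB_2_2[of c] unfolding T_def by auto
  have bad: "\<not> ?G a b c" if "2 \<le> c" "c < a \<and> c < b \<or> a = b \<and> 3 \<le> a \<and> a \<le> c" for a b c
    using that not_dims_GIB_min[of c a b] not_dims_GIB_two_min[of a c] by auto
  show ?thesis
  proof
    assume G: "?G r0 r1 r2"
    show "T r0 r1 r2 \<or> T r1 r2 r0 \<or> T r2 r0 r1"
    proof (rule ccontr)
      assume n: "\<not> (T r0 r1 r2 \<or> T r1 r2 r0 \<or> T r2 r0 r1)"
      then have ge: "2 \<le> r0" "2 \<le> r1" "2 \<le> r2" by (auto simp: T_def)
      \<comment> \<open>All entries are at least 2: either the minimum is strict, or two entries
        share it and, the pair \<open>(2, 2)\<close> being excluded, it is at least 3. Any two of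
        three entries are cyclically adjacent.\<close>
      have "r2 < r0 \<and> r2 < r1 \<or> r0 = r1 \<and> 3 \<le> r0 \<and> r0 \<le> r2 \<or> r0 < r1 \<and> r0 < r2 \<or> r1 = r2 \<and> 3 \<le> r1 \<and> r1 \<le> r0
          \<or> r1 < r2 \<and> r1 < r0 \<or> r2 = r0 \<and> 3 \<le> r2 \<and> r2 \<le> r1"
        using n ge unfolding T_def by presburger
      then show False
        using bad[of r2 r0 r1] bad[of r0 r1 r2] bad[of r1 r2 r0] ge G rot by blast
    qed
  next
    assume "T r0 r1 r2 \<or> T r1 r2 r0 \<or> T r2 r0 r1"
    then show "?G r0 r1 r2" using good rot by blast
  qed
qed

theorem theorem4p11:
  fixes \<zeta> :: "'k :: {alg_closed_field, field_char_0}"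
    and \<theta> :: "'k mat \<Rightarrow> 'k mat"
    and n r0 r1 r2 :: nat
  assumes "primitive_root_of_unity 3 \<zeta>"
    and "inner_automorphism_with_multiplicities n \<zeta> [r0, r1, r2] \<theta>"
    and "has_order n \<theta> 3"
  shows "automorphism_has_GIB n \<zeta> \<theta> \<longleftrightarrow>
    (\<exists>k a b. rotate k [r0, r1, r2] \<in> {[a, b, 0], [a, b, 1], [2, 2, a]})"
proof -
  \<comment> \<open>Rotation of a list of length three depends on \<open>k\<close> modulo 3 only, so
    the existential statement becomes a disjunction of three cases.\<close>
  have "(\<exists>k a b. rotate k [r0, r1, r2] \<in> {[a, b, 0], [a, b, 1], [2, 2, a]}) \<longleftrightarrow>
      (\<exists>k<3. \<exists>a b. rotate k [r0, r1, r2] \<in> {[a, b, 0], [a, b, 1], [2, 2, a]})"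
  proof
    assume "\<exists>k a b. rotate k [r0, r1, r2] \<in> {[a, b, 0], [a, b, 1], [2, 2, a]}"
    then obtain k a b where k: "rotate k [r0, r1, r2] \<in> {[a, b, 0], [a, b, 1], [2, 2, a]}" by blast
    have "rotate k [r0, r1, r2] = rotate (k mod 3) [r0, r1, r2]"
      using rotate_conv_mod[of k "[r0, r1, r2]"] by simp
    then have "rotate (k mod 3) [r0, r1, r2] \<in> {[a, b, 0], [a, b, 1], [2, 2, a]}" using k by simp
    moreover have "k mod 3 < 3" by simp
    ultimately show "\<exists>k<3. \<exists>a b. rotate k [r0, r1, r2] \<in> {[a, b, 0], [a, b, 1], [2, 2, a]}" by blast
  qed blast
  also have "\<dots> \<longleftrightarrow> (r2 = 0 \<or> r2 = 1 \<or> r0 = 2 \<and> r1 = 2) \<or> (r0 = 0 \<or> r0 = 1 \<or> r1 = 2 \<and> r2 = 2)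
      \<or> (r1 = 0 \<or> r1 = 1 \<or> r2 = 2 \<and> r0 = 2)"
    by (auto simp: less_3_iff conj_disj_distribR ex_disj_distrib numeral_2_eq_2)
  finally show ?thesis
    unfolding GIB_iff_max_orbit_dim[OF assms(1,2)]
    using dims_GIB_iff[of r0 r1 r2, where 'k='k, unfolded dims_GIB_def] by simp
qed

end
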